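(* There exists a constant $\mathcal{R}_0\geq\pi$ such that for every $H>0$, every $H$-disk $\mathcal{D}$ and every point $p\in\mathcal{D}$, $$d_{\mathbb{R}^3}(p,\partial\mathcal{D})<\frac{\mathcal{R}_0}{H}.$$
   Context: An $H$-surface is an oriented, connected surface embedded in $\mathbb{R}^3$ with constant mean curvature $H>0$. An $H$-disk is an $H$-surface homeomorphic to a closed disk. $d_{\mathbb{R}^3}$ is Euclidean distance. *)

theory Defs
  imports "HOL-Analysis.Analysis"
begin

definition C2_param ::
  "(real \<times> real) set \<Rightarrow> (real \<times> real \<Rightarrow> real^3)
   \<Rightarrow> (real \<times> real \<Rightarrow> real^3) \<Rightarrow> (real \<times> real \<Rightarrow> real^3)
   \<Rightarrow> (real \<times> real \<Rightarrow> real^3) \<Rightarrow> (real \<times> real \<Rightarrow> real^3)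
   \<Rightarrow> (real \<times> real \<Rightarrow> real^3) \<Rightarrow> (real \<times> real \<Rightarrow> real^3) \<Rightarrow> bool" where
  "C2_param S f fu fv fuu fuv fvu fvv \<longleftrightarrow>
     (\<forall>x\<in>S.
        (f has_derivative (\<lambda>(a,b). a *\<^sub>R fu x + b *\<^sub>R fv x)) (at x) \<and>
        (fu has_derivative (\<lambda>(a,b). a *\<^sub>R fuu x + b *\<^sub>R fuv x)) (at x) \<and>
        (fv has_derivative (\<lambda>(a,b). a *\<^sub>R fvu x + b *\<^sub>R fvv x)) (at x)) \<and>
     continuous_on S fuu \<and> continuous_on S fuv \<and>
     continuous_on S fvu \<and> continuous_on S fvv"

definition mean_curv ::
  "real^3 \<Rightarrow> real^3 \<Rightarrow> real^3 \<Rightarrow> real^3 \<Rightarrow> real^3 \<Rightarrow> real" where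
  "mean_curv xu xv xuu xuv xvv =
     (let E = xu \<bullet> xu; F = xu \<bullet> xv; G = xv \<bullet> xv;
          N = (1 / norm (cross3 xu xv)) *\<^sub>R cross3 xu xv;
          L = xuu \<bullet> N; M = xuv \<bullet> N; NN = xvv \<bullet> N
      in (E * NN - 2 * F * M + G * L) / (2 * (E * G - F\<^sup>2)))"

text \<open>An H-disk: the image f(closed unit disk) of a topological embedding
  (continuous injective map of the compact disk) which, on the open disk,
  is a C^2 immersion whose mean curvature is constantly H for one of the
  two orientations (unit normals N or -N).  Its boundary is f(unit circle).\<close>

definition H_disk :: "real \<Rightarrow> (real \<times> real \<Rightarrow> real^3) \<Rightarrow> bool" where
  "H_disk H f \<longleftrightarrow>
     continuous_on (cball 0 1) f \<and> inj_on f (cball 0 1) \<and>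
     (\<exists>fu fv fuu fuv fvu fvv.
        C2_param (ball 0 1) f fu fv fuu fuv fvu fvv \<and>
        (\<forall>x\<in>ball 0 1. cross3 (fu x) (fv x) \<noteq> 0) \<and>
        ((\<forall>x\<in>ball 0 1. mean_curv (fu x) (fv x) (fuu x) (fuv x) (fvv x) = H) \<or>
         (\<forall>x\<in>ball 0 1. mean_curv (fu x) (fv x) (fuu x) (fuv x) (fvv x) = - H)))"

end

theory Submission
  imports Defs "HOL-Analysis.Cross3" "HOL-Complex_Analysis.Winding_Numbers"
begin

text \<open>Rescale so that the mean curvature is 1 and \<open>p = 0\<close>, and suppose that the boundary lies outside the ball
  of radius 60. A compact cap of the surface cut off by a plane has height at most 4: Alexandrov reflection
  shows that its upper half is a graph, and graphs of mean curvature 1 have height at most 2. Therefore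
  the component of any slab of half-width 5 through its central point reaches the boundary. Join \<open>p\<close> inside the
  ball of radius 20 to a point \<open>q\<close> with \<open>norm q = 20\<close>, follow from \<open>p\<close> and from \<open>q\<close> the two disjoint slabs orthogonal
  to \<open>q\<close> to the boundary, and close up near the boundary. This loop in the disk is mapped to a curve linking
  once a circle of radius about 30 which lies halfway between the slabs.

  On the other hand, a ball of radius 2 moved once around this circle cannot return having crossed the surface
  with non-zero total sign, since a ball of radius larger than 1 cannot touch the surface from its mean
  convex side; the same holds for the part of the surface over the points of the disk where the loop has
  a given winding number. Hence the intersection points of the circle with the surface, counted with sign and with
  the winding number of the loop around them, add up to 0. This count is the linking number, a
  contradiction.\<close>

section \<open>Surfaces of mean curvature one\<close>

text \<open>The linking number appears as the winding number of a complex function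
  \<open>lev\<close> whose zero set is the circle, so all counting happens in the parameter disk.
  The obstacle is that the loop winds around different parameters differently often. Loop and
  boundary are mapped outside a tube around the circle; hence the sheet over the parameters of
  winding number k is closed in the tube, the moving ball applies to it alone, and the weighted
  count vanishes for each k separately. Constants: half-width 5 exceeds the cap height 4. The slabs
  fill heights below 5 and above 15; a tube of radius 3, large enough for balls of radius 2, around
  a circle at height 9 to 11 fits between them. Circle radius 30 to 31 keeps the tube outside the
  ball of radius 20, which contains the path from \<open>p\<close> to \<open>q\<close>, and inside
  the ball of radius 59; the boundary at distance 60 leaves a collar in which the loop is closed up.
  Height and radius of the circle are left free in intervals so that Sard's theorem can make every
  crossing transversal.\<close>

lemma second_derivative_at_min:
  fixes \<phi> \<phi>' :: "real \<Rightarrow> real"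
  assumes d1: "\<forall>\<^sub>F s in nhds 0. (\<phi> has_real_derivative \<phi>' s) (at s)"
    and d2: "(\<phi>' has_real_derivative d) (at 0)"
    and mn: "\<forall>\<^sub>F s in nhds 0. \<phi> 0 \<le> \<phi> s"
  shows "\<phi>' 0 = 0" "d \<ge> 0"
proof -
  obtain e1 where e1: "e1 > 0" "\<And>s. \<bar>s\<bar> < e1 \<Longrightarrow> (\<phi> has_real_derivative \<phi>' s) (at s) \<and> \<phi> 0 \<le> \<phi> s"
    using eventually_conj[OF d1 mn] unfolding eventually_nhds_metric by (auto simp: dist_real_def)
  show z: "\<phi>' 0 = 0"
    using DERIV_local_min[of \<phi> "\<phi>' 0" 0 e1] e1 by auto
  show "d \<ge> 0"
  proof (rule ccontr)
    assume "\<not> d \<ge> 0"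
    then obtain e2 where e2: "e2 > 0" "\<And>h. 0 < h \<Longrightarrow> h < e2 \<Longrightarrow> \<phi>' h < \<phi>' 0"
      using has_real_derivative_neg_dec_right[of \<phi>' d 0 UNIV] d2 by auto
    define h where "h = min e1 e2 / 2"
    have h: "0 < h" "h < e1" "h < e2" using e1(1) e2(1) by (auto simp: h_def)
    obtain z where z1: "0 < z" "z < h" "\<phi> h - \<phi> 0 = (h - 0) * \<phi>' z"
      using MVT2[of 0 h \<phi> \<phi>'] h e1(2) by auto
    have "\<phi>' z < 0" using e2(2)[of z] z1 h z by auto
    then have "h * \<phi>' z < 0" using h by (simp add: mult_pos_neg)
    then have "\<phi> h < \<phi> 0" using z1 by simp
    then show False using e1(2)[of h] h by auto
  qed
qed

section \<open>Derivatives along lines and mixed partial derivatives\<close>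

lemma eventually_line_in_open:
  fixes x v :: "'a::real_normed_vector"
  assumes "open S" "x \<in> S"
  shows "\<forall>\<^sub>F s in nhds (0::real). x + s *\<^sub>R v \<in> S"
proof -
  have "((\<lambda>s. x + s *\<^sub>R v) \<longlongrightarrow> x + 0 *\<^sub>R v) (nhds 0)"
    by (intro tendsto_add tendsto_const tendsto_scaleR filterlim_ident)
  then show ?thesis using assms by (simp add: topological_tendstoD)
qed

lemma has_vector_derivative_along_line:
  fixes F :: "real \<times> real \<Rightarrow> 'b::real_normed_vector"
  assumes "(F has_derivative (\<lambda>(a,b). a *\<^sub>R Fu + b *\<^sub>R Fv)) (at (x + s *\<^sub>R v))"
  shows "((\<lambda>s. F (x + s *\<^sub>R v)) has_vector_derivative (fst v *\<^sub>R Fu + snd v *\<^sub>R Fv)) (at s)"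
proof -
  have "((\<lambda>s. x + s *\<^sub>R v) has_derivative (\<lambda>h. h *\<^sub>R v)) (at s)"
    by (auto intro!: derivative_eq_intros)
  from has_derivative_compose[OF this assms]
  show ?thesis
    by (simp add: has_vector_derivative_def case_prod_beta scaleR_add_right mult.commute)
qed

text \<open>\<open>C2_param\<close> lists the two mixed derivatives as separate functions. Schwarz's
  argument rests on the real mean value theorem, so everything is paired with the vector
  \<open>c\<close>, the supposed difference of the two mixed derivatives at
  \<open>x\<close>.\<close>

lemma mixed_partials_eq:
  fixes f :: "real \<times> real \<Rightarrow> 'b::euclidean_space"
  assumes S: "open S" "x \<in> S"
    and df: "\<And>x. x \<in> S \<Longrightarrow> (f has_derivative (\<lambda>(a,b). a *\<^sub>R fu x + b *\<^sub>R fv x)) (at x)"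
    and dfu: "\<And>x. x \<in> S \<Longrightarrow> (fu has_derivative (\<lambda>(a,b). a *\<^sub>R fuu x + b *\<^sub>R fuv x)) (at x)"
    and dfv: "\<And>x. x \<in> S \<Longrightarrow> (fv has_derivative (\<lambda>(a,b). a *\<^sub>R fvu x + b *\<^sub>R fvv x)) (at x)"
    and c1: "continuous_on S fuv" and c2: "continuous_on S fvu"
  shows "fuv x = fvu x"
proof (rule ccontr)
  assume ne: "fuv x \<noteq> fvu x"
  define c where "c = fuv x - fvu x"
  have cpos: "c \<bullet> fuv x - c \<bullet> fvu x > 0" using ne by (simp add: c_def flip: inner_diff_right)
  define \<epsilon> where "\<epsilon> = (c \<bullet> fuv x - c \<bullet> fvu x) / 2"
  have "\<epsilon> > 0" using cpos by (simp add: \<epsilon>_def)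
  have cont1: "isCont (\<lambda>y. c \<bullet> fuv y) x" "isCont (\<lambda>y. c \<bullet> fvu y) x"
    using c1 c2 S by (auto intro!: continuous_intros simp: continuous_on_eq_continuous_at)
  obtain d1 where d1: "d1 > 0" "\<And>y. dist y x < d1 \<Longrightarrow> \<bar>c \<bullet> fuv y - c \<bullet> fuv x\<bar> < \<epsilon>"
    using cont1(1) \<open>\<epsilon> > 0\<close> unfolding continuous_at_eps_delta by (auto simp: dist_real_def)
  obtain d2 where d2: "d2 > 0" "\<And>y. dist y x < d2 \<Longrightarrow> \<bar>c \<bullet> fvu y - c \<bullet> fvu x\<bar> < \<epsilon>"
    using cont1(2) \<open>\<epsilon> > 0\<close> unfolding continuous_at_eps_delta by (auto simp: dist_real_def)
  obtain d3 where d3: "d3 > 0" "ball x d3 \<subseteq> S" using S open_contains_ball by blast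
  define h where "h = min d1 (min d2 d3) / 3"
  have h: "h > 0" "2 * h < d1" "2 * h < d2" "2 * h < d3" using d1(1) d2(1) d3(1) by (auto simp: h_def)
  obtain x1 x2 where x: "x = (x1,x2)" by force
  have near: "dist (a,b) x < 2*h" if "x1 \<le> a" "a \<le> x1+h" "x2 \<le> b" "b \<le> x2+h" for a b
  proof -
    have "dist (a,b) x \<le> \<bar>a - x1\<bar> + \<bar>b - x2\<bar>"
      unfolding x dist_Pair_Pair dist_real_def power2_abs by (rule sqrt_sum_squares_le_sum_abs)
    moreover have "dist (a,b) x < 2*h \<or> (a = x1+h \<and> b = x2 + h)" using calculation that by auto
    moreover have "dist (x1+h,x2+h) x < 2*h"
    proof -
      have "sqrt (h\<^sup>2+h\<^sup>2) < 2*h" using h by (intro real_less_lsqrt) (auto simp: power2_eq_square)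
      then show ?thesis by (simp add: x dist_Pair_Pair dist_real_def)
    qed
    ultimately show ?thesis by auto
  qed
  have inS: "(a,b) \<in> S" if "x1 \<le> a" "a \<le> x1+h" "x2 \<le> b" "b \<le> x2+h" for a b
    using near[OF that] d3 h by (auto simp: dist_commute)
  have L1: "((\<lambda>t. c \<bullet> F (t,b)) has_real_derivative c \<bullet> Fu) (at a)"
    if "(F has_derivative (\<lambda>(p,q). p *\<^sub>R Fu + q *\<^sub>R Fv)) (at (a,b))" for F :: "real\<times>real \<Rightarrow> 'b" and Fu Fv a b
  proof -
    have "((\<lambda>t. F (t,b)) has_derivative (\<lambda>h. h *\<^sub>R Fu)) (at a)"
      using has_derivative_compose[OF has_derivative_Pair[OF has_derivative_ident has_derivative_const] that] by simp
    then have "((\<lambda>t. c \<bullet> F (t,b)) has_derivative (\<lambda>h. c \<bullet> (h *\<^sub>R Fu))) (at a)"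
      by (rule has_derivative_inner_right)
    then show ?thesis by (simp add: has_field_derivative_def mult_commute_abs)
  qed
  have L2: "((\<lambda>t. c \<bullet> F (a,t)) has_real_derivative c \<bullet> Fv) (at b)"
    if "(F has_derivative (\<lambda>(p,q). p *\<^sub>R Fu + q *\<^sub>R Fv)) (at (a,b))" for F :: "real\<times>real \<Rightarrow> 'b" and Fu Fv a b
  proof -
    have "((\<lambda>t. F (a,t)) has_derivative (\<lambda>h. h *\<^sub>R Fv)) (at b)"
      using has_derivative_compose[OF has_derivative_Pair[OF has_derivative_const has_derivative_ident] that] by simp
    then have "((\<lambda>t. c \<bullet> F (a,t)) has_derivative (\<lambda>h. c \<bullet> (h *\<^sub>R Fv))) (at b)"
      by (rule has_derivative_inner_right)
    then show ?thesis by (simp add: has_field_derivative_def mult_commute_abs)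
  qed
  \<comment> \<open>The second difference over a square with corner \<open>x\<close>. Evaluated in
    the two orders, it equals \<open>h * h\<close> times the one or the other mixed derivative at
    some point of the square.\<close>
  let ?A = "(c \<bullet> f (x1+h,x2+h) - c \<bullet> f (x1+h,x2)) - (c \<bullet> f (x1,x2+h) - c \<bullet> f (x1,x2))"
  have "\<exists>z>x1. z < x1+h \<and> ?A = (x1+h-x1) * (c \<bullet> fu (z,x2+h) - c \<bullet> fu (z,x2))"
    by (rule MVT2[of x1 "x1+h" "\<lambda>t. c \<bullet> f (t,x2+h) - c \<bullet> f (t,x2)"])
       (use h in \<open>auto intro!: DERIV_diff L1[OF df] inS\<close>)
  then obtain z where z: "x1 < z" "z < x1+h" "?A = h * (c \<bullet> fu (z,x2+h) - c \<bullet> fu (z,x2))" by auto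
  have "\<exists>w>x2. w < x2+h \<and> c \<bullet> fu (z,x2+h) - c \<bullet> fu (z,x2) = (x2+h-x2) * (c \<bullet> fuv (z,w))"
    by (rule MVT2[of x2 "x2+h" "\<lambda>t. c \<bullet> fu (z,t)"])
       (use h z in \<open>auto intro!: L2[OF dfu] inS\<close>)
  then obtain w where w: "x2 < w" "w < x2+h" "?A = h * h * (c \<bullet> fuv (z,w))" using z by auto
  have "\<exists>z>x2. z < x2+h \<and> (c \<bullet> f (x1+h,x2+h) - c \<bullet> f (x1,x2+h)) - (c \<bullet> f (x1+h,x2) - c \<bullet> f (x1,x2)) = (x2+h-x2) * (c \<bullet> fv (x1+h,z) - c \<bullet> fv (x1,z))"
    by (rule MVT2[of x2 "x2+h" "\<lambda>t. c \<bullet> f (x1+h,t) - c \<bullet> f (x1,t)"])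
       (use h in \<open>auto intro!: DERIV_diff L2[OF df] inS\<close>)
  then obtain z' where z': "x2 < z'" "z' < x2+h" "?A = h * (c \<bullet> fv (x1+h,z') - c \<bullet> fv (x1,z'))" by auto
  have "\<exists>w>x1. w < x1+h \<and> c \<bullet> fv (x1+h,z') - c \<bullet> fv (x1,z') = (x1+h-x1) * (c \<bullet> fvu (w,z'))"
    by (rule MVT2[of x1 "x1+h" "\<lambda>t. c \<bullet> fv (t,z')"])
       (use h z' in \<open>auto intro!: L1[OF dfv] inS\<close>)
  then obtain w' where w': "x1 < w'" "w' < x1+h" "?A = h * h * (c \<bullet> fvu (w',z'))" using z' by auto
  have "h * h * (c \<bullet> fuv (z,w)) = h * h * (c \<bullet> fvu (w',z'))" using w(3) w'(3) by metis
  then have "c \<bullet> fuv (z,w) = c \<bullet> fvu (w',z')" using h by simp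
  moreover have "\<bar>c \<bullet> fuv (z,w) - c \<bullet> fuv x\<bar> < \<epsilon>"
    by (rule d1(2)) (use near[of z w] z w h in auto)
  moreover have "\<bar>c \<bullet> fvu (w',z') - c \<bullet> fvu x\<bar> < \<epsilon>"
    by (rule d2(2)) (use near[of w' z'] z' w' h in auto)
  ultimately show False by (simp add: \<epsilon>_def abs_if field_simps split: if_splits)
qed

text \<open>Scaling normalises the mean curvature to 1; \<open>nu\<close> is the unit normal pointing in the direction of
  the mean curvature vector, with partial derivatives \<open>nuu\<close> and \<open>nuv\<close>.\<close>

locale csurf =
  fixes f fu fv fuu fuv fvv nu nuu nuv :: "real \<times> real \<Rightarrow> real^3"
  assumes df: "\<And>x. x \<in> ball 0 1 \<Longrightarrow> (f has_derivative (\<lambda>(a,b). a *\<^sub>R fu x + b *\<^sub>R fv x)) (at x)"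
    and dfu: "\<And>x. x \<in> ball 0 1 \<Longrightarrow> (fu has_derivative (\<lambda>(a,b). a *\<^sub>R fuu x + b *\<^sub>R fuv x)) (at x)"
    and dfv: "\<And>x. x \<in> ball 0 1 \<Longrightarrow> (fv has_derivative (\<lambda>(a,b). a *\<^sub>R fuv x + b *\<^sub>R fvv x)) (at x)"
    and dnu: "\<And>x. x \<in> ball 0 1 \<Longrightarrow> (nu has_derivative (\<lambda>(a,b). a *\<^sub>R nuu x + b *\<^sub>R nuv x)) (at x)"
    and cuu: "continuous_on (ball 0 1) fuu" and cuv: "continuous_on (ball 0 1) fuv"
    and cvv: "continuous_on (ball 0 1) fvv"
    and cnu: "continuous_on (ball 0 1) nuu" and cnv: "continuous_on (ball 0 1) nuv"
    and cf: "continuous_on (cball 0 1) f" and injf: "inj_on f (cball 0 1)"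
    and nun: "\<And>x. x \<in> ball 0 1 \<Longrightarrow> nu x \<bullet> nu x = 1"
    and nufu: "\<And>x. x \<in> ball 0 1 \<Longrightarrow> nu x \<bullet> fu x = 0"
    and nufv: "\<And>x. x \<in> ball 0 1 \<Longrightarrow> nu x \<bullet> fv x = 0"
    and ind: "\<And>x. x \<in> ball 0 1 \<Longrightarrow> (fu x \<bullet> fu x) * (fv x \<bullet> fv x) - (fu x \<bullet> fv x)\<^sup>2 > 0"
    and mc: "\<And>x. x \<in> ball 0 1 \<Longrightarrow>
       (fu x \<bullet> fu x) * (fvv x \<bullet> nu x) - 2 * (fu x \<bullet> fv x) * (fuv x \<bullet> nu x) + (fv x \<bullet> fv x) * (fuu x \<bullet> nu x)
        = 2 * ((fu x \<bullet> fu x) * (fv x \<bullet> fv x) - (fu x \<bullet> fv x)\<^sup>2)"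

section \<open>From an H-disk to the normalised surface\<close>

lemma cross_inner_self:
  "cross3 x y \<bullet> cross3 x y = (x \<bullet> x) * (y \<bullet> y) - (x \<bullet> y)\<^sup>2" for x y :: "real^3"
  using norm_cross_dot[of x y] by (simp add: power_mult_distrib flip: power2_norm_eq_inner)

text \<open>Dilation by \<open>H\<close> multiplies the first fundamental form by the square of
  \<open>H\<close>, the second by \<open>H\<close>, and leaves the unit normal alone, so the
  curvature equation loses its factor \<open>H\<close>. The alternative between the two orientations
  is absorbed into a sign \<open>s\<close> in \<open>nu\<close>.\<close>

lemma H_disk_imp_csurf:
  assumes H: "H > 0" and hd: "H_disk H f"
  obtains fu fv fuu fuv fvv nu nuu nuv
  where "csurf (\<lambda>x. H *\<^sub>R (f x - p)) fu fv fuu fuv fvv nu nuu nuv"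
proof -
  obtain fu fv fuu fuv fvu fvv where cf: "continuous_on (cball 0 1) f" and injf: "inj_on f (cball 0 1)"
    and C2: "C2_param (ball 0 1) f fu fv fuu fuv fvu fvv"
    and cr: "\<forall>x\<in>ball 0 1. cross3 (fu x) (fv x) \<noteq> 0"
    and mcs: "(\<forall>x\<in>ball 0 1. mean_curv (fu x) (fv x) (fuu x) (fuv x) (fvv x) = H) \<or>
         (\<forall>x\<in>ball 0 1. mean_curv (fu x) (fv x) (fuu x) (fuv x) (fvv x) = - H)"
    using hd unfolding H_disk_def by blast
  obtain s :: real where s: "s = 1 \<or> s = -1"
    and mc: "\<And>x. x \<in> ball 0 1 \<Longrightarrow> mean_curv (fu x) (fv x) (fuu x) (fuv x) (fvv x) = s * H"
    using mcs by (metis mult_1 mult_minus1)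
  have df: "\<And>x. x \<in> ball 0 1 \<Longrightarrow> (f has_derivative (\<lambda>(a,b). a *\<^sub>R fu x + b *\<^sub>R fv x)) (at x)"
    and dfu: "\<And>x. x \<in> ball 0 1 \<Longrightarrow> (fu has_derivative (\<lambda>(a,b). a *\<^sub>R fuu x + b *\<^sub>R fuv x)) (at x)"
    and dfv': "\<And>x. x \<in> ball 0 1 \<Longrightarrow> (fv has_derivative (\<lambda>(a,b). a *\<^sub>R fvu x + b *\<^sub>R fvv x)) (at x)"
    and c: "continuous_on (ball 0 1) fuu" "continuous_on (ball 0 1) fuv" "continuous_on (ball 0 1) fvu" "continuous_on (ball 0 1) fvv"
    using C2 unfolding C2_param_def by auto
  have sym: "fvu x = fuv x" if "x \<in> ball 0 1" for x
    using mixed_partials_eq[OF open_ball that df dfu dfv' c(2,3)] by simp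
  have dfv: "\<And>x. x \<in> ball 0 1 \<Longrightarrow> (fv has_derivative (\<lambda>(a,b). a *\<^sub>R fuv x + b *\<^sub>R fvv x)) (at x)"
    using dfv' sym by metis
  have contfu: "continuous_on (ball 0 1) fu" "continuous_on (ball 0 1) fv"
    using dfu dfv has_derivative_continuous continuous_at_imp_continuous_on by blast+
  define m where "m x = cross3 (fu x) (fv x)" for x
  define mu where "mu x = cross3 (fuu x) (fv x) + cross3 (fu x) (fuv x)" for x
  define mv where "mv x = cross3 (fuv x) (fv x) + cross3 (fu x) (fvv x)" for x
  have bb: "bounded_bilinear cross3" using bilinear_cross bilinear_conv_bounded_bilinear by blast
  have dm: "(m has_derivative (\<lambda>(a,b). a *\<^sub>R mu x + b *\<^sub>R mv x)) (at x)" if x: "x \<in> ball 0 1" for x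
  proof -
    have m_eq: "m = (\<lambda>x. cross3 (fu x) (fv x))" by (simp add: fun_eq_iff m_def)
    show ?thesis unfolding m_eq
      by (rule has_derivative_eq_rhs[OF bounded_bilinear.FDERIV[OF bb dfu[OF x] dfv[OF x]]])
         (auto simp: fun_eq_iff mu_def mv_def cross_add_left cross_add_right cross_mult_left cross_mult_right scaleR_add_right)
  qed
  have m0: "m x \<noteq> 0" if "x \<in> ball 0 1" for x using cr that by (simp add: m_def)
  define nu where "nu x = (s / norm (m x)) *\<^sub>R m x" for x
  \<comment> \<open>\<open>pr x k\<close> is the differential at \<open>m x\<close> of the
    normalisation of \<open>m\<close> to length 1 (with sign \<open>s\<close>), applied to
    \<open>k\<close>; the closed formula exhibits the continuity of the partial derivatives of
    \<open>nu\<close>.\<close>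
  define pr where "pr x k = (s / norm (m x)) *\<^sub>R k - (s * (m x \<bullet> k) / norm (m x)^3) *\<^sub>R m x" for x k
  have dnu: "(nu has_derivative (\<lambda>(a,b). a *\<^sub>R pr x (mu x) + b *\<^sub>R pr x (mv x))) (at x)" if x: "x \<in> ball 0 1" for x
  proof -
    have n0: "norm (m x) \<noteq> 0" using m0[OF x] by simp
    have d1: "((\<lambda>x. m x \<bullet> m x) has_derivative (\<lambda>h. 2 * (m x \<bullet> (case h of (a,b) \<Rightarrow> a *\<^sub>R mu x + b *\<^sub>R mv x)))) (at x)"
      by (rule has_derivative_eq_rhs[OF has_derivative_inner[OF dm[OF x] dm[OF x]]]) (auto simp: fun_eq_iff inner_commute)
    have d2: "((\<lambda>x. norm (m x)) has_derivative (\<lambda>h. (m x \<bullet> (case h of (a,b) \<Rightarrow> a *\<^sub>R mu x + b *\<^sub>R mv x)) / norm (m x))) (at x)"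
      unfolding norm_eq_sqrt_inner
      by (rule has_derivative_eq_rhs[OF has_derivative_real_sqrt[OF _ d1]]) (use n0 in \<open>auto simp: fun_eq_iff field_simps\<close>)
    have d3: "((\<lambda>x. s / norm (m x)) has_derivative (\<lambda>h. - s * (m x \<bullet> (case h of (a,b) \<Rightarrow> a *\<^sub>R mu x + b *\<^sub>R mv x)) / norm (m x)^3)) (at x)"
      by (rule has_derivative_eq_rhs[OF has_derivative_divide[OF has_derivative_const d2 n0]])
         (use n0 in \<open>auto simp: fun_eq_iff field_simps power3_eq_cube\<close>)
    have nu_eq: "nu = (\<lambda>x. (s / norm (m x)) *\<^sub>R m x)" by (simp add: fun_eq_iff nu_def)
    show ?thesis unfolding nu_eq
    proof (rule has_derivative_eq_rhs[OF has_derivative_scaleR[OF d3 dm[OF x]]], rule ext, clarify)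
      fix a b :: real
      show "(s / norm (m x)) *\<^sub>R (a *\<^sub>R mu x + b *\<^sub>R mv x) + (- s * (m x \<bullet> (a *\<^sub>R mu x + b *\<^sub>R mv x)) / norm (m x) ^ 3) *\<^sub>R m x =
          a *\<^sub>R pr x (mu x) + b *\<^sub>R pr x (mv x)"
        by (simp add: pr_def inner_add_right scaleR_add_right scaleR_diff_right add_divide_distrib diff_divide_distrib
            scaleR_add_left scaleR_diff_left right_diff_distrib distrib_left mult.commute mult.left_commute)
    qed
  qed
  have contm: "continuous_on (ball 0 1) m" "continuous_on (ball 0 1) mu" "continuous_on (ball 0 1) mv"
    unfolding m_def mu_def mv_def using c contfu by (auto intro!: continuous_intros continuous_on_cross)
  have nm: "norm (m x) ^2 = (fu x \<bullet> fu x) * (fv x \<bullet> fv x) - (fu x \<bullet> fv x)\<^sup>2" for x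
    unfolding power2_norm_eq_inner m_def cross_inner_self ..
  have pos: "(fu x \<bullet> fu x) * (fv x \<bullet> fv x) - (fu x \<bullet> fv x)\<^sup>2 > 0" if "x \<in> ball 0 1" for x
    using m0[OF that] nm[of x] by (metis zero_less_norm_iff zero_less_power)
  have inn: "y \<bullet> nu x = s * (y \<bullet> ((1 / norm (m x)) *\<^sub>R m x))" for x y by (simp add: nu_def)
  have ss: "s * s = 1" using s by auto
  have mc': "(fu x \<bullet> fu x) * (fvv x \<bullet> nu x) - 2 * (fu x \<bullet> fv x) * (fuv x \<bullet> nu x) + (fv x \<bullet> fv x) * (fuu x \<bullet> nu x)
        = 2 * H * ((fu x \<bullet> fu x) * (fv x \<bullet> fv x) - (fu x \<bullet> fv x)\<^sup>2)" if x: "x \<in> ball 0 1" for x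
  proof -
    let ?N = "(1 / norm (m x)) *\<^sub>R m x"
    let ?D = "(fu x \<bullet> fu x) * (fv x \<bullet> fv x) - (fu x \<bullet> fv x)\<^sup>2"
    have "((fu x \<bullet> fu x) * (fvv x \<bullet> ?N) - 2 * (fu x \<bullet> fv x) * (fuv x \<bullet> ?N) + (fv x \<bullet> fv x) * (fuu x \<bullet> ?N)) / (2 * ?D) = s * H"
      using mc[OF x] by (simp only: mean_curv_def Let_def m_def)
    then have "(fu x \<bullet> fu x) * (fvv x \<bullet> ?N) - 2 * (fu x \<bullet> fv x) * (fuv x \<bullet> ?N) + (fv x \<bullet> fv x) * (fuu x \<bullet> ?N) = s * H * (2 * ?D)"
      using pos[OF x] by (simp only: divide_eq_eq) (auto split: if_splits)
    then have "s * ((fu x \<bullet> fu x) * (fvv x \<bullet> ?N) - 2 * (fu x \<bullet> fv x) * (fuv x \<bullet> ?N) + (fv x \<bullet> fv x) * (fuu x \<bullet> ?N)) = s * (s * H * (2 * ?D))"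
      by simp
    also have "\<dots> = 2 * H * ?D" using ss by (simp add: mult.assoc[symmetric])
    finally show ?thesis unfolding inn by (simp add: algebra_simps)
  qed
  have "csurf (\<lambda>x. H *\<^sub>R (f x - p)) (\<lambda>x. H *\<^sub>R fu x) (\<lambda>x. H *\<^sub>R fv x) (\<lambda>x. H *\<^sub>R fuu x) (\<lambda>x. H *\<^sub>R fuv x) (\<lambda>x. H *\<^sub>R fvv x)
     nu (\<lambda>x. pr x (mu x)) (\<lambda>x. pr x (mv x))"
  proof
    fix x :: "real \<times> real" assume x: "x \<in> ball 0 1"
    show "((\<lambda>x. H *\<^sub>R (f x - p)) has_derivative (\<lambda>(a, b). a *\<^sub>R H *\<^sub>R fu x + b *\<^sub>R H *\<^sub>R fv x)) (at x)"
      by (auto intro!: derivative_eq_intros df[OF x] simp: fun_eq_iff algebra_simps)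
    show "((\<lambda>x. H *\<^sub>R fu x) has_derivative (\<lambda>(a, b). a *\<^sub>R H *\<^sub>R fuu x + b *\<^sub>R H *\<^sub>R fuv x)) (at x)"
      by (auto intro!: derivative_eq_intros dfu[OF x] simp: fun_eq_iff algebra_simps)
    show "((\<lambda>x. H *\<^sub>R fv x) has_derivative (\<lambda>(a, b). a *\<^sub>R H *\<^sub>R fuv x + b *\<^sub>R H *\<^sub>R fvv x)) (at x)"
      by (auto intro!: derivative_eq_intros dfv[OF x] simp: fun_eq_iff algebra_simps)
    show "(nu has_derivative (\<lambda>(a, b). a *\<^sub>R pr x (mu x) + b *\<^sub>R pr x (mv x))) (at x)" by (rule dnu[OF x])
    show "nu x \<bullet> nu x = 1" using m0[OF x] ss by (simp add: nu_def power2_eq_square flip: power2_norm_eq_inner)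
    show "nu x \<bullet> H *\<^sub>R fu x = 0" "nu x \<bullet> H *\<^sub>R fv x = 0"
      by (simp_all add: nu_def m_def inner_commute dot_cross_self)
    show "0 < H *\<^sub>R fu x \<bullet> H *\<^sub>R fu x * (H *\<^sub>R fv x \<bullet> H *\<^sub>R fv x) - (H *\<^sub>R fu x \<bullet> H *\<^sub>R fv x)\<^sup>2"
    proof -
      have "H *\<^sub>R fu x \<bullet> H *\<^sub>R fu x * (H *\<^sub>R fv x \<bullet> H *\<^sub>R fv x) - (H *\<^sub>R fu x \<bullet> H *\<^sub>R fv x)\<^sup>2
        = H^4 * ((fu x \<bullet> fu x) * (fv x \<bullet> fv x) - (fu x \<bullet> fv x)\<^sup>2)"
        by (simp add: algebra_simps power2_eq_square power4_eq_xxxx)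
      then show ?thesis using pos[OF x] H by simp
    qed
    show "H *\<^sub>R fu x \<bullet> H *\<^sub>R fu x * (H *\<^sub>R fvv x \<bullet> nu x) - 2 * (H *\<^sub>R fu x \<bullet> H *\<^sub>R fv x) * (H *\<^sub>R fuv x \<bullet> nu x) +
         H *\<^sub>R fv x \<bullet> H *\<^sub>R fv x * (H *\<^sub>R fuu x \<bullet> nu x) =
         2 * (H *\<^sub>R fu x \<bullet> H *\<^sub>R fu x * (H *\<^sub>R fv x \<bullet> H *\<^sub>R fv x) - (H *\<^sub>R fu x \<bullet> H *\<^sub>R fv x)\<^sup>2)"
      (is "?l = ?r")
    proof -
      have "?l = H^3 * ((fu x \<bullet> fu x) * (fvv x \<bullet> nu x) - 2 * (fu x \<bullet> fv x) * (fuv x \<bullet> nu x) + (fv x \<bullet> fv x) * (fuu x \<bullet> nu x))"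
        by (simp add: algebra_simps power3_eq_cube)
      also have "\<dots> = ?r" unfolding mc'[OF x] by (simp add: algebra_simps power3_eq_cube power2_eq_square)
      finally show ?thesis .
    qed
  next
    show "continuous_on (ball 0 1) (\<lambda>x. H *\<^sub>R fuu x)" "continuous_on (ball 0 1) (\<lambda>x. H *\<^sub>R fuv x)" "continuous_on (ball 0 1) (\<lambda>x. H *\<^sub>R fvv x)"
      using c by (auto intro!: continuous_intros)
    show "continuous_on (ball 0 1) (\<lambda>x. pr x (mu x))" "continuous_on (ball 0 1) (\<lambda>x. pr x (mv x))"
      unfolding pr_def using contm m0 by (auto intro!: continuous_intros)
    show "continuous_on (cball 0 1) (\<lambda>x. H *\<^sub>R (f x - p))" using cf by (auto intro!: continuous_intros)
    show "inj_on (\<lambda>x. H *\<^sub>R (f x - p)) (cball 0 1)" using injf H by (auto simp: inj_on_def)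
  qed
  then show thesis by (rule that)
qed

section \<open>Orthonormal frames and curvature algebra\<close>

lemma perp_two_eq_cross:
  fixes a b x :: "real^3"
  assumes "x \<bullet> a = 0" "x \<bullet> b = 0" "cross3 a b \<noteq> 0"
  shows "x = ((x \<bullet> cross3 a b) / (cross3 a b \<bullet> cross3 a b)) *\<^sub>R cross3 a b"
proof -
  let ?c = "cross3 a b"
  let ?z = "x - ((x \<bullet> ?c) / (?c \<bullet> ?c)) *\<^sub>R ?c"
  have "?z \<bullet> ?c = 0" using assms(3) by (simp add: inner_diff_left)
  \<comment> \<open>Triple product formula: the product is a combination of \<open>a\<close> and
    \<open>b\<close> with coefficients \<open>x \<bullet> b\<close> and
    \<open>x \<bullet> a\<close>, both 0.\<close>
  moreover have "cross3 x ?c = 0"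
  proof -
    have "cross3 x ?c = (x \<bullet> b) *\<^sub>R a - (x \<bullet> a) *\<^sub>R b"
      by (simp add: cross3_simps forall_3)
    then show ?thesis using assms by simp
  qed
  then have "cross3 ?z ?c = 0" by (simp add: Cross3.left_diff_distrib cross_mult_left)
  ultimately have "?z = 0" using norm_and_cross_eq_0[of ?z ?c] assms(3) by blast
  then show ?thesis by simp
qed

text \<open>No orientation is prescribed. Where a sign depends on it, \<open>b = cross3 e a\<close>
  is assumed in addition.\<close>

definition orthoframe :: "real^3 \<Rightarrow> real^3 \<Rightarrow> real^3 \<Rightarrow> bool" where
  "orthoframe a b n \<longleftrightarrow> a \<bullet> a = 1 \<and> b \<bullet> b = 1 \<and> n \<bullet> n = 1 \<and> a \<bullet> b = 0 \<and> a \<bullet> n = 0 \<and> b \<bullet> n = 0"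

lemma orthoframe_expand:
  assumes "orthoframe a b n"
  shows "x = (x \<bullet> a) *\<^sub>R a + (x \<bullet> b) *\<^sub>R b + (x \<bullet> n) *\<^sub>R n"
proof -
  have o: "a \<bullet> a = 1" "b \<bullet> b = 1" "n \<bullet> n = 1" "a \<bullet> b = 0" "a \<bullet> n = 0" "b \<bullet> n = 0" "b \<bullet> a = 0" "n \<bullet> a = 0" "n \<bullet> b = 0"
    using assms by (auto simp: orthoframe_def inner_commute)
  have c1: "cross3 a b \<bullet> cross3 a b = 1" unfolding cross_inner_self using o by simp
  then have c: "cross3 a b \<noteq> 0" by auto
  let ?z = "x - (x \<bullet> a) *\<^sub>R a - (x \<bullet> b) *\<^sub>R b - (x \<bullet> n) *\<^sub>R n"
  have z: "?z \<bullet> a = 0" "?z \<bullet> b = 0" "?z \<bullet> n = 0" using o by (simp_all add: inner_diff_left)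
  obtain k where k: "?z = k *\<^sub>R cross3 a b" using perp_two_eq_cross[OF z(1,2) c] by blast
  obtain l where l: "n = l *\<^sub>R cross3 a b" using perp_two_eq_cross[OF o(8,9) c] by blast
  have "k * l = 0" using z(3) unfolding k by (subst (asm) l) (auto simp: c1)
  moreover have "l \<noteq> 0" using l o by auto
  ultimately have "?z = 0" using k by simp
  then show ?thesis by (simp add: algebra_simps)
qed

lemma orthoframe_inner:
  assumes "orthoframe a b n"
  shows "x \<bullet> y = (x \<bullet> a) * (y \<bullet> a) + (x \<bullet> b) * (y \<bullet> b) + (x \<bullet> n) * (y \<bullet> n)"
proof -
  have "x \<bullet> y = x \<bullet> ((y \<bullet> a) *\<^sub>R a + (y \<bullet> b) *\<^sub>R b + (y \<bullet> n) *\<^sub>R n)"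
    using orthoframe_expand[OF assms, of y] by simp
  then show ?thesis by (simp add: inner_add_right algebra_simps)
qed

lemma unit_perp_two:
  fixes m n :: "real^3"
  obtains a where "a \<bullet> a = 1" "a \<bullet> m = 0" "a \<bullet> n = 0"
proof -
  have "\<exists>a. a \<noteq> 0 \<and> a \<bullet> m = 0 \<and> a \<bullet> n = 0"
  proof (cases "cross3 m n = 0")
    case False
    then show ?thesis using dot_cross_self by (metis inner_commute)
  next
    case True
    show ?thesis
    proof (cases "n = 0")
      case n0: True
      obtain z where "z \<noteq> 0" "orthogonal m z" using orthogonal_to_vector_exists[of m] by auto
      then show ?thesis using n0 by (auto simp: orthogonal_def inner_commute)
    next
      case n0: False
      obtain z where z: "z \<noteq> 0" "orthogonal n z" using orthogonal_to_vector_exists[of n] by auto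
      let ?m = "m - ((m \<bullet> n) / (n \<bullet> n)) *\<^sub>R n"
      have "?m \<bullet> n = 0" using n0 by (simp add: inner_diff_left)
      moreover have "cross3 ?m n = 0" using True by (simp add: Cross3.left_diff_distrib cross_mult_left)
      ultimately have "?m = 0" using norm_and_cross_eq_0[of ?m n] n0 by blast
      then have "m = ((m \<bullet> n) / (n \<bullet> n)) *\<^sub>R n" by simp
      then have "z \<bullet> m = 0" using z(2) by (metis inner_scaleR_right mult_zero_right orthogonal_def inner_commute)
      then show ?thesis using z by (auto simp: orthogonal_def inner_commute)
    qed
  qed
  then obtain a where a: "a \<noteq> 0" "a \<bullet> m = 0" "a \<bullet> n = 0" by blast
  show thesis
    by (rule that[of "(1 / norm a) *\<^sub>R a"]) (use a in \<open>auto simp: dot_square_norm power2_eq_square\<close>)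
qed

lemma orthoframe_cross:
  assumes "n \<bullet> n = 1" "a \<bullet> a = 1" "a \<bullet> n = 0"
  shows "orthoframe a (cross3 n a) n"
  using assms cross_inner_self[of n a] unfolding orthoframe_def
  by (auto simp: inner_commute dot_cross_self)

lemma orthoframe_exists:
  assumes "(n::real^3) \<bullet> n = 1"
  obtains a b where "orthoframe a b n"
  using orthoframe_cross assms unit_perp_two[of n n] by metis

text \<open>\<open>(a1, b1)\<close> and \<open>(a2, b2)\<close> are the horizontal components of the
  two coordinate vectors, \<open>(p, q)\<close> is the gradient of the graph,
  \<open>\<kappa>\<close> the vertical component of the unit normal, and \<open>Pu\<close> to
  \<open>Qv\<close> are the derivatives of the gradient in the parameters. In these terms both sides
  of the curvature equation carry the factor \<open>\<delta>\<^sup>2\<close>, the squared Jacobian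
  of the projection; cancelling it leaves the mean curvature equation of graphs.\<close>

lemma graph_mean_curvature_algebra:
  fixes p q p1 p2 q1 q2 a1 b1 a2 b2 \<kappa> :: real
  assumes "\<delta> = a1 * b2 - a2 * b1" "\<delta> \<noteq> 0" "\<kappa> > 0" "\<kappa>\<^sup>2 * (1 + p\<^sup>2 + q\<^sup>2) = 1"
    and "E = a1\<^sup>2 + b1\<^sup>2 + (p*a1+q*b1)\<^sup>2" "F = a1*a2 + b1*b2 + (p*a1+q*b1)*(p*a2+q*b2)"
    and "G = a2\<^sup>2 + b2\<^sup>2 + (p*a2+q*b2)\<^sup>2"
    and "Pu = p1*a1+p2*b1" "Pv = p1*a2+p2*b2" "Qu = q1*a1+q2*b1" "Qv = q1*a2+q2*b2"
    and "L = \<kappa>*(Pu*a1+Qu*b1)" "M = \<kappa>*(Pv*a1+Qv*b1)" "M = \<kappa>*(Pu*a2+Qu*b2)" "N = \<kappa>*(Pv*a2+Qv*b2)"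
    and mc: "E*N - 2*F*M + G*L = 2*(E*G-F\<^sup>2)"
  shows "(1+q\<^sup>2)*p1 - p*q*(p2+q1) + (1+p\<^sup>2)*q2 = 2 * (1 + p\<^sup>2 + q\<^sup>2) * sqrt (1 + p\<^sup>2 + q\<^sup>2)"
proof -
  \<comment> \<open>Averaging the two formulas for \<open>M\<close> brings in \<open>p2\<close> and
    \<open>q1\<close> only through their sum.\<close>
  have M2: "2 * M = \<kappa>*(Pv*a1+Qv*b1 + Pu*a2+Qu*b2)" using assms by (simp add: algebra_simps)
  have "E*N - 2*F*M + G*L = E*N - F*(2*M) + G*L" by simp
  also have "\<dots> = \<kappa> * (\<delta>\<^sup>2 * ((1+q\<^sup>2)*p1 - p*q*(p2+q1) + (1+p\<^sup>2)*q2))"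
    unfolding M2 unfolding assms(1,5-12,15) by (simp only: power2_eq_square) algebra
  finally have 1: "E*N - 2*F*M + G*L = \<kappa> * (\<delta>\<^sup>2 * ((1+q\<^sup>2)*p1 - p*q*(p2+q1) + (1+p\<^sup>2)*q2))" .
  have 2: "E*G-F\<^sup>2 = \<delta>\<^sup>2 * (1 + p\<^sup>2 + q\<^sup>2)" unfolding assms(1,5-7) by (simp only: power2_eq_square) algebra
  have "\<delta>\<^sup>2 * (\<kappa> * ((1+q\<^sup>2)*p1 - p*q*(p2+q1) + (1+p\<^sup>2)*q2)) = \<delta>\<^sup>2 * (2 * (1 + p\<^sup>2 + q\<^sup>2))"
    using mc unfolding 1 2 by (simp add: algebra_simps)
  then have 3: "\<kappa> * ((1+q\<^sup>2)*p1 - p*q*(p2+q1) + (1+p\<^sup>2)*q2) = 2 * (1 + p\<^sup>2 + q\<^sup>2)" using \<open>\<delta> \<noteq> 0\<close> by simp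
  have "(\<kappa> * sqrt (1 + p\<^sup>2 + q\<^sup>2))\<^sup>2 = 1" using assms(4) by (simp add: power_mult_distrib)
  moreover have "\<kappa> * sqrt (1 + p\<^sup>2 + q\<^sup>2) \<ge> 0" using \<open>\<kappa> > 0\<close> by simp
  ultimately have 4: "sqrt (1 + p\<^sup>2 + q\<^sup>2) * \<kappa> = 1" by (metis mult.commute one_power2 power2_eq_imp_eq zero_le_one)
  have "sqrt (1 + p\<^sup>2 + q\<^sup>2) * (\<kappa> * ((1+q\<^sup>2)*p1 - p*q*(p2+q1) + (1+p\<^sup>2)*q2)) = sqrt (1 + p\<^sup>2 + q\<^sup>2) * (2 * (1 + p\<^sup>2 + q\<^sup>2))"
    unfolding 3 ..
  then show ?thesis unfolding mult.assoc[symmetric] 4 by (simp add: algebra_simps)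
qed

text \<open>\<open>(a1, b1)\<close> and \<open>(a2, b2)\<close> are orthonormal for the metric with
  coefficients \<open>E\<close>, \<open>F\<close>, \<open>G\<close>. Orthonormality inverts the
  metric: the three relations in the proof are the entries of the inverse matrix times the
  determinant. The left-hand side is therefore the trace of the second fundamental form with respect
  to the first.\<close>

lemma trace_algebra:
  fixes E F G L M N :: real
  assumes "E*a1\<^sup>2+2*F*a1*b1+G*b1\<^sup>2 = 1" "E*a2\<^sup>2+2*F*a2*b2+G*b2\<^sup>2 = 1"
    and "E*a1*a2+F*(a1*b2+a2*b1)+G*b1*b2 = 0"
    and mc: "E*N - 2*F*M + G*L = 2*(E*G-F\<^sup>2)" and pos: "E*G-F\<^sup>2 > 0"
  shows "(a1\<^sup>2*L + 2*a1*b1*M + b1\<^sup>2*N) + (a2\<^sup>2*L + 2*a2*b2*M + b2\<^sup>2*N) = 2"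
proof -
  let ?d = "E*G-F\<^sup>2"
  have 1: "?d*(a1\<^sup>2+a2\<^sup>2) = G" "?d*(b1\<^sup>2+b2\<^sup>2) = E" "?d*(a1*b1+a2*b2) = -F"
    using assms(1-3) unfolding power2_eq_square by algebra+
  have "?d * ((a1\<^sup>2*L + 2*a1*b1*M + b1\<^sup>2*N) + (a2\<^sup>2*L + 2*a2*b2*M + b2\<^sup>2*N))
     = (?d*(a1\<^sup>2+a2\<^sup>2))*L + 2*(?d*(a1*b1+a2*b2))*M + (?d*(b1\<^sup>2+b2\<^sup>2))*N" by (simp add: algebra_simps)
  also have "\<dots> = 2 * ?d" unfolding 1 using mc by (simp add: algebra_simps)
  finally have "?d * ((a1\<^sup>2*L + 2*a1*b1*M + b1\<^sup>2*N) + (a2\<^sup>2*L + 2*a2*b2*M + b2\<^sup>2*N) - 2) = 0"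
    by (simp add: right_diff_distrib)
  then show ?thesis using pos by simp
qed

section \<open>Tangent vectors, second derivatives, touching balls and local graphs\<close>

context csurf
begin

definition Dv :: "real \<times> real \<Rightarrow> real \<times> real \<Rightarrow> real^3" where
  "Dv x v = fst v *\<^sub>R fu x + snd v *\<^sub>R fv x"

text \<open>The whole second derivative of \<open>f\<close> along the parameter line in direction
  \<open>v\<close>; only its component along \<open>nu\<close> is the second fundamental
  form.\<close>

definition II :: "real \<times> real \<Rightarrow> real \<times> real \<Rightarrow> real^3" where
  "II x v = (fst v)\<^sup>2 *\<^sub>R fuu x + (2 * fst v * snd v) *\<^sub>R fuv x + (snd v)\<^sup>2 *\<^sub>R fvv x"

lemma curve_deriv:
  assumes "x + s *\<^sub>R v \<in> ball 0 1"
  shows "((\<lambda>s. f (x + s *\<^sub>R v)) has_vector_derivative Dv (x + s *\<^sub>R v) v) (at s)"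
  unfolding Dv_def by (rule has_vector_derivative_along_line[OF df[OF assms]])

lemma curve_deriv2:
  assumes "x + s *\<^sub>R v \<in> ball 0 1"
  shows "((\<lambda>s. Dv (x + s *\<^sub>R v) v) has_vector_derivative II (x + s *\<^sub>R v) v) (at s)"
proof -
  obtain a b where v: "v = (a,b)" by force
  have 1: "((\<lambda>s. fu (x + s *\<^sub>R v)) has_vector_derivative (a *\<^sub>R fuu (x + s *\<^sub>R v) + b *\<^sub>R fuv (x + s *\<^sub>R v))) (at s)"
    using has_vector_derivative_along_line[OF dfu[OF assms]] by (simp add: v)
  have 2: "((\<lambda>s. fv (x + s *\<^sub>R v)) has_vector_derivative (a *\<^sub>R fuv (x + s *\<^sub>R v) + b *\<^sub>R fvv (x + s *\<^sub>R v))) (at s)"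
    using has_vector_derivative_along_line[OF dfv[OF assms]] by (simp add: v)
  have 3: "((\<lambda>s. a *\<^sub>R fu (x + s *\<^sub>R v) + b *\<^sub>R fv (x + s *\<^sub>R v)) has_vector_derivative
     (a *\<^sub>R (a *\<^sub>R fuu (x + s *\<^sub>R v) + b *\<^sub>R fuv (x + s *\<^sub>R v)) + b *\<^sub>R (a *\<^sub>R fuv (x + s *\<^sub>R v) + b *\<^sub>R fvv (x + s *\<^sub>R v)))) (at s)"
    by (intro has_vector_derivative_add bounded_linear.has_vector_derivative[OF bounded_linear_scaleR_right] 1 2)
  have 4: "a *\<^sub>R (a *\<^sub>R X + b *\<^sub>R Y) + b *\<^sub>R (a *\<^sub>R Y + b *\<^sub>R Z) = a\<^sup>2 *\<^sub>R X + (2 * a * b) *\<^sub>R Y + b\<^sup>2 *\<^sub>R Z" for X Y Z :: "real^3"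
    by (simp add: vec_eq_iff power2_eq_square algebra_simps)
  show ?thesis using 3 unfolding 4 by (simp add: Dv_def II_def v)
qed

lemma cont_fu: "continuous_on (ball 0 1) fu" and cont_fv: "continuous_on (ball 0 1) fv"
  and cont_nu: "continuous_on (ball 0 1) nu"
  by (intro continuous_at_imp_continuous_on ballI has_derivative_continuous, erule dfu,
      intro continuous_at_imp_continuous_on ballI has_derivative_continuous, erule dfv,
      intro continuous_at_imp_continuous_on ballI has_derivative_continuous, erule dnu)

lemma cross_ne: "x \<in> ball 0 1 \<Longrightarrow> cross3 (fu x) (fv x) \<noteq> 0"
  using ind[of x] cross_inner_self[of "fu x" "fv x"] by auto

text \<open>Cramer's rule for the Gram matrix yields \<open>v\<close> such that
  \<open>Dv x v\<close> and \<open>y\<close> have the same products with \<open>fu x\<close> and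
  \<open>fv x\<close>. The remainder is orthogonal to both, hence a multiple of the cross product
  and so of \<open>nu x\<close>; being orthogonal to \<open>nu x\<close> as well, it is 0.\<close>

lemma perp_nu_iff_tangent:
  assumes x: "x \<in> ball 0 1"
  shows "y \<bullet> nu x = 0 \<longleftrightarrow> (\<exists>v. y = Dv x v)"
proof
  assume y: "y \<bullet> nu x = 0"
  define d where "d = (fu x \<bullet> fu x) * (fv x \<bullet> fv x) - (fu x \<bullet> fv x)\<^sup>2"
  have d: "d > 0" using ind[OF x] by (simp add: d_def)
  define v where "v = (((fv x \<bullet> fv x) * (y \<bullet> fu x) - (fu x \<bullet> fv x) * (y \<bullet> fv x)) / d, ((fu x \<bullet> fu x) * (y \<bullet> fv x) - (fu x \<bullet> fv x) * (y \<bullet> fu x)) / d)"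
  let ?z = "y - Dv x v"
  have "Dv x v \<bullet> fu x = y \<bullet> fu x" "Dv x v \<bullet> fv x = y \<bullet> fv x"
    using d by (simp_all add: Dv_def v_def inner_add_left field_simps inner_commute[of "fv x" "fu x"])
       (simp_all add: d_def algebra_simps power2_eq_square)
  then have z: "?z \<bullet> fu x = 0" "?z \<bullet> fv x = 0" by (simp_all add: inner_diff_left)
  have zn: "?z \<bullet> nu x = 0" using y nufu[OF x] nufv[OF x] by (simp add: Dv_def inner_diff_left inner_add_left inner_commute[of _ "nu x"] inner_diff_right inner_add_right)
  obtain k where k: "?z = k *\<^sub>R cross3 (fu x) (fv x)" using perp_two_eq_cross[OF z cross_ne[OF x]] by blast
  obtain l where l: "nu x = l *\<^sub>R cross3 (fu x) (fv x)" using perp_two_eq_cross[OF nufu[OF x] nufv[OF x] cross_ne[OF x]] by blast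
  have "k * l = 0" using zn cross_ne[OF x] unfolding k by (subst (asm) l) auto
  moreover have "l \<noteq> 0" using l nun[OF x] by auto
  ultimately have "?z = 0" using k by simp
  then have "y = Dv x v" by simp
  then show "\<exists>v. y = Dv x v" ..
next
  assume "\<exists>v. y = Dv x v"
  then show "y \<bullet> nu x = 0" using nufu[OF x] nufv[OF x] by (auto simp: Dv_def inner_add_left inner_commute[of _ "nu x"] inner_add_right)
qed

lemma II_trace:
  assumes x: "x \<in> ball 0 1" and "Dv x v \<bullet> Dv x v = 1" "Dv x w \<bullet> Dv x w = 1" "Dv x v \<bullet> Dv x w = 0"
  shows "II x v \<bullet> nu x + II x w \<bullet> nu x = 2"
proof -
  have "((fst v)\<^sup>2 * (fuu x \<bullet> nu x) + 2 * fst v * snd v * (fuv x \<bullet> nu x) + (snd v)\<^sup>2 * (fvv x \<bullet> nu x))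
     + ((fst w)\<^sup>2 * (fuu x \<bullet> nu x) + 2 * fst w * snd w * (fuv x \<bullet> nu x) + (snd w)\<^sup>2 * (fvv x \<bullet> nu x)) = 2"
    by (rule trace_algebra[OF _ _ _ mc[OF x] ind[OF x]])
       (use assms(2-4) in \<open>simp_all add: Dv_def inner_add_left inner_add_right inner_commute[of "fv x" "fu x"] algebra_simps power2_eq_square\<close>)
  then show ?thesis by (simp add: II_def inner_add_left)
qed

lemma tangent_frame:
  assumes x: "x \<in> ball 0 1" and "orthoframe a b (nu x)"
  obtains v w where "Dv x v = a" "Dv x w = b"
  using assms perp_nu_iff_tangent[OF x] unfolding orthoframe_def by metis

text \<open>The squared distance to \<open>c\<close> has a local minimum at \<open>x\<close>. Half
  its second derivative in a unit tangent direction is 1 minus \<open>r\<close> times the normal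
  curvature. Added over an orthonormal pair this is \<open>2 - 2 * r\<close>, because the two normal
  curvatures have sum 2. The restriction concerns only balls on the side of
  \<open>nu\<close>.\<close>

lemma inner_touching_ball_radius:
  assumes x: "x \<in> ball 0 1" and touch: "\<forall>\<^sub>F y in nhds x. norm (f x - c) \<le> norm (f y - c)"
    and c: "c = f x + r *\<^sub>R nu x"
  shows "r \<le> 1"
proof -
  have *: "Dv x v \<bullet> Dv x v + (f x - c) \<bullet> II x v \<ge> 0" for v
  proof -
    let ?p = "\<lambda>s. f (x + s *\<^sub>R v)"
    have ev: "\<forall>\<^sub>F s in nhds (0::real). x + s *\<^sub>R v \<in> ball 0 1" using eventually_line_in_open[OF open_ball x] .
    have d1: "\<forall>\<^sub>F s in nhds 0. ((\<lambda>s. (?p s - c) \<bullet> (?p s - c)) has_real_derivative (2 * ((?p s - c) \<bullet> Dv (x + s *\<^sub>R v) v))) (at s)"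
      using ev
    proof eventually_elim
      case (elim s)
      have "((\<lambda>s. ?p s - c) has_vector_derivative Dv (x + s *\<^sub>R v) v) (at s)"
        using has_vector_derivative_diff[OF curve_deriv[OF elim] has_vector_derivative_const[of c]] by simp
      from has_derivative_inner[OF this[unfolded has_vector_derivative_def] this[unfolded has_vector_derivative_def]]
      show ?case unfolding has_field_derivative_def
        by (rule has_derivative_eq_rhs) (simp add: fun_eq_iff inner_commute)
    qed
    have x0: "x + 0 *\<^sub>R v \<in> ball 0 1" using x by simp
    have c1: "((\<lambda>s. ?p s - c) has_vector_derivative Dv x v) (at 0)"
      using has_vector_derivative_diff[OF curve_deriv[OF x0] has_vector_derivative_const[of c]] by simp
    have c2: "((\<lambda>s. Dv (x + s *\<^sub>R v) v) has_vector_derivative II x v) (at 0)"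
      using curve_deriv2[OF x0] by simp
    have "((\<lambda>s. (?p s - c) \<bullet> Dv (x + s *\<^sub>R v) v) has_real_derivative ((f x - c) \<bullet> II x v + Dv x v \<bullet> Dv x v)) (at 0)"
      using has_derivative_inner[OF c1[unfolded has_vector_derivative_def] c2[unfolded has_vector_derivative_def]]
      unfolding has_field_derivative_def
      by (rule has_derivative_eq_rhs) (simp add: fun_eq_iff inner_commute algebra_simps)
    then have d2: "((\<lambda>s. 2 * ((?p s - c) \<bullet> Dv (x + s *\<^sub>R v) v)) has_real_derivative (2 * ((f x - c) \<bullet> II x v + Dv x v \<bullet> Dv x v))) (at 0)"
      by (rule DERIV_cmult)
    have lim: "filterlim (\<lambda>s::real. x + s *\<^sub>R v) (nhds x) (nhds 0)"
    proof -
      have "((\<lambda>s. x + s *\<^sub>R v) \<longlongrightarrow> x + 0 *\<^sub>R v) (nhds 0)"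
        by (intro tendsto_add tendsto_const tendsto_scaleR filterlim_ident)
      then show ?thesis by simp
    qed
    have mn: "\<forall>\<^sub>F s in nhds 0. (?p 0 - c) \<bullet> (?p 0 - c) \<le> (?p s - c) \<bullet> (?p s - c)"
      using eventually_compose_filterlim[OF touch lim]
      by (rule eventually_mono) (simp add: dot_square_norm)
    show ?thesis using second_derivative_at_min(2)[OF d1 d2 mn] by simp
  qed
  obtain a b where fr: "orthoframe a b (nu x)" using orthoframe_exists nun[OF x] by blast
  obtain v w where vw: "Dv x v = a" "Dv x w = b" using tangent_frame[OF x fr] .
  have "II x v \<bullet> nu x + II x w \<bullet> nu x = 2" by (rule II_trace[OF x]) (use fr in \<open>auto simp: vw orthoframe_def\<close>)
  moreover have "1 - r * (II x v \<bullet> nu x) \<ge> 0" "1 - r * (II x w \<bullet> nu x) \<ge> 0"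
    using *[of v] *[of w] fr by (auto simp: vw orthoframe_def c inner_commute)
  moreover have "r * (II x v \<bullet> nu x) + r * (II x w \<bullet> nu x) = r * (II x v \<bullet> nu x + II x w \<bullet> nu x)"
    by (simp add: distrib_left)
  ultimately show ?thesis by simp
qed

text \<open>The inverse function theorem provides one derivative of the inverse
  \<open>\<psi>\<close>, hence at first one of \<open>u\<close>. The gradient of \<open>u\<close>,
  however, is a quotient of components of \<open>nu\<close>, which is differentiable in the
  parameters; composing this quotient with \<open>\<psi>\<close> gives the second derivatives of
  \<open>u\<close> without a second derivative of \<open>\<psi>\<close>.\<close>

lemma local_graph:
  assumes x0: "x0 \<in> G" and G: "open G" "G \<subseteq> ball 0 1" and fr: "orthoframe a b n" and pos: "nu x0 \<bullet> n > 0"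
  obtains O' V \<psi> u p q p1 p2 q1 q2 where
    "open O'" "x0 \<in> O'" "O' \<subseteq> G" "open V" "homeomorphism O' V (\<lambda>x. (f x \<bullet> a, f x \<bullet> b)) \<psi>"
    "\<And>x. x \<in> O' \<Longrightarrow> nu x \<bullet> n > 0"
    "\<And>x. x \<in> O' \<Longrightarrow> f x \<bullet> n = u (f x \<bullet> a, f x \<bullet> b)"
    "\<And>x. x \<in> O' \<Longrightarrow> nu x \<bullet> a = - (nu x \<bullet> n) * p (f x \<bullet> a, f x \<bullet> b) \<and> nu x \<bullet> b = - (nu x \<bullet> n) * q (f x \<bullet> a, f x \<bullet> b)"
    "\<And>y. y \<in> V \<Longrightarrow> (u has_derivative (\<lambda>(h,k). h * p y + k * q y)) (at y)"
    "\<And>y. y \<in> V \<Longrightarrow> (p has_derivative (\<lambda>(h,k). h * p1 y + k * p2 y)) (at y)"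
    "\<And>y. y \<in> V \<Longrightarrow> (q has_derivative (\<lambda>(h,k). h * q1 y + k * q2 y)) (at y)"
    "continuous_on V p1" "continuous_on V p2" "continuous_on V q1" "continuous_on V q2"
    "\<And>y. y \<in> V \<Longrightarrow> (1+(q y)\<^sup>2) * p1 y - p y * q y * (p2 y + q1 y) + (1+(p y)\<^sup>2) * q2 y
        = 2 * (1 + (p y)\<^sup>2 + (q y)\<^sup>2) * sqrt (1 + (p y)\<^sup>2 + (q y)\<^sup>2)"
proof -
  define U where "U = G \<inter> {x \<in> ball 0 1. nu x \<bullet> n > 0}"
  have "open {x \<in> ball 0 1. 0 < nu x \<bullet> n}"
  proof -
    have "continuous_on (ball 0 1) (\<lambda>x. nu x \<bullet> n)" by (intro continuous_intros cont_nu)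
    from continuous_open_preimage[OF this open_ball, of "{0<..}"]
    show ?thesis by (simp add: Int_def vimage_def)
  qed
  then have oU: "open U" using G(1) unfolding U_def by blast
  have x0U: "x0 \<in> U" using x0 G pos by (auto simp: U_def)
  have Ub: "x \<in> ball 0 1" "nu x \<bullet> n > 0" "x \<in> G" if "x \<in> U" for x using that by (auto simp: U_def)
  define a1 where "a1 x = fu x \<bullet> a" for x
  define a2 where "a2 x = fv x \<bullet> a" for x
  define b1 where "b1 x = fu x \<bullet> b" for x
  define b2 where "b2 x = fv x \<bullet> b" for x
  define P where "P x = - (nu x \<bullet> a) / (nu x \<bullet> n)" for x
  define Q where "Q x = - (nu x \<bullet> b) / (nu x \<bullet> n)" for x
  define \<delta> where "\<delta> x = a1 x * b2 x - a2 x * b1 x" for x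
  define \<phi> where "\<phi> x = (f x \<bullet> a, f x \<bullet> b)" for x
  have na: "nu x \<bullet> a = - (nu x \<bullet> n) * P x" "nu x \<bullet> b = - (nu x \<bullet> n) * Q x" if "x \<in> U" for x
    using Ub(2)[OF that] by (auto simp: P_def Q_def)
  have fnu: "fu x \<bullet> n = P x * a1 x + Q x * b1 x" if x: "x \<in> U" for x
  proof -
    have "nu x \<bullet> fu x = (nu x \<bullet> a) * a1 x + (nu x \<bullet> b) * b1 x + (nu x \<bullet> n) * (fu x \<bullet> n)"
      using orthoframe_inner[OF fr, of "nu x" "fu x"] by (simp add: a1_def b1_def)
    then have "(nu x \<bullet> n) * (fu x \<bullet> n - P x * a1 x - Q x * b1 x) = 0"
      using nufu[OF Ub(1)[OF x]] na[OF x] by (simp add: algebra_simps)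
    then show ?thesis using Ub(2)[OF x] by simp
  qed
  have fvn: "fv x \<bullet> n = P x * a2 x + Q x * b2 x" if x: "x \<in> U" for x
  proof -
    have "nu x \<bullet> fv x = (nu x \<bullet> a) * a2 x + (nu x \<bullet> b) * b2 x + (nu x \<bullet> n) * (fv x \<bullet> n)"
      using orthoframe_inner[OF fr, of "nu x" "fv x"] by (simp add: a2_def b2_def)
    then have "(nu x \<bullet> n) * (fv x \<bullet> n - P x * a2 x - Q x * b2 x) = 0"
      using nufv[OF Ub(1)[OF x]] na[OF x] by (simp add: algebra_simps)
    then show ?thesis using Ub(2)[OF x] by simp
  qed
  have EFG: "fu x \<bullet> fu x = (a1 x)\<^sup>2 + (b1 x)\<^sup>2 + (P x * a1 x + Q x * b1 x)\<^sup>2"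
     "fu x \<bullet> fv x = a1 x * a2 x + b1 x * b2 x + (P x * a1 x + Q x * b1 x) * (P x * a2 x + Q x * b2 x)"
     "fv x \<bullet> fv x = (a2 x)\<^sup>2 + (b2 x)\<^sup>2 + (P x * a2 x + Q x * b2 x)\<^sup>2" if x: "x \<in> U" for x
    using orthoframe_inner[OF fr, of "fu x" "fu x"] orthoframe_inner[OF fr, of "fu x" "fv x"] orthoframe_inner[OF fr, of "fv x" "fv x"]
      fnu[OF x] fvn[OF x] by (simp_all add: a1_def a2_def b1_def b2_def power2_eq_square)
  have \<delta>0: "\<delta> x \<noteq> 0" if x: "x \<in> U" for x
  proof
    assume z: "\<delta> x = 0"
    have "(fu x \<bullet> fu x) * (fv x \<bullet> fv x) - (fu x \<bullet> fv x)\<^sup>2 = (\<delta> x)\<^sup>2 * (1 + (P x)\<^sup>2 + (Q x)\<^sup>2)"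
      unfolding EFG[OF x] \<delta>_def by (simp only: power2_eq_square) algebra
    then show False using ind[OF Ub(1)[OF x]] z by simp
  qed
  have cab: "continuous_on U a1" "continuous_on U a2" "continuous_on U b1" "continuous_on U b2" "continuous_on U (\<lambda>x. nu x \<bullet> n)"
    "continuous_on U P" "continuous_on U Q"
    "continuous_on U (\<lambda>x. nu x \<bullet> a)" "continuous_on U (\<lambda>x. nu x \<bullet> b)"
    unfolding a1_def a2_def b1_def b2_def P_def Q_def using Ub
    by (fastforce intro!: continuous_intros continuous_on_subset[OF cont_fu] continuous_on_subset[OF cont_fv] continuous_on_subset[OF cont_nu])+
  define \<phi>' where "\<phi>' x = Blinfun (\<lambda>(h,k). (h * a1 x + k * a2 x, h * b1 x + k * b2 x))" for x
  have lin: "bounded_linear (\<lambda>(h,k). (h * r1 + k * r2, h * r3 + k * r4) :: real \<times> real)" for r1 r2 r3 r4 :: real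
    unfolding linear_conv_bounded_linear[symmetric] by (rule linearI) (auto simp: algebra_simps)
  have \<phi>'a: "blinfun_apply (\<phi>' x) = (\<lambda>(h,k). (h * a1 x + k * a2 x, h * b1 x + k * b2 x))" for x
    unfolding \<phi>'_def by (rule bounded_linear_Blinfun_apply[OF lin])
  have d\<phi>: "(\<phi> has_derivative blinfun_apply (\<phi>' x)) (at x)" if x: "x \<in> U" for x
    unfolding \<phi>_def \<phi>'a
    by (rule has_derivative_eq_rhs[OF has_derivative_Pair[OF has_derivative_inner_left[OF df[OF Ub(1)[OF x]]] has_derivative_inner_left[OF df[OF Ub(1)[OF x]]]]])
       (auto simp: fun_eq_iff a1_def a2_def b1_def b2_def inner_add_left)
  have c\<phi>': "continuous_on U \<phi>'"
    by (rule continuous_on_blinfun_componentwise) (auto simp: Basis_prod_def \<phi>'a intro!: continuous_intros cab)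
  \<comment> \<open>Cramer's formula for the inverse of \<open>\<phi>'\<close>, with determinant
    \<open>\<delta>\<close>.\<close>
  define inv where "inv x = Blinfun (\<lambda>(h,k). (h * (b2 x / \<delta> x) + k * (- a2 x / \<delta> x), h * (- b1 x / \<delta> x) + k * (a1 x / \<delta> x)))" for x
  have inva: "blinfun_apply (inv x) = (\<lambda>(h,k). (h * (b2 x / \<delta> x) + k * (- a2 x / \<delta> x), h * (- b1 x / \<delta> x) + k * (a1 x / \<delta> x)))" for x
    unfolding inv_def by (rule bounded_linear_Blinfun_apply[OF lin])
  have inv1: "blinfun_apply (inv x) (blinfun_apply (\<phi>' x) v) = v" if x: "x \<in> U" for x v
    using \<delta>0[OF x] by (cases v) (auto simp: inva \<phi>'a field_simps, simp_all add: \<delta>_def algebra_simps)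
  have inv2: "blinfun_apply (\<phi>' x) (blinfun_apply (inv x) v) = v" if x: "x \<in> U" for x v
    using \<delta>0[OF x] by (cases v) (auto simp: inva \<phi>'a field_simps, simp_all add: \<delta>_def algebra_simps)
  have "inv x0 o\<^sub>L \<phi>' x0 = id_blinfun"
    by (rule blinfun_eqI) (simp add: inv1[OF x0U])
  from inverse_function_theorem[OF oU d\<phi> c\<phi>' x0U this]
  obtain O' V \<psi> g' where O': "open O'" "O' \<subseteq> U" "x0 \<in> O'" "open V" "\<phi> x0 \<in> V" "homeomorphism O' V \<phi> \<psi>"
    and d\<psi>': "\<And>y. y \<in> V \<Longrightarrow> (\<psi> has_derivative g' y) (at y)"
      "\<And>y. y \<in> V \<Longrightarrow> g' y = Hilbert_Choice.inv (blinfun_apply (\<phi>' (\<psi> y)))"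
    by metis
  have \<psi>O: "\<psi> y \<in> O'" "\<psi> y \<in> U" "\<phi> (\<psi> y) = y" if "y \<in> V" for y
    using O'(2,6) that by (auto simp: homeomorphism_def)
  have \<psi>\<phi>: "\<psi> (\<phi> x) = x" "\<phi> x \<in> V" if "x \<in> O'" for x
    using O'(6) that by (auto simp: homeomorphism_def)
  have d\<psi>: "(\<psi> has_derivative blinfun_apply (inv (\<psi> y))) (at y)" if y: "y \<in> V" for y
  proof -
    have "Hilbert_Choice.inv (blinfun_apply (\<phi>' (\<psi> y))) = blinfun_apply (inv (\<psi> y))"
      by (rule inv_equality) (auto simp: inv1 inv2 \<psi>O[OF y])
    then show ?thesis using d\<psi>'[OF y] by simp
  qed
  have c\<psi>: "continuous_on V \<psi>" using O'(6) by (simp add: homeomorphism_def)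
  define Pu where "Pu x = (- (nuu x \<bullet> a) - P x * (nuu x \<bullet> n)) / (nu x \<bullet> n)" for x
  define Pv where "Pv x = (- (nuv x \<bullet> a) - P x * (nuv x \<bullet> n)) / (nu x \<bullet> n)" for x
  define Qu where "Qu x = (- (nuu x \<bullet> b) - Q x * (nuu x \<bullet> n)) / (nu x \<bullet> n)" for x
  define Qv where "Qv x = (- (nuv x \<bullet> b) - Q x * (nuv x \<bullet> n)) / (nu x \<bullet> n)" for x
  have dPgen: "((\<lambda>x. - (nu x \<bullet> c) / (nu x \<bullet> n)) has_derivative (\<lambda>(h,k). h * ((- (nuu x \<bullet> c) - (- (nu x \<bullet> c) / (nu x \<bullet> n)) * (nuu x \<bullet> n)) / (nu x \<bullet> n))
      + k * ((- (nuv x \<bullet> c) - (- (nu x \<bullet> c) / (nu x \<bullet> n)) * (nuv x \<bullet> n)) / (nu x \<bullet> n)))) (at x)" if x: "x \<in> U" for x c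
  proof -
    have n0: "nu x \<bullet> n \<noteq> 0" using Ub(2)[OF x] by simp
    have e: "(\<lambda>h. (- ((case h of (a, b) \<Rightarrow> a *\<^sub>R nuu x + b *\<^sub>R nuv x) \<bullet> c) * (nu x \<bullet> n) - - (nu x \<bullet> c) * ((case h of (a, b) \<Rightarrow> a *\<^sub>R nuu x + b *\<^sub>R nuv x) \<bullet> n)) / ((nu x \<bullet> n) * (nu x \<bullet> n))) = (\<lambda>(h,k). h * ((- (nuu x \<bullet> c) - (- (nu x \<bullet> c) / (nu x \<bullet> n)) * (nuu x \<bullet> n)) / (nu x \<bullet> n))
      + k * ((- (nuv x \<bullet> c) - (- (nu x \<bullet> c) / (nu x \<bullet> n)) * (nuv x \<bullet> n)) / (nu x \<bullet> n)))"
      using n0 by (auto simp: fun_eq_iff inner_add_left field_simps)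
    show ?thesis
      by (rule has_derivative_eq_rhs[OF has_derivative_divide'[OF has_derivative_minus[OF has_derivative_inner_left[OF dnu[OF Ub(1)[OF x]]]] has_derivative_inner_left[OF dnu[OF Ub(1)[OF x]]] n0] e])
  qed
  have dP: "(P has_derivative (\<lambda>(h,k). h * Pu x + k * Pv x)) (at x)" if x: "x \<in> U" for x
    using dPgen[OF x, of a] unfolding P_def[abs_def] Pu_def Pv_def by (simp add: P_def)
  have dQ: "(Q has_derivative (\<lambda>(h,k). h * Qu x + k * Qv x)) (at x)" if x: "x \<in> U" for x
    using dPgen[OF x, of b] unfolding Q_def[abs_def] Qu_def Qv_def by (simp add: Q_def)
  have cP: "continuous_on U Pu" "continuous_on U Pv" "continuous_on U Qu" "continuous_on U Qv"
    unfolding Pu_def Pv_def Qu_def Qv_def using Ub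
    by (fastforce intro!: continuous_intros cab continuous_on_subset[OF cnu] continuous_on_subset[OF cnv])+
  \<comment> \<open>Chain rule through \<open>\<psi>\<close>: these four are the derivatives of the
    slopes \<open>P\<close> and \<open>Q\<close> with respect to the graph coordinates.\<close>
  define p1 where "p1 x = Pu x * (b2 x / \<delta> x) + Pv x * (- b1 x / \<delta> x)" for x
  define p2 where "p2 x = Pu x * (- a2 x / \<delta> x) + Pv x * (a1 x / \<delta> x)" for x
  define q1 where "q1 x = Qu x * (b2 x / \<delta> x) + Qv x * (- b1 x / \<delta> x)" for x
  define q2 where "q2 x = Qu x * (- a2 x / \<delta> x) + Qv x * (a1 x / \<delta> x)" for x
  have c\<delta>: "continuous_on U \<delta>" unfolding \<delta>_def by (intro continuous_intros cab)
  have cp: "continuous_on U p1" "continuous_on U p2" "continuous_on U q1" "continuous_on U q2"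
    unfolding p1_def p2_def q1_def q2_def using \<delta>0 by (auto intro!: continuous_intros cab cP c\<delta>)
  have sub: "\<psi> ` V \<subseteq> U" using \<psi>O by auto
  have bck: "Pu x = p1 x * a1 x + p2 x * b1 x" "Pv x = p1 x * a2 x + p2 x * b2 x"
     "Qu x = q1 x * a1 x + q2 x * b1 x" "Qv x = q1 x * a2 x + q2 x * b2 x" if x: "x \<in> U" for x
    using \<delta>0[OF x] unfolding p1_def p2_def q1_def q2_def
    by (simp_all add: field_simps) (simp_all add: \<delta>_def algebra_simps)
  define u where "u y = f (\<psi> y) \<bullet> n" for y
  show thesis
  proof (rule that[of O' V \<psi> u "P \<circ> \<psi>" "Q \<circ> \<psi>" "p1 \<circ> \<psi>" "p2 \<circ> \<psi>" "q1 \<circ> \<psi>" "q2 \<circ> \<psi>"])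
    show "open O'" "x0 \<in> O'" "open V" by fact+
    show "O' \<subseteq> G" using O'(2) by (auto simp: U_def)
    show "homeomorphism O' V (\<lambda>x. (f x \<bullet> a, f x \<bullet> b)) \<psi>" using O'(6) by (simp add: \<phi>_def[abs_def])
    show "nu x \<bullet> n > 0" if "x \<in> O'" for x using O'(2) that Ub(2) by blast
    show "f x \<bullet> n = u (f x \<bullet> a, f x \<bullet> b)" if "x \<in> O'" for x
      using \<psi>\<phi>(1)[OF that] by (simp add: u_def \<phi>_def)
    show "nu x \<bullet> a = - (nu x \<bullet> n) * (P \<circ> \<psi>) (f x \<bullet> a, f x \<bullet> b) \<and> nu x \<bullet> b = - (nu x \<bullet> n) * (Q \<circ> \<psi>) (f x \<bullet> a, f x \<bullet> b)" if "x \<in> O'" for x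
      using \<psi>\<phi>(1)[OF that] na[of x] O'(2) that by (auto simp: \<phi>_def)
    show "continuous_on V (p1 \<circ> \<psi>)" "continuous_on V (p2 \<circ> \<psi>)" "continuous_on V (q1 \<circ> \<psi>)" "continuous_on V (q2 \<circ> \<psi>)"
      unfolding o_def using cp c\<psi> sub by (blast intro: continuous_on_compose2)+
    fix y assume y: "y \<in> V"
    let ?x = "\<psi> y"
    note x = \<psi>O(2)[OF y]
    have "((\<lambda>y. f (\<psi> y) \<bullet> n) has_derivative (\<lambda>v. (case blinfun_apply (inv ?x) v of (h,k) \<Rightarrow> h *\<^sub>R fu ?x + k *\<^sub>R fv ?x) \<bullet> n)) (at y)"
      by (rule has_derivative_inner_left[OF has_derivative_compose[OF d\<psi>[OF y] df[OF Ub(1)[OF x]]]])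
    then show "(u has_derivative (\<lambda>(h, k). h * (P \<circ> \<psi>) y + k * (Q \<circ> \<psi>) y)) (at y)"
      unfolding u_def[abs_def]
      by (rule has_derivative_eq_rhs)
         (use \<delta>0[OF x] in \<open>auto simp: fun_eq_iff inva inner_add_left fnu[OF x] fvn[OF x] field_simps, simp add: \<delta>_def algebra_simps\<close>)
    show "((P \<circ> \<psi>) has_derivative (\<lambda>(h, k). h * (p1 \<circ> \<psi>) y + k * (p2 \<circ> \<psi>) y)) (at y)"
      unfolding o_def
      by (rule has_derivative_eq_rhs[OF has_derivative_compose[OF d\<psi>[OF y] dP[OF x]]])
         (auto simp: fun_eq_iff inva p1_def p2_def algebra_simps)
    show "((Q \<circ> \<psi>) has_derivative (\<lambda>(h, k). h * (q1 \<circ> \<psi>) y + k * (q2 \<circ> \<psi>) y)) (at y)"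
      unfolding o_def
      by (rule has_derivative_eq_rhs[OF has_derivative_compose[OF d\<psi>[OF y] dQ[OF x]]])
         (auto simp: fun_eq_iff inva q1_def q2_def algebra_simps)
    note xb = Ub(1)[OF x]
    \<comment> \<open>Weingarten relations: differentiating the orthogonality of \<open>nu\<close>
      to \<open>fu\<close> and \<open>fv\<close> expresses the second fundamental form by
      derivatives of \<open>nu\<close>. The mixed coefficient arises in two ways, and
      \<open>graph_mean_curvature_algebra\<close> takes both.\<close>
    have dz: "fuv ?x \<bullet> nu ?x = - (nuv ?x \<bullet> fu ?x)" "fuu ?x \<bullet> nu ?x = - (nuu ?x \<bullet> fu ?x)"
      "fvv ?x \<bullet> nu ?x = - (nuv ?x \<bullet> fv ?x)" "fuv ?x \<bullet> nu ?x = - (nuu ?x \<bullet> fv ?x)"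
    proof -
      have e1: "((\<lambda>z. nu z \<bullet> fu z) has_derivative (\<lambda>h. 0)) (at ?x)"
        by (rule has_derivative_transform_within_open[OF has_derivative_const open_ball xb]) (simp add: nufu)
      have e2: "((\<lambda>z. nu z \<bullet> fv z) has_derivative (\<lambda>h. 0)) (at ?x)"
        by (rule has_derivative_transform_within_open[OF has_derivative_const open_ball xb]) (simp add: nufv)
      have "(\<lambda>h. 0) = (\<lambda>h. nu ?x \<bullet> (case h of (a, b) \<Rightarrow> a *\<^sub>R fuu ?x + b *\<^sub>R fuv ?x) + (case h of (a, b) \<Rightarrow> a *\<^sub>R nuu ?x + b *\<^sub>R nuv ?x) \<bullet> fu ?x)"
        by (rule has_derivative_unique[OF e1 has_derivative_inner[OF dnu[OF xb] dfu[OF xb]]])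
      from fun_cong[OF this, of "(1,0)"] fun_cong[OF this, of "(0,1)"]
      show "fuu ?x \<bullet> nu ?x = - (nuu ?x \<bullet> fu ?x)" "fuv ?x \<bullet> nu ?x = - (nuv ?x \<bullet> fu ?x)" by (simp_all add: inner_commute)
      have "(\<lambda>h. 0) = (\<lambda>h. nu ?x \<bullet> (case h of (a, b) \<Rightarrow> a *\<^sub>R fuv ?x + b *\<^sub>R fvv ?x) + (case h of (a, b) \<Rightarrow> a *\<^sub>R nuu ?x + b *\<^sub>R nuv ?x) \<bullet> fv ?x)"
        by (rule has_derivative_unique[OF e2 has_derivative_inner[OF dnu[OF xb] dfv[OF xb]]])
      from fun_cong[OF this, of "(1,0)"] fun_cong[OF this, of "(0,1)"]
      show "fuv ?x \<bullet> nu ?x = - (nuu ?x \<bullet> fv ?x)" "fvv ?x \<bullet> nu ?x = - (nuv ?x \<bullet> fv ?x)" by (simp_all add: inner_commute)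
    qed
    define \<kappa> where "\<kappa> = nu ?x \<bullet> n"
    have \<kappa>: "\<kappa> > 0" using Ub(2)[OF x] by (simp add: \<kappa>_def)
    have nn: "nuu ?x \<bullet> a = - \<kappa> * Pu ?x - P ?x * (nuu ?x \<bullet> n)" "nuu ?x \<bullet> b = - \<kappa> * Qu ?x - Q ?x * (nuu ?x \<bullet> n)"
       "nuv ?x \<bullet> a = - \<kappa> * Pv ?x - P ?x * (nuv ?x \<bullet> n)" "nuv ?x \<bullet> b = - \<kappa> * Qv ?x - Q ?x * (nuv ?x \<bullet> n)"
      using \<kappa> by (simp_all add: Pu_def Qu_def Pv_def Qv_def \<kappa>_def)
    have "(1+(Q ?x)\<^sup>2) * p1 ?x - P ?x * Q ?x * (p2 ?x + q1 ?x) + (1+(P ?x)\<^sup>2) * q2 ?x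
        = 2 * (1 + (P ?x)\<^sup>2 + (Q ?x)\<^sup>2) * sqrt (1 + (P ?x)\<^sup>2 + (Q ?x)\<^sup>2)"
    proof (rule graph_mean_curvature_algebra[OF \<delta>_def \<delta>0[OF x] \<kappa> _ EFG[OF x] bck[OF x] _ _ _ _ mc[OF xb]])
      have "nu ?x \<bullet> nu ?x = (nu ?x \<bullet> a)\<^sup>2 + (nu ?x \<bullet> b)\<^sup>2 + \<kappa>\<^sup>2"
        using orthoframe_inner[OF fr, of "nu ?x" "nu ?x"] by (simp add: \<kappa>_def power2_eq_square)
      then show "\<kappa>\<^sup>2 * (1 + (P ?x)\<^sup>2 + (Q ?x)\<^sup>2) = 1"
        using nun[OF xb] unfolding na[OF x] by (simp add: \<kappa>_def[symmetric] algebra_simps power2_eq_square)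
      show "fuu ?x \<bullet> nu ?x = \<kappa> * (Pu ?x * a1 ?x + Qu ?x * b1 ?x)"
        unfolding dz(2) orthoframe_inner[OF fr, of "nuu ?x" "fu ?x"] nn fnu[OF x] a1_def[symmetric] b1_def[symmetric] by (simp add: algebra_simps)
      show "fuv ?x \<bullet> nu ?x = \<kappa> * (Pv ?x * a1 ?x + Qv ?x * b1 ?x)"
        unfolding dz(1) orthoframe_inner[OF fr, of "nuv ?x" "fu ?x"] nn fnu[OF x] a1_def[symmetric] b1_def[symmetric] by (simp add: algebra_simps)
      show "fuv ?x \<bullet> nu ?x = \<kappa> * (Pu ?x * a2 ?x + Qu ?x * b2 ?x)"
        unfolding dz(4) orthoframe_inner[OF fr, of "nuu ?x" "fv ?x"] nn fvn[OF x] a2_def[symmetric] b2_def[symmetric] by (simp add: algebra_simps)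
      show "fvv ?x \<bullet> nu ?x = \<kappa> * (Pv ?x * a2 ?x + Qv ?x * b2 ?x)"
        unfolding dz(3) orthoframe_inner[OF fr, of "nuv ?x" "fv ?x"] nn fvn[OF x] a2_def[symmetric] b2_def[symmetric] by (simp add: algebra_simps)
    qed
    then show "(1+((Q \<circ> \<psi>) y)\<^sup>2) * (p1 \<circ> \<psi>) y - (P \<circ> \<psi>) y * (Q \<circ> \<psi>) y * ((p2 \<circ> \<psi>) y + (q1 \<circ> \<psi>) y) + (1+((P \<circ> \<psi>) y)\<^sup>2) * (q2 \<circ> \<psi>) y
        = 2 * (1 + ((P \<circ> \<psi>) y)\<^sup>2 + ((Q \<circ> \<psi>) y)\<^sup>2) * sqrt (1 + ((P \<circ> \<psi>) y)\<^sup>2 + ((Q \<circ> \<psi>) y)\<^sup>2)" by simp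
  qed
qed

end

section \<open>Local defining functions and circle-valued collars\<close>

lemma has_real_derivative_gradient_line:
  fixes \<phi> :: "'a::real_inner \<Rightarrow> real"
  assumes "(\<phi> has_derivative (\<lambda>h. gr \<bullet> h)) (at (z + s *\<^sub>R v))"
  shows "((\<lambda>s. \<phi> (z + s *\<^sub>R v)) has_real_derivative (gr \<bullet> v)) (at s)"
proof -
  have "((\<lambda>s. z + s *\<^sub>R v) has_derivative (\<lambda>h. h *\<^sub>R v)) (at s)"
    by (auto intro!: derivative_eq_intros)
  from has_derivative_compose[OF this assms]
  show ?thesis by (simp add: has_field_derivative_def mult_commute_abs)
qed

lemma circle_lift:
  fixes k :: "'a::real_normed_vector \<Rightarrow> complex"
  assumes "continuous_on T k" "contractible T" "\<And>z. z \<in> T \<Longrightarrow> norm (k z) = 1"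
  obtains h :: "'a \<Rightarrow> real" where "continuous_on T h" "\<And>z. z \<in> T \<Longrightarrow> k z = cis (h z)"
proof -
  have "\<And>z. z \<in> T \<Longrightarrow> k z \<noteq> 0" using assms(3) by force
  then obtain w where w: "continuous_on T w" "\<And>z. z \<in> T \<Longrightarrow> k z = exp (w z)"
    using continuous_logarithm_on_contractible[OF assms(1,2)] by blast
  show thesis
  proof (rule that[of "\<lambda>z. Im (w z)"])
    show "continuous_on T (\<lambda>z. Im (w z))" using w(1) by (intro continuous_intros)
    fix z assume z: "z \<in> T"
    have "exp (Re (w z)) = 1" using assms(3)[OF z] w(2)[OF z] by simp
    then show "k z = cis (Im (w z))" using w(2)[OF z] by (simp add: exp_eq_polar)
  qed
qed

lemma cis_eq_1_imp_int: "cis t = 1 \<Longrightarrow> \<exists>m::int. t = 2 * pi * of_int m"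
proof -
  assume "cis t = 1"
  then have "cos t = 1" by (metis cis.simps(1) one_complex.simps(1))
  then obtain n::int where "t = of_int n * 2 * pi" using cos_one_2pi_int by auto
  then show ?thesis by (intro exI[of _ n]) simp
qed

context csurf
begin

text \<open>A local equation of the sheet over \<open>G\<close>, with gradient \<open>gr\<close>,
  positive on the side into which \<open>nu\<close> points. The bounds 1/2 and 2 control how fast
  \<open>\<phi>\<close> moves along \<open>nu x0\<close> and how large it is near
  \<open>f x0\<close>; this allows the comparison of two such equations with different
  centres.\<close>

definition good_def_fn :: "(real \<times> real) set \<Rightarrow> real \<times> real \<Rightarrow> real \<Rightarrow> (real^3 \<Rightarrow> real) \<Rightarrow> (real^3 \<Rightarrow> real^3) \<Rightarrow> bool" where
  "good_def_fn G x0 \<epsilon> \<phi> gr \<longleftrightarrow> \<epsilon> > 0 \<and>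
     (\<forall>z\<in>ball (f x0) \<epsilon>. (\<phi> has_derivative (\<lambda>h. gr z \<bullet> h)) (at z) \<and> gr z \<bullet> nu x0 > 1/2 \<and> norm (gr z) \<le> 2 \<and>
        (\<phi> z = 0 \<longleftrightarrow> z \<in> f ` G)) \<and>
     isCont gr (f x0) \<and> gr (f x0) = nu x0 \<and>
     (\<forall>x\<in>G. f x \<in> ball (f x0) \<epsilon> \<longrightarrow> (\<exists>\<kappa>>0. gr (f x) = \<kappa> *\<^sub>R nu x))"

text \<open>\<open>(p, q)\<close> is the gradient of \<open>u\<close>, and \<open>p1\<close>,
  \<open>p2\<close>, \<open>q1\<close>, \<open>q2\<close> are its derivatives; the displayed
  equation is the mean curvature equation of graphs. The two mixed derivatives \<open>p2\<close> and
  \<open>q1\<close> are carried separately and enter it through their sum.\<close>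

definition graph_rep :: "(real \<times> real) set \<Rightarrow> real^3 \<Rightarrow> real^3 \<Rightarrow> real^3 \<Rightarrow> (real \<times> real) set \<Rightarrow> (real \<times> real) set \<Rightarrow>
    (real \<times> real \<Rightarrow> real \<times> real) \<Rightarrow> (real \<times> real \<Rightarrow> real) \<Rightarrow> (real \<times> real \<Rightarrow> real) \<Rightarrow> (real \<times> real \<Rightarrow> real) \<Rightarrow>
    (real \<times> real \<Rightarrow> real) \<Rightarrow> (real \<times> real \<Rightarrow> real) \<Rightarrow> (real \<times> real \<Rightarrow> real) \<Rightarrow> (real \<times> real \<Rightarrow> real) \<Rightarrow> bool" where
  "graph_rep G a b n O' V \<psi> u p q p1 p2 q1 q2 \<longleftrightarrow>
    open O' \<and> O' \<subseteq> G \<and> open V \<and> homeomorphism O' V (\<lambda>x. (f x \<bullet> a, f x \<bullet> b)) \<psi> \<and>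
    (\<forall>x\<in>O'. nu x \<bullet> n > 0 \<and> f x \<bullet> n = u (f x \<bullet> a, f x \<bullet> b) \<and>
      nu x \<bullet> a = - (nu x \<bullet> n) * p (f x \<bullet> a, f x \<bullet> b) \<and> nu x \<bullet> b = - (nu x \<bullet> n) * q (f x \<bullet> a, f x \<bullet> b)) \<and>
    (\<forall>y\<in>V. (u has_derivative (\<lambda>(h,k). h * p y + k * q y)) (at y) \<and>
      (p has_derivative (\<lambda>(h,k). h * p1 y + k * p2 y)) (at y) \<and>
      (q has_derivative (\<lambda>(h,k). h * q1 y + k * q2 y)) (at y) \<and>
      (1+(q y)\<^sup>2) * p1 y - p y * q y * (p2 y + q1 y) + (1+(p y)\<^sup>2) * q2 y
        = 2 * (1 + (p y)\<^sup>2 + (q y)\<^sup>2) * sqrt (1 + (p y)\<^sup>2 + (q y)\<^sup>2)) \<and>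
    continuous_on V p1 \<and> continuous_on V p2 \<and> continuous_on V q1 \<and> continuous_on V q2"

lemma graph_rep_exists:
  assumes x0: "x0 \<in> G" and G: "open G" "G \<subseteq> ball 0 1" and fr: "orthoframe a b n" and pos: "nu x0 \<bullet> n > 0"
  shows "\<exists>O' V \<psi> u p q p1 p2 q1 q2. x0 \<in> O' \<and> graph_rep G a b n O' V \<psi> u p q p1 p2 q1 q2"
proof (rule local_graph[OF assms])
  fix O' V \<psi> u p q p1 p2 q1 q2
  assume *: "open O'" "x0 \<in> O'" "O' \<subseteq> G" "open V" "homeomorphism O' V (\<lambda>x. (f x \<bullet> a, f x \<bullet> b)) \<psi>"
    "\<And>x. x \<in> O' \<Longrightarrow> 0 < nu x \<bullet> n"
    "\<And>x. x \<in> O' \<Longrightarrow> f x \<bullet> n = u (f x \<bullet> a, f x \<bullet> b)"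
    "\<And>x. x \<in> O' \<Longrightarrow> nu x \<bullet> a = - (nu x \<bullet> n) * p (f x \<bullet> a, f x \<bullet> b) \<and> nu x \<bullet> b = - (nu x \<bullet> n) * q (f x \<bullet> a, f x \<bullet> b)"
    "\<And>y. y \<in> V \<Longrightarrow> (u has_derivative (\<lambda>(h,k). h * p y + k * q y)) (at y)"
    "\<And>y. y \<in> V \<Longrightarrow> (p has_derivative (\<lambda>(h,k). h * p1 y + k * p2 y)) (at y)"
    "\<And>y. y \<in> V \<Longrightarrow> (q has_derivative (\<lambda>(h,k). h * q1 y + k * q2 y)) (at y)"
    "continuous_on V p1" "continuous_on V p2" "continuous_on V q1" "continuous_on V q2"
    "\<And>y. y \<in> V \<Longrightarrow> (1+(q y)\<^sup>2) * p1 y - p y * q y * (p2 y + q1 y) + (1+(p y)\<^sup>2) * q2 y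
        = 2 * (1 + (p y)\<^sup>2 + (q y)\<^sup>2) * sqrt (1 + (p y)\<^sup>2 + (q y)\<^sup>2)"
  have "graph_rep G a b n O' V \<psi> u p q p1 p2 q1 q2"
    unfolding graph_rep_def by (intro conjI ballI) (simp_all only: * simp_thms)
  then show ?thesis using *(2) by blast
qed

lemma good_def_fn_mono: "good_def_fn G x0 \<epsilon> \<phi> gr \<Longrightarrow> 0 < \<epsilon>' \<Longrightarrow> \<epsilon>' \<le> \<epsilon> \<Longrightarrow> good_def_fn G x0 \<epsilon>' \<phi> gr"
  unfolding good_def_fn_def by (meson order_less_le_trans mem_ball)

text \<open>Embeddedness enters here: the remaining part of the closed disk is compact, and by
  injectivity its image misses \<open>f x0\<close>, so a small ball around \<open>f x0\<close> meets
  no other sheet of the surface.\<close>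

lemma image_away:
  assumes "x0 \<in> O'" "open O'" "O' \<subseteq> ball 0 1"
  obtains \<epsilon> where "\<epsilon> > 0" "\<And>x. x \<in> cball 0 1 \<Longrightarrow> f x \<in> ball (f x0) \<epsilon> \<Longrightarrow> x \<in> O'"
proof -
  have "compact (f ` (cball 0 1 - O'))"
    by (intro compact_continuous_image continuous_on_subset[OF cf] compact_diff assms) auto
  then have "open (- (f ` (cball 0 1 - O')))" by (intro open_Compl compact_imp_closed)
  moreover have "f x0 \<in> - (f ` (cball 0 1 - O'))"
  proof
    assume "f x0 \<in> f ` (cball 0 1 - O')"
    then obtain y where y: "y \<in> cball 0 1" "y \<notin> O'" "f x0 = f y" by blast
    have "x0 \<in> cball 0 1" using assms ball_subset_cball by blast
    then have "x0 = y" using inj_onD[OF injf y(3)] y(1) by blast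
    then show False using y assms by blast
  qed
  ultimately obtain \<epsilon> where "\<epsilon> > 0" "ball (f x0) \<epsilon> \<subseteq> - (f ` (cball 0 1 - O'))"
    using open_contains_ball by blast
  then show thesis using that by blast
qed

text \<open>The difference between the coordinate along \<open>nu x0\<close> and the local graph
  function serves as \<open>\<phi>\<close>. Its gradient on the surface is a positive multiple of
  \<open>nu\<close>, and \<open>image_away\<close> keeps other sheets out of the ball.\<close>

lemma good_def_fn_exists:
  assumes x0: "x0 \<in> G" and G: "open G" "G \<subseteq> ball 0 1"
  obtains \<epsilon> \<phi> gr where "good_def_fn G x0 \<epsilon> \<phi> gr"
proof -
  have x0b: "x0 \<in> ball 0 1" using x0 G by auto
  obtain a b where fr: "orthoframe a b (nu x0)" using orthoframe_exists nun[OF x0b] by blast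
  let ?n = "nu x0"
  have pos: "nu x0 \<bullet> ?n > 0" using nun[OF x0b] by simp
  obtain O' V \<psi> u p q p1 p2 q1 q2 where x0O: "x0 \<in> O'" and gg: "graph_rep G a b ?n O' V \<psi> u p q p1 p2 q1 q2"
    using graph_rep_exists[OF x0 G fr pos] by blast
  have g: "open O'" "x0 \<in> O'" "O' \<subseteq> G" "open V" "homeomorphism O' V (\<lambda>x. (f x \<bullet> a, f x \<bullet> b)) \<psi>"
    "\<And>x. x \<in> O' \<Longrightarrow> nu x \<bullet> ?n > 0"
    "\<And>x. x \<in> O' \<Longrightarrow> f x \<bullet> ?n = u (f x \<bullet> a, f x \<bullet> b)"
    "\<And>x. x \<in> O' \<Longrightarrow> nu x \<bullet> a = - (nu x \<bullet> ?n) * p (f x \<bullet> a, f x \<bullet> b) \<and> nu x \<bullet> b = - (nu x \<bullet> ?n) * q (f x \<bullet> a, f x \<bullet> b)"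
    "\<And>y. y \<in> V \<Longrightarrow> (u has_derivative (\<lambda>(h,k). h * p y + k * q y)) (at y)"
    "\<And>y. y \<in> V \<Longrightarrow> (p has_derivative (\<lambda>(h,k). h * p1 y + k * p2 y)) (at y)"
    "\<And>y. y \<in> V \<Longrightarrow> (q has_derivative (\<lambda>(h,k). h * q1 y + k * q2 y)) (at y)"
    using gg x0O unfolding graph_rep_def by blast+
  have y0: "(f x0 \<bullet> a, f x0 \<bullet> b) \<in> V" using g(2,5) by (auto simp: homeomorphism_def)
  define \<pi> where "\<pi> z = (z \<bullet> a, z \<bullet> b)" for z
  define \<phi> where "\<phi> z = z \<bullet> ?n - u (\<pi> z)" for z
  define gr where "gr z = ?n - p (\<pi> z) *\<^sub>R a - q (\<pi> z) *\<^sub>R b" for z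
  have c\<pi>: "isCont \<pi> z" for z unfolding \<pi>_def by (intro continuous_intros)
  have cpq: "isCont p (\<pi> (f x0))" "isCont q (\<pi> (f x0))"
    unfolding \<pi>_def by (rule has_derivative_continuous[OF g(10)[OF y0]], rule has_derivative_continuous[OF g(11)[OF y0]])
  have grc: "isCont gr (f x0)" unfolding gr_def
    by (intro continuous_intros isCont_o2[OF c\<pi>] cpq)
  have fro: "a \<bullet> a = 1" "b \<bullet> b = 1" "?n \<bullet> ?n = 1" "a \<bullet> b = 0" "a \<bullet> ?n = 0" "b \<bullet> ?n = 0" "?n \<bullet> a = 0" "?n \<bullet> b = 0"
    using fr by (auto simp: orthoframe_def inner_commute)
  have gr0: "gr (f x0) = ?n" using g(8)[OF g(2)] fro by (simp add: gr_def \<pi>_def)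
  obtain e1 where e1: "e1 > 0" "\<And>x. x \<in> cball 0 1 \<Longrightarrow> f x \<in> ball (f x0) e1 \<Longrightarrow> x \<in> O'"
    using image_away[of x0 O'] g(1-3) G(2) by (metis order_trans)
  have "open (\<pi> -` V)" using c\<pi> g(4) by (intro open_vimage) (auto simp: continuous_on_eq_continuous_at)
  then obtain e2 where e2: "e2 > 0" "ball (f x0) e2 \<subseteq> \<pi> -` V"
    using y0 unfolding open_contains_ball by (metis \<pi>_def vimageI)
  have "isCont (\<lambda>z. gr z \<bullet> ?n) (f x0)" "isCont (\<lambda>z. norm (gr z)) (f x0)"
    using grc by (auto intro!: continuous_intros)
  moreover have "norm ?n = 1" using fro(3) by (simp add: norm_eq_sqrt_inner)
  ultimately obtain e4 e5 where "e4 > 0" "\<And>z. dist z (f x0) < e4 \<Longrightarrow> dist (gr z \<bullet> ?n) 1 < 1/2"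
    "e5 > 0" "\<And>z. dist z (f x0) < e5 \<Longrightarrow> dist (norm (gr z)) 1 < 1"
    unfolding continuous_at_eps_delta gr0 fro(3) by (metis half_gt_zero_iff zero_less_one)
  then have e3: "min e4 e5 > 0" "\<And>z. dist z (f x0) < min e4 e5 \<Longrightarrow> \<bar>gr z \<bullet> ?n - 1\<bar> < 1/2 \<and> \<bar>norm (gr z) - 1\<bar> < 1"
    by (auto simp: dist_real_def)
  define \<epsilon> where "\<epsilon> = min e1 (min e2 (min e4 e5))"
  have gnu: "\<exists>\<kappa>>0. gr (f x) = \<kappa> *\<^sub>R nu x" if x: "x \<in> O'" for x
  proof -
    have "nu x = (nu x \<bullet> a) *\<^sub>R a + (nu x \<bullet> b) *\<^sub>R b + (nu x \<bullet> ?n) *\<^sub>R ?n" by (rule orthoframe_expand[OF fr])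
    also have "\<dots> = (nu x \<bullet> ?n) *\<^sub>R gr (f x)" using g(8)[OF x] by (simp add: gr_def \<pi>_def scaleR_diff_right)
    finally have e: "nu x = (nu x \<bullet> ?n) *\<^sub>R gr (f x)" .
    have "(1 / (nu x \<bullet> ?n)) *\<^sub>R nu x = (1 / (nu x \<bullet> ?n)) *\<^sub>R (nu x \<bullet> ?n) *\<^sub>R gr (f x)" using e by metis
    then have "gr (f x) = (1 / (nu x \<bullet> ?n)) *\<^sub>R nu x" using g(6)[OF x] by simp
    then show ?thesis using g(6)[OF x] by (intro exI[of _ "1 / (nu x \<bullet> ?n)"]) auto
  qed
  have "good_def_fn G x0 \<epsilon> \<phi> gr"
    unfolding good_def_fn_def
  proof (intro conjI ballI impI)
    show "\<epsilon> > 0" using e1 e2 e3 by (simp add: \<epsilon>_def)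
    show "isCont gr (f x0)" "gr (f x0) = nu x0" by fact+
    show "\<exists>\<kappa>>0. gr (f x) = \<kappa> *\<^sub>R nu x" if "x \<in> G" "f x \<in> ball (f x0) \<epsilon>" for x
      by (rule gnu, rule e1(2)) (use that G ball_subset_cball in \<open>auto simp: \<epsilon>_def\<close>)
    fix z assume z: "z \<in> ball (f x0) \<epsilon>"
    then have zV: "\<pi> z \<in> V" using e2(2) by (auto simp: \<epsilon>_def)
    have d\<pi>: "(\<pi> has_derivative \<pi>) (at z)" unfolding \<pi>_def by (auto intro!: derivative_eq_intros)
    show "(\<phi> has_derivative (\<lambda>h. gr z \<bullet> h)) (at z)" unfolding \<phi>_def
      by (rule has_derivative_eq_rhs[OF has_derivative_diff[OF has_derivative_inner_left[OF has_derivative_ident] has_derivative_compose[OF d\<pi> g(9)[OF zV]]]])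
         (auto simp: fun_eq_iff \<pi>_def gr_def inner_diff_left inner_commute algebra_simps)
    show "gr z \<bullet> nu x0 > 1/2" "norm (gr z) \<le> 2" using e3(2)[of z] z by (auto simp: \<epsilon>_def dist_commute abs_if split: if_splits)
    show "\<phi> z = 0 \<longleftrightarrow> z \<in> f ` G"
    proof
      assume "\<phi> z = 0"
      then have zn: "z \<bullet> ?n = u (\<pi> z)" by (simp add: \<phi>_def)
      define x where "x = \<psi> (\<pi> z)"
      have x: "x \<in> O'" "(f x \<bullet> a, f x \<bullet> b) = \<pi> z" using zV g(5) by (auto simp: x_def homeomorphism_def)
      have "f x = (f x \<bullet> a) *\<^sub>R a + (f x \<bullet> b) *\<^sub>R b + (f x \<bullet> ?n) *\<^sub>R ?n" by (rule orthoframe_expand[OF fr])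
      also have "\<dots> = (z \<bullet> a) *\<^sub>R a + (z \<bullet> b) *\<^sub>R b + (z \<bullet> ?n) *\<^sub>R ?n"
        using x g(7)[OF x(1)] zn by (simp add: \<pi>_def)
      also have "\<dots> = z" by (rule orthoframe_expand[OF fr, symmetric])
      finally show "z \<in> f ` G" using x g(3) by auto
    next
      assume "z \<in> f ` G"
      then obtain x where x: "x \<in> G" "z = f x" by auto
      then have "x \<in> O'" using z G ball_subset_cball by (intro e1(2)) (auto simp: \<epsilon>_def)
      then show "\<phi> z = 0" using g(7) x by (simp add: \<phi>_def \<pi>_def)
    qed
  qed
  then show thesis by (rule that)
qed

text \<open>From \<open>z\<close> a straight segment in direction
  \<open>- \<sigma> *\<^sub>R nu x0\<close> runs towards the sheet until it hits it. Before the hit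
  neither equation vanishes, since both have the sheet as their zero set; at the hit both gradients
  are positive multiples of the same normal. So the second equation has the right sign just before
  the hit, and then back to \<open>z\<close>.\<close>

lemma good_side_agree:
  assumes x0: "x0 \<in> G" and y0: "y0 \<in> G" and Gb: "G \<subseteq> ball 0 1"
    and g1: "good_def_fn G x0 \<epsilon> \<phi> gr" and g2: "good_def_fn G y0 \<epsilon>' \<phi>' gr'" and le: "\<epsilon> \<le> \<epsilon>'"
    and z1: "z \<in> ball (f x0) (\<epsilon>/10)" and z2: "z \<in> ball (f y0) (\<epsilon>'/10)"
    and \<sigma>: "\<sigma> = 1 \<or> \<sigma> = (-1::real)" and pos: "\<sigma> * \<phi> z > 0"
  shows "\<sigma> * \<phi>' z > 0"
proof -
  let ?n = "nu x0"
  have x0b: "x0 \<in> ball 0 1" using x0 Gb by auto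
  have \<sigma>2: "\<sigma> * \<sigma> = 1" using \<sigma> by auto
  have epos: "\<epsilon> > 0" "\<epsilon>' > 0" using g1 g2 by (auto simp: good_def_fn_def)
  define r where "r = dist z (f x0)"
  have r: "r < \<epsilon>/10" "r \<ge> 0" using z1 by (auto simp: r_def dist_commute)
  \<comment> \<open>\<open>\<sigma> * \<phi>\<close> starts with at most \<open>2 * r\<close> and
    decreases with speed above 1/2, so the sheet is reached by time \<open>4 * r\<close>. Because
    \<open>r < \<epsilon>/10\<close> and \<open>\<epsilon> \<le> \<epsilon>'\<close>, the segment
    stays in both full balls up to then; this is the origin of the factor 10.\<close>
  define c where "c s = z + s *\<^sub>R (- \<sigma> *\<^sub>R ?n)" for s
  have nn: "norm ?n = 1" using nun[OF x0b] by (simp add: norm_eq_sqrt_inner)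
  have cz: "dist (c s) z = \<bar>s\<bar>" for s using \<sigma> nn by (auto simp: c_def dist_norm)
  have c1: "c s \<in> ball (f x0) \<epsilon>" if "0 \<le> s" "s \<le> 4 * r" for s
    using dist_triangle[of "f x0" "c s" z] cz[of s] that r epos by (auto simp: r_def dist_commute)
  have c2: "c s \<in> ball (f y0) \<epsilon>'" if "0 \<le> s" "s \<le> 4 * r" for s
    using dist_triangle[of "f y0" "c s" z] cz[of s] that r z2 le epos by (auto simp: dist_commute)
  define h where "h s = \<sigma> * \<phi> (c s)" for s
  define k where "k s = \<sigma> * \<phi>' (c s)" for s
  have dh: "(h has_real_derivative - (gr (c s) \<bullet> ?n)) (at s)" if "0 \<le> s" "s \<le> 4 * r" for s
  proof -
    have "((\<lambda>s. \<phi> (c s)) has_real_derivative (gr (c s) \<bullet> (- \<sigma> *\<^sub>R ?n))) (at s)" unfolding c_def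
      by (rule has_real_derivative_gradient_line) (use g1 c1[OF that] in \<open>auto simp: good_def_fn_def c_def\<close>)
    from DERIV_cmult[OF this, of \<sigma>] show ?thesis using \<sigma>2 by (simp add: h_def[abs_def] mult.assoc[symmetric])
  qed
  have dk: "(k has_real_derivative - (gr' (c s) \<bullet> ?n)) (at s)" if "0 \<le> s" "s \<le> 4 * r" for s
  proof -
    have "((\<lambda>s. \<phi>' (c s)) has_real_derivative (gr' (c s) \<bullet> (- \<sigma> *\<^sub>R ?n))) (at s)" unfolding c_def
      by (rule has_real_derivative_gradient_line) (use g2 c2[OF that] in \<open>auto simp: good_def_fn_def c_def\<close>)
    from DERIV_cmult[OF this, of \<sigma>] show ?thesis using \<sigma>2 by (simp add: k_def[abs_def] mult.assoc[symmetric])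
  qed
  have neg: "- (gr (c s) \<bullet> ?n) < - 1/2" if "0 \<le> s" "s \<le> 4 * r" for s
    using g1 c1[OF that] by (auto simp: good_def_fn_def)
  have h0: "h 0 > 0" using pos by (simp add: h_def c_def)
  have rpos: "r > 0"
  proof (rule ccontr)
    assume "\<not> r > 0"
    then have "z = f x0" using r by (simp add: r_def)
    then have "\<phi> z = 0" using g1 x0 epos by (auto simp: good_def_fn_def)
    then show False using pos by simp
  qed
  have h0le: "h 0 \<le> 2 * r"
  proof -
    let ?v = "z - f x0"
    have "\<exists>t>0. t < 1 \<and> \<phi> (f x0 + 1 *\<^sub>R ?v) - \<phi> (f x0 + 0 *\<^sub>R ?v) = (1 - 0) * (gr (f x0 + t *\<^sub>R ?v) \<bullet> ?v)"
    proof (rule MVT2)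
      fix t :: real assume t: "0 \<le> t" "t \<le> 1"
      have "dist (f x0) (f x0 + t *\<^sub>R ?v) \<le> r" using t mult_left_le_one_le[of r t] r by (simp add: dist_norm r_def norm_minus_commute)
      then have "f x0 + t *\<^sub>R ?v \<in> ball (f x0) \<epsilon>" using r epos by auto
      then show "((\<lambda>t. \<phi> (f x0 + t *\<^sub>R ?v)) has_real_derivative (gr (f x0 + t *\<^sub>R ?v) \<bullet> ?v)) (at t)"
        using g1 by (intro has_real_derivative_gradient_line) (auto simp: good_def_fn_def)
    qed simp
    then obtain t where t: "0 < t" "t < 1" "\<phi> z - \<phi> (f x0) = gr (f x0 + t *\<^sub>R ?v) \<bullet> ?v" by auto
    have "dist (f x0) (f x0 + t *\<^sub>R ?v) \<le> r" using t mult_left_le_one_le[of r t] r by (simp add: dist_norm r_def norm_minus_commute)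
    then have "f x0 + t *\<^sub>R ?v \<in> ball (f x0) \<epsilon>" using r epos by auto
    then have "norm (gr (f x0 + t *\<^sub>R ?v)) \<le> 2" using g1 by (auto simp: good_def_fn_def)
    then have "\<bar>gr (f x0 + t *\<^sub>R ?v) \<bullet> ?v\<bar> \<le> 2 * r"
      using Cauchy_Schwarz_ineq2[of "gr (f x0 + t *\<^sub>R ?v)" ?v] mult_right_mono[of "norm (gr (f x0 + t *\<^sub>R ?v))" 2 r] r
      by (simp add: r_def dist_norm)
    moreover have "\<phi> (f x0) = 0" using g1 x0 epos by (auto simp: good_def_fn_def)
    ultimately have "\<bar>\<phi> z\<bar> \<le> 2 * r" using t by simp
    then show ?thesis using \<sigma> by (auto simp: h_def c_def)
  qed
  have "h (4*r) \<le> 0"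
  proof -
    obtain t where t: "0 < t" "t < 4 * r" "h (4*r) - h 0 = (4 * r - 0) * (- (gr (c t) \<bullet> ?n))"
      using MVT2[of 0 "4*r" h "\<lambda>s. - (gr (c s) \<bullet> ?n)"] dh rpos by auto
    have "(4 * r - 0) * (- (gr (c t) \<bullet> ?n)) = - (4 * r * (gr (c t) \<bullet> ?n))" by simp
    moreover have "(4 * r) * (1/2) \<le> (4 * r) * (gr (c t) \<bullet> ?n)"
      using neg[of t] t rpos by (intro mult_left_mono) auto
    ultimately show ?thesis using h0le t(3) by linarith
  qed
  moreover have "continuous_on {0..4*r} h"
    by (intro continuous_at_imp_continuous_on ballI) (metis DERIV_isCont dh atLeastAtMost_iff)
  ultimately obtain s0 where s0: "0 \<le> s0" "s0 \<le> 4*r" "h s0 = 0"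
    using IVT2'[of h "4*r" 0 0] h0 rpos by auto
  have s0p: "s0 > 0" using s0 h0 by (cases "s0 = 0") auto
  have hpos: "h s > 0" if s: "0 \<le> s" "s < s0" for s
  proof -
    have "h s0 < h s"
    proof (rule DERIV_neg_imp_decreasing[OF s(2)])
      fix x assume "s \<le> x" "x \<le> s0"
      then have "0 \<le> x" "x \<le> 4 * r" using s s0 by auto
      then show "\<exists>y. (h has_real_derivative y) (at x) \<and> y < 0" using dh[of x] neg[of x] by (intro exI[of _ "- (gr (c x) \<bullet> ?n)"]) auto
    qed
    then show ?thesis using s0 by simp
  qed
  have knz: "k s \<noteq> 0" if s: "0 \<le> s" "s < s0" for s
  proof
    assume "k s = 0"
    then have "\<phi>' (c s) = 0" using \<sigma> by (auto simp: k_def)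
    then have "c s \<in> f ` G" using g2 c2[of s] s s0 by (auto simp: good_def_fn_def)
    then have "\<phi> (c s) = 0" using g1 c1[of s] s s0 by (auto simp: good_def_fn_def)
    then show False using hpos[OF s] by (simp add: h_def)
  qed
  have "\<phi> (c s0) = 0" using s0 \<sigma> by (auto simp: h_def)
  then have "c s0 \<in> f ` G" using g1 c1[of s0] s0 by (auto simp: good_def_fn_def)
  then obtain x where x: "x \<in> G" "c s0 = f x" by auto
  have k0: "k s0 = 0" using g2 c2[of s0] s0 x by (auto simp: good_def_fn_def k_def)
  \<comment> \<open>The common normal direction at the first hit transfers the sign of the slope
    along the segment from \<open>gr\<close> to \<open>gr'\<close>.\<close>
  obtain \<kappa> where \<kappa>: "\<kappa> > 0" "gr (f x) = \<kappa> *\<^sub>R nu x" using g1 x c1[of s0] s0 by (auto simp: good_def_fn_def)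
  obtain \<kappa>' where \<kappa>': "\<kappa>' > 0" "gr' (f x) = \<kappa>' *\<^sub>R nu x" using g2 x c2[of s0] s0 by (auto simp: good_def_fn_def)
  have "\<kappa> * (nu x \<bullet> ?n) > 0" using neg[of s0] s0 \<kappa> x by auto
  then have "nu x \<bullet> ?n > 0" using \<kappa> by (simp add: zero_less_mult_iff)
  then have "- (gr' (c s0) \<bullet> ?n) < 0" using \<kappa>' x by simp
  from has_real_derivative_neg_dec_left[OF dk[OF s0(1,2)] this]
  obtain d where d: "d > 0" "\<And>h. 0 < h \<Longrightarrow> h < d \<Longrightarrow> k s0 < k (s0 - h)" by auto
  define t where "t = s0 - min d s0 / 2"
  have t: "0 \<le> t" "t < s0" "k t > 0" using d(1) d(2)[of "min d s0 / 2"] s0p k0 by (auto simp: t_def)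
  have "k 0 > 0"
  proof (rule ccontr)
    assume "\<not> k 0 > 0"
    moreover have "continuous_on {0..t} k"
      using t s0 by (intro continuous_at_imp_continuous_on ballI) (metis DERIV_isCont dk atLeastAtMost_iff less_imp_le order_trans)
    ultimately obtain s where "0 \<le> s" "s \<le> t" "k s = 0"
      using IVT'[of k 0 0 t] t by auto
    then show False using knz[of s] t by auto
  qed
  then show ?thesis by (simp add: k_def c_def)
qed

text \<open>The local equations agree in sign on overlaps, so the two sides \<open>O1\<close> and
  \<open>O2\<close> of the sheet within a neighbourhood are well defined and disjoint. A Urysohn
  function \<open>d\<close>, 0 exactly on the sheet and 1 exactly off the neighbourhood, becomes an
  angle, pi times \<open>d\<close> on one side and its negative on the other. The two signs agree on
  the circle at the angles 0 and pi, so the function is continuous even if the sheet does not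
  separate \<open>U\<close>.\<close>

lemma collar_function:
  assumes G: "open G" "G \<subseteq> ball 0 1" and U: "open U" "f ` G \<subseteq> U" "closedin (top_of_set U) (f ` G)"
  obtains g :: "real^3 \<Rightarrow> complex" where "continuous_on U g" "\<And>z. z \<in> U \<Longrightarrow> norm (g z) = 1"
    "\<And>z. z \<in> U \<Longrightarrow> g z = 1 \<longleftrightarrow> z \<in> f ` G"
    "\<And>x0. x0 \<in> G \<Longrightarrow> \<exists>\<epsilon> \<phi> gr. good_def_fn G x0 \<epsilon> \<phi> gr \<and> ball (f x0) \<epsilon> \<subseteq> U \<and>
       (\<forall>z\<in>ball (f x0) \<epsilon>. (\<phi> z > 0 \<longrightarrow> Im (g z) > 0) \<and> (\<phi> z < 0 \<longrightarrow> Im (g z) < 0))"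
proof -
  have "\<exists>\<epsilon> \<phi> gr. good_def_fn G x0 \<epsilon> \<phi> gr \<and> ball (f x0) \<epsilon> \<subseteq> U" if x0: "x0 \<in> G" for x0
  proof -
    obtain \<epsilon> \<phi> gr where g: "good_def_fn G x0 \<epsilon> \<phi> gr" using good_def_fn_exists[OF x0 G] .
    obtain e where e: "e > 0" "ball (f x0) e \<subseteq> U" using U x0 open_contains_ball[of U] by blast
    have "good_def_fn G x0 (min e \<epsilon>) \<phi> gr" by (rule good_def_fn_mono[OF g]) (use e g in \<open>auto simp: good_def_fn_def\<close>)
    then show ?thesis using e by (intro exI[of _ "min e \<epsilon>"] exI) auto
  qed
  then obtain E \<Phi> GR where g: "\<And>x0. x0 \<in> G \<Longrightarrow> good_def_fn G x0 (E x0) (\<Phi> x0) (GR x0)"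
    and gU: "\<And>x0. x0 \<in> G \<Longrightarrow> ball (f x0) (E x0) \<subseteq> U"
    by metis
  have Epos: "E x0 > 0" if "x0 \<in> G" for x0 using g[OF that] by (simp add: good_def_fn_def)
  \<comment> \<open>A tenth of the radius, as required by \<open>good_side_agree\<close>.\<close>
  define B where "B x0 = ball (f x0) (E x0 / 10)" for x0
  have BE: "B x0 \<subseteq> ball (f x0) (E x0)" if "x0 \<in> G" for x0 using Epos[OF that] by (auto simp: B_def)
  define O1 where "O1 = (\<Union>x0\<in>G. {z \<in> B x0. \<Phi> x0 z > 0})"
  define O2 where "O2 = (\<Union>x0\<in>G. {z \<in> B x0. \<Phi> x0 z < 0})"
  have c\<Phi>: "continuous_on (B x0) (\<Phi> x0)" if "x0 \<in> G" for x0
    using g[OF that] BE[OF that] unfolding good_def_fn_def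
    by (intro continuous_at_imp_continuous_on ballI) (blast intro: has_derivative_continuous)
  have "open {z \<in> B x0. \<Phi> x0 z > 0}" "open {z \<in> B x0. \<Phi> x0 z < 0}" if "x0 \<in> G" for x0
    using continuous_open_preimage[OF c\<Phi>[OF that], of "{0<..}"] continuous_open_preimage[OF c\<Phi>[OF that], of "{..<0}"]
    by (simp_all add: B_def Int_def vimage_def)
  then have oO: "open O1" "open O2" unfolding O1_def O2_def by auto
  let ?S = "f ` G"
  have S0: "\<Phi> x0 z = 0 \<longleftrightarrow> z \<in> ?S" if "x0 \<in> G" "z \<in> B x0" for x0 z
    using g[OF that(1)] BE[OF that(1)] that unfolding good_def_fn_def by blast
  have agree: "\<sigma> * \<Phi> y0 z > 0" if "x0 \<in> G" "y0 \<in> G" "z \<in> B x0" "z \<in> B y0" "\<sigma> = 1 \<or> \<sigma> = (-1::real)" "\<sigma> * \<Phi> x0 z > 0" for x0 y0 z \<sigma>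
  proof (cases "E x0 \<le> E y0")
    case True
    show ?thesis by (rule good_side_agree[OF that(1,2) G(2) g[OF that(1)] g[OF that(2)] True]) (use that in \<open>auto simp: B_def\<close>)
  next
    case False
    show ?thesis
    proof (rule ccontr)
      assume n: "\<not> ?thesis"
      have "\<Phi> y0 z \<noteq> 0" using S0[OF that(1,3)] S0[OF that(2,4)] that(6) by auto
      then have "(- \<sigma>) * \<Phi> y0 z > 0" using n that(5) by auto
      then have "(- \<sigma>) * \<Phi> x0 z > 0"
        by (intro good_side_agree[OF that(2,1) G(2) g[OF that(2)] g[OF that(1)]]) (use that False in \<open>auto simp: B_def\<close>)
      then show False using that by simp
    qed
  qed
  have disj: "O1 \<inter> O2 = {}"
  proof -
    have False if z: "z \<in> O1" "z \<in> O2" for z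
    proof -
      obtain x0 where x0: "x0 \<in> G" "z \<in> B x0" "\<Phi> x0 z > 0" using z(1) unfolding O1_def by blast
      obtain y0 where y0: "y0 \<in> G" "z \<in> B y0" "\<Phi> y0 z < 0" using z(2) unfolding O2_def by blast
      show False using agree[of x0 y0 z 1] x0 y0 by simp
    qed
    then show ?thesis by blast
  qed
  have SO: "?S \<inter> O1 = {}" "?S \<inter> O2 = {}"
    unfolding O1_def O2_def using S0 by (fastforce dest: less_imp_neq)+
  define OC where "OC = (\<Union>x0\<in>G. B x0)"
  have Oeq: "OC = ?S \<union> O1 \<union> O2"
  proof
    show "OC \<subseteq> ?S \<union> O1 \<union> O2"
    proof
      fix z assume "z \<in> OC"
      then obtain x0 where x0: "x0 \<in> G" "z \<in> B x0" unfolding OC_def by blast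
      then show "z \<in> ?S \<union> O1 \<union> O2" using S0[OF x0] unfolding O1_def O2_def by (cases "\<Phi> x0 z" "0::real" rule: linorder_cases) blast+
    qed
    have "f x \<in> B x" if "x \<in> G" for x using Epos[OF that] by (simp add: B_def)
    then show "?S \<union> O1 \<union> O2 \<subseteq> OC" unfolding OC_def O1_def O2_def by blast
  qed
  have oOO: "open OC" by (auto simp: OC_def B_def)
  have OU: "OC \<subseteq> U" using gU BE unfolding OC_def by blast
  have "closedin (top_of_set U) (U - OC)" using oOO by (simp add: Diff_eq closedin_closed_Int closed_Compl)
  then have cl: "closedin (top_of_set U) (U - OC)" .
  have dj: "?S \<inter> (U - OC) = {}" using Oeq by auto
  have "\<exists>d::real^3 \<Rightarrow> real. continuous_on U d \<and> (\<forall>z\<in>U. d z \<in> closed_segment 0 1) \<and> (\<forall>z\<in>U. d z = 0 \<longleftrightarrow> z \<in> ?S) \<and> (\<forall>z\<in>U. d z = 1 \<longleftrightarrow> z \<in> U - OC)"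
    by (rule Urysohn_local_strong[OF U(3) cl dj zero_neq_one]) blast
  then obtain d :: "real^3 \<Rightarrow> real" where d: "continuous_on U d" "\<And>z. z \<in> U \<Longrightarrow> d z \<in> closed_segment 0 1"
    "\<And>z. z \<in> U \<Longrightarrow> d z = 0 \<longleftrightarrow> z \<in> ?S" "\<And>z. z \<in> U \<Longrightarrow> d z = 1 \<longleftrightarrow> z \<in> U - OC" by blast
  have d01: "0 \<le> d z" "d z \<le> 1" if "z \<in> U" for z using d(2)[OF that] by (auto simp: closed_segment_eq_real_ivl)
  define gg where "gg z = (if z \<in> O2 then cis (- pi * d z) else cis (pi * d z))" for z
  have cg: "continuous_on U gg"
  proof -
    have U2: "U = (U - O1) \<union> (U - O2)" using disj by auto
    have "continuous_on ((U - O1) \<union> (U - O2)) (\<lambda>z. if z \<in> O2 then cis (- pi * d z) else cis (pi * d z))"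
    proof (rule continuous_on_cases_local)
      show "closedin (top_of_set (U - O1 \<union> (U - O2))) (U - O1)" "closedin (top_of_set (U - O1 \<union> (U - O2))) (U - O2)"
        using oO unfolding U2[symmetric] by (simp_all add: Diff_eq closedin_closed_Int closed_Compl)
      show "continuous_on (U - O1) (\<lambda>z. cis (- pi * d z))" "continuous_on (U - O2) (\<lambda>z. cis (pi * d z))"
        using d(1) by (auto intro!: continuous_intros continuous_on_cis intro: continuous_on_subset)
      fix z assume z: "z \<in> U - O1 \<and> z \<notin> O2 \<or> z \<in> U - O2 \<and> z \<in> O2"
      then have "z \<in> ?S \<or> z \<in> U - OC" using Oeq by auto
      then have "d z = 0 \<or> d z = 1" using d z by auto
      then show "cis (- pi * d z) = cis (pi * d z)" by (auto simp: complex_eq_iff)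
    qed
    then show ?thesis unfolding gg_def[abs_def] U2[symmetric] .
  qed
  show thesis
  proof (rule that[of gg])
    show "continuous_on U gg" by (rule cg)
    show "norm (gg z) = 1" for z by (simp add: gg_def)
    show "gg z = 1 \<longleftrightarrow> z \<in> f ` G" if z: "z \<in> U" for z
    proof -
      have "cis (pi * d z) = 1 \<longleftrightarrow> d z = 0" "cis (- pi * d z) = 1 \<longleftrightarrow> d z = 0"
      proof -
        have c: "cos (pi * d z) = 1 \<longleftrightarrow> d z = 0"
          using cos_inj_pi[of "pi * d z" 0] d01[OF z] by auto
        show "cis (pi * d z) = 1 \<longleftrightarrow> d z = 0" "cis (- pi * d z) = 1 \<longleftrightarrow> d z = 0"
          using c by (auto simp: complex_eq_iff)
      qed
      then show ?thesis using d(3)[OF z] by (auto simp: gg_def)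
    qed
    fix x0 assume x0: "x0 \<in> G"
    have "good_def_fn G x0 (E x0 / 10) (\<Phi> x0) (GR x0)" using good_def_fn_mono[OF g[OF x0]] Epos[OF x0] by auto
    moreover have BU: "ball (f x0) (E x0 / 10) \<subseteq> U" using BE[OF x0] gU[OF x0] by (auto simp: B_def)
    moreover have "(\<Phi> x0 z > 0 \<longrightarrow> Im (gg z) > 0) \<and> (\<Phi> x0 z < 0 \<longrightarrow> Im (gg z) < 0)" if z: "z \<in> ball (f x0) (E x0 / 10)" for z
    proof -
      have zU: "z \<in> U" using BU z by auto
      have s: "sin (pi * d z) > 0" if "z \<in> O1 \<or> z \<in> O2"
      proof (rule sin_gt_zero)
        have "d z \<noteq> 0" "d z \<noteq> 1" using that d(3,4)[OF zU] SO Oeq by auto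
        then show "0 < pi * d z" "pi * d z < pi" using d01[OF zU] by auto
      qed
      have "\<Phi> x0 z > 0 \<Longrightarrow> z \<in> O1" "\<Phi> x0 z < 0 \<Longrightarrow> z \<in> O2" using x0 z by (auto simp: O1_def O2_def B_def)
      then show ?thesis using s disj by (auto simp: gg_def)
    qed
    ultimately show "\<exists>\<epsilon> \<phi> gr. good_def_fn G x0 \<epsilon> \<phi> gr \<and> ball (f x0) \<epsilon> \<subseteq> U \<and>
       (\<forall>z\<in>ball (f x0) \<epsilon>. (\<phi> z > 0 \<longrightarrow> Im (gg z) > 0) \<and> (\<phi> z < 0 \<longrightarrow> Im (gg z) < 0))" by blast
  qed
qed

end

section \<open>Real lifts of circle-valued functions\<close>

lemma sin_pos_imp_pos:
  fixes x :: real
  assumes "\<bar>x\<bar> < pi" shows "sin x > 0 \<Longrightarrow> x > 0" "sin x < 0 \<Longrightarrow> x < 0"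
proof -
  show "x > 0" if "sin x > 0"
  proof (rule ccontr)
    assume "\<not> x > 0"
    then have "x = 0 \<or> 0 < - x" by auto
    then show False using that sin_gt_zero[of "-x"] assms by auto
  qed
  show "x < 0" if "sin x < 0"
  proof (rule ccontr)
    assume "\<not> x < 0"
    then have "x = 0 \<or> 0 < x" by auto
    then show False using that sin_gt_zero[of x] assms by auto
  qed
qed

lemma cis_eq_imp_int: "cis s = cis t \<Longrightarrow> \<exists>m::int. s - t = 2 * pi * of_int m"
proof -
  assume "cis s = cis t"
  then have "cis (s - t) = 1" by (simp flip: cis_divide)
  then show ?thesis by (rule cis_eq_1_imp_int)
qed

lemma constant_integer_difference:
  fixes h1 h2 :: "'a::topological_space \<Rightarrow> real"
  assumes "connected T" "continuous_on T h1" "continuous_on T h2" "\<And>z. z \<in> T \<Longrightarrow> cis (h1 z) = cis (h2 z)"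
  obtains m :: int where "\<And>z. z \<in> T \<Longrightarrow> h1 z - h2 z = 2 * pi * of_int m"
proof (cases "T = {}")
  case False
  then obtain z0 where z0: "z0 \<in> T" by auto
  have ex: "\<exists>m::int. h1 z - h2 z = 2 * pi * of_int m" if "z \<in> T" for z
    using cis_eq_imp_int[OF assms(4)[OF that]] .
  have "(\<lambda>z. (h1 z - h2 z) / (2 * pi)) constant_on T"
  proof (rule continuous_discrete_range_constant[OF assms(1)])
    show "continuous_on T (\<lambda>z. (h1 z - h2 z) / (2 * pi))" by (intro continuous_intros assms) auto
    fix x assume x: "x \<in> T"
    show "\<exists>e>0. \<forall>y. y \<in> T \<and> (h1 y - h2 y) / (2 * pi) \<noteq> (h1 x - h2 x) / (2 * pi) \<longrightarrow> e \<le> norm ((h1 y - h2 y) / (2 * pi) - (h1 x - h2 x) / (2 * pi))"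
    proof (intro exI[of _ 1] conjI allI impI)
      fix y assume y: "y \<in> T \<and> (h1 y - h2 y) / (2 * pi) \<noteq> (h1 x - h2 x) / (2 * pi)"
      obtain m m' :: int where "h1 x - h2 x = 2 * pi * of_int m" "h1 y - h2 y = 2 * pi * of_int m'" using ex x y by blast
      then have "(h1 x - h2 x) / (2 * pi) = of_int m" "(h1 y - h2 y) / (2 * pi) = of_int m'" by auto
      moreover from this have "m \<noteq> m'" using y by auto
      then have "1 \<le> \<bar>real_of_int m' - of_int m\<bar>" by linarith
      ultimately show "1 \<le> norm ((h1 y - h2 y) / (2 * pi) - (h1 x - h2 x) / (2 * pi))" by simp
    qed simp
  qed
  then obtain c where c: "\<And>z. z \<in> T \<Longrightarrow> (h1 z - h2 z) / (2 * pi) = c" unfolding constant_on_def by blast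
  obtain m :: int where "h1 z0 - h2 z0 = 2 * pi * of_int m" using ex[OF z0] by blast
  then have "c = of_int m" using c[OF z0] by auto
  then show thesis using c by (intro that[of m]) (auto simp: field_simps)
qed auto

section \<open>Crossing a sheet and the sliding ball\<close>

context csurf
begin

lemma normal_multiple:
  assumes x: "x \<in> ball 0 1" and w: "w \<bullet> fu x = 0" "w \<bullet> fv x = 0"
  shows "w = (w \<bullet> nu x) *\<^sub>R nu x"
proof -
  let ?z = "w - (w \<bullet> nu x) *\<^sub>R nu x"
  have "?z \<bullet> nu x = 0" using nun[OF x] by (simp add: inner_diff_left)
  then obtain v where v: "?z = Dv x v" using perp_nu_iff_tangent[OF x] by blast
  have "?z \<bullet> fu x = 0" "?z \<bullet> fv x = 0" using w nufu[OF x] nufv[OF x] by (simp_all add: inner_diff_left)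
  then have "?z \<bullet> Dv x v = 0" by (simp add: Dv_def inner_add_right)
  then have "?z \<bullet> ?z = 0" using v by metis
  then show ?thesis by simp
qed

lemma critical_distance:
  assumes x: "x \<in> ball 0 1" and touch: "\<forall>\<^sub>F y in nhds x. norm (f x - c) \<le> norm (f y - c)"
  shows "f x - c = ((f x - c) \<bullet> nu x) *\<^sub>R nu x"
proof (rule normal_multiple[OF x])
  have d: "((\<lambda>y. f y - c) has_derivative (\<lambda>(a,b). a *\<^sub>R fu x + b *\<^sub>R fv x)) (at x)"
    using has_derivative_diff[OF df[OF x] has_derivative_const[of c]] by simp
  have e: "\<forall>\<^sub>F y in at x. (f x - c) \<bullet> (f x - c) \<le> (f y - c) \<bullet> (f y - c)"
    using touch unfolding eventually_nhds_conv_at by (auto elim!: eventually_mono simp: dot_square_norm)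
  have "(\<lambda>h. (f x - c) \<bullet> (case h of (a, b) \<Rightarrow> a *\<^sub>R fu x + b *\<^sub>R fv x) + (case h of (a, b) \<Rightarrow> a *\<^sub>R fu x + b *\<^sub>R fv x) \<bullet> (f x - c)) = (\<lambda>h. 0)"
    by (rule has_derivative_local_min[OF has_derivative_inner[OF d d] e])
  from fun_cong[OF this, of "(1,0)"] fun_cong[OF this, of "(0,1)"]
  show "(f x - c) \<bullet> fu x = 0" "(f x - c) \<bullet> fv x = 0" by (simp_all add: inner_commute)
qed

text \<open>The sheet \<open>f ` G\<close> is the fibre of \<open>g\<close> over 1, crossed positively in the direction of \<open>nu\<close>; hence a
  real lift of \<open>g\<close> along a curve counts the signed crossings of the curve with the sheet.\<close>

definition collar :: "(real \<times> real) set \<Rightarrow> (real^3) set \<Rightarrow> (real^3 \<Rightarrow> complex) \<Rightarrow> bool" where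
  "collar G U g \<longleftrightarrow> continuous_on U g \<and> (\<forall>z\<in>U. norm (g z) = 1) \<and> (\<forall>z\<in>U. g z = 1 \<longleftrightarrow> z \<in> f ` G) \<and>
     (\<forall>x0\<in>G. \<exists>\<epsilon> \<phi> gr. good_def_fn G x0 \<epsilon> \<phi> gr \<and> ball (f x0) \<epsilon> \<subseteq> U \<and>
       (\<forall>z\<in>ball (f x0) \<epsilon>. (\<phi> z > 0 \<longrightarrow> Im (g z) > 0) \<and> (\<phi> z < 0 \<longrightarrow> Im (g z) < 0)))"

lemma collar_exists:
  assumes "open G" "G \<subseteq> ball 0 1" "open U" "f ` G \<subseteq> U" "closedin (top_of_set U) (f ` G)"
  obtains g where "collar G U g"
proof (rule collar_function[OF assms])
  fix g assume "continuous_on U g" "\<And>z. z \<in> U \<Longrightarrow> norm (g z) = 1" "\<And>z. z \<in> U \<Longrightarrow> g z = 1 \<longleftrightarrow> z \<in> f ` G"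
    "\<And>x0. x0 \<in> G \<Longrightarrow> \<exists>\<epsilon> \<phi> gr. good_def_fn G x0 \<epsilon> \<phi> gr \<and> ball (f x0) \<epsilon> \<subseteq> U \<and>
       (\<forall>z\<in>ball (f x0) \<epsilon>. (\<phi> z > 0 \<longrightarrow> Im (g z) > 0) \<and> (\<phi> z < 0 \<longrightarrow> Im (g z) < 0))"
  then have "collar G U g" unfolding collar_def by blast
  then show thesis by (rule that)
qed

text \<open>Near \<open>\<tau>0\<close> the lift differs from its value \<open>2 * pi * m\<close> by
  less than pi, and in that range the sign of the difference is the sign of its sine, which is the
  imaginary part of \<open>g\<close>. The parameter set \<open>T\<close> is any metric set because
  the lemma is applied to balls, to a half-space and to curves.\<close>

lemma lift_sides:
  fixes T :: "'t::metric_space set"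
  assumes col: "collar G U g" and x0: "x0 \<in> G" and \<tau>0: "\<tau>0 \<in> T" "c \<tau>0 = f x0"
    and cc: "continuous_on T c" and hc: "continuous_on T h"
    and lift: "\<And>\<tau>. \<tau> \<in> T \<Longrightarrow> c \<tau> \<in> U \<and> g (c \<tau>) = cis (h \<tau>)"
  obtains m :: int and \<epsilon> \<phi> gr \<delta> where "h \<tau>0 = 2 * pi * of_int m" "good_def_fn G x0 \<epsilon> \<phi> gr" "\<delta> > 0"
    "\<And>\<tau>. \<tau> \<in> T \<Longrightarrow> dist \<tau> \<tau>0 < \<delta> \<Longrightarrow> c \<tau> \<in> ball (f x0) \<epsilon> \<and> (\<phi> (c \<tau>) > 0 \<longrightarrow> h \<tau> > 2 * pi * of_int m) \<and>
       (\<phi> (c \<tau>) < 0 \<longrightarrow> h \<tau> < 2 * pi * of_int m) \<and> (\<phi> (c \<tau>) = 0 \<longrightarrow> h \<tau> = 2 * pi * of_int m)"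
proof -
  obtain \<epsilon> \<phi> gr where gd: "good_def_fn G x0 \<epsilon> \<phi> gr" and bU: "ball (f x0) \<epsilon> \<subseteq> U"
    and side: "\<And>z. z \<in> ball (f x0) \<epsilon> \<Longrightarrow> (\<phi> z > 0 \<longrightarrow> Im (g z) > 0) \<and> (\<phi> z < 0 \<longrightarrow> Im (g z) < 0)"
    using col x0 unfolding collar_def by blast
  have gS: "g z = 1 \<longleftrightarrow> z \<in> f ` G" if "z \<in> U" for z using col that by (auto simp: collar_def)
  have "g (c \<tau>0) = 1" using gS[of "c \<tau>0"] lift[OF \<tau>0(1)] \<tau>0 x0 by (metis imageI)
  then obtain m :: int where m: "h \<tau>0 = 2 * pi * of_int m" using lift[OF \<tau>0(1)] cis_eq_1_imp_int by metis
  have \<epsilon>: "\<epsilon> > 0" using gd by (simp add: good_def_fn_def)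
  obtain d1 where d1: "d1 > 0" "\<And>\<tau>. \<tau> \<in> T \<Longrightarrow> dist \<tau> \<tau>0 < d1 \<Longrightarrow> dist (c \<tau>) (c \<tau>0) < \<epsilon>"
    using cc \<tau>0(1) \<epsilon> unfolding continuous_on_iff by blast
  obtain d2 where d2: "d2 > 0" "\<And>\<tau>. \<tau> \<in> T \<Longrightarrow> dist \<tau> \<tau>0 < d2 \<Longrightarrow> dist (h \<tau>) (h \<tau>0) < pi"
    using hc \<tau>0(1) pi_gt_zero unfolding continuous_on_iff by blast
  show thesis
  proof (rule that[OF m gd, of "min d1 d2"])
    show "min d1 d2 > 0" using d1 d2 by simp
    fix \<tau> assume \<tau>: "\<tau> \<in> T" "dist \<tau> \<tau>0 < min d1 d2"
    have cb: "c \<tau> \<in> ball (f x0) \<epsilon>" using d1(2)[of \<tau>] \<tau> \<tau>0 by (auto simp: dist_commute)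
    let ?k = "h \<tau> - 2 * pi * of_int m"
    have k: "\<bar>?k\<bar> < pi" using d2(2)[of \<tau>] \<tau> m by (auto simp: dist_real_def)
    have "Im (g (c \<tau>)) = sin (h \<tau>)" using lift[OF \<tau>(1)] by simp
    also have "\<dots> = sin ?k"
    proof -
      have "cis (2 * pi * of_int m) = 1" by (intro cis_multiple_2pi Ints_of_int)
      then have "cis ?k = cis (h \<tau>)" by (simp flip: cis_divide)
      then show ?thesis by (metis cis.sel(2))
    qed
    finally have s: "Im (g (c \<tau>)) = sin ?k" .
    have "h \<tau> = 2 * pi * of_int m" if "\<phi> (c \<tau>) = 0"
    proof -
      have "c \<tau> \<in> f ` G" using gd that cb by (auto simp: good_def_fn_def)
      then have "cis (h \<tau>) = 1" using gS[of "c \<tau>"] lift[OF \<tau>(1)] by metis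
      then obtain m' :: int where m': "h \<tau> = 2 * pi * of_int m'" using cis_eq_1_imp_int by blast
      then have "\<bar>2 * pi * of_int (m' - m)\<bar> < pi" using k by (simp add: algebra_simps)
      then have "2 * \<bar>real_of_int (m' - m)\<bar> < 1" by (simp add: abs_mult)
      then have "real_of_int \<bar>m' - m\<bar> < 1" by simp
      then have "\<bar>m' - m\<bar> < 1" by linarith
      then have "m' = m" by simp
      then show ?thesis using m' by simp
    qed
    then show "c \<tau> \<in> ball (f x0) \<epsilon> \<and> (\<phi> (c \<tau>) > 0 \<longrightarrow> h \<tau> > 2 * pi * of_int m) \<and>
       (\<phi> (c \<tau>) < 0 \<longrightarrow> h \<tau> < 2 * pi * of_int m) \<and> (\<phi> (c \<tau>) = 0 \<longrightarrow> h \<tau> = 2 * pi * of_int m)"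
      using cb side[OF cb] s sin_pos_imp_pos[OF k] by auto
  qed
qed

text \<open>If the lift gained along the curve, a ball slid along the curve would at some moment first touch
  the sheet from the side of \<open>nu\<close>, which \<open>inner_touching_ball_radius\<close> excludes for radius larger than 1.\<close>

lemma sliding_ball_contradiction:
  assumes Gb: "G \<subseteq> ball 0 1" and oG: "open G" and col: "collar G U g" and r: "r > 1"
    and cc: "continuous_on UNIV c" and cU: "\<And>t::real. cball (c t) r \<subseteq> U"
    and hc: "continuous_on (UNIV \<times> cball 0 r) h"
    and lift: "\<And>t y. norm y \<le> r \<Longrightarrow> g (c t + y) = cis (h (t,y))"
    and per: "\<And>t y. norm y \<le> r \<Longrightarrow> h (t+1,y) = h (t,y) + 2 * pi * of_int n" and n: "n > (0::int)"
  shows False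
proof -
  have per': "h (t + real k,y) = h (t,y) + 2 * pi * of_int n * real k" if "norm y \<le> r" for t k y
  proof (induction k)
    case (Suc k)
    have "h (t + real (Suc k), y) = h ((t + real k) + 1, y)" by (simp add: algebra_simps)
    also have "\<dots> = h (t + real k, y) + 2 * pi * of_int n" by (rule per[OF that])
    also have "\<dots> = h (t,y) + 2 * pi * of_int n * real (Suc k)" unfolding Suc by (simp add: algebra_simps)
    finally show ?case .
  qed simp
  have "compact ({0..1::real} \<times> cball (0::real^3) r)" by (intro compact_Times) auto
  then have "compact (h ` ({0..1} \<times> cball 0 r))"
    by (rule compact_continuous_image[rotated]) (rule continuous_on_subset[OF hc], auto)
  then obtain M where M: "\<And>t y. t \<in> {0..1} \<Longrightarrow> norm y \<le> r \<Longrightarrow> \<bar>h (t,y)\<bar> \<le> M"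
  proof -
    obtain M where "\<And>z. z \<in> h ` ({0..1} \<times> cball 0 r) \<Longrightarrow> norm z \<le> M"
      using compact_imp_bounded[OF \<open>compact (h ` ({0..1} \<times> cball 0 r))\<close>] unfolding bounded_iff by blast
    then have "\<bar>h (t,y)\<bar> \<le> M" if "t \<in> {0..1}" "norm y \<le> r" for t y using that by force
    then show ?thesis using that by blast
  qed
  \<comment> \<open>The gain over \<open>K\<close> periods exceeds the bound \<open>M\<close> of the
    lift over one period. So from time \<open>K\<close> on the lift is positive on the whole ball,
    while at time \<open>- K\<close> it is still nonpositive at the centre.\<close>
  obtain K :: nat where K: "real K > M / (2 * pi)" using reals_Archimedean2 by blast
  have n1: "real_of_int n \<ge> 1" using n by simp
  have MK: "M < 2 * pi * real K" using K by (simp add: field_simps)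
  have big: "h (t,y) > 0" if "t \<ge> real K" "norm y \<le> r" for t y
  proof -
    define k where "k = nat \<lfloor>t\<rfloor>"
    have t0: "t \<ge> 0" using that by (meson of_nat_0_le_iff order_trans)
    have k: "real k \<le> t" "t < real k + 1" using t0 by (auto simp: k_def)
    have kK: "k \<ge> K" using that(1) t0 by (simp add: k_def le_nat_iff le_floor_iff)
    have "h (t,y) = h ((t - real k) + real k, y)" by simp
    also have "\<dots> = h (t - real k, y) + 2 * pi * of_int n * real k" by (rule per'[OF that(2)])
    finally have e: "h (t,y) = h (t - real k, y) + 2 * pi * of_int n * real k" .
    have "1 * real K \<le> of_int n * real k" using n1 kK by (intro mult_mono) auto
    then have "2 * pi * real K \<le> 2 * pi * of_int n * real k" by (simp add: mult.assoc)
    moreover have "- M \<le> h (t - real k, y)" using M[of "t - real k" y] k that by (simp add: abs_le_iff)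
    ultimately show ?thesis using e MK by linarith
  qed
  \<comment> \<open>\<open>Sup A\<close> is the last time at which the ball contains a point with
    nonpositive lift. At that time the minimum of the lift over the ball is 0: the ball touches the
    sheet and lies, near the point of contact, on its positive side.\<close>
  define A where "A = {t. \<exists>y. norm y \<le> r \<and> h (t,y) \<le> 0}"
  have Abd: "t \<le> real K" if "t \<in> A" for t using big[of t] that by (force simp: A_def)
  have r0: "norm (0::real^3) \<le> r" using r by simp
  have "- real K \<in> A"
  proof -
    have "h (- real K + real K, 0) = h (- real K, 0) + 2 * pi * of_int n * real K" by (rule per'[OF r0])
    then have 1: "h (0,0) = h (- real K, 0) + 2 * pi * of_int n * real K" by simp
    have "1 * real K \<le> of_int n * real K" using n1 by (intro mult_right_mono) auto
    then have 2: "2 * pi * real K \<le> 2 * pi * of_int n * real K" by (simp add: mult.assoc)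
    have "h (0, 0) \<le> M" using M[of 0 0] r0 by (simp add: abs_le_iff)
    then have "h (- real K, 0) \<le> 0" using MK 1 2 by linarith
    then show ?thesis unfolding A_def using r0 by blast
  qed
  define t1 where "t1 = Sup A"
  have bdd: "bdd_above A" using Abd by (auto simp: bdd_above_def)
  have ge: "h (t1,y) \<ge> 0" if y: "norm y \<le> r" for y
  proof (rule ccontr)
    assume "\<not> h (t1,y) \<ge> 0"
    moreover have "continuous_on UNIV (\<lambda>t. h (t,y))"
      by (rule continuous_on_compose2[OF hc]) (use y in \<open>auto intro!: continuous_intros\<close>)
    ultimately obtain d where d: "d > 0" "\<And>t. dist t t1 < d \<Longrightarrow> dist (h (t,y)) (h (t1,y)) < - h (t1,y)"
      unfolding continuous_on_iff by (metis UNIV_I neg_0_less_iff_less not_less)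
    have "h (t1 + d/2, y) \<le> 0" using d(2)[of "t1 + d/2"] d(1) by (auto simp: dist_real_def)
    then have "t1 + d/2 \<in> A" using y by (auto simp: A_def)
    then have "t1 + d/2 \<le> t1" unfolding t1_def using bdd by (rule cSup_upper)
    then show False using d by simp
  qed
  have "\<exists>y. norm y \<le> r \<and> h (t1,y) \<le> 0"
  proof (rule ccontr)
    assume "\<nexists>y. norm y \<le> r \<and> h (t1,y) \<le> 0"
    then have pos: "\<And>y. norm y \<le> r \<Longrightarrow> h (t1,y) > 0" by force
    have "compact ({t1} \<times> cball (0::real^3) r)" by (intro compact_Times) auto
    moreover have "{t1} \<times> cball 0 r \<noteq> {}" using r by auto
    ultimately obtain m where m: "m \<in> {t1} \<times> cball 0 r" "\<And>z. z \<in> {t1} \<times> cball 0 r \<Longrightarrow> h m \<le> h z"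
      using continuous_attains_inf[of "{t1} \<times> cball 0 r" h] continuous_on_subset[OF hc, of "{t1} \<times> cball 0 r"] by auto
    have hm: "h m > 0" using m pos by auto
    have "compact ({t1-1..t1+1} \<times> cball (0::real^3) r)" by (intro compact_Times) auto
    then have "uniformly_continuous_on ({t1-1..t1+1} \<times> cball 0 r) h"
      by (rule compact_uniformly_continuous[rotated]) (rule continuous_on_subset[OF hc], auto)
    then obtain d where d: "d > 0" "\<And>z z'. z \<in> {t1-1..t1+1} \<times> cball 0 r \<Longrightarrow> z' \<in> {t1-1..t1+1} \<times> cball 0 r \<Longrightarrow> dist z' z < d \<Longrightarrow> dist (h z') (h z) < h m"
      unfolding uniformly_continuous_on_def using hm by metis
    have none: "t \<notin> A" if t: "t1 - min d 1 < t" "t \<le> t1" for t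
    proof
      assume "t \<in> A"
      then obtain y where y: "norm y \<le> r" "h (t,y) \<le> 0" by (auto simp: A_def)
      have "dist (h (t,y)) (h (t1,y)) < h m"
        by (rule d(2)) (use t y in \<open>auto simp: dist_Pair_Pair dist_real_def\<close>)
      moreover have "h m \<le> h (t1,y)" using m(2)[of "(t1,y)"] y by auto
      ultimately show False using y by (auto simp: dist_real_def)
    qed
    have "A \<noteq> {}" using \<open>- real K \<in> A\<close> by auto
    moreover have "t \<le> t1 - min d 1" if "t \<in> A" for t
      using none[of t] that cSup_upper[OF that bdd] by (force simp: t1_def)
    ultimately have "t1 \<le> t1 - min d 1" unfolding t1_def by (metis cSup_least)
    then show False using d by simp
  qed
  then obtain y1 where y1: "norm y1 \<le> r" "h (t1,y1) = 0" using ge by force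
  let ?c = "c t1"
  have "g (?c + y1) = 1" using lift[OF y1(1), of t1] y1(2) by simp
  moreover have yU: "?c + y \<in> U" if "norm y \<le> r" for y using cU[of t1] that by (auto simp: dist_norm)
  ultimately have "?c + y1 \<in> f ` G" using col y1 unfolding collar_def by blast
  then obtain x1 where x1: "x1 \<in> G" "?c + y1 = f x1" by auto
  have x1b: "x1 \<in> ball 0 1" using x1 Gb by auto
  have c1: "continuous_on (cball 0 r) (\<lambda>y. ?c + y)" by (intro continuous_intros)
  have c2: "continuous_on (cball 0 r) (\<lambda>y. h (t1,y))"
    by (rule continuous_on_compose2[OF hc]) (auto intro!: continuous_intros)
  have y1c: "y1 \<in> cball 0 r" using y1 by simp
  obtain m :: int and \<epsilon> \<phi> gr \<delta> where m: "h (t1,y1) = 2 * pi * of_int m" and gd: "good_def_fn G x1 \<epsilon> \<phi> gr" and \<delta>: "\<delta> > 0"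
    and sd: "\<And>y. y \<in> cball 0 r \<Longrightarrow> dist y y1 < \<delta> \<Longrightarrow> ?c + y \<in> ball (f x1) \<epsilon> \<and> (\<phi> (?c + y) > 0 \<longrightarrow> h (t1,y) > 2 * pi * of_int m) \<and>
       (\<phi> (?c + y) < 0 \<longrightarrow> h (t1,y) < 2 * pi * of_int m) \<and> (\<phi> (?c + y) = 0 \<longrightarrow> h (t1,y) = 2 * pi * of_int m)"
    by (rule lift_sides[OF col x1(1) y1c x1(2) c1 c2]) (use lift yU in auto)
  have m0: "2 * pi * of_int m = 0" using m y1 by simp
  have \<phi>ge: "\<phi> z \<ge> 0" if z: "z \<in> cball ?c r" "dist z (f x1) < \<delta>" for z
  proof -
    have "z - ?c \<in> cball 0 r" "dist (z - ?c) y1 < \<delta>" using z x1(2)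
      by (auto simp: dist_norm norm_minus_commute algebra_simps)
    from sd[OF this] show ?thesis using ge[of "z - ?c"] m0 z by (auto simp: dist_norm norm_minus_commute not_less[symmetric])
  qed
  have \<epsilon>: "\<epsilon> > 0" using gd by (simp add: good_def_fn_def)
  \<comment> \<open>A small step against \<open>nu x1\<close> leads from the sheet to the negative
    side. A sheet point near \<open>f x1\<close> can therefore not lie in the open ball, since the
    ball would then contain points of the negative side.\<close>
  have down: "\<exists>s. 0 < s \<and> s < d \<and> \<phi> (z + s *\<^sub>R (- nu x1)) < 0" if z: "z \<in> f ` G" "z \<in> ball (f x1) \<epsilon>" and d: "d > 0" for z d
  proof -
    have "((\<lambda>s. \<phi> (z + s *\<^sub>R (- nu x1))) has_real_derivative (gr z \<bullet> (- nu x1))) (at 0)"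
      by (rule has_real_derivative_gradient_line) (use gd z in \<open>auto simp: good_def_fn_def\<close>)
    moreover have "gr z \<bullet> (- nu x1) < 0" using gd z by (force simp: good_def_fn_def)
    ultimately obtain e where e: "e > 0" "\<And>h. 0 < h \<Longrightarrow> h < e \<Longrightarrow> \<phi> (z + h *\<^sub>R (- nu x1)) < \<phi> z"
      using has_real_derivative_neg_dec_right[of "\<lambda>s. \<phi> (z + s *\<^sub>R (- nu x1))" "gr z \<bullet> (- nu x1)" 0 UNIV] by auto
    have "\<phi> z = 0" using gd z by (auto simp: good_def_fn_def)
    then show ?thesis using e(1) e(2)[of "min e d / 2"] d by (intro exI[of _ "min e d / 2"]) auto
  qed
  have nn: "norm (nu x1) = 1" using nun[OF x1b] by (simp add: norm_eq_sqrt_inner)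
  have away: "norm (f x - ?c) \<ge> r" if x: "x \<in> G" "dist (f x) (f x1) < min \<delta> \<epsilon>" for x
  proof (rule ccontr)
    assume a: "\<not> norm (f x - ?c) \<ge> r"
    define d where "d = min (r - norm (f x - ?c)) (\<delta> - dist (f x) (f x1))"
    have d: "d > 0" using a x by (simp add: d_def)
    obtain s where s: "0 < s" "s < d" "\<phi> (f x + s *\<^sub>R (- nu x1)) < 0"
      using down[of "f x" d] x d by (auto simp: dist_commute)
    have "norm (f x + s *\<^sub>R (- nu x1) - ?c) \<le> norm (f x - ?c) + s"
      using norm_triangle_ineq[of "f x - ?c" "s *\<^sub>R (- nu x1)"] s nn by (simp add: algebra_simps)
    moreover have "dist (f x + s *\<^sub>R (- nu x1)) (f x1) \<le> dist (f x) (f x1) + s"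
      using norm_triangle_ineq[of "f x - f x1" "s *\<^sub>R (- nu x1)"] s nn by (simp add: dist_norm algebra_simps)
    ultimately have "\<phi> (f x + s *\<^sub>R (- nu x1)) \<ge> 0"
      using s by (intro \<phi>ge) (auto simp: d_def dist_norm norm_minus_commute)
    then show False using s by simp
  qed
  have nr: "norm (f x1 - ?c) = r" using away[OF x1(1)] \<delta> \<epsilon> y1 x1(2)[symmetric] by simp
  have touch: "\<forall>\<^sub>F y in nhds x1. norm (f x1 - ?c) \<le> norm (f y - ?c)"
  proof -
    have "isCont f x1" using df[OF x1b] has_derivative_continuous by blast
    then have "\<forall>\<^sub>F y in nhds x1. dist (f y) (f x1) < min \<delta> \<epsilon>"
      using \<delta> \<epsilon> tendstoD[of f "f x1" "at x1" "min \<delta> \<epsilon>"] by (simp add: isCont_def eventually_nhds_conv_at del: min_less_iff_conj)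
    moreover have "\<forall>\<^sub>F y in nhds x1. y \<in> G" using oG x1(1) by (rule eventually_nhds_in_open)
    ultimately show ?thesis by eventually_elim (use away nr in auto)
  qed
  \<comment> \<open>The centre lies on the normal line at signed distance \<open>\<rho>\<close> from
    the contact point. A negative \<open>\<rho>\<close> would again place points of the negative
    side in the ball.\<close>
  define \<rho> where "\<rho> = - ((f x1 - ?c) \<bullet> nu x1)"
  have e: "?c = f x1 + \<rho> *\<^sub>R nu x1" using critical_distance[OF x1b touch] by (simp add: \<rho>_def algebra_simps)
  have "\<bar>\<rho>\<bar> = r" using nr nn unfolding e by simp
  moreover have "\<rho> > 0"
  proof (rule ccontr)
    assume "\<not> \<rho> > 0"
    then have \<rho>: "\<rho> = - r" using \<open>\<bar>\<rho>\<bar> = r\<close> r by auto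
    obtain s where s: "0 < s" "s < min r \<delta>" "\<phi> (f x1 + s *\<^sub>R (- nu x1)) < 0"
      using down[of "f x1" "min r \<delta>"] x1 \<epsilon> \<delta> r by auto
    have "f x1 + s *\<^sub>R (- nu x1) - ?c = (r - s) *\<^sub>R nu x1" unfolding e \<rho> by (simp add: algebra_simps)
    then have "norm (f x1 + s *\<^sub>R (- nu x1) - ?c) \<le> r" using s nn by simp
    then have "\<phi> (f x1 + s *\<^sub>R (- nu x1)) \<ge> 0" using s nn by (intro \<phi>ge) (auto simp: dist_norm norm_minus_commute)
    then show False using s by simp
  qed
  ultimately have "?c = f x1 + r *\<^sub>R nu x1" using e by simp
  then have "r \<le> 1" by (rule inner_touching_ball_radius[OF x1b touch])
  then show False using r by simp
qed

text \<open>Lifting over the product of the line with the ball, a convex set, makes the gain per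
  period one and the same integer \<open>n\<close> for all points of the ball. A positive
  \<open>n\<close> is excluded by the sliding ball, and running the curve backwards turns a negative
  \<open>n\<close> into a positive one.\<close>

lemma tube_winding_zero:
  assumes Gb: "G \<subseteq> ball 0 1" and oG: "open G" and col: "collar G U g" and r: "r > 1"
    and cc: "continuous_on UNIV c" and cU: "\<And>t::real. cball (c t) r \<subseteq> U" and cper: "\<And>t. c (t+1) = c t"
    and hc: "continuous_on UNIV h" and lift: "\<And>t. g (c t) = cis (h t)"
  shows "h (t + 1) = h t"
proof -
  let ?T = "(UNIV::real set) \<times> cball (0::real^3) r"
  have conv: "convex ?T" by (intro convex_Times) auto
  have cT: "continuous_on ?T (\<lambda>z. c (fst z) + snd z)"
    by (intro continuous_intros continuous_on_compose2[OF cc]) auto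
  have im: "(\<lambda>z. c (fst z) + snd z) ` ?T \<subseteq> U"
  proof clarsimp
    fix t and y :: "real^3" assume "norm y \<le> r"
    then have "c t + y \<in> cball (c t) r" by (simp add: dist_norm)
    then show "c t + y \<in> U" using cU by blast
  qed
  have cg: "continuous_on U g" using col by (simp add: collar_def)
  have cgT: "continuous_on ?T (\<lambda>z. g (c (fst z) + snd z))"
    by (rule continuous_on_compose2[OF cg cT im])
  have nrm: "norm (g (c (fst z) + snd z)) = 1" if "z \<in> ?T" for z
  proof -
    have "c (fst z) + snd z \<in> U" using im that by blast
    then show ?thesis using col by (simp add: collar_def)
  qed
  obtain h2 :: "real \<times> (real^3) \<Rightarrow> real" where h2: "continuous_on ?T h2" "\<And>z. z \<in> ?T \<Longrightarrow> g (c (fst z) + snd z) = cis (h2 z)"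
    by (rule circle_lift[OF cgT convex_imp_contractible[OF conv] nrm]) (assumption | rule that)+
  have lift2: "g (c t + y) = cis (h2 (t,y))" if "norm y \<le> r" for t y using h2(2)[of "(t,y)"] that by simp
  have conn: "connected ?T" using conv by (rule convex_connected)
  have shift: "continuous_on ?T (\<lambda>z. h2 (fst z + 1, snd z))"
    by (rule continuous_on_compose2[OF h2(1)]) (auto intro!: continuous_intros)
  obtain n :: int where n: "\<And>z. z \<in> ?T \<Longrightarrow> h2 (fst z + 1, snd z) - h2 z = 2 * pi * of_int n"
    by (rule constant_integer_difference[OF conn shift h2(1)])
       (use h2(2) cper lift2 in \<open>auto simp: lift2[symmetric]\<close>)
  have per: "h2 (t+1,y) = h2 (t,y) + 2 * pi * of_int n" if "norm y \<le> r" for t y using n[of "(t,y)"] that by simp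
  have "\<not> n > 0"
    using sliding_ball_contradiction[OF Gb oG col r cc cU h2(1) lift2 per] by blast
  moreover have "\<not> n < 0"
  proof
    assume "n < 0"
    then have n': "- n > 0" by simp
    have 1: "continuous_on UNIV (\<lambda>t. c (- t))" by (rule continuous_on_compose2[OF cc]) (auto intro!: continuous_intros)
    have 2: "continuous_on ?T (\<lambda>z. h2 (- fst z, snd z))"
      by (rule continuous_on_compose2[OF h2(1)]) (auto intro!: continuous_intros)
    have 3: "h2 (- fst (t+1,y), snd (t+1,y)) = h2 (- fst (t,y), snd (t,y)) + 2 * pi * of_int (- n)" if "norm y \<le> r" for t y
      using per[OF that, of "- t - 1"] by simp
    show False
      by (rule sliding_ball_contradiction[OF Gb oG col r 1 _ 2 _ 3 n']) (use cU lift2 in auto)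
  qed
  ultimately have "n = 0" by simp
  then have p2: "h2 (t+1,0) = h2 (t,0)" using per[of 0 t] r by simp
  have c3: "continuous_on UNIV (\<lambda>t. h2 (t,0))"
    by (rule continuous_on_compose2[OF h2(1)]) (use r in \<open>auto intro!: continuous_intros\<close>)
  obtain m :: int where "\<And>t. t \<in> UNIV \<Longrightarrow> h t - h2 (t,0) = 2 * pi * of_int m"
    by (rule constant_integer_difference[OF connected_UNIV hc c3]) (use lift lift2[of 0] r in \<open>auto simp flip: lift\<close>)
  from this[of t] this[of "t+1"] p2 show ?thesis by simp
qed

end

section \<open>Maximum principles for graphs\<close>

type_synonym rfun = "real \<times> real \<Rightarrow> real"

definition C2s :: "(real \<times> real) set \<Rightarrow> rfun \<Rightarrow> rfun \<Rightarrow> rfun \<Rightarrow> rfun \<Rightarrow> rfun \<Rightarrow> rfun \<Rightarrow> rfun \<Rightarrow> bool" where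
  "C2s V w p q p1 p2 q1 q2 \<longleftrightarrow> open V \<and>
    (\<forall>y\<in>V. (w has_derivative (\<lambda>(h,k). h * p y + k * q y)) (at y) \<and>
      (p has_derivative (\<lambda>(h,k). h * p1 y + k * p2 y)) (at y) \<and>
      (q has_derivative (\<lambda>(h,k). h * q1 y + k * q2 y)) (at y))"

lemma C2s_line:
  assumes "C2s V w p q p1 p2 q1 q2" "y + s *\<^sub>R v \<in> V"
  shows "((\<lambda>s. w (y + s *\<^sub>R v)) has_real_derivative (fst v * p (y + s *\<^sub>R v) + snd v * q (y + s *\<^sub>R v))) (at s)"
    "((\<lambda>s. fst v * p (y + s *\<^sub>R v) + snd v * q (y + s *\<^sub>R v)) has_real_derivative
      ((fst v)\<^sup>2 * p1 (y + s *\<^sub>R v) + fst v * snd v * (p2 (y + s *\<^sub>R v) + q1 (y + s *\<^sub>R v)) + (snd v)\<^sup>2 * q2 (y + s *\<^sub>R v))) (at s)"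
proof -
  have *: "((\<lambda>s. F (y + s *\<^sub>R v)) has_real_derivative (fst v * Fu + snd v * Fv)) (at s)"
    if "(F has_derivative (\<lambda>(h,k). h * Fu + k * Fv)) (at (y + s *\<^sub>R v))" for F :: rfun and Fu Fv
    using has_vector_derivative_along_line[of F Fu Fv y s v] that
    by (simp add: has_real_derivative_iff_has_vector_derivative)
  show "((\<lambda>s. w (y + s *\<^sub>R v)) has_real_derivative (fst v * p (y + s *\<^sub>R v) + snd v * q (y + s *\<^sub>R v))) (at s)"
    using assms by (intro *) (auto simp: C2s_def)
  have 1: "((\<lambda>s. p (y + s *\<^sub>R v)) has_real_derivative (fst v * p1 (y + s *\<^sub>R v) + snd v * p2 (y + s *\<^sub>R v))) (at s)"
    using assms by (intro *) (auto simp: C2s_def)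
  have 2: "((\<lambda>s. q (y + s *\<^sub>R v)) has_real_derivative (fst v * q1 (y + s *\<^sub>R v) + snd v * q2 (y + s *\<^sub>R v))) (at s)"
    using assms by (intro *) (auto simp: C2s_def)
  show "((\<lambda>s. fst v * p (y + s *\<^sub>R v) + snd v * q (y + s *\<^sub>R v)) has_real_derivative
      ((fst v)\<^sup>2 * p1 (y + s *\<^sub>R v) + fst v * snd v * (p2 (y + s *\<^sub>R v) + q1 (y + s *\<^sub>R v)) + (snd v)\<^sup>2 * q2 (y + s *\<^sub>R v))) (at s)"
    using DERIV_add[OF DERIV_cmult[OF 1, of "fst v"] DERIV_cmult[OF 2, of "snd v"]]
    by (simp add: algebra_simps power2_eq_square)
qed

lemma C2s_min:
  assumes C: "C2s V w p q p1 p2 q1 q2" and y: "y \<in> V" and mn: "\<forall>\<^sub>F x in nhds y. w y \<le> w x"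
  shows "p y = 0" "q y = 0" "h\<^sup>2 * p1 y + h * k * (p2 y + q1 y) + k\<^sup>2 * q2 y \<ge> 0"
proof -
  have oV: "open V" using C by (simp add: C2s_def)
  have *: "fst v * p y + snd v * q y = 0 \<and> (fst v)\<^sup>2 * p1 y + fst v * snd v * (p2 y + q1 y) + (snd v)\<^sup>2 * q2 y \<ge> 0" for v
  proof -
    have ev: "\<forall>\<^sub>F s in nhds (0::real). y + s *\<^sub>R v \<in> V" by (rule eventually_line_in_open[OF oV y])
    have 1: "\<forall>\<^sub>F s in nhds 0. ((\<lambda>s. w (y + s *\<^sub>R v)) has_real_derivative (fst v * p (y + s *\<^sub>R v) + snd v * q (y + s *\<^sub>R v))) (at s)"
      using ev by eventually_elim (rule C2s_line(1)[OF C])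
    have 2: "((\<lambda>s. fst v * p (y + s *\<^sub>R v) + snd v * q (y + s *\<^sub>R v)) has_real_derivative
      ((fst v)\<^sup>2 * p1 y + fst v * snd v * (p2 y + q1 y) + (snd v)\<^sup>2 * q2 y)) (at 0)"
      using C2s_line(2)[OF C, of y 0 v] y by simp
    have "((\<lambda>s. y + s *\<^sub>R v) \<longlongrightarrow> y + 0 *\<^sub>R v) (nhds 0)"
      by (intro tendsto_add tendsto_const tendsto_scaleR filterlim_ident)
    then have "filterlim (\<lambda>s. y + s *\<^sub>R v) (nhds y) (nhds 0)" by simp
    from eventually_compose_filterlim[OF mn this]
    have 3: "\<forall>\<^sub>F s in nhds 0. w (y + 0 *\<^sub>R v) \<le> w (y + s *\<^sub>R v)" by simp
    show ?thesis using second_derivative_at_min[OF 1 2 3] by simp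
  qed
  show "p y = 0" "q y = 0" using *[of "(1,0)"] *[of "(0,1)"] by auto
  show "h\<^sup>2 * p1 y + h * k * (p2 y + q1 y) + k\<^sup>2 * q2 y \<ge> 0" using *[of "(h,k)"] by simp
qed

lemma C2s_diff:
  assumes "C2s V w p q p1 p2 q1 q2" "C2s V w' p' q' p1' p2' q1' q2'"
  shows "C2s V (\<lambda>y. w y - c * w' y) (\<lambda>y. p y - c * p' y) (\<lambda>y. q y - c * q' y) (\<lambda>y. p1 y - c * p1' y) (\<lambda>y. p2 y - c * p2' y) (\<lambda>y. q1 y - c * q1' y) (\<lambda>y. q2 y - c * q2' y)"
proof -
  have *: "((\<lambda>y. F y - c * F' y) has_derivative (\<lambda>(h,k). h * (a - c * a') + k * (b - c * b'))) (at y)"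
    if "(F has_derivative (\<lambda>(h,k). h * a + k * b)) (at y)" "(F' has_derivative (\<lambda>(h,k). h * a' + k * b')) (at y)" for F F' :: rfun and a b a' b' y
    by (rule has_derivative_eq_rhs[OF has_derivative_diff[OF that(1) has_derivative_mult_right[OF that(2)]]])
       (auto simp: fun_eq_iff algebra_simps)
  show ?thesis using assms unfolding C2s_def by (auto intro!: *)
qed

text \<open>The coefficient matrix is the identity plus the dyadic square of
  \<open>(Q, - P)\<close>, so the expression is the sum of the values of the quadratic form at
  \<open>(1, 0)\<close>, \<open>(0, 1)\<close> and \<open>(Q, - P)\<close>.\<close>

lemma elliptic_trace_nonneg:
  fixes p1 s q2 P Q :: real
  assumes "\<And>h k. h\<^sup>2 * p1 + h * k * s + k\<^sup>2 * q2 \<ge> 0"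
  shows "(1+Q\<^sup>2) * p1 - P * Q * s + (1+P\<^sup>2) * q2 \<ge> 0"
  using assms[of 1 0] assms[of 0 1] assms[of Q "-P"] by (simp add: algebra_simps)

lemma hopf_barrier:
  fixes c :: "real \<times> real" and \<alpha> \<beta> :: real
  defines "e \<equiv> \<lambda>y. exp (- \<alpha> * ((fst y - fst c)\<^sup>2 + (snd y - snd c)\<^sup>2))"
  shows "C2s UNIV (\<lambda>y. e y - \<beta>) (\<lambda>y. - 2 * \<alpha> * (fst y - fst c) * e y) (\<lambda>y. - 2 * \<alpha> * (snd y - snd c) * e y)
    (\<lambda>y. (4 * \<alpha>\<^sup>2 * (fst y - fst c)\<^sup>2 - 2 * \<alpha>) * e y) (\<lambda>y. 4 * \<alpha>\<^sup>2 * (fst y - fst c) * (snd y - snd c) * e y)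
    (\<lambda>y. 4 * \<alpha>\<^sup>2 * (fst y - fst c) * (snd y - snd c) * e y) (\<lambda>y. (4 * \<alpha>\<^sup>2 * (snd y - snd c)\<^sup>2 - 2 * \<alpha>) * e y)"
proof -
  have de: "(e has_derivative (\<lambda>(h,k). h * (- 2 * \<alpha> * (fst y - fst c) * e y) + k * (- 2 * \<alpha> * (snd y - snd c) * e y))) (at y)" for y
    unfolding e_def by (auto intro!: derivative_eq_intros simp: fun_eq_iff algebra_simps)
  show ?thesis unfolding C2s_def
  proof (intro conjI ballI)
    fix y
    show "((\<lambda>y. e y - \<beta>) has_derivative (\<lambda>(h,k). h * (- 2 * \<alpha> * (fst y - fst c) * e y) + k * (- 2 * \<alpha> * (snd y - snd c) * e y))) (at y)"
      using has_derivative_diff[OF de[of y] has_derivative_const[of \<beta>]] by simp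
    show "((\<lambda>y. - 2 * \<alpha> * (fst y - fst c) * e y) has_derivative (\<lambda>(h, k). h * ((4 * \<alpha>\<^sup>2 * (fst y - fst c)\<^sup>2 - 2 * \<alpha>) * e y) + k * (4 * \<alpha>\<^sup>2 * (fst y - fst c) * (snd y - snd c) * e y))) (at y)"
      by (auto intro!: derivative_eq_intros de[of y] simp: fun_eq_iff algebra_simps power2_eq_square)
    show "((\<lambda>y. - 2 * \<alpha> * (snd y - snd c) * e y) has_derivative (\<lambda>(h, k). h * (4 * \<alpha>\<^sup>2 * (fst y - fst c) * (snd y - snd c) * e y) + k * ((4 * \<alpha>\<^sup>2 * (snd y - snd c)\<^sup>2 - 2 * \<alpha>) * e y))) (at y)"
      by (auto intro!: derivative_eq_intros de[of y] simp: fun_eq_iff algebra_simps power2_eq_square)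
  qed simp
qed

lemma norm_sq_pair: "(fst y - fst c)\<^sup>2 + (snd y - snd c)\<^sup>2 = (dist y c)\<^sup>2" for y c :: "real \<times> real"
  by (simp add: dist_prod_def dist_real_def)

text \<open>Hopf's boundary point lemma. On the annulus between radius \<open>\<rho>/2\<close> and
  \<open>\<rho>\<close> a small multiple of the Gaussian barrier \<open>e - \<beta>\<close> stays
  below \<open>w\<close>: a negative minimum of the difference would be interior, and there the
  differential inequality fails for large \<open>\<alpha>\<close>. The barrier has non-zero inward
  slope at \<open>x0\<close>, so \<open>w\<close> cannot have zero gradient there.\<close>

lemma hopf_lemma:
  assumes C: "C2s V w p q p1 p2 q1 q2" and \<rho>: "\<rho> > 0" "cball c \<rho> \<subseteq> V"
    and K: "K \<ge> 0" and bd: "\<And>y. y \<in> cball c \<rho> \<Longrightarrow> \<bar>P y\<bar> \<le> M \<and> \<bar>Q y\<bar> \<le> M"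
    and ell: "\<And>y. y \<in> cball c \<rho> \<Longrightarrow> (1+(Q y)\<^sup>2) * p1 y - P y * Q y * (p2 y + q1 y) + (1+(P y)\<^sup>2) * q2 y \<le> K * (\<bar>p y\<bar> + \<bar>q y\<bar>)"
    and pos: "\<And>y. y \<in> ball c \<rho> \<Longrightarrow> w y > 0" and x0: "x0 \<in> sphere c \<rho>" "w x0 = 0"
  shows "\<not> (p x0 = 0 \<and> q x0 = 0)"
proof
  assume z: "p x0 = 0 \<and> q x0 = 0"
  have cw: "continuous_on V w"
    using C unfolding C2s_def by (intro continuous_at_imp_continuous_on ballI) (blast intro: has_derivative_continuous)
  \<comment> \<open>On the annulus the leading term
    \<open>4 * \<alpha>\<^sup>2 * (dist y c)\<^sup>2\<close> is at least
    \<open>\<alpha>\<^sup>2 * \<rho>\<^sup>2\<close>. It has to beat the trace term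
    \<open>2 * \<alpha> * (2 + 2 * M\<^sup>2)\<close> and the gradient term
    \<open>4 * \<alpha> * K * \<rho>\<close>; the summand 1 makes this strict.\<close>
  define \<alpha> where "\<alpha> = (2 * (2 + 2 * M\<^sup>2) + 4 * K * \<rho> + 1) / \<rho>\<^sup>2"
  have num: "2 * (2 + 2 * M\<^sup>2) + 4 * K * \<rho> \<ge> 0" using K \<rho> by auto
  have \<alpha>: "\<alpha> > 0" "\<alpha> * \<rho>\<^sup>2 = 2 * (2 + 2 * M\<^sup>2) + 4 * K * \<rho> + 1"
    using \<rho> num by (auto simp: \<alpha>_def intro!: divide_pos_pos add_nonneg_pos)
  define \<beta> where "\<beta> = exp (- \<alpha> * \<rho>\<^sup>2)"
  define e where "e y = exp (- \<alpha> * ((fst y - fst c)\<^sup>2 + (snd y - snd c)\<^sup>2))" for y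
  have ed: "e y = exp (- \<alpha> * (dist y c)\<^sup>2)" for y by (simp add: e_def norm_sq_pair)
  have bar: "C2s UNIV (\<lambda>y. e y - \<beta>) (\<lambda>y. - 2 * \<alpha> * (fst y - fst c) * e y) (\<lambda>y. - 2 * \<alpha> * (snd y - snd c) * e y)
    (\<lambda>y. (4 * \<alpha>\<^sup>2 * (fst y - fst c)\<^sup>2 - 2 * \<alpha>) * e y) (\<lambda>y. 4 * \<alpha>\<^sup>2 * (fst y - fst c) * (snd y - snd c) * e y)
    (\<lambda>y. 4 * \<alpha>\<^sup>2 * (fst y - fst c) * (snd y - snd c) * e y) (\<lambda>y. (4 * \<alpha>\<^sup>2 * (snd y - snd c)\<^sup>2 - 2 * \<alpha>) * e y)"
    unfolding e_def by (rule hopf_barrier)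
  then have barV: "C2s V (\<lambda>y. e y - \<beta>) (\<lambda>y. - 2 * \<alpha> * (fst y - fst c) * e y) (\<lambda>y. - 2 * \<alpha> * (snd y - snd c) * e y)
    (\<lambda>y. (4 * \<alpha>\<^sup>2 * (fst y - fst c)\<^sup>2 - 2 * \<alpha>) * e y) (\<lambda>y. 4 * \<alpha>\<^sup>2 * (fst y - fst c) * (snd y - snd c) * e y)
    (\<lambda>y. 4 * \<alpha>\<^sup>2 * (fst y - fst c) * (snd y - snd c) * e y) (\<lambda>y. (4 * \<alpha>\<^sup>2 * (snd y - snd c)\<^sup>2 - 2 * \<alpha>) * e y)"
    using C unfolding C2s_def by blast
  have ce: "continuous_on UNIV e" unfolding e_def by (intro continuous_intros)
  let ?S = "sphere c (\<rho>/2)"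
  have sne: "?S \<noteq> {}" using \<rho> by simp
  have "compact ?S" by simp
  moreover have "continuous_on ?S w" by (rule continuous_on_subset[OF cw]) (use \<rho> in \<open>auto simp: subset_iff\<close>)
  ultimately obtain y1 where y1: "y1 \<in> ?S" "\<And>y. y \<in> ?S \<Longrightarrow> w y1 \<le> w y"
    using continuous_attains_inf[of ?S w] sne by blast
  define \<epsilon> where "\<epsilon> = w y1"
  have \<epsilon>: "\<epsilon> > 0" unfolding \<epsilon>_def by (rule pos) (use y1 \<rho> in auto)
  have nonneg: "w y \<ge> 0" if "y \<in> cball c \<rho>" for y
  proof (rule ccontr)
    assume n: "\<not> w y \<ge> 0"
    have "y \<in> closure (ball c \<rho>)" using that \<rho> by simp
    then obtain X where X: "\<And>n. X n \<in> ball c \<rho>" "X \<longlonglongrightarrow> y" unfolding closure_sequential by blast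
    have "isCont w y" using cw C that \<rho> unfolding C2s_def by (metis continuous_on_eq_continuous_at subsetD)
    then have "(\<lambda>n. w (X n)) \<longlonglongrightarrow> w y" using X(2) isCont_tendsto_compose by blast
    then have "w y \<ge> 0" by (rule LIMSEQ_le_const) (use X pos less_imp_le in blast)
    then show False using n by simp
  qed
  define A where "A = cball c \<rho> - ball c (\<rho>/2)"
  have cA: "compact A" unfolding A_def by (intro compact_diff) auto
  have AV: "A \<subseteq> V" using \<rho> by (auto simp: A_def)
  define v where "v y = w y - \<epsilon> * (e y - \<beta>)" for y
  have Cv: "C2s V v (\<lambda>y. p y - \<epsilon> * (- 2 * \<alpha> * (fst y - fst c) * e y)) (\<lambda>y. q y - \<epsilon> * (- 2 * \<alpha> * (snd y - snd c) * e y))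
     (\<lambda>y. p1 y - \<epsilon> * ((4 * \<alpha>\<^sup>2 * (fst y - fst c)\<^sup>2 - 2 * \<alpha>) * e y)) (\<lambda>y. p2 y - \<epsilon> * (4 * \<alpha>\<^sup>2 * (fst y - fst c) * (snd y - snd c) * e y))
     (\<lambda>y. q1 y - \<epsilon> * (4 * \<alpha>\<^sup>2 * (fst y - fst c) * (snd y - snd c) * e y)) (\<lambda>y. q2 y - \<epsilon> * ((4 * \<alpha>\<^sup>2 * (snd y - snd c)\<^sup>2 - 2 * \<alpha>) * e y))"
    unfolding v_def[abs_def] by (rule C2s_diff[OF C barV])
  have vA: "v y \<ge> 0" if yA: "y \<in> A" for y
  proof (rule ccontr)
    assume neg: "\<not> v y \<ge> 0"
    have "continuous_on A v" unfolding v_def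
      by (intro continuous_intros continuous_on_subset[OF cw AV] continuous_on_subset[OF ce]) auto
    then obtain y' where y': "y' \<in> A" "\<And>x. x \<in> A \<Longrightarrow> v y' \<le> v x" using continuous_attains_inf[OF cA, of v] yA by blast
    have vneg: "v y' < 0" using y'(2)[OF yA] neg by simp
    have ebeta: "e x \<le> 1" "\<beta> \<ge> 0" for x using \<alpha> by (auto simp: ed \<beta>_def)
    have in1: "dist c y' > \<rho>/2"
    proof (rule ccontr)
      assume "\<not> dist c y' > \<rho>/2"
      then have "y' \<in> ?S" using y' by (auto simp: A_def)
      then have "w y' \<ge> \<epsilon>" using y1 by (simp add: \<epsilon>_def)
      moreover have "\<epsilon> * (e y' - \<beta>) \<le> \<epsilon> * 1" using \<epsilon> ebeta(1)[of y'] ebeta(2) by (intro mult_left_mono) auto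
      ultimately show False using vneg by (simp add: v_def)
    qed
    have in2: "dist c y' < \<rho>"
    proof (rule ccontr)
      assume "\<not> dist c y' < \<rho>"
      then have "dist y' c = \<rho>" using y' by (auto simp: A_def dist_commute)
      then have "v y' = w y'" by (simp add: v_def ed \<beta>_def)
      then show False using nonneg[of y'] vneg y' by (auto simp: A_def)
    qed
    have y'c: "y' \<in> cball c \<rho>" "y' \<in> V" using y' AV by (auto simp: A_def)
    have "open {x. \<rho>/2 < dist c x \<and> dist c x < \<rho>}"
      by (intro open_Collect_conj open_Collect_less continuous_intros)
    then have "\<forall>\<^sub>F x in nhds y'. x \<in> {x. \<rho>/2 < dist c x \<and> dist c x < \<rho>}" using in1 in2 by (intro eventually_nhds_in_open) auto
    then have mn: "\<forall>\<^sub>F x in nhds y'. v y' \<le> v x" by eventually_elim (use y' in \<open>auto simp: A_def\<close>)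
    define d1 where "d1 = fst y' - fst c"
    define d2 where "d2 = snd y' - snd c"
    define E where "E = e y'"
    have E: "E > 0" by (simp add: E_def ed)
    have gr: "p y' = \<epsilon> * (- 2 * \<alpha> * d1 * E)" "q y' = \<epsilon> * (- 2 * \<alpha> * d2 * E)"
      using C2s_min(1,2)[OF Cv y'c(2) mn] by (simp_all add: d1_def d2_def E_def)
    have "(1+(Q y')\<^sup>2) * (p1 y' - \<epsilon> * ((4 * \<alpha>\<^sup>2 * d1\<^sup>2 - 2 * \<alpha>) * E)) - P y' * Q y' * ((p2 y' - \<epsilon> * (4 * \<alpha>\<^sup>2 * d1 * d2 * E)) + (q1 y' - \<epsilon> * (4 * \<alpha>\<^sup>2 * d1 * d2 * E)))
        + (1+(P y')\<^sup>2) * (q2 y' - \<epsilon> * ((4 * \<alpha>\<^sup>2 * d2\<^sup>2 - 2 * \<alpha>) * E)) \<ge> 0"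
      by (rule elliptic_trace_nonneg) (use C2s_min(3)[OF Cv y'c(2) mn] in \<open>simp add: d1_def d2_def E_def\<close>)
    moreover have "(1+(Q y')\<^sup>2) * (p1 y' - \<epsilon> * ((4 * \<alpha>\<^sup>2 * d1\<^sup>2 - 2 * \<alpha>) * E)) - P y' * Q y' * ((p2 y' - \<epsilon> * (4 * \<alpha>\<^sup>2 * d1 * d2 * E)) + (q1 y' - \<epsilon> * (4 * \<alpha>\<^sup>2 * d1 * d2 * E)))
        + (1+(P y')\<^sup>2) * (q2 y' - \<epsilon> * ((4 * \<alpha>\<^sup>2 * d2\<^sup>2 - 2 * \<alpha>) * E))
      = ((1+(Q y')\<^sup>2) * p1 y' - P y' * Q y' * (p2 y' + q1 y') + (1+(P y')\<^sup>2) * q2 y')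
        - \<epsilon> * E * (4 * \<alpha>\<^sup>2 * (d1\<^sup>2 + d2\<^sup>2 + (Q y' * d1 - P y' * d2)\<^sup>2) - 2 * \<alpha> * (2 + (P y')\<^sup>2 + (Q y')\<^sup>2))"
      by (simp add: power2_eq_square algebra_simps)
    ultimately have i1: "\<epsilon> * E * (4 * \<alpha>\<^sup>2 * (d1\<^sup>2 + d2\<^sup>2 + (Q y' * d1 - P y' * d2)\<^sup>2) - 2 * \<alpha> * (2 + (P y')\<^sup>2 + (Q y')\<^sup>2)) \<le> K * (\<bar>p y'\<bar> + \<bar>q y'\<bar>)"
      using ell[OF y'c(1)] by linarith
    have dd: "d1\<^sup>2 + d2\<^sup>2 = (dist y' c)\<^sup>2" by (simp add: d1_def d2_def norm_sq_pair)
    have dge: "d1\<^sup>2 + d2\<^sup>2 \<ge> (\<rho>/2)\<^sup>2" unfolding dd using in1 \<rho> by (intro power_mono) (auto simp: dist_commute)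
    have dle: "\<bar>d1\<bar> \<le> \<rho>" "\<bar>d2\<bar> \<le> \<rho>"
    proof -
      have "d1\<^sup>2 \<le> \<rho>\<^sup>2" "d2\<^sup>2 \<le> \<rho>\<^sup>2"
      proof -
        have "(dist y' c)\<^sup>2 \<le> \<rho>\<^sup>2" using in2 by (intro power_mono) (auto simp: dist_commute)
        then have "d1\<^sup>2 + d2\<^sup>2 \<le> \<rho>\<^sup>2" using dd by simp
        then show "d1\<^sup>2 \<le> \<rho>\<^sup>2" "d2\<^sup>2 \<le> \<rho>\<^sup>2" using zero_le_power2[of d1] zero_le_power2[of d2] by linarith+
      qed
      then show "\<bar>d1\<bar> \<le> \<rho>" "\<bar>d2\<bar> \<le> \<rho>" using \<rho> by (simp_all add: abs_le_square_iff[symmetric])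
    qed
    have "\<bar>p y'\<bar> + \<bar>q y'\<bar> = \<epsilon> * E * (2 * \<alpha> * (\<bar>d1\<bar> + \<bar>d2\<bar>))"
      using \<epsilon> E \<alpha> by (simp add: gr abs_mult algebra_simps)
    also have "\<dots> \<le> \<epsilon> * E * (2 * \<alpha> * (2 * \<rho>))" using \<epsilon> E \<alpha> dle by (intro mult_left_mono) auto
    finally have "K * (\<bar>p y'\<bar> + \<bar>q y'\<bar>) \<le> K * (\<epsilon> * E * (2 * \<alpha> * (2 * \<rho>)))" by (rule mult_left_mono[OF _ K])
    with i1 have "\<epsilon> * E * (4 * \<alpha>\<^sup>2 * (d1\<^sup>2 + d2\<^sup>2 + (Q y' * d1 - P y' * d2)\<^sup>2) - 2 * \<alpha> * (2 + (P y')\<^sup>2 + (Q y')\<^sup>2)) \<le> \<epsilon> * E * (4 * \<alpha> * K * \<rho>)"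
      by (simp add: algebra_simps)
    then have i2: "4 * \<alpha>\<^sup>2 * (d1\<^sup>2 + d2\<^sup>2 + (Q y' * d1 - P y' * d2)\<^sup>2) - 2 * \<alpha> * (2 + (P y')\<^sup>2 + (Q y')\<^sup>2) \<le> 4 * \<alpha> * K * \<rho>"
      using \<epsilon> E by (simp add: mult_le_cancel_left_pos)
    have "(P y')\<^sup>2 \<le> M\<^sup>2" "(Q y')\<^sup>2 \<le> M\<^sup>2" using bd[OF y'c(1)] by (auto simp: abs_le_square_iff[symmetric])
    then have "2 * \<alpha> * (2 + (P y')\<^sup>2 + (Q y')\<^sup>2) \<le> 2 * \<alpha> * (2 + 2 * M\<^sup>2)" using \<alpha> by (intro mult_left_mono) auto
    moreover have "4 * \<alpha>\<^sup>2 * ((\<rho>/2)\<^sup>2) \<le> 4 * \<alpha>\<^sup>2 * (d1\<^sup>2 + d2\<^sup>2 + (Q y' * d1 - P y' * d2)\<^sup>2)"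
      using dge by (intro mult_left_mono) (auto intro: add_increasing2)
    moreover have "4 * \<alpha>\<^sup>2 * ((\<rho>/2)\<^sup>2) = \<alpha> * (\<alpha> * \<rho>\<^sup>2)" by (simp add: power2_eq_square)
    ultimately have "\<alpha> * (\<alpha> * \<rho>\<^sup>2) \<le> \<alpha> * (2 * (2 + 2 * M\<^sup>2) + 4 * K * \<rho>)" using i2 by (simp add: algebra_simps)
    then have "\<alpha> * \<rho>\<^sup>2 \<le> 2 * (2 + 2 * M\<^sup>2) + 4 * K * \<rho>" using \<alpha>(1) by simp
    then show False using \<alpha>(2) by simp
  qed
  have x0V: "x0 \<in> V" using x0 \<rho> by auto
  let ?d = "c - x0"
  have dx: "dist (x0 + s *\<^sub>R ?d) c = (1 - s) * \<rho>" if "0 \<le> s" "s \<le> 1" for s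
  proof -
    have "x0 + s *\<^sub>R ?d - c = (1 - s) *\<^sub>R (x0 - c)" by (simp add: algebra_simps)
    then show ?thesis using x0 that by (simp add: dist_norm norm_minus_commute)
  qed
  have D: "((\<lambda>s. w (x0 + s *\<^sub>R ?d)) has_real_derivative 0) (at 0)"
    using C2s_line(1)[OF C, of x0 0 ?d] x0V z by simp
  have D2: "((\<lambda>s. exp (- \<alpha> * ((1 - s) * \<rho>)\<^sup>2) - \<beta>) has_real_derivative (2 * \<alpha> * \<rho>\<^sup>2 * \<beta>)) (at 0)"
    by (auto intro!: derivative_eq_intros simp: \<beta>_def power2_eq_square algebra_simps)
  \<comment> \<open>Inward from \<open>x0\<close> the derivative of \<open>w\<close> is 0 and that
    of the barrier is positive, so the difference, which vanishes at \<open>x0\<close> and is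
    nonnegative on the annulus, would become negative.\<close>
  have "((\<lambda>s. w (x0 + s *\<^sub>R ?d) - \<epsilon> * (exp (- \<alpha> * ((1 - s) * \<rho>)\<^sup>2) - \<beta>)) has_real_derivative (0 - \<epsilon> * (2 * \<alpha> * \<rho>\<^sup>2 * \<beta>))) (at 0)"
    by (intro DERIV_diff D DERIV_cmult D2)
  moreover have "0 - \<epsilon> * (2 * \<alpha> * \<rho>\<^sup>2 * \<beta>) < 0" using \<epsilon> \<alpha>(1) \<rho> by (auto simp: \<beta>_def)
  ultimately obtain t where t: "t > 0" "\<And>s. 0 < s \<Longrightarrow> s < t \<Longrightarrow>
      w (x0 + s *\<^sub>R ?d) - \<epsilon> * (exp (- \<alpha> * ((1 - s) * \<rho>)\<^sup>2) - \<beta>) < w x0 - \<epsilon> * (exp (- \<alpha> * \<rho>\<^sup>2) - \<beta>)"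
    using has_real_derivative_neg_dec_right[of "\<lambda>s. w (x0 + s *\<^sub>R ?d) - \<epsilon> * (exp (- \<alpha> * ((1 - s) * \<rho>)\<^sup>2) - \<beta>)" "0 - \<epsilon> * (2 * \<alpha> * \<rho>\<^sup>2 * \<beta>)" 0 UNIV] by auto
  define s where "s = min t 1 / 2"
  have s: "0 < s" "s < t" "s \<le> 1/2" using t(1) by (auto simp: s_def)
  have "x0 + s *\<^sub>R ?d \<in> A"
  proof -
    have "dist c (x0 + s *\<^sub>R ?d) = (1 - s) * \<rho>" using dx[of s] s by (simp add: dist_commute)
    moreover have "1/2 * \<rho> \<le> (1 - s) * \<rho>" "(1 - s) * \<rho> \<le> 1 * \<rho>" using s \<rho> by (intro mult_right_mono; simp)+
    ultimately show ?thesis by (simp add: A_def)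
  qed
  from vA[OF this] have "w (x0 + s *\<^sub>R ?d) - \<epsilon> * (exp (- \<alpha> * ((1 - s) * \<rho>)\<^sup>2) - \<beta>) \<ge> 0"
    using dx[of s] s by (simp add: v_def ed)
  then show False using t(2)[OF s(1,2)] x0 by (simp add: \<beta>_def)
qed

text \<open>The coefficients \<open>P\<close>, \<open>Q\<close> are kept apart from the gradient
  \<open>p\<close>, \<open>q\<close>: for the difference of two graphs the former are the gradient
  of the first graph and the latter the gradient of the difference.\<close>

definition ell_loc :: "(real \<times> real) set \<Rightarrow> rfun \<Rightarrow> rfun \<Rightarrow> rfun \<Rightarrow> rfun \<Rightarrow> rfun \<Rightarrow> rfun \<Rightarrow> rfun \<Rightarrow> rfun \<Rightarrow> bool" where
  "ell_loc V P Q p q p1 p2 q1 q2 \<longleftrightarrow> (\<forall>z\<in>V. \<exists>r>0. \<exists>K\<ge>0. \<exists>M. cball z r \<subseteq> V \<and> (\<forall>y\<in>cball z r. \<bar>P y\<bar> \<le> M \<and> \<bar>Q y\<bar> \<le> M \<and>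
     (1+(Q y)\<^sup>2) * p1 y - P y * Q y * (p2 y + q1 y) + (1+(P y)\<^sup>2) * q2 y \<le> K * (\<bar>p y\<bar> + \<bar>q y\<bar>)))"

text \<open>The zero set is closed. If it were not open, some \<open>x\<close> with
  \<open>w x > 0\<close> close to a zero would have a nearest zero \<open>x0\<close>, on the
  boundary of a disk in which \<open>w\<close> is positive. Hopf's lemma then gives a non-zero
  gradient at \<open>x0\<close>, although \<open>w\<close> has a minimum there.\<close>

lemma strong_max_principle:
  assumes C: "C2s V w p q p1 p2 q1 q2" and el: "ell_loc V P Q p q p1 p2 q1 q2" and con: "connected V"
    and nn: "\<And>y. y \<in> V \<Longrightarrow> w y \<ge> 0" and z0: "z0 \<in> V" "w z0 = 0" and y: "y \<in> V"
  shows "w y = 0"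
proof -
  have oV: "open V" using C by (simp add: C2s_def)
  have cw: "continuous_on V w"
    using C unfolding C2s_def by (intro continuous_at_imp_continuous_on ballI) (blast intro: has_derivative_continuous)
  let ?Z = "{y \<in> V. w y = 0}"
  have "open ?Z"
    unfolding open_contains_ball
  proof
    fix z assume z: "z \<in> ?Z"
    then obtain r K M where r: "r > 0" "K \<ge> 0" "cball z r \<subseteq> V" and bd: "\<And>y. y \<in> cball z r \<Longrightarrow> \<bar>P y\<bar> \<le> M \<and> \<bar>Q y\<bar> \<le> M \<and>
     (1+(Q y)\<^sup>2) * p1 y - P y * Q y * (p2 y + q1 y) + (1+(P y)\<^sup>2) * q2 y \<le> K * (\<bar>p y\<bar> + \<bar>q y\<bar>)"
      using el unfolding ell_loc_def by (smt (verit) mem_Collect_eq)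
    \<comment> \<open>Half the radius, so that the disk around \<open>x\<close> up to its nearest
      zero remains in \<open>cball z r\<close>.\<close>
    have "ball z (r/2) \<subseteq> ?Z"
    proof
      fix x assume x: "x \<in> ball z (r/2)"
      have xV: "x \<in> V" by (rule subsetD[OF r(3)]) (use x r(1) in auto)
      show "x \<in> ?Z"
      proof (rule ccontr)
        assume nx: "x \<notin> ?Z"
        let ?T = "{y \<in> cball z r. w y = 0}"
        have "compact ?T"
        proof -
          have "closed {y \<in> cball z r. w y = 0}"
            using continuous_closed_preimage_constant[OF continuous_on_subset[OF cw r(3)], of 0] by simp
          then show ?thesis using compact_Int_closed[of "cball z r" "{y \<in> cball z r. w y = 0}"] by (simp add: Int_def conj_ac cong: conj_cong)
        qed
        moreover have zT: "z \<in> ?T" using z r by auto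
        ultimately obtain x0 where x0: "x0 \<in> ?T" "\<And>y. y \<in> ?T \<Longrightarrow> dist x x0 \<le> dist x y"
          using distance_attains_inf[of ?T x] compact_imp_closed by blast
        define \<rho> where "\<rho> = dist x x0"
        have \<rho>: "\<rho> > 0" using x0 nx xV by (auto simp: \<rho>_def)
        have \<rho>r: "\<rho> < r/2" using x0(2)[OF zT] x by (auto simp: \<rho>_def dist_commute)
        have sub: "cball x \<rho> \<subseteq> cball z r"
        proof
          fix y assume "y \<in> cball x \<rho>"
          then show "y \<in> cball z r" using dist_triangle[of z y x] x \<rho>r by (auto simp: dist_commute)
        qed
        have po: "w y > 0" if "y \<in> ball x \<rho>" for y
        proof (rule ccontr)
          assume "\<not> w y > 0"
          moreover have "y \<in> cball z r" using that sub ball_subset_cball by blast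
          moreover have "w y \<ge> 0" by (rule nn) (use calculation(2) r(3) in blast)
          ultimately have "y \<in> ?T" by simp
          then show False using x0(2)[of y] that by (auto simp: \<rho>_def)
        qed
        have "\<not> (p x0 = 0 \<and> q x0 = 0)"
          by (rule hopf_lemma[OF C \<rho> _ r(2), where P = P and Q = Q and M = M and c = x])
             (use sub r(3) bd po x0 in \<open>auto simp: \<rho>_def subset_iff\<close>)
        moreover have x0V: "x0 \<in> V" using x0 r by auto
        have "\<forall>\<^sub>F y in nhds x0. y \<in> V" using oV x0V by (rule eventually_nhds_in_open)
        then have "\<forall>\<^sub>F y in nhds x0. w x0 \<le> w y" by eventually_elim (use nn x0 in auto)
        then have "p x0 = 0" "q x0 = 0" using C2s_min(1,2)[OF C x0V] by blast+
        ultimately show False by blast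
      qed
    qed
    then show "\<exists>e>0. ball z e \<subseteq> ?Z" using r by (intro exI[of _ "r/2"]) auto
  qed
  then have "openin (top_of_set V) ?Z" by (intro open_openin_trans oV) auto
  moreover have "closedin (top_of_set V) ?Z" using continuous_closedin_preimage_constant[OF cw, of 0] .
  ultimately have "?Z = {} \<or> ?Z = V" using con connected_clopen by blast
  then show ?thesis using z0 y by blast
qed

section \<open>Comparison of two graphs of mean curvature one\<close>

definition graph_sol :: "(real \<times> real) set \<Rightarrow> rfun \<Rightarrow> rfun \<Rightarrow> rfun \<Rightarrow> rfun \<Rightarrow> rfun \<Rightarrow> rfun \<Rightarrow> rfun \<Rightarrow> bool" where
  "graph_sol V u p q p1 p2 q1 q2 \<longleftrightarrow> C2s V u p q p1 p2 q1 q2 \<and>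
    continuous_on V p1 \<and> continuous_on V p2 \<and> continuous_on V q1 \<and> continuous_on V q2 \<and>
    (\<forall>y\<in>V. (1+(q y)\<^sup>2) * p1 y - p y * q y * (p2 y + q1 y) + (1+(p y)\<^sup>2) * q2 y
        = 2 * (1 + (p y)\<^sup>2 + (q y)\<^sup>2) * sqrt (1 + (p y)\<^sup>2 + (q y)\<^sup>2))"

lemma graph_sol_subset: "graph_sol V u p q p1 p2 q1 q2 \<Longrightarrow> open V' \<Longrightarrow> V' \<subseteq> V \<Longrightarrow> graph_sol V' u p q p1 p2 q1 q2"
  unfolding graph_sol_def C2s_def by (auto intro: continuous_on_subset)

text \<open>Subtracting the equations with the coefficients of the first solution leaves products of
  coefficient differences with second derivatives of the second solution, and the difference of the
  right-hand sides. For bounded data all of these are Lipschitz in the gradients. \<open>s\<close>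
  and \<open>s'\<close> stand for sums of two mixed derivatives, hence the bound
  \<open>2 * M\<close>.\<close>

lemma graph_difference_estimate:
  fixes a b a' b' r s t r' s' t' M :: real
  assumes bd: "\<bar>a\<bar> \<le> M" "\<bar>b\<bar> \<le> M" "\<bar>a'\<bar> \<le> M" "\<bar>b'\<bar> \<le> M" "\<bar>r'\<bar> \<le> M" "\<bar>s'\<bar> \<le> 2 * M" "\<bar>t'\<bar> \<le> M"
    and e1: "(1+b\<^sup>2) * r - a * b * s + (1+a\<^sup>2) * t = 2 * (1 + a\<^sup>2 + b\<^sup>2) * sqrt (1 + a\<^sup>2 + b\<^sup>2)"
    and e2: "(1+b'\<^sup>2) * r' - a' * b' * s' + (1+a'\<^sup>2) * t' = 2 * (1 + a'\<^sup>2 + b'\<^sup>2) * sqrt (1 + a'\<^sup>2 + b'\<^sup>2)"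
  shows "(1+b\<^sup>2) * (r - r') - a * b * (s - s') + (1+a\<^sup>2) * (t - t') \<le> (8 * M * (1 + 2 * M\<^sup>2) + 8 * M\<^sup>2) * (\<bar>a - a'\<bar> + \<bar>b - b'\<bar>)"
proof -
  define \<Delta> where "\<Delta> = \<bar>a - a'\<bar> + \<bar>b - b'\<bar>"
  have M: "M \<ge> 0" using bd by linarith
  have \<Delta>: "\<Delta> \<ge> 0" "\<bar>a - a'\<bar> \<le> \<Delta>" "\<bar>b - b'\<bar> \<le> \<Delta>" by (auto simp: \<Delta>_def)
  define X where "X = 1 + a\<^sup>2 + b\<^sup>2"
  define Y where "Y = 1 + a'\<^sup>2 + b'\<^sup>2"
  have sq: "x\<^sup>2 \<le> M\<^sup>2" if "\<bar>x\<bar> \<le> M" for x using that M by (simp add: abs_le_square_iff[symmetric])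
  have XY: "X \<ge> 1" "Y \<ge> 1" "X \<le> 1 + 2 * M\<^sup>2" "Y \<le> 1 + 2 * M\<^sup>2" using sq[OF bd(1)] sq[OF bd(2)] sq[OF bd(3)] sq[OF bd(4)] by (simp_all add: X_def Y_def)
  have dsq: "\<bar>x\<^sup>2 - y\<^sup>2\<bar> \<le> 2 * M * \<bar>x - y\<bar>" if "\<bar>x\<bar> \<le> M" "\<bar>y\<bar> \<le> M" for x y
  proof -
    have "\<bar>x\<^sup>2 - y\<^sup>2\<bar> = \<bar>x + y\<bar> * \<bar>x - y\<bar>" by (simp add: power2_eq_square square_diff_square_factored abs_mult flip: abs_mult)
    also have "\<dots> \<le> (2 * M) * \<bar>x - y\<bar>" using that by (intro mult_right_mono) auto
    finally show ?thesis .
  qed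
  have XmY: "\<bar>X - Y\<bar> \<le> 2 * M * \<Delta>"
  proof -
    have "\<bar>X - Y\<bar> \<le> \<bar>a\<^sup>2 - a'\<^sup>2\<bar> + \<bar>b\<^sup>2 - b'\<^sup>2\<bar>" by (simp add: X_def Y_def)
    also have "\<dots> \<le> 2 * M * \<bar>a - a'\<bar> + 2 * M * \<bar>b - b'\<bar>" using dsq bd by (intro add_mono) auto
    finally show ?thesis by (simp add: \<Delta>_def algebra_simps)
  qed
  have sX: "1 \<le> sqrt X" "1 \<le> sqrt Y" "sqrt X \<le> X" using XY by (auto intro!: real_le_lsqrt simp: self_le_power power2_eq_square)
  have sd: "\<bar>sqrt X - sqrt Y\<bar> \<le> \<bar>X - Y\<bar>"
  proof -
    have "X - Y = (sqrt X - sqrt Y) * (sqrt X + sqrt Y)" using XY by (simp add: algebra_simps)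
    then have "\<bar>X - Y\<bar> = \<bar>sqrt X - sqrt Y\<bar> * (sqrt X + sqrt Y)" using sX by (simp add: abs_mult)
    moreover have "1 \<le> sqrt X + sqrt Y" using sX(1,2) by linarith
    then have "\<bar>sqrt X - sqrt Y\<bar> * 1 \<le> \<bar>sqrt X - sqrt Y\<bar> * (sqrt X + sqrt Y)" by (intro mult_left_mono) auto
    ultimately show ?thesis by simp
  qed
  have cub: "\<bar>X * sqrt X - Y * sqrt Y\<bar> \<le> 2 * (1 + 2 * M\<^sup>2) * (2 * M * \<Delta>)"
  proof -
    have "X * sqrt X - Y * sqrt Y = sqrt X * (X - Y) + Y * (sqrt X - sqrt Y)" by (simp add: algebra_simps)
    then have "\<bar>X * sqrt X - Y * sqrt Y\<bar> \<le> \<bar>sqrt X * (X - Y)\<bar> + \<bar>Y * (sqrt X - sqrt Y)\<bar>" by linarith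
    also have "\<dots> = sqrt X * \<bar>X - Y\<bar> + Y * \<bar>sqrt X - sqrt Y\<bar>" using XY by (simp add: abs_mult)
    also have "\<dots> \<le> (1 + 2 * M\<^sup>2) * (2 * M * \<Delta>) + (1 + 2 * M\<^sup>2) * (2 * M * \<Delta>)"
      using XY sX sd XmY by (intro add_mono mult_mono) auto
    finally show ?thesis by (simp add: algebra_simps)
  qed
  have t1: "\<bar>(b\<^sup>2 - b'\<^sup>2) * r'\<bar> \<le> (2 * M * \<Delta>) * M" "\<bar>(a\<^sup>2 - a'\<^sup>2) * t'\<bar> \<le> (2 * M * \<Delta>) * M"
  proof -
    have "\<bar>b\<^sup>2 - b'\<^sup>2\<bar> \<le> 2 * M * \<Delta>" using dsq[of b b'] bd \<Delta> M by (smt (verit) mult_left_mono)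
    then show "\<bar>(b\<^sup>2 - b'\<^sup>2) * r'\<bar> \<le> (2 * M * \<Delta>) * M" unfolding abs_mult using bd M by (intro mult_mono) auto
    have "\<bar>a\<^sup>2 - a'\<^sup>2\<bar> \<le> 2 * M * \<Delta>" using dsq[of a a'] bd \<Delta> M by (smt (verit) mult_left_mono)
    then show "\<bar>(a\<^sup>2 - a'\<^sup>2) * t'\<bar> \<le> (2 * M * \<Delta>) * M" unfolding abs_mult using bd M by (intro mult_mono) auto
  qed
  have t2: "\<bar>(a * b - a' * b') * s'\<bar> \<le> (2 * M * \<Delta>) * (2 * M)"
  proof -
    have "a * b - a' * b' = a * (b - b') + (a - a') * b'" by (simp add: algebra_simps)
    then have "\<bar>a * b - a' * b'\<bar> \<le> \<bar>a\<bar> * \<bar>b - b'\<bar> + \<bar>a - a'\<bar> * \<bar>b'\<bar>" by (metis abs_mult abs_triangle_ineq)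
    also have "\<dots> \<le> M * \<Delta> + \<Delta> * M"
      by (intro add_mono mult_mono bd \<Delta> M abs_ge_zero)
    finally have "\<bar>a * b - a' * b'\<bar> \<le> 2 * M * \<Delta>" by simp
    then show ?thesis unfolding abs_mult using bd M by (intro mult_mono) auto
  qed
  have "(1+b\<^sup>2) * (r - r') - a * b * (s - s') + (1+a\<^sup>2) * (t - t')
     = ((1+b\<^sup>2) * r - a * b * s + (1+a\<^sup>2) * t) - ((1+b'\<^sup>2) * r' - a' * b' * s' + (1+a'\<^sup>2) * t')
       - ((b\<^sup>2 - b'\<^sup>2) * r' - (a * b - a' * b') * s' + (a\<^sup>2 - a'\<^sup>2) * t')" by (simp add: algebra_simps)
  also have "\<dots> = 2 * (X * sqrt X - Y * sqrt Y) - ((b\<^sup>2 - b'\<^sup>2) * r' - (a * b - a' * b') * s' + (a\<^sup>2 - a'\<^sup>2) * t')"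
    unfolding e1 e2 X_def[symmetric] Y_def[symmetric] by simp
  also have "\<dots> \<le> 2 * (2 * (1 + 2 * M\<^sup>2) * (2 * M * \<Delta>)) + ((2 * M * \<Delta>) * M + (2 * M * \<Delta>) * (2 * M) + (2 * M * \<Delta>) * M)"
  proof -
    have *: "2 * A - (B - C + D) \<le> 2 * a1 + (b1 + c1 + d1)" if "\<bar>A\<bar> \<le> a1" "\<bar>B\<bar> \<le> b1" "\<bar>C\<bar> \<le> c1" "\<bar>D\<bar> \<le> d1" for A B C D a1 b1 c1 d1 :: real
      using that by linarith
    show ?thesis by (rule *[OF cub t1(1) t2 t1(2)])
  qed
  also have "\<dots> = (8 * M * (1 + 2 * M\<^sup>2) + 8 * M\<^sup>2) * \<Delta>" by (simp add: algebra_simps power2_eq_square)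
  finally show ?thesis by (simp add: \<Delta>_def)
qed

lemma nonneg_sum8_bounds:
  fixes a b c d e f g h M :: real
  assumes "0 \<le> a" "0 \<le> b" "0 \<le> c" "0 \<le> d" "0 \<le> e" "0 \<le> f" "0 \<le> g" "0 \<le> h" "a + b + c + d + e + f + g + h \<le> M"
  shows "a \<le> M" "b \<le> M" "c \<le> M" "d \<le> M" "e \<le> M" "f + g \<le> 2 * M" "h \<le> M"
  using assms by linarith+

lemma graph_sol_ell_loc:
  assumes g1: "graph_sol V u p q p1 p2 q1 q2" and g2: "graph_sol V u' p' q' p1' p2' q1' q2'"
  shows "ell_loc V p q (\<lambda>y. p y - 1 * p' y) (\<lambda>y. q y - 1 * q' y) (\<lambda>y. p1 y - 1 * p1' y) (\<lambda>y. p2 y - 1 * p2' y) (\<lambda>y. q1 y - 1 * q1' y) (\<lambda>y. q2 y - 1 * q2' y)"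
  unfolding ell_loc_def
proof
  fix z assume z: "z \<in> V"
  have oV: "open V" using g1 by (simp add: graph_sol_def C2s_def)
  obtain r where r: "r > 0" "cball z r \<subseteq> V" using oV z open_contains_cball by blast
  have cont: "continuous_on V p" "continuous_on V q" "continuous_on V p'" "continuous_on V q'"
    using g1 g2 unfolding graph_sol_def C2s_def
    by (intro continuous_at_imp_continuous_on ballI; blast intro: has_derivative_continuous)+
  have cont2: "continuous_on V p1'" "continuous_on V p2'" "continuous_on V q1'" "continuous_on V q2'"
    using g2 unfolding graph_sol_def by auto
  have bdd: "\<exists>M. \<forall>y\<in>cball z r. \<bar>F y\<bar> \<le> M" if "continuous_on V F" for F :: rfun
  proof -
    have "compact (F ` cball z r)" by (intro compact_continuous_image continuous_on_subset[OF that r(2)]) auto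
    from compact_imp_bounded[OF this] obtain M where "\<And>z'. z' \<in> F ` cball z r \<Longrightarrow> norm z' \<le> M" unfolding bounded_iff by blast
    then show ?thesis by (intro exI[of _ M]) force
  qed
  have "continuous_on V (\<lambda>y. \<bar>p y\<bar> + \<bar>q y\<bar> + \<bar>p' y\<bar> + \<bar>q' y\<bar> + \<bar>p1' y\<bar> + \<bar>p2' y\<bar> + \<bar>q1' y\<bar> + \<bar>q2' y\<bar>)"
    by (intro continuous_intros cont cont2)
  from bdd[OF this] obtain M where M: "\<And>y. y \<in> cball z r \<Longrightarrow> \<bar>p y\<bar> + \<bar>q y\<bar> + \<bar>p' y\<bar> + \<bar>q' y\<bar> + \<bar>p1' y\<bar> + \<bar>p2' y\<bar> + \<bar>q1' y\<bar> + \<bar>q2' y\<bar> \<le> M"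
    by fastforce
  have M0: "M \<ge> 0" using M[of z] r by simp
  have K0: "0 \<le> 8 * M * (1 + 2 * M\<^sup>2) + 8 * M\<^sup>2" using M0 by auto
  show "\<exists>r>0. \<exists>K\<ge>0. \<exists>M. cball z r \<subseteq> V \<and> (\<forall>y\<in>cball z r. \<bar>p y\<bar> \<le> M \<and> \<bar>q y\<bar> \<le> M \<and>
     (1+(q y)\<^sup>2) * (p1 y - 1 * p1' y) - p y * q y * ((p2 y - 1 * p2' y) + (q1 y - 1 * q1' y)) + (1+(p y)\<^sup>2) * (q2 y - 1 * q2' y) \<le> K * (\<bar>p y - 1 * p' y\<bar> + \<bar>q y - 1 * q' y\<bar>))"
  proof (rule exI[of _ r], rule conjI[OF r(1)], rule exI[of _ "8 * M * (1 + 2 * M\<^sup>2) + 8 * M\<^sup>2"], rule conjI[OF K0],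
      rule exI[of _ M], rule conjI[OF r(2)], rule ballI, intro conjI)
    fix y assume y: "y \<in> cball z r"
    note bM = nonneg_sum8_bounds[OF abs_ge_zero abs_ge_zero abs_ge_zero abs_ge_zero abs_ge_zero abs_ge_zero abs_ge_zero abs_ge_zero M[OF y]]
    show "\<bar>p y\<bar> \<le> M" "\<bar>q y\<bar> \<le> M" by (rule bM)+
    have yV: "y \<in> V" using y r by auto
    have "(1+(q y)\<^sup>2) * (p1 y - p1' y) - p y * q y * ((p2 y + q1 y) - (p2' y + q1' y)) + (1+(p y)\<^sup>2) * (q2 y - q2' y) \<le> (8 * M * (1 + 2 * M\<^sup>2) + 8 * M\<^sup>2) * (\<bar>p y - p' y\<bar> + \<bar>q y - q' y\<bar>)"
    proof (rule graph_difference_estimate)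
      show "\<bar>p2' y + q1' y\<bar> \<le> 2 * M" by (rule order_trans[OF abs_triangle_ineq bM(6)])
    qed (use g1 g2 yV bM in \<open>simp_all add: graph_sol_def\<close>)
    then show "(1+(q y)\<^sup>2) * (p1 y - 1 * p1' y) - p y * q y * ((p2 y - 1 * p2' y) + (q1 y - 1 * q1' y)) + (1+(p y)\<^sup>2) * (q2 y - 1 * q2' y) \<le> (8 * M * (1 + 2 * M\<^sup>2) + 8 * M\<^sup>2) * (\<bar>p y - 1 * p' y\<bar> + \<bar>q y - 1 * q' y\<bar>)"
      by (simp only: mult_1 add_diff_add)
  qed
qed

lemma graph_strong_comparison:
  assumes g1: "graph_sol V u p q p1 p2 q1 q2" and g2: "graph_sol V u' p' q' p1' p2' q1' q2'"
    and "connected V" "\<And>y. y \<in> V \<Longrightarrow> u' y \<le> u y" "z0 \<in> V" "u z0 = u' z0" "y \<in> V"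
  shows "u y = u' y"
proof -
  have "u y - 1 * u' y = 0"
    by (rule strong_max_principle[OF C2s_diff graph_sol_ell_loc[OF g1 g2]]) (use assms in \<open>auto simp: graph_sol_def\<close>)
  then show ?thesis by simp
qed

text \<open>The strict order is known only on a half disk with \<open>x0\<close> on its straight
  edge. The disk of radius \<open>s\<close> around \<open>x0 + s *\<^sub>R n\<close> lies on that
  side and touches the edge at \<open>x0\<close>, so Hopf's lemma applies. Both solutions live on a
  full neighbourhood of \<open>x0\<close>, which bounds the coefficients up to the edge.\<close>

lemma graph_hopf_comparison:
  assumes g1: "graph_sol V u p q p1 p2 q1 q2" and g2: "graph_sol V u' p' q' p1' p2' q1' q2'"
    and x0: "x0 \<in> V" "u x0 = u' x0" "p x0 = p' x0" "q x0 = q' x0"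
    and n: "norm n = 1" and \<rho>: "\<rho> > 0" and pos: "\<And>y. y \<in> V \<Longrightarrow> dist y x0 < \<rho> \<Longrightarrow> (y - x0) \<bullet> n > 0 \<Longrightarrow> u y > u' y"
  shows False
proof -
  obtain r K M where r: "r > 0" "K \<ge> 0" "cball x0 r \<subseteq> V" and bd: "\<And>y. y \<in> cball x0 r \<Longrightarrow> \<bar>p y\<bar> \<le> M \<and> \<bar>q y\<bar> \<le> M \<and>
     (1+(q y)\<^sup>2) * (p1 y - 1 * p1' y) - p y * q y * ((p2 y - 1 * p2' y) + (q1 y - 1 * q1' y)) + (1+(p y)\<^sup>2) * (q2 y - 1 * q2' y) \<le> K * (\<bar>p y - 1 * p' y\<bar> + \<bar>q y - 1 * q' y\<bar>)"
    using graph_sol_ell_loc[OF g1 g2] x0(1) unfolding ell_loc_def by meson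
  define s where "s = min r \<rho> / 3"
  have s: "s > 0" "2 * s < r" "2 * s < \<rho>" using r \<rho> by (auto simp: s_def)
  define c where "c = x0 + s *\<^sub>R n"
  have dc: "dist c x0 = s" using n s by (simp add: c_def dist_norm)
  have sub: "dist y x0 \<le> 2 * s" if "y \<in> cball c s" for y
    using dist_triangle[of y x0 c] that dc by (auto simp: dist_commute)
  have Cd: "C2s V (\<lambda>y. u y - 1 * u' y) (\<lambda>y. p y - 1 * p' y) (\<lambda>y. q y - 1 * q' y) (\<lambda>y. p1 y - 1 * p1' y) (\<lambda>y. p2 y - 1 * p2' y) (\<lambda>y. q1 y - 1 * q1' y) (\<lambda>y. q2 y - 1 * q2' y)"
    using g1 g2 by (intro C2s_diff) (auto simp: graph_sol_def)
  have inr: "y \<in> cball x0 r" if "y \<in> cball c s" for y using sub[OF that] s by (simp add: dist_commute)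
  have "\<not> (p x0 - 1 * p' x0 = 0 \<and> q x0 - 1 * q' x0 = 0)"
  proof (rule hopf_lemma[OF Cd s(1) _ r(2), where P = p and Q = q and M = M and c = c])
    show "cball c s \<subseteq> V" using inr r by blast
    show "\<bar>p y\<bar> \<le> M \<and> \<bar>q y\<bar> \<le> M" if "y \<in> cball c s" for y using bd[OF inr[OF that]] by blast
    show "(1+(q y)\<^sup>2) * (p1 y - 1 * p1' y) - p y * q y * ((p2 y - 1 * p2' y) + (q1 y - 1 * q1' y)) + (1+(p y)\<^sup>2) * (q2 y - 1 * q2' y) \<le> K * (\<bar>p y - 1 * p' y\<bar> + \<bar>q y - 1 * q' y\<bar>)"
      if "y \<in> cball c s" for y using bd[OF inr[OF that]] by blast
    show "x0 \<in> sphere c s" using dc by simp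
    show "u x0 - 1 * u' x0 = 0" using x0 by simp
    fix y assume y: "y \<in> ball c s"
    then have yc: "y \<in> cball c s" by auto
    have "norm (y - x0 - s *\<^sub>R n) < s" using y by (simp add: c_def dist_norm norm_minus_commute algebra_simps)
    then have "\<bar>(y - x0 - s *\<^sub>R n) \<bullet> n\<bar> < s" using Cauchy_Schwarz_ineq2[of "y - x0 - s *\<^sub>R n" n] n by simp
    moreover have "n \<bullet> n = 1" using n by (simp add: norm_eq_1)
    ultimately have "(y - x0) \<bullet> n > 0" by (simp add: inner_diff_left)
    moreover have "dist y x0 < \<rho>" using sub[OF yc] s by simp
    ultimately show "u y - 1 * u' y > 0" using pos[of y] inr[OF yc] r by auto
  qed
  then show False using x0 by simp
qed

section \<open>Alexandrov reflection of a compact cap\<close>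

definition rlin :: "real^3 \<Rightarrow> real^3 \<Rightarrow> real^3" where "rlin e x = x - (2 * (x \<bullet> e)) *\<^sub>R e"
definition refl_plane :: "real^3 \<Rightarrow> real \<Rightarrow> real^3 \<Rightarrow> real^3" where "refl_plane e t x = x - (2 * (x \<bullet> e - t)) *\<^sub>R e"

lemma rlin_inner: "e \<bullet> e = 1 \<Longrightarrow> rlin e x \<bullet> rlin e y = x \<bullet> y"
  by (simp add: rlin_def inner_diff_left inner_diff_right algebra_simps inner_commute)

lemma rlin_add: "rlin e (x + y) = rlin e x + rlin e y" and rlin_scale: "rlin e (c *\<^sub>R x) = c *\<^sub>R rlin e x"
  by (simp_all add: rlin_def inner_add_left algebra_simps)

lemma bounded_linear_rlin: "bounded_linear (rlin e)"
  unfolding linear_conv_bounded_linear[symmetric] by (rule linearI) (simp_all add: rlin_add rlin_scale)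

lemma refl_plane_eq: "refl_plane e t x = rlin e x + (2 * t) *\<^sub>R e"
  by (simp add: refl_plane_def rlin_def algebra_simps)

lemma refl_plane_height: "e \<bullet> e = 1 \<Longrightarrow> refl_plane e t x \<bullet> e = 2 * t - x \<bullet> e"
  by (simp add: refl_plane_def inner_diff_left)

lemma refl_plane_invol: "e \<bullet> e = 1 \<Longrightarrow> refl_plane e t (refl_plane e t x) = x"
  using refl_plane_height[of e t x] by (simp add: refl_plane_def[of e t "refl_plane e t x"]) (simp add: refl_plane_def algebra_simps)

lemma refl_plane_fix: "x \<bullet> e = t \<Longrightarrow> refl_plane e t x = x"
  by (simp add: refl_plane_def)

lemma continuous_refl_plane: "continuous_on A F \<Longrightarrow> continuous_on A (\<lambda>x. refl_plane e t (F x))"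
  unfolding refl_plane_def by (intro continuous_intros)

text \<open>A reflection is an isometry and preserves every inner product in the locale. It reverses
  orientation, but \<open>nu\<close> is determined by orthogonality and the curvature equation and
  not by a cross product, so the mean curvature is again +1 for the reflected normal.\<close>

lemma csurf_refl_plane:
  assumes "csurf f fu fv fuu fuv fvv nu nuu nuv" and e: "e \<bullet> e = 1"
  shows "csurf (\<lambda>x. refl_plane e t (f x)) (\<lambda>x. rlin e (fu x)) (\<lambda>x. rlin e (fv x)) (\<lambda>x. rlin e (fuu x)) (\<lambda>x. rlin e (fuv x)) (\<lambda>x. rlin e (fvv x))
    (\<lambda>x. rlin e (nu x)) (\<lambda>x. rlin e (nuu x)) (\<lambda>x. rlin e (nuv x))"
proof -
  interpret csurf f fu fv fuu fuv fvv nu nuu nuv by fact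
  have d: "((\<lambda>x. rlin e (F x)) has_derivative (\<lambda>(a,b). a *\<^sub>R rlin e A + b *\<^sub>R rlin e B)) (at x)"
    if "(F has_derivative (\<lambda>(a,b). a *\<^sub>R A + b *\<^sub>R B)) (at x)" for F :: "real \<times> real \<Rightarrow> real^3" and A B x
    by (rule has_derivative_eq_rhs[OF bounded_linear.has_derivative[OF bounded_linear_rlin that]])
       (auto simp: fun_eq_iff rlin_add rlin_scale)
  have c: "continuous_on T (\<lambda>x. rlin e (F x))" if "continuous_on T F" for F :: "real \<times> real \<Rightarrow> real^3" and T
    unfolding rlin_def by (intro continuous_intros that)
  show ?thesis
  proof
    fix x :: "real \<times> real" assume x: "x \<in> ball 0 1"
    show "((\<lambda>x. refl_plane e t (f x)) has_derivative (\<lambda>(a, b). a *\<^sub>R rlin e (fu x) + b *\<^sub>R rlin e (fv x))) (at x)"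
      unfolding refl_plane_eq
      using has_derivative_add[OF d[OF df[OF x]] has_derivative_const[of "(2 * t) *\<^sub>R e"]] by simp
    show "((\<lambda>x. rlin e (fu x)) has_derivative (\<lambda>(a, b). a *\<^sub>R rlin e (fuu x) + b *\<^sub>R rlin e (fuv x))) (at x)" by (rule d[OF dfu[OF x]])
    show "((\<lambda>x. rlin e (fv x)) has_derivative (\<lambda>(a, b). a *\<^sub>R rlin e (fuv x) + b *\<^sub>R rlin e (fvv x))) (at x)" by (rule d[OF dfv[OF x]])
    show "0 < rlin e (fu x) \<bullet> rlin e (fu x) * (rlin e (fv x) \<bullet> rlin e (fv x)) - (rlin e (fu x) \<bullet> rlin e (fv x))\<^sup>2"
      using ind[OF x] by (simp only: rlin_inner[OF e])
    show "rlin e (fu x) \<bullet> rlin e (fu x) * (rlin e (fvv x) \<bullet> rlin e (nu x)) - 2 * (rlin e (fu x) \<bullet> rlin e (fv x)) * (rlin e (fuv x) \<bullet> rlin e (nu x)) +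
         rlin e (fv x) \<bullet> rlin e (fv x) * (rlin e (fuu x) \<bullet> rlin e (nu x)) =
         2 * (rlin e (fu x) \<bullet> rlin e (fu x) * (rlin e (fv x) \<bullet> rlin e (fv x)) - (rlin e (fu x) \<bullet> rlin e (fv x))\<^sup>2)"
      using mc[OF x] by (simp only: rlin_inner[OF e])
    show "((\<lambda>x. rlin e (nu x)) has_derivative (\<lambda>(a, b). a *\<^sub>R rlin e (nuu x) + b *\<^sub>R rlin e (nuv x))) (at x)" by (rule d[OF dnu[OF x]])
  next
    show "continuous_on (cball 0 1) (\<lambda>x. refl_plane e t (f x))" by (rule continuous_refl_plane[OF cf])
    show "inj_on (\<lambda>x. refl_plane e t (f x)) (cball 0 1)"
      using injf refl_plane_invol[OF e] unfolding inj_on_def by metis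
  qed (simp_all add: rlin_inner[OF e] nun nufu nufv c cuu cuv cvv cnu cnv)
qed

context csurf
begin

lemma good_D:
  assumes "good_def_fn G x0 \<epsilon> \<phi> gr" "y \<in> ball (f x0) \<epsilon>"
  shows "(\<phi> has_derivative (\<lambda>k. gr y \<bullet> k)) (at y)" "gr y \<bullet> nu x0 > 1/2" "\<phi> y = 0 \<longleftrightarrow> y \<in> f ` G"
  using assms unfolding good_def_fn_def by blast+

text \<open>The tangent plane is orthogonal to \<open>e\<close>, so \<open>nu x\<close> is
  \<open>e\<close> or \<open>- e\<close>. At a maximum all second derivatives of the height are
  nonpositive, whereas the trace of the second derivatives along \<open>nu x\<close> is 2; this
  excludes \<open>nu x = e\<close>.\<close>

lemma local_extremum_normal:
  assumes x: "x \<in> ball 0 1" and e: "e \<bullet> e = 1" and mx: "\<forall>\<^sub>F y in nhds x. f y \<bullet> e \<le> f x \<bullet> e"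
  shows "nu x = - e"
proof -
  have d1: "((\<lambda>y. f y \<bullet> e) has_derivative (\<lambda>h. (case h of (a,b) \<Rightarrow> a *\<^sub>R fu x + b *\<^sub>R fv x) \<bullet> e)) (at x)"
    by (rule has_derivative_inner_left[OF df[OF x]])
  have "(\<lambda>h. (case h of (a,b) \<Rightarrow> a *\<^sub>R fu x + b *\<^sub>R fv x) \<bullet> e) = (\<lambda>h. 0)"
    by (rule has_derivative_local_max[OF d1]) (use mx in \<open>auto simp: eventually_nhds_conv_at\<close>)
  from fun_cong[OF this, of "(1,0)"] fun_cong[OF this, of "(0,1)"]
  have "e \<bullet> fu x = 0" "e \<bullet> fv x = 0" by (simp_all add: inner_commute)
  then have en: "e = (e \<bullet> nu x) *\<^sub>R nu x" by (rule normal_multiple[OF x])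
  then have "e \<bullet> e = (e \<bullet> nu x) * (nu x \<bullet> e)" by (metis inner_scaleR_left)
  then have sq: "(e \<bullet> nu x)\<^sup>2 = 1" using e by (simp add: power2_eq_square inner_commute)
  have II: "II x v \<bullet> e \<le> 0" for v
  proof -
    have ev: "\<forall>\<^sub>F s in nhds (0::real). x + s *\<^sub>R v \<in> ball 0 1" using eventually_line_in_open[OF open_ball x] .
    have g1: "\<forall>\<^sub>F s in nhds 0. ((\<lambda>s. - (f (x + s *\<^sub>R v) \<bullet> e)) has_real_derivative (- (Dv (x + s *\<^sub>R v) v \<bullet> e))) (at s)"
      using ev
    proof eventually_elim
      case (elim s)
      have "((\<lambda>s. f (x + s *\<^sub>R v) \<bullet> e) has_real_derivative (Dv (x + s *\<^sub>R v) v \<bullet> e)) (at s)"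
        using bounded_linear.has_vector_derivative[OF bounded_linear_inner_left curve_deriv[OF elim]]
        by (simp add: has_real_derivative_iff_has_vector_derivative)
      then show ?case by (rule DERIV_minus)
    qed
    have "((\<lambda>s. Dv (x + s *\<^sub>R v) v \<bullet> e) has_real_derivative (II x v \<bullet> e)) (at 0)"
      using bounded_linear.has_vector_derivative[OF bounded_linear_inner_left curve_deriv2[of x 0 v]] x
      by (simp add: has_real_derivative_iff_has_vector_derivative)
    then have g2: "((\<lambda>s. - (Dv (x + s *\<^sub>R v) v \<bullet> e)) has_real_derivative (- (II x v \<bullet> e))) (at 0)" by (rule DERIV_minus)
    have "((\<lambda>s. x + s *\<^sub>R v) \<longlongrightarrow> x + 0 *\<^sub>R v) (nhds 0)"
      by (intro tendsto_add tendsto_const tendsto_scaleR filterlim_ident)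
    then have lim: "filterlim (\<lambda>s. x + s *\<^sub>R v) (nhds x) (nhds 0)" by simp
    have g3: "\<forall>\<^sub>F s in nhds 0. - (f (x + 0 *\<^sub>R v) \<bullet> e) \<le> - (f (x + s *\<^sub>R v) \<bullet> e)"
      using eventually_compose_filterlim[OF mx lim] by simp
    show ?thesis using second_derivative_at_min(2)[OF g1 g2 g3] by simp
  qed
  obtain a b where fr: "orthoframe a b (nu x)" using orthoframe_exists nun[OF x] by blast
  obtain v w where vw: "Dv x v = a" "Dv x w = b" using tangent_frame[OF x fr] .
  have tr: "II x v \<bullet> nu x + II x w \<bullet> nu x = 2" by (rule II_trace[OF x]) (use fr in \<open>auto simp: vw orthoframe_def\<close>)
  have "e \<bullet> nu x \<noteq> 1"
  proof
    assume "e \<bullet> nu x = 1"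
    then have "nu x = e" using en by simp
    then show False using tr II[of v] II[of w] by simp
  qed
  then have "e \<bullet> nu x = -1" using sq by (simp add: power2_eq_1_iff)
  then show ?thesis using en by simp
qed

end

section \<open>A cap over its base plane and the region inside it\<close>

locale cap = csurf +
  fixes \<Omega> :: "(real \<times> real) set" and e :: "real^3" and h :: real and xt :: "real \<times> real"
  assumes e1: "e \<bullet> e = 1" and oO: "open \<Omega>" and conO: "connected \<Omega>" and clO: "closure \<Omega> \<subseteq> ball 0 1"
    and zpos: "\<And>x. x \<in> \<Omega> \<Longrightarrow> f x \<bullet> e > 0" and zfr: "\<And>x. x \<in> frontier \<Omega> \<Longrightarrow> f x \<bullet> e = 0"
    and xt: "xt \<in> \<Omega>" "f xt \<bullet> e = h" and hmax: "\<And>x. x \<in> \<Omega> \<Longrightarrow> f x \<bullet> e \<le> h"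
begin

abbreviation z where "z x \<equiv> f x \<bullet> e"
abbreviation "S \<equiv> f ` \<Omega>"
definition "U = {y. y \<bullet> e > 0}"

lemma Ob: "x \<in> \<Omega> \<Longrightarrow> x \<in> ball 0 1" and Obs: "\<Omega> \<subseteq> ball 0 1" using clO closure_subset by blast+

lemma closure_pos: "x \<in> closure \<Omega> \<Longrightarrow> z x > 0 \<Longrightarrow> x \<in> \<Omega>"
  using zfr[of x] oO by (auto simp: frontier_def interior_open)

lemma compact_cl: "compact (closure \<Omega>)"
  using bounded_subset[OF bounded_ball Obs] by (simp add: compact_closure)

lemma cfO: "continuous_on (closure \<Omega>) f" using cf clO ball_subset_cball by (meson continuous_on_subset order_trans)

lemma openU: "open U" unfolding U_def by (intro open_Collect_less continuous_intros)
lemma convU: "convex U"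
  using convex_halfspace_gt[of 0 e] by (simp add: U_def inner_commute)

lemma SU: "S \<subseteq> U" using zpos by (auto simp: U_def)

lemma S_eq: "S = f ` closure \<Omega> \<inter> U"
  using closure_subset zpos closure_pos by (fastforce simp: U_def)

lemma closedS: "closedin (top_of_set U) S"
proof -
  have "closed (f ` closure \<Omega>)" by (intro compact_imp_closed compact_continuous_image cfO compact_cl)
  then show ?thesis unfolding S_eq by (simp add: closedin_closed_Int Int_commute)
qed

lemma isCont_f: "x \<in> ball 0 1 \<Longrightarrow> isCont f x" using df has_derivative_continuous by blast
lemma isCont_nu: "x \<in> ball 0 1 \<Longrightarrow> isCont nu x" using dnu has_derivative_continuous by blast

text \<open>The edge of the cap lies in the base plane, so the cap is closed in the open half-space
  \<open>U\<close>. As \<open>U\<close> is contractible, the circle-valued collar function has a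
  real lift on all of \<open>U\<close>. The lift is constant on the connected cap, and the set where
  it exceeds this constant is the inside, the side into which \<open>nu\<close> points. This takes
  the place of a separation theorem.\<close>

lemma inside_exists:
  "\<exists>W. open W \<and> W \<subseteq> U \<and> W \<inter> S = {} \<and> closedin (top_of_set U) (W \<union> S) \<and>
    (\<forall>x0\<in>\<Omega>. \<exists>\<epsilon> \<phi> gr. good_def_fn \<Omega> x0 \<epsilon> \<phi> gr \<and> ball (f x0) \<epsilon> \<subseteq> U \<and> (\<forall>y\<in>ball (f x0) \<epsilon>. \<phi> y > 0 \<longleftrightarrow> y \<in> W))"
proof -
  obtain g where col: "collar \<Omega> U g" by (rule collar_exists[OF oO Obs openU SU closedS])
  have cg: "continuous_on U g" and ng: "\<And>y. y \<in> U \<Longrightarrow> norm (g y) = 1" and gS: "\<And>y. y \<in> U \<Longrightarrow> g y = 1 \<longleftrightarrow> y \<in> S"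
    using col unfolding collar_def by blast+
  obtain H :: "real^3 \<Rightarrow> real" where H: "continuous_on U H" "\<And>y. y \<in> U \<Longrightarrow> g y = cis (H y)"
    by (rule circle_lift[OF cg convex_imp_contractible[OF convU] ng]) (assumption | rule that)+
  have cHf: "continuous_on \<Omega> (\<lambda>x. H (f x))"
    by (rule continuous_on_compose2[OF H(1) continuous_on_subset[OF cfO closure_subset]]) (use SU in auto)
  have one: "cis (H (f x)) = cis 0" if "x \<in> \<Omega>" for x
    using H(2)[of "f x"] gS[of "f x"] SU that by (metis cis_zero imageI subsetD)
  obtain m :: int where m: "\<And>x. x \<in> \<Omega> \<Longrightarrow> H (f x) - 0 = 2 * pi * of_int m"
    by (rule constant_integer_difference[OF conO cHf continuous_on_const one]) (assumption | rule that)+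
  define c where "c = 2 * pi * of_int m"
  have Hc: "H y = c \<longleftrightarrow> y \<in> S" if "y \<in> U" for y
  proof
    assume "H y = c"
    then have "g y = 1" using H(2)[OF that] unfolding c_def by (simp add: cis_multiple_2pi)
    then show "y \<in> S" using gS that by blast
  qed (use m in \<open>auto simp: c_def\<close>)
  define W where "W = {y \<in> U. H y > c}"
  have Weq: "W = U \<inter> H -` {c<..}" by (auto simp: W_def)
  have oW: "open W" unfolding Weq by (rule continuous_open_preimage[OF H(1) openU]) simp
  have WSeq: "W \<union> S = U \<inter> H -` {c..}"
  proof -
    have "y \<in> W \<union> S \<longleftrightarrow> y \<in> U \<inter> H -` {c..}" for y
      using Hc[of y] SU by (auto simp: W_def less_le)
    then show ?thesis by blast
  qed
  have "closedin (top_of_set U) (W \<union> S)" unfolding WSeq by (rule continuous_closedin_preimage[OF H(1)]) simp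
  moreover have "W \<inter> S = {}" using Hc SU by (auto simp: W_def)
  moreover have "\<exists>\<epsilon> \<phi> gr. good_def_fn \<Omega> x0 \<epsilon> \<phi> gr \<and> ball (f x0) \<epsilon> \<subseteq> U \<and> (\<forall>y\<in>ball (f x0) \<epsilon>. \<phi> y > 0 \<longleftrightarrow> y \<in> W)" if x0: "x0 \<in> \<Omega>" for x0
  proof -
    have fU: "f x0 \<in> U" using SU x0 by auto
    obtain m' :: int and \<epsilon> \<phi> gr \<delta> where m': "H (f x0) = 2 * pi * of_int m'" and gd: "good_def_fn \<Omega> x0 \<epsilon> \<phi> gr" and \<delta>: "\<delta> > 0"
      and sd: "\<And>y. y \<in> U \<Longrightarrow> dist y (f x0) < \<delta> \<Longrightarrow> y \<in> ball (f x0) \<epsilon> \<and> (\<phi> y > 0 \<longrightarrow> H y > 2 * pi * of_int m') \<and>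
       (\<phi> y < 0 \<longrightarrow> H y < 2 * pi * of_int m') \<and> (\<phi> y = 0 \<longrightarrow> H y = 2 * pi * of_int m')"
      by (rule lift_sides[OF col x0 fU refl continuous_on_id H(1)]) (use H(2) in auto)
    have mc: "2 * pi * of_int m' = c" using m' m[OF x0] by (simp add: c_def)
    obtain \<delta>' where \<delta>': "\<delta>' > 0" "ball (f x0) \<delta>' \<subseteq> U" using openU fU open_contains_ball by blast
    have \<epsilon>: "\<epsilon> > 0" using gd by (simp add: good_def_fn_def)
    let ?\<epsilon> = "min \<epsilon> (min \<delta> \<delta>')"
    have g': "good_def_fn \<Omega> x0 ?\<epsilon> \<phi> gr" by (rule good_def_fn_mono[OF gd]) (use \<epsilon> \<delta> \<delta>' in auto)
    have "\<phi> y > 0 \<longleftrightarrow> y \<in> W" if y: "y \<in> ball (f x0) ?\<epsilon>" for y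
    proof -
      have yU: "y \<in> U" using y \<delta>' by auto
      have "dist y (f x0) < \<delta>" using y by (simp add: dist_commute)
      from sd[OF yU this] show ?thesis unfolding mc W_def using yU by (cases "\<phi> y" "0::real" rule: linorder_cases) auto
    qed
    moreover have "ball (f x0) ?\<epsilon> \<subseteq> U" using \<delta>'(2) by auto
    ultimately show ?thesis using g' by blast
  qed
  ultimately show ?thesis using oW by (intro exI[of _ W]) (auto simp: W_def)
qed

definition W where "W = (SOME W. open W \<and> W \<subseteq> U \<and> W \<inter> S = {} \<and> closedin (top_of_set U) (W \<union> S) \<and>
    (\<forall>x0\<in>\<Omega>. \<exists>\<epsilon> \<phi> gr. good_def_fn \<Omega> x0 \<epsilon> \<phi> gr \<and> ball (f x0) \<epsilon> \<subseteq> U \<and> (\<forall>y\<in>ball (f x0) \<epsilon>. \<phi> y > 0 \<longleftrightarrow> y \<in> W)))"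

lemma W: "open W" "W \<subseteq> U" "W \<inter> S = {}" "closedin (top_of_set U) (W \<union> S)"
    "\<And>x0. x0 \<in> \<Omega> \<Longrightarrow> \<exists>\<epsilon> \<phi> gr. good_def_fn \<Omega> x0 \<epsilon> \<phi> gr \<and> ball (f x0) \<epsilon> \<subseteq> U \<and> (\<forall>y\<in>ball (f x0) \<epsilon>. \<phi> y > 0 \<longleftrightarrow> y \<in> W)"
  using someI_ex[OF inside_exists] unfolding W_def[symmetric] by blast+

lemma good_increasing:
  assumes g: "good_def_fn \<Omega> x0 \<epsilon> \<phi> gr" and y: "y \<in> ball (f x0) \<epsilon>" "y + s *\<^sub>R v \<in> ball (f x0) \<epsilon>" and s: "s > 0"
    and pos: "\<And>y. y \<in> ball (f x0) \<epsilon> \<Longrightarrow> gr y \<bullet> v > 0"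
  shows "\<phi> y < \<phi> (y + s *\<^sub>R v)"
proof -
  have "\<exists>t>0. t < s \<and> \<phi> (y + s *\<^sub>R v) - \<phi> (y + 0 *\<^sub>R v) = (s - 0) * (gr (y + t *\<^sub>R v) \<bullet> v)"
  proof (rule MVT2[OF s])
    fix t assume t: "0 \<le> t" "t \<le> s"
    have "y + t *\<^sub>R v = (1 - t / s) *\<^sub>R y + (t / s) *\<^sub>R (y + s *\<^sub>R v)" using s by (simp add: algebra_simps)
    then have "y + t *\<^sub>R v \<in> ball (f x0) \<epsilon>"
      using convexD[OF convex_ball y, of "1 - t / s" "t / s"] t s by simp
    then show "((\<lambda>t. \<phi> (y + t *\<^sub>R v)) has_real_derivative (gr (y + t *\<^sub>R v) \<bullet> v)) (at t)"
      using g by (intro has_real_derivative_gradient_line) (auto simp: good_def_fn_def)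
  qed
  then obtain t where t: "0 < t" "t < s" "\<phi> (y + s *\<^sub>R v) - \<phi> y = s * (gr (y + t *\<^sub>R v) \<bullet> v)" by auto
  have "y + t *\<^sub>R v = (1 - t / s) *\<^sub>R y + (t / s) *\<^sub>R (y + s *\<^sub>R v)" using s by (simp add: algebra_simps)
  then have "y + t *\<^sub>R v \<in> ball (f x0) \<epsilon>"
    using convexD[OF convex_ball y, of "1 - t / s" "t / s"] t s by simp
  then have "s * (gr (y + t *\<^sub>R v) \<bullet> v) > 0" using pos s by simp
  then show ?thesis using t(3) by linarith
qed

lemma good_shrink:
  assumes g: "good_def_fn \<Omega> x0 \<epsilon> \<phi> gr" and v: "nu x0 \<bullet> v > 0"
  obtains \<epsilon>' where "0 < \<epsilon>'" "\<epsilon>' \<le> \<epsilon>" "\<And>y. y \<in> ball (f x0) \<epsilon>' \<Longrightarrow> gr y \<bullet> v > 0"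
proof -
  have "isCont (\<lambda>y. gr y \<bullet> v) (f x0)" using g unfolding good_def_fn_def by (intro continuous_intros) auto
  moreover have "gr (f x0) \<bullet> v > 0" using g v by (simp add: good_def_fn_def)
  ultimately obtain d where d: "d > 0" "\<And>y. dist y (f x0) < d \<Longrightarrow> dist (gr y \<bullet> v) (gr (f x0) \<bullet> v) < gr (f x0) \<bullet> v"
    unfolding continuous_at_eps_delta by blast
  show thesis
  proof (rule that[of "min d \<epsilon>"])
    show "0 < min d \<epsilon>" using d g by (simp add: good_def_fn_def)
    show "gr y \<bullet> v > 0" if "y \<in> ball (f x0) (min d \<epsilon>)" for y
      using d(2)[of y] that by (simp add: dist_commute dist_real_def)
  qed simp
qed

text \<open>A single \<open>\<eta>\<close> serves all points of the cap near \<open>x0\<close>; the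
  limit arguments with moving points and moving planes depend on this uniformity.\<close>

lemma enters_inside:
  assumes x0: "x0 \<in> \<Omega>" and v: "nu x0 \<bullet> v > 0"
  obtains \<eta> where "\<eta> > 0" "\<And>x s. x \<in> \<Omega> \<Longrightarrow> dist x x0 < \<eta> \<Longrightarrow> 0 < s \<Longrightarrow> s < \<eta> \<Longrightarrow> f x + s *\<^sub>R v \<in> W \<and> f x - s *\<^sub>R v \<notin> W \<union> S"
proof -
  obtain \<epsilon> \<phi> gr where g: "good_def_fn \<Omega> x0 \<epsilon> \<phi> gr" and W': "\<And>y. y \<in> ball (f x0) \<epsilon> \<Longrightarrow> \<phi> y > 0 \<longleftrightarrow> y \<in> W"
    using W(5)[OF x0] by blast
  obtain \<epsilon>' where \<epsilon>': "0 < \<epsilon>'" "\<epsilon>' \<le> \<epsilon>" "\<And>y. y \<in> ball (f x0) \<epsilon>' \<Longrightarrow> gr y \<bullet> v > 0" by (rule good_shrink[OF g v]) blast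
  have g': "good_def_fn \<Omega> x0 \<epsilon>' \<phi> gr" by (rule good_def_fn_mono[OF g \<epsilon>'(1,2)])
  have v0: "norm v > 0" using v by auto
  obtain d where d: "d > 0" "\<And>x. dist x x0 < d \<Longrightarrow> dist (f x) (f x0) < \<epsilon>'/2"
    using isCont_f[OF Ob[OF x0]] \<epsilon>'(1) unfolding continuous_at_eps_delta by (meson half_gt_zero)
  define \<eta> where "\<eta> = min d (\<epsilon>' / (2 * norm v))"
  have \<eta>: "\<eta> > 0" using d \<epsilon>' v0 by (simp add: \<eta>_def)
  have "f x + s *\<^sub>R v \<in> W \<and> f x - s *\<^sub>R v \<notin> W \<union> S" if x: "x \<in> \<Omega>" "dist x x0 < \<eta>" and s: "0 < s" "s < \<eta>" for x s
  proof -
    have fx: "dist (f x) (f x0) < \<epsilon>'/2" using d(2)[of x] x by (simp add: \<eta>_def)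
    have "s < \<epsilon>' / (2 * norm v)" using s by (simp add: \<eta>_def)
    then have "s * norm v < \<epsilon>' / 2" using v0 by (simp add: field_simps)
    then have n: "norm (s *\<^sub>R v) < \<epsilon>'/2" using s by simp
    have b0: "f x \<in> ball (f x0) \<epsilon>'" using fx \<epsilon>' by (auto simp: dist_commute)
    have b1: "f x + s *\<^sub>R v \<in> ball (f x0) \<epsilon>'"
      using dist_triangle[of "f x0" "f x + s *\<^sub>R v" "f x"] n fx by (simp add: dist_norm norm_minus_commute)
    have b2: "f x - s *\<^sub>R v \<in> ball (f x0) \<epsilon>'"
      using dist_triangle[of "f x0" "f x - s *\<^sub>R v" "f x"] n fx by (simp add: dist_norm norm_minus_commute)
    have \<phi>0: "\<phi> (f x) = 0" using g' b0 x by (auto simp: good_def_fn_def)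
    have "\<phi> (f x) < \<phi> (f x + s *\<^sub>R v)" by (rule good_increasing[OF g' b0 b1 s(1) \<epsilon>'(3)])
    then have 1: "f x + s *\<^sub>R v \<in> W" using W'[of "f x + s *\<^sub>R v"] b1 \<epsilon>'(2) \<phi>0 by auto
    have "\<phi> (f x - s *\<^sub>R v) < \<phi> ((f x - s *\<^sub>R v) + s *\<^sub>R v)"
      by (rule good_increasing[OF g' b2 _ s(1) \<epsilon>'(3)]) (use b0 in auto)
    then have neg: "\<phi> (f x - s *\<^sub>R v) < 0" using \<phi>0 by simp
    then have "f x - s *\<^sub>R v \<notin> W" using W'[of "f x - s *\<^sub>R v"] b2 \<epsilon>'(2) by auto
    moreover have "\<phi> (f x - s *\<^sub>R v) = 0 \<longleftrightarrow> f x - s *\<^sub>R v \<in> S" using g' b2 unfolding good_def_fn_def by blast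
    then have "f x - s *\<^sub>R v \<notin> S" using neg by simp
    ultimately show ?thesis using 1 by blast
  qed
  then show thesis using that[OF \<eta>] by blast
qed

text \<open>The moving plane at height \<open>t\<close> can get stuck in two ways: a reflected point
  reaches the cap away from the plane, or the cap becomes vertical at the plane. Both are excluded
  strictly.\<close>

definition Pt :: "real \<Rightarrow> bool" where
  "Pt t \<longleftrightarrow> (\<forall>x\<in>\<Omega>. z x > t \<longrightarrow> refl_plane e t (f x) \<in> W) \<and> (\<forall>x\<in>\<Omega>. z x = t \<longrightarrow> nu x \<bullet> e < 0)"

text \<open>As long as the plane is above \<open>h/2\<close>, reflected points stay above the base
  plane, so they can leave the inside only through the cap itself.\<close>

definition above :: "real \<Rightarrow> bool" where
  "above t0 \<longleftrightarrow> h/2 < t0 \<and> (\<forall>t>t0. Pt t)"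

lemma above_strict: "above t0 \<Longrightarrow> x \<in> \<Omega> \<Longrightarrow> z x > t0 \<Longrightarrow> nu x \<bullet> e < 0"
  unfolding above_def Pt_def by blast

lemma above_weak_reflection:
  assumes A: "above t0" and x: "x \<in> \<Omega>" "z x > t0"
  shows "refl_plane e t0 (f x) \<in> W \<union> S"
proof (rule ccontr)
  assume n: "refl_plane e t0 (f x) \<notin> W \<union> S"
  obtain C where C: "closed C" "W \<union> S = U \<inter> C" using W(4) by (auto simp: closedin_closed)
  have "refl_plane e t0 (f x) \<bullet> e > 0" using refl_plane_height[OF e1] hmax[OF x(1)] A by (simp add: above_def)
  then have nC: "refl_plane e t0 (f x) \<in> - C" using n C by (auto simp: U_def)
  have "isCont (\<lambda>t. refl_plane e t (f x)) t0" unfolding refl_plane_def by (intro continuous_intros)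
  then obtain d where d: "d > 0" "\<And>t. dist t t0 < d \<Longrightarrow> refl_plane e t (f x) \<in> - C"
    using C(1) nC unfolding continuous_at_open by (metis (no_types, lifting) continuous_at_open dist_commute open_Compl open_contains_ball mem_ball subsetD)
  define t where "t = t0 + min d (z x - t0) / 2"
  have t: "t > t0" "t < z x" "dist t t0 < d" using d(1) x by (auto simp: t_def dist_real_def min_def field_simps)
  have "refl_plane e t (f x) \<in> W" using A x t unfolding above_def Pt_def by blast
  then show False using d(2)[OF t(3)] C by blast
qed

text \<open>If the normal pointed upwards at \<open>x\<close>, it would do so nearby, and since
  normals above height \<open>t0\<close> point downwards, no neighbour could lie above
  \<open>t0\<close>. So \<open>x\<close> would be a local maximum of the height, where the normal is
  \<open>- e\<close>.\<close>

lemma above_weak_normal: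
  assumes A: "above t0" and x: "x \<in> \<Omega>" "z x = t0"
  shows "nu x \<bullet> e \<le> 0"
proof (rule ccontr)
  assume n: "\<not> nu x \<bullet> e \<le> 0"
  have "isCont (\<lambda>y. nu y \<bullet> e) x" using isCont_nu[OF Ob[OF x(1)]] by (intro continuous_intros)
  then have "\<forall>\<^sub>F y in nhds x. nu y \<bullet> e > 0"
    using n by (simp add: isCont_def tendsto_nhds_iff order_tendstoD(1) eventually_nhds_conv_at)
  moreover have "\<forall>\<^sub>F y in nhds x. y \<in> \<Omega>" using oO x by (intro eventually_nhds_in_open) auto
  ultimately have "\<forall>\<^sub>F y in nhds x. z y \<le> z x"
    by eventually_elim (use above_strict[OF A] x in force)
  then have "nu x = - e" by (rule local_extremum_normal[OF Ob[OF x(1)] e1])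
  then show False using n e1 by simp
qed

definition gp :: "real^3 \<Rightarrow> real^3 \<Rightarrow> real^3 \<Rightarrow> real \<times> real \<Rightarrow> real \<Rightarrow> real^3" where
  "gp a b n y s = fst y *\<^sub>R a + snd y *\<^sub>R b + s *\<^sub>R n"

lemma gp_expand: "orthoframe a b n \<Longrightarrow> w = gp a b n (w \<bullet> a, w \<bullet> b) (w \<bullet> n)"
  unfolding gp_def using orthoframe_expand by simp

lemma graph_rep_point:
  assumes gr: "graph_rep G a b n O' V \<psi> u p q p1 p2 q1 q2" and fr: "orthoframe a b n" and y: "y \<in> V"
  shows "\<psi> y \<in> O'" "f (\<psi> y) = gp a b n y (u y)"
proof -
  show 1: "\<psi> y \<in> O'" using gr y by (auto simp: graph_rep_def homeomorphism_def)
  have 2: "(f (\<psi> y) \<bullet> a, f (\<psi> y) \<bullet> b) = y" using gr y by (auto simp: graph_rep_def homeomorphism_def)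
  have "f (\<psi> y) \<bullet> n = u (f (\<psi> y) \<bullet> a, f (\<psi> y) \<bullet> b)" using gr 1 by (auto simp: graph_rep_def)
  then show "f (\<psi> y) = gp a b n y (u y)" using gp_expand[OF fr, of "f (\<psi> y)"] 2 by simp
qed

text \<open>Near the point the inside is the region where the local equation is positive, and the
  local equation increases along \<open>n\<close>.\<close>

lemma inside_above_graph:
  assumes x2: "x2 \<in> \<Omega>" and n: "n = nu x2" and fr: "orthoframe a b n" and gr: "graph_rep \<Omega> a b n O' V \<psi> u p q p1 p2 q1 q2" and x2O: "x2 \<in> O'"
  obtains \<rho> where "\<rho> > 0" "ball (f x2 \<bullet> a, f x2 \<bullet> b) \<rho> \<subseteq> V"
    "\<And>y s. y \<in> ball (f x2 \<bullet> a, f x2 \<bullet> b) \<rho> \<Longrightarrow> \<bar>s - f x2 \<bullet> n\<bar> < \<rho> \<Longrightarrow> gp a b n y s \<in> W \<union> S \<Longrightarrow> u y \<le> s"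
proof -
  let ?q = "f x2"
  let ?y0 = "(?q \<bullet> a, ?q \<bullet> b)"
  have y0V: "?y0 \<in> V" using gr x2O by (auto simp: graph_rep_def homeomorphism_def)
  have oV: "open V" using gr by (simp add: graph_rep_def)
  have u0: "u ?y0 = ?q \<bullet> n" using gr x2O by (auto simp: graph_rep_def)
  have uc: "isCont u ?y0" using gr y0V has_derivative_continuous unfolding graph_rep_def by blast
  obtain \<epsilon> \<phi> gr' where g: "good_def_fn \<Omega> x2 \<epsilon> \<phi> gr'" and W': "\<And>y. y \<in> ball (f x2) \<epsilon> \<Longrightarrow> \<phi> y > 0 \<longleftrightarrow> y \<in> W"
    using W(5)[OF x2] by blast
  have \<epsilon>: "\<epsilon> > 0" using g by (simp add: good_def_fn_def)
  have grp: "gr' y \<bullet> n > 0" if "y \<in> ball (f x2) \<epsilon>" for y using good_D(2)[OF g that] n by simp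
  obtain d1 where d1: "d1 > 0" "ball ?y0 d1 \<subseteq> V" using oV y0V open_contains_ball by blast
  obtain d2 where d2: "d2 > 0" "\<And>y. dist y ?y0 < d2 \<Longrightarrow> dist (u y) (u ?y0) < \<epsilon>/3"
  proof -
    have "\<epsilon>/3 > 0" using \<epsilon> by simp
    then show ?thesis using uc that unfolding continuous_at_eps_delta by blast
  qed
  define \<rho> where "\<rho> = min d1 (min d2 (\<epsilon>/3))"
  have \<rho>: "\<rho> > 0" using d1 d2 \<epsilon> by (simp add: \<rho>_def)
  have near: "gp a b n y s \<in> ball ?q \<epsilon>" if y: "y \<in> ball ?y0 \<rho>" and s: "\<bar>s - ?q \<bullet> n\<bar> < \<epsilon>/3" for y s
  proof -
    have "?q = gp a b n ?y0 (?q \<bullet> n)" by (rule gp_expand[OF fr])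
    then have "gp a b n y s - ?q = (fst y - ?q \<bullet> a) *\<^sub>R a + (snd y - ?q \<bullet> b) *\<^sub>R b + (s - ?q \<bullet> n) *\<^sub>R n"
    proof -
      have "gp a b n y s - gp a b n ?y0 (?q \<bullet> n) = (fst y - ?q \<bullet> a) *\<^sub>R a + (snd y - ?q \<bullet> b) *\<^sub>R b + (s - ?q \<bullet> n) *\<^sub>R n"
        by (simp add: gp_def algebra_simps)
      then show ?thesis using \<open>?q = gp a b n ?y0 (?q \<bullet> n)\<close> by metis
    qed
    then have "norm (gp a b n y s - ?q) \<le> \<bar>fst y - ?q \<bullet> a\<bar> * norm a + \<bar>snd y - ?q \<bullet> b\<bar> * norm b + \<bar>s - ?q \<bullet> n\<bar> * norm n"
      using norm_triangle_ineq[of "(fst y - ?q \<bullet> a) *\<^sub>R a + (snd y - ?q \<bullet> b) *\<^sub>R b" "(s - ?q \<bullet> n) *\<^sub>R n"]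
        norm_triangle_ineq[of "(fst y - ?q \<bullet> a) *\<^sub>R a" "(snd y - ?q \<bullet> b) *\<^sub>R b"] by simp
    moreover have "norm a = 1" "norm b = 1" "norm n = 1" using fr by (auto simp: orthoframe_def norm_eq_1)
    moreover have "\<bar>fst y - ?q \<bullet> a\<bar> < \<epsilon>/3" "\<bar>snd y - ?q \<bullet> b\<bar> < \<epsilon>/3"
      using y dist_fst_le[of ?y0 y] dist_snd_le[of ?y0 y] by (auto simp: \<rho>_def dist_real_def abs_minus_commute)
    ultimately have "norm (gp a b n y s - ?q) < \<epsilon>" using s by simp
    then show ?thesis by (simp add: dist_norm norm_minus_commute)
  qed
  show thesis
  proof (rule that[OF \<rho>])
    show sub: "ball ?y0 \<rho> \<subseteq> V" using d1 by (auto simp: \<rho>_def)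
    fix y s assume y: "y \<in> ball ?y0 \<rho>" and s: "\<bar>s - ?q \<bullet> n\<bar> < \<rho>" and w: "gp a b n y s \<in> W \<union> S"
    show "u y \<le> s"
    proof (rule ccontr)
      assume c: "\<not> u y \<le> s"
      have "dist (u y) (u ?y0) < \<epsilon>/3" using d2(2)[of y] y by (simp add: \<rho>_def dist_commute)
      then have us: "\<bar>u y - ?q \<bullet> n\<bar> < \<epsilon>/3" using u0 by (simp add: dist_real_def)
      have b1: "gp a b n y s \<in> ball ?q \<epsilon>" by (rule near[OF y]) (use s in \<open>simp add: \<rho>_def\<close>)
      have b2: "gp a b n y (u y) \<in> ball ?q \<epsilon>" by (rule near[OF y us])
      have eq: "gp a b n y (u y) = gp a b n y s + (u y - s) *\<^sub>R n" by (simp add: gp_def algebra_simps)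
      have "\<phi> (gp a b n y s) < \<phi> (gp a b n y s + (u y - s) *\<^sub>R n)"
        by (rule good_increasing[OF g b1 _ _ grp]) (use b2 eq c in auto)
      moreover have yV: "y \<in> V" using y sub by blast
      have "gp a b n y (u y) \<in> S" using graph_rep_point[OF gr fr yV] gr by (auto simp: graph_rep_def intro!: rev_image_eqI[of "\<psi> y"])
      then have "\<phi> (gp a b n y (u y)) = 0" using g b2 unfolding good_def_fn_def by blast
      ultimately have neg: "\<phi> (gp a b n y s) < 0" using eq by simp
      have "\<phi> (gp a b n y s) = 0 \<longleftrightarrow> gp a b n y s \<in> S" using g b1 unfolding good_def_fn_def by blast
      then show False using w W'[OF b1] neg by auto
    qed
  qed
qed

lemma graph_rep_sol: "graph_rep G a b n O' V \<psi> u p q p1 p2 q1 q2 \<Longrightarrow> graph_sol V u p q p1 p2 q1 q2"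
  unfolding graph_rep_def graph_sol_def C2s_def by blast

text \<open>Taking the interior makes the set open from the start. The contact lemmas below show
  that it is closed in \<open>\<Omega>\<close> as well, so that a single contact would make the
  whole cap symmetric.\<close>

definition Msym :: "real \<Rightarrow> (real \<times> real) set" where
  "Msym t = interior {x \<in> \<Omega>. refl_plane e t (f x) \<in> S}"

text \<open>The reflected sheet touches the cap from inside. The normals at the contact agree, so
  both sheets are graphs over one tangent plane, the reflected one on top, and the strong comparison
  principle makes them coincide nearby.\<close>

lemma contact_interior:
  assumes A: "above t0" and x1: "x1 \<in> \<Omega>" "z x1 > t0" and c: "refl_plane e t0 (f x1) \<in> S"
  shows "x1 \<in> Msym t0"
proof -
  let ?R = "\<lambda>x. refl_plane e t0 (f x)"
  interpret R: csurf ?R "\<lambda>x. rlin e (fu x)" "\<lambda>x. rlin e (fv x)" "\<lambda>x. rlin e (fuu x)" "\<lambda>x. rlin e (fuv x)" "\<lambda>x. rlin e (fvv x)"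
    "\<lambda>x. rlin e (nu x)" "\<lambda>x. rlin e (nuu x)" "\<lambda>x. rlin e (nuv x)" by (rule csurf_refl_plane[OF csurf_axioms e1])
  obtain x2 where x2: "x2 \<in> \<Omega>" "?R x1 = f x2" using c by auto
  let ?q = "f x2"
  define n where "n = nu x2"
  define G1 where "G1 = {x \<in> \<Omega>. z x > t0}"
  have "continuous_on \<Omega> z" by (intro continuous_intros continuous_on_subset[OF cfO closure_subset])
  then have oG1: "open G1" unfolding G1_def using continuous_open_preimage[OF _ oO, of z "{t0<..}"] by (simp add: Int_def vimage_def)
  have G1b: "G1 \<subseteq> ball 0 1" using Obs by (auto simp: G1_def)
  have x1G: "x1 \<in> G1" using x1 by (simp add: G1_def)
  have x1b: "x1 \<in> ball 0 1" using x1 Ob by auto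
  have GWS: "?R x \<in> W \<union> S" if "x \<in> G1" for x using above_weak_reflection[OF A] that by (auto simp: G1_def)
  have nun2: "n \<bullet> n = 1" using nun[OF Ob[OF x2(1)]] by (simp add: n_def)
  \<comment> \<open>Contact from inside is a minimum of the local equation along the reflected
    sheet; this makes the two normals parallel. They are not opposite, because the reflected normal
    points strictly upwards and \<open>n\<close> does not point downwards.\<close>
  have nn: "n = rlin e (nu x1)"
  proof -
    obtain \<epsilon> \<phi> gr where g: "good_def_fn \<Omega> x2 \<epsilon> \<phi> gr" and W': "\<And>y. y \<in> ball ?q \<epsilon> \<Longrightarrow> \<phi> y > 0 \<longleftrightarrow> y \<in> W"
      using W(5)[OF x2(1)] by blast
    have \<epsilon>: "\<epsilon> > 0" using g by (simp add: good_def_fn_def)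
    have phS: "\<phi> y = 0 \<longleftrightarrow> y \<in> S" if "y \<in> ball ?q \<epsilon>" for y using g that unfolding good_def_fn_def by blast
    have cR: "isCont ?R x1" using R.df[OF x1b] has_derivative_continuous by blast
    then have "\<forall>\<^sub>F y in at x1. dist (?R y) ?q < \<epsilon>" using \<epsilon> x2(2) by (simp add: isCont_def tendstoD)
    moreover have "\<forall>\<^sub>F y in at x1. y \<in> G1" using eventually_nhds_in_open[OF oG1 x1G] by (simp add: eventually_nhds_conv_at)
    ultimately have mn: "\<forall>\<^sub>F y in at x1. \<phi> (?R x1) \<le> \<phi> (?R y)"
    proof eventually_elim
      case (elim y)
      have b: "?R y \<in> ball ?q \<epsilon>" using elim by (simp add: dist_commute)
      have "\<phi> (?R x1) = 0" using phS[of ?q] x2 \<epsilon> by auto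
      moreover have "\<phi> (?R y) \<ge> 0" using GWS[OF elim(2)] phS[OF b] W'[OF b] by (cases "?R y \<in> S") auto
      ultimately show ?case by simp
    qed
    have dph: "(\<phi> has_derivative (\<lambda>k. gr ?q \<bullet> k)) (at (?R x1))" unfolding x2(2) by (rule good_D(1)[OF g]) (use \<epsilon> in simp)
    have "(\<lambda>v. gr ?q \<bullet> (case v of (a,b) \<Rightarrow> a *\<^sub>R rlin e (fu x1) + b *\<^sub>R rlin e (fv x1))) = (\<lambda>v. 0)"
      by (rule has_derivative_local_min[OF has_derivative_compose[OF R.df[OF x1b] dph] mn])
    moreover have "gr ?q = n" using g by (simp add: good_def_fn_def n_def)
    ultimately have *: "\<And>v. n \<bullet> (case v of (a,b) \<Rightarrow> a *\<^sub>R rlin e (fu x1) + b *\<^sub>R rlin e (fv x1)) = 0" by metis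
    from *[of "(1,0)"] *[of "(0,1)"] have "n \<bullet> rlin e (fu x1) = 0" "n \<bullet> rlin e (fv x1) = 0" by simp_all
    then have en: "n = (n \<bullet> rlin e (nu x1)) *\<^sub>R rlin e (nu x1)" by (rule R.normal_multiple[OF x1b])
    then have "n \<bullet> n = (n \<bullet> rlin e (nu x1)) * (rlin e (nu x1) \<bullet> n)" by (metis inner_scaleR_left)
    then have sq: "(n \<bullet> rlin e (nu x1))\<^sup>2 = 1" using nun2 by (simp add: power2_eq_square inner_commute)
    \<comment> \<open>Raising the plane by \<open>s/2\<close> raises the reflected point by
      \<open>s\<close>. For the higher planes this point is inside, whereas an upward step from a
      point whose normal points downwards leaves the inside.\<close>
    have ge: "n \<bullet> e \<ge> 0"
    proof (rule ccontr)
      assume "\<not> n \<bullet> e \<ge> 0"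
      then have "nu x2 \<bullet> (- e) > 0" by (simp add: n_def)
      from enters_inside[OF x2(1) this] obtain \<eta> where \<eta>: "\<eta> > 0" "\<And>x s. x \<in> \<Omega> \<Longrightarrow> dist x x2 < \<eta> \<Longrightarrow> 0 < s \<Longrightarrow> s < \<eta> \<Longrightarrow> f x - s *\<^sub>R (- e) \<notin> W \<union> S" by metis
      define s where "s = min \<eta> (z x1 - t0) / 2"
      have s: "0 < s" "s < \<eta>" "t0 + s/2 < z x1" using \<eta>(1) x1 by (auto simp: s_def min_def field_simps)
      have "?q + s *\<^sub>R e \<notin> W" using \<eta>(2)[OF x2(1) _ s(1,2)] \<eta>(1) by simp
      moreover have "refl_plane e (t0 + s/2) (f x1) = ?q + s *\<^sub>R e"
        unfolding x2(2)[symmetric] by (simp add: refl_plane_def algebra_simps)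
      moreover have "refl_plane e (t0 + s/2) (f x1) \<in> W" using A x1 s unfolding above_def Pt_def by simp
      ultimately show False by simp
    qed
    have neg: "nu x1 \<bullet> e < 0" by (rule above_strict[OF A x1])
    have "rlin e (nu x1) \<bullet> e = - (nu x1 \<bullet> e)" using e1 by (simp add: rlin_def inner_diff_left)
    then have "n \<bullet> rlin e (nu x1) \<noteq> -1" using en ge neg by (metis inner_scaleR_left less_le_not_le minus_minus mult_minus1 neg_less_0_iff_less)
    then have "n \<bullet> rlin e (nu x1) = 1" using sq by (simp add: power2_eq_1_iff)
    then show ?thesis using en by simp
  qed
  obtain a b where fr: "orthoframe a b n" using orthoframe_exists nun2 by blast
  have pos2: "nu x2 \<bullet> n > 0" and pos1: "rlin e (nu x1) \<bullet> n > 0" using nun2 nn by (simp_all add: n_def)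
  obtain O2 V2 \<psi>2 u2 p q p1 p2 q1 q2 where x2O: "x2 \<in> O2" and g2: "graph_rep \<Omega> a b n O2 V2 \<psi>2 u2 p q p1 p2 q1 q2"
    using graph_rep_exists[OF x2(1) oO Obs fr pos2] by blast
  obtain O1 V1 \<psi>1 u1 p' q' p1' p2' q1' q2' where x1O: "x1 \<in> O1" and g1: "R.graph_rep G1 a b n O1 V1 \<psi>1 u1 p' q' p1' p2' q1' q2'"
    using R.graph_rep_exists[OF x1G oG1 G1b fr pos1] by blast
  let ?y0 = "(?q \<bullet> a, ?q \<bullet> b)"
  obtain \<rho> where \<rho>: "\<rho> > 0" "ball ?y0 \<rho> \<subseteq> V2" and up: "\<And>y s. y \<in> ball ?y0 \<rho> \<Longrightarrow> \<bar>s - ?q \<bullet> n\<bar> < \<rho> \<Longrightarrow> gp a b n y s \<in> W \<union> S \<Longrightarrow> u2 y \<le> s"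
    by (rule inside_above_graph[OF x2(1) n_def fr g2 x2O]) blast
  have O1: "O1 \<subseteq> G1" "open O1" "open V1" using g1 by (auto simp: R.graph_rep_def)
  have y0V1: "?y0 \<in> V1" using g1 x1O x2(2)[symmetric] by (auto simp: R.graph_rep_def homeomorphism_def)
  have u10: "u1 ?y0 = ?q \<bullet> n" using g1 x1O x2(2)[symmetric] by (auto simp: R.graph_rep_def)
  have uc: "isCont u1 ?y0" using g1 y0V1 has_derivative_continuous unfolding R.graph_rep_def by blast
  obtain d1 where d1: "d1 > 0" "ball ?y0 d1 \<subseteq> V1" using O1 y0V1 open_contains_ball by blast
  obtain d2 where d2: "d2 > 0" "\<And>y. dist y ?y0 < d2 \<Longrightarrow> dist (u1 y) (u1 ?y0) < \<rho>"
    using uc \<rho> unfolding continuous_at_eps_delta by blast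
  define B where "B = ball ?y0 (min \<rho> (min d1 d2))"
  have BV: "B \<subseteq> V1" "B \<subseteq> V2" "B \<subseteq> ball ?y0 \<rho>" using d1 \<rho> by (auto simp: B_def)
  have y0B: "?y0 \<in> B" using \<rho> d1 d2 by (simp add: B_def)
  have pt1: "\<psi>1 y \<in> O1 \<and> ?R (\<psi>1 y) = gp a b n y (u1 y)" if "y \<in> V1" for y
  proof -
    have 1: "\<psi>1 y \<in> O1" "(?R (\<psi>1 y) \<bullet> a, ?R (\<psi>1 y) \<bullet> b) = y" using g1 that by (auto simp: R.graph_rep_def homeomorphism_def)
    have "?R (\<psi>1 y) \<bullet> n = u1 (?R (\<psi>1 y) \<bullet> a, ?R (\<psi>1 y) \<bullet> b)" using g1 1(1) by (auto simp: R.graph_rep_def)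
    then show ?thesis using gp_expand[OF fr, of "?R (\<psi>1 y)"] 1 by simp
  qed
  have le: "u2 y \<le> u1 y" if y: "y \<in> B" for y
  proof (rule up)
    show "y \<in> ball ?y0 \<rho>" using BV y by blast
    show "\<bar>u1 y - ?q \<bullet> n\<bar> < \<rho>" using d2(2)[of y] y u10 by (simp add: B_def dist_commute dist_real_def)
    show "gp a b n y (u1 y) \<in> W \<union> S" using pt1[of y] GWS[of "\<psi>1 y"] O1 BV y by (metis subsetD)
  qed
  have s1: "graph_sol B u1 p' q' p1' p2' q1' q2'"
  proof (rule graph_sol_subset[OF _ _ BV(1)])
    show "graph_sol V1 u1 p' q' p1' p2' q1' q2'" using g1 unfolding R.graph_rep_def graph_sol_def C2s_def by blast
  qed (simp add: B_def)
  have s2: "graph_sol B u2 p q p1 p2 q1 q2" by (rule graph_sol_subset[OF graph_rep_sol[OF g2] _ BV(2)]) (simp add: B_def)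
  have u20: "u2 ?y0 = ?q \<bullet> n" using g2 x2O by (auto simp: graph_rep_def)
  have eq: "u1 y = u2 y" if "y \<in> B" for y
    by (rule graph_strong_comparison[OF s1 s2 _ le y0B _ that]) (auto simp: B_def u10 u20)
  define N where "N = O1 \<inter> (\<lambda>x. (?R x \<bullet> a, ?R x \<bullet> b)) -` B"
  have "continuous_on O1 (\<lambda>x. (?R x \<bullet> a, ?R x \<bullet> b))" using g1 by (simp add: R.graph_rep_def homeomorphism_def)
  then have oN: "open N" unfolding N_def by (rule continuous_open_preimage[OF _ O1(2)]) (simp add: B_def)
  have x1N: "x1 \<in> N" using x1O x2(2) y0B by (simp add: N_def)
  have "N \<subseteq> {x \<in> \<Omega>. ?R x \<in> S}"
  proof
    fix x assume x: "x \<in> N"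
    let ?y = "(?R x \<bullet> a, ?R x \<bullet> b)"
    have xO: "x \<in> O1" "?y \<in> B" using x by (auto simp: N_def)
    have "?R x \<bullet> n = u1 ?y" using g1 xO by (auto simp: R.graph_rep_def)
    then have "?R x = gp a b n ?y (u2 ?y)" using gp_expand[OF fr, of "?R x"] eq[OF xO(2)] by simp
    then have "?R x = f (\<psi>2 ?y)" "\<psi>2 ?y \<in> O2" using graph_rep_point[OF g2 fr, of ?y] BV xO by auto
    moreover have "O2 \<subseteq> \<Omega>" using g2 by (simp add: graph_rep_def)
    ultimately have "?R x \<in> S" by blast
    then show "x \<in> {x \<in> \<Omega>. ?R x \<in> S}" using xO O1 by (auto simp: G1_def)
  qed
  then show ?thesis unfolding Msym_def using oN x1N by (meson interiorI)
qed

text \<open>Where the normal is horizontal at the plane, the cap and its reflection are tangent, and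
  both are graphs over the vertical tangent plane, ordered on one side of the reflection plane. The
  boundary form of Hopf's lemma produces a further contact on that side, and the strong comparison
  principle then coincidence.\<close>

lemma contact_corner:
  assumes A: "above t0" and x0: "x0 \<in> \<Omega>" "z x0 = t0" "nu x0 \<bullet> e = 0"
  shows "x0 \<in> Msym t0"
proof -
  let ?R = "\<lambda>x. refl_plane e t0 (f x)"
  interpret R: csurf ?R "\<lambda>x. rlin e (fu x)" "\<lambda>x. rlin e (fv x)" "\<lambda>x. rlin e (fuu x)" "\<lambda>x. rlin e (fuv x)" "\<lambda>x. rlin e (fvv x)"
    "\<lambda>x. rlin e (nu x)" "\<lambda>x. rlin e (nuu x)" "\<lambda>x. rlin e (nuv x)" by (rule csurf_refl_plane[OF csurf_axioms e1])
  define n where "n = nu x0"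
  have nun2: "n \<bullet> n = 1" using nun[OF Ob[OF x0(1)]] by (simp add: n_def)
  have rn: "rlin e (nu x0) = n" using x0 by (simp add: rlin_def n_def)
  have Rq: "?R x0 = f x0" using x0 by (simp add: refl_plane_fix)
  let ?q = "f x0"
  \<comment> \<open>\<open>e\<close> is tangent to the surface here and serves as first axis of the
    frame, so the reflection plane becomes the line where the first coordinate is
    \<open>t0\<close>.\<close>
  define b where "b = cross3 n e"
  have fr: "orthoframe e b n" unfolding b_def by (rule orthoframe_cross[OF nun2 e1]) (use x0 in \<open>simp add: n_def inner_commute\<close>)
  have pos2: "nu x0 \<bullet> n > 0" and pos1: "rlin e (nu x0) \<bullet> n > 0" using nun2 rn by (simp_all add: n_def)
  obtain O2 V2 \<psi>2 u2 p q p1 p2 q1 q2 where x2O: "x0 \<in> O2" and g2: "graph_rep \<Omega> e b n O2 V2 \<psi>2 u2 p q p1 p2 q1 q2"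
    using graph_rep_exists[OF x0(1) oO Obs fr pos2] by blast
  obtain O1 V1 \<psi>1 u1 p' q' p1' p2' q1' q2' where x1O: "x0 \<in> O1" and g1: "R.graph_rep \<Omega> e b n O1 V1 \<psi>1 u1 p' q' p1' p2' q1' q2'"
    using R.graph_rep_exists[OF x0(1) oO Obs fr pos1] by blast
  let ?y0 = "(?q \<bullet> e, ?q \<bullet> b)"
  obtain \<rho> where \<rho>: "\<rho> > 0" "ball ?y0 \<rho> \<subseteq> V2" and up: "\<And>y s. y \<in> ball ?y0 \<rho> \<Longrightarrow> \<bar>s - ?q \<bullet> n\<bar> < \<rho> \<Longrightarrow> gp e b n y s \<in> W \<union> S \<Longrightarrow> u2 y \<le> s"
    by (rule inside_above_graph[OF x0(1) n_def fr g2 x2O]) blast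
  have O1: "O1 \<subseteq> \<Omega>" "open O1" "open V1" using g1 by (auto simp: R.graph_rep_def)
  have O2: "O2 \<subseteq> \<Omega>" "open O2" "open V2" using g2 by (auto simp: graph_rep_def)
  have "(?R x0 \<bullet> e, ?R x0 \<bullet> b) \<in> V1" "u1 (?R x0 \<bullet> e, ?R x0 \<bullet> b) = ?R x0 \<bullet> n" using g1 x1O unfolding R.graph_rep_def homeomorphism_def by auto
  then have y0V1: "?y0 \<in> V1" and u10: "u1 ?y0 = ?q \<bullet> n" unfolding Rq .
  have u20: "u2 ?y0 = ?q \<bullet> n" using g2 x2O by (auto simp: graph_rep_def)
  have uc: "isCont u1 ?y0" using g1 y0V1 has_derivative_continuous unfolding R.graph_rep_def by blast
  have grad2: "p ?y0 = 0" "q ?y0 = 0"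
  proof -
    have "nu x0 \<bullet> e = - (nu x0 \<bullet> n) * p ?y0" "nu x0 \<bullet> b = - (nu x0 \<bullet> n) * q ?y0" using g2 x2O by (auto simp: graph_rep_def)
    moreover have "nu x0 \<bullet> b = 0" using fr by (simp add: orthoframe_def n_def inner_commute)
    ultimately show "p ?y0 = 0" "q ?y0 = 0" using x0(3) nun2 unfolding n_def by auto
  qed
  have grad1: "p' ?y0 = 0" "q' ?y0 = 0"
  proof -
    have "rlin e (nu x0) \<bullet> e = - (rlin e (nu x0) \<bullet> n) * p' (?R x0 \<bullet> e, ?R x0 \<bullet> b)" "rlin e (nu x0) \<bullet> b = - (rlin e (nu x0) \<bullet> n) * q' (?R x0 \<bullet> e, ?R x0 \<bullet> b)"
      using g1 x1O unfolding R.graph_rep_def by blast+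
    moreover have "n \<bullet> b = 0" "n \<bullet> e = 0" using fr by (simp_all add: orthoframe_def inner_commute)
    ultimately show "p' ?y0 = 0" "q' ?y0 = 0" using nun2 unfolding rn Rq by auto
  qed
  obtain d1 where d1: "d1 > 0" "ball ?y0 d1 \<subseteq> V1" using O1 y0V1 open_contains_ball by blast
  obtain d2 where d2: "d2 > 0" "\<And>y. dist y ?y0 < d2 \<Longrightarrow> dist (u1 y) (u1 ?y0) < \<rho>"
    using uc \<rho> unfolding continuous_at_eps_delta by blast
  define r where "r = min \<rho> (min d1 d2)"
  define B where "B = ball ?y0 r"
  have r: "r > 0" using \<rho> d1 d2 by (simp add: r_def)
  have BV: "B \<subseteq> V1" "B \<subseteq> V2" "B \<subseteq> ball ?y0 \<rho>" using d1 \<rho> by (auto simp: B_def r_def)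
  have y0B: "?y0 \<in> B" using r by (simp add: B_def)
  \<comment> \<open>Points of the reflected sheet with first coordinate below \<open>t0\<close> come
    from cap points above the plane, for which weak reflection is known.\<close>
  define Bm where "Bm = B \<inter> {y. fst y < t0}"
  have oBm: "open Bm" unfolding Bm_def B_def by (intro open_Int open_ball open_Collect_less continuous_intros)
  have "convex {y :: real \<times> real. fst y < t0}"
  proof -
    have "{y :: real \<times> real. fst y < t0} = {y. (1,0) \<bullet> y < t0}" by auto
    then show ?thesis using convex_halfspace_lt by metis
  qed
  then have conBm: "connected Bm" unfolding Bm_def B_def by (intro convex_connected convex_Int convex_ball)
  have pt1: "\<psi>1 y \<in> O1 \<and> ?R (\<psi>1 y) = gp e b n y (u1 y) \<and> ?R (\<psi>1 y) \<bullet> e = fst y" if "y \<in> V1" for y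
  proof -
    have 1: "\<psi>1 y \<in> O1" "(?R (\<psi>1 y) \<bullet> e, ?R (\<psi>1 y) \<bullet> b) = y" using g1 that by (auto simp: R.graph_rep_def homeomorphism_def)
    have "?R (\<psi>1 y) \<bullet> n = u1 (?R (\<psi>1 y) \<bullet> e, ?R (\<psi>1 y) \<bullet> b)" using g1 1(1) by (auto simp: R.graph_rep_def)
    moreover have "?R (\<psi>1 y) \<bullet> e = fst y" using 1(2) by (metis fst_conv)
    ultimately show ?thesis using gp_expand[OF fr, of "?R (\<psi>1 y)"] 1 by simp
  qed
  have le: "u2 y \<le> u1 y" if y: "y \<in> Bm" for y
  proof (rule up)
    have yB: "y \<in> B" and ft: "fst y < t0" using y by (auto simp: Bm_def)
    show "y \<in> ball ?y0 \<rho>" using BV yB by blast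
    show "\<bar>u1 y - ?q \<bullet> n\<bar> < \<rho>" using d2(2)[of y] yB u10 by (simp add: B_def r_def dist_commute dist_real_def)
    have p: "\<psi>1 y \<in> \<Omega>" "?R (\<psi>1 y) = gp e b n y (u1 y)" "?R (\<psi>1 y) \<bullet> e = fst y" using pt1[of y] O1 BV yB by blast+
    have "z (\<psi>1 y) > t0" using p(3) ft refl_plane_height[OF e1, of t0 "f (\<psi>1 y)"] by simp
    then show "gp e b n y (u1 y) \<in> W \<union> S" using above_weak_reflection[OF A p(1)] p(2) by simp
  qed
  have s1B: "graph_sol B u1 p' q' p1' p2' q1' q2'"
  proof (rule graph_sol_subset[OF _ _ BV(1)])
    show "graph_sol V1 u1 p' q' p1' p2' q1' q2'" using g1 unfolding R.graph_rep_def graph_sol_def C2s_def by blast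
  qed (simp add: B_def)
  have s2B: "graph_sol B u2 p q p1 p2 q1 q2" by (rule graph_sol_subset[OF graph_rep_sol[OF g2] _ BV(2)]) (simp add: B_def)
  have s1: "graph_sol Bm u1 p' q' p1' p2' q1' q2'" by (rule graph_sol_subset[OF s1B oBm]) (simp add: Bm_def)
  have s2: "graph_sol Bm u2 p q p1 p2 q1 q2" by (rule graph_sol_subset[OF s2B oBm]) (simp add: Bm_def)
  have "\<exists>y\<in>Bm. u1 y = u2 y"
  proof (rule ccontr)
    assume ne: "\<not> (\<exists>y\<in>Bm. u1 y = u2 y)"
    show False
    proof (rule graph_hopf_comparison[OF s1B s2B y0B, where n = "(-1,0)" and \<rho> = r])
      show "u1 ?y0 = u2 ?y0" "p' ?y0 = p ?y0" "q' ?y0 = q ?y0" using u10 u20 grad1 grad2 by simp_all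
      fix y assume y: "y \<in> B" "(y - ?y0) \<bullet> (- 1, 0) > 0"
      then have "y \<in> Bm" using x0(2) by (cases y) (auto simp: Bm_def)
      then show "u2 y < u1 y" using le[of y] ne by (metis order_le_imp_less_or_eq)
    qed (use r in auto)
  qed
  then obtain y1 where y1: "y1 \<in> Bm" "u1 y1 = u2 y1" by blast
  have eq: "u1 y = u2 y" if "y \<in> Bm" for y
    by (rule graph_strong_comparison[OF s1 s2 conBm le y1 that])
  let ?F1 = "\<lambda>x. (?R x \<bullet> e, ?R x \<bullet> b)" let ?F2 = "\<lambda>x. (f x \<bullet> e, f x \<bullet> b)"
  define N where "N = (O1 \<inter> ?F1 -` B) \<inter> (O2 \<inter> ?F2 -` B)"
  have "continuous_on O1 ?F1" "continuous_on O2 ?F2" using g1 g2 by (simp_all add: R.graph_rep_def graph_rep_def homeomorphism_def)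
  then have oN: "open N" unfolding N_def using O1(2) O2(2) by (intro open_Int continuous_open_preimage) (simp_all add: B_def)
  have x0N: "x0 \<in> N" using x1O x2O Rq y0B by (simp add: N_def)
  have "N \<subseteq> {x \<in> \<Omega>. ?R x \<in> S}"
  proof
    fix x assume x: "x \<in> N"
    have xO: "x \<in> O1" "?F1 x \<in> B" "x \<in> O2" "?F2 x \<in> B" using x by (auto simp: N_def)
    have xOm: "x \<in> \<Omega>" using xO O1 by blast
    have hR: "?R x \<bullet> e = 2 * t0 - z x" by (rule refl_plane_height[OF e1])
    have "?R x \<in> S"
    proof (cases "z x" t0 rule: linorder_cases)
      case equal
      then show ?thesis using refl_plane_fix xOm by auto
    next
      case greater
      then have m: "?F1 x \<in> Bm" using xO hR by (simp add: Bm_def)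
      have "?R x \<bullet> n = u1 (?F1 x)" using g1 xO by (auto simp: R.graph_rep_def)
      then have "?R x = gp e b n (?F1 x) (u2 (?F1 x))" using gp_expand[OF fr, of "?R x"] eq[OF m] by simp
      then have "?R x = f (\<psi>2 (?F1 x))" "\<psi>2 (?F1 x) \<in> O2" using graph_rep_point[OF g2 fr, of "?F1 x"] BV xO by auto
      then show ?thesis using O2 by blast
    next
      \<comment> \<open>For a cap point below the plane the equality of the two graphs is read in
        the other direction: the point lies on the reflected sheet, so its reflection lies on the
        cap.\<close>
      case less
      then have m: "?F2 x \<in> Bm" using xO by (simp add: Bm_def)
      have "f x \<bullet> n = u2 (?F2 x)" using g2 xO by (auto simp: graph_rep_def)
      then have "f x = gp e b n (?F2 x) (u1 (?F2 x))" using gp_expand[OF fr, of "f x"] eq[OF m] by simp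
      then have "f x = ?R (\<psi>1 (?F2 x))" "\<psi>1 (?F2 x) \<in> O1" using pt1[of "?F2 x"] BV xO by auto
      then have "?R x = f (\<psi>1 (?F2 x))" by (metis refl_plane_invol[OF e1])
      then show ?thesis using \<open>\<psi>1 (?F2 x) \<in> O1\<close> O1 by blast
    qed
    then show "x \<in> {x \<in> \<Omega>. ?R x \<in> S}" using xOm by blast
  qed
  then show ?thesis unfolding Msym_def using oN x0N by (meson interiorI)
qed

end

section \<open>The symmetric part of the cap and the moving plane\<close>

context cap
begin

lemma refl_in_S_pos:
  assumes t0: "h/2 < t0" and x: "x \<in> \<Omega>" and m: "refl_plane e t0 (f x) \<in> f ` closure \<Omega>"
  shows "refl_plane e t0 (f x) \<in> S"
proof -
  have "refl_plane e t0 (f x) \<bullet> e > 0" using refl_plane_height[OF e1] hmax[OF x] t0 by simp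
  then show ?thesis using m unfolding S_eq U_def by blast
qed

text \<open>Every point of a horizontal piece is a maximum of the height for \<open>e\<close> and
  for \<open>- e\<close>, which would force both \<open>- e\<close> and \<open>e\<close> as
  normal.\<close>

lemma not_locally_horizontal:
  assumes "open Q" "Q \<subseteq> \<Omega>" "y \<in> Q" "\<And>x. x \<in> Q \<Longrightarrow> z x = t" shows False
proof -
  have yb: "y \<in> ball 0 1" using assms Ob by blast
  have ev: "\<forall>\<^sub>F x in nhds y. x \<in> Q" using assms by (intro eventually_nhds_in_open) auto
  then have 1: "\<forall>\<^sub>F x in nhds y. f x \<bullet> e \<le> f y \<bullet> e" by eventually_elim (use assms in auto)
  have 2: "\<forall>\<^sub>F x in nhds y. f x \<bullet> (- e) \<le> f y \<bullet> (- e)" using ev by eventually_elim (use assms in auto)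
  have "nu y = - e" by (rule local_extremum_normal[OF yb e1 1])
  moreover have "nu y = - (- e)" by (rule local_extremum_normal[OF yb _ 2]) (use e1 in simp)
  ultimately have "e = - e" by simp
  then have "e \<bullet> e = - (e \<bullet> e)" by (metis inner_minus_left)
  then show False using e1 by simp
qed

lemma Msym_subset: "x \<in> Msym t \<Longrightarrow> x \<in> \<Omega> \<and> refl_plane e t (f x) \<in> S"
  unfolding Msym_def using interior_subset by blast

text \<open>On parameters the reflection induces the map \<open>\<theta>\<close>, continuous by
  compactness of the disk and injective. By invariance of domain it sends \<open>Msym t0\<close> to
  an open set, which again consists of points with their reflection on the cap.\<close>

lemma Msym_transfer:
  assumes A: "above t0" and y: "y \<in> Msym t0" and x: "x \<in> \<Omega>" "f x = refl_plane e t0 (f y)"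
  shows "x \<in> Msym t0"
proof -
  let ?R = "\<lambda>x. refl_plane e t0 (f x)"
  let ?D = "cball (0::real \<times> real) 1"
  define \<theta> where "\<theta> x = inv_into ?D f (?R x)" for x
  have MO: "Msym t0 \<subseteq> \<Omega>" using Msym_subset by blast
  have oM: "open (Msym t0)" unfolding Msym_def by (rule open_interior)
  have Ocb: "\<Omega> \<subseteq> ?D" using Obs ball_subset_cball by blast
  have th: "\<theta> w \<in> \<Omega> \<and> f (\<theta> w) = ?R w" if w: "w \<in> Msym t0" for w
  proof -
    obtain w' where w': "w' \<in> \<Omega>" "?R w = f w'" using Msym_subset[OF w] by blast
    then have "\<theta> w = w'" unfolding \<theta>_def using inv_into_f_f[OF injf] Ocb by (metis subsetD)
    then show ?thesis using w' by simp
  qed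
  have "continuous_on (f ` ?D) (inv_into ?D f)"
    by (rule continuous_on_inv[OF cf]) (use injf in auto)
  moreover have "continuous_on (Msym t0) ?R"
    by (rule continuous_refl_plane[OF continuous_on_subset[OF cfO]]) (use MO closure_subset in blast)
  moreover have "?R ` Msym t0 \<subseteq> f ` ?D" using Msym_subset Ocb by blast
  ultimately have "continuous_on (Msym t0) \<theta>" unfolding \<theta>_def by (rule continuous_on_compose2)
  moreover have "inj_on \<theta> (Msym t0)"
  proof (rule inj_onI)
    fix a b assume ab: "a \<in> Msym t0" "b \<in> Msym t0" "\<theta> a = \<theta> b"
    then have "?R a = ?R b" using th by metis
    then have "f a = f b" using refl_plane_invol[OF e1] by metis
    then show "a = b" using inj_onD[OF injf] ab MO Ocb by blast
  qed
  ultimately have oT: "open (\<theta> ` Msym t0)" using invariance_of_domain oM by blast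
  have "\<theta> y = x"
  proof -
    have "f (\<theta> y) = f x" "\<theta> y \<in> \<Omega>" using th[OF y] x by simp_all
    then show ?thesis using inj_onD[OF injf] x Ocb by blast
  qed
  then have "x \<in> \<theta> ` Msym t0" using y by blast
  moreover have "\<theta> ` Msym t0 \<subseteq> {x \<in> \<Omega>. ?R x \<in> S}"
  proof (rule image_subsetI)
    fix w assume w: "w \<in> Msym t0"
    have "?R (\<theta> w) = f w" using th[OF w] refl_plane_invol[OF e1] by metis
    then show "\<theta> w \<in> {x \<in> \<Omega>. ?R x \<in> S}" using th[OF w] w MO by blast
  qed
  ultimately have "x \<in> interior {x \<in> \<Omega>. ?R x \<in> S}" using oT by (meson interiorI)
  then show ?thesis by (simp only: Msym_def)
qed

text \<open>The reflection of a limit of symmetric points lies on the compact cap. Above the plane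
  the limit is an interior contact; below the plane its mirror image is one; on the plane with
  horizontal normal it is a corner contact. The remaining case, a downward normal on the plane,
  cannot occur.\<close>

lemma Msym_closed:
  assumes A: "above t0" and x: "x \<in> \<Omega>" "x \<in> closure (Msym t0)"
  shows "x \<in> Msym t0"
proof -
  let ?R = "\<lambda>x. refl_plane e t0 (f x)"
  have t0: "h/2 < t0" using A by (simp add: above_def)
  have MO: "Msym t0 \<subseteq> \<Omega>" using Msym_subset by blast
  have oM: "open (Msym t0)" unfolding Msym_def by (rule open_interior)
  have xb: "x \<in> ball 0 1" using x Ob by blast
  have "?R x \<in> f ` closure \<Omega>"
  proof -
    have cl: "closed (f ` closure \<Omega>)" by (intro compact_imp_closed compact_continuous_image cfO compact_cl)
    obtain X where X: "\<And>n. X n \<in> Msym t0" "X \<longlonglongrightarrow> x" using x(2) unfolding closure_sequential by blast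
    have "isCont ?R x" unfolding refl_plane_def using isCont_f[OF xb] by (intro continuous_intros)
    then have "(\<lambda>n. ?R (X n)) \<longlonglongrightarrow> ?R x" using X(2) isCont_tendsto_compose by blast
    moreover have "?R (X n) \<in> f ` closure \<Omega>" for n using Msym_subset[OF X(1)] closure_subset by blast
    ultimately show ?thesis using cl unfolding closed_sequential_limits by fast
  qed
  then have RS: "?R x \<in> S" by (rule refl_in_S_pos[OF t0 x(1)])
  show ?thesis
  proof (cases "z x" t0 rule: linorder_cases)
    case greater
    then show ?thesis using contact_interior[OF A x(1) _ RS] by simp
  next
    case less
    obtain y where y: "y \<in> \<Omega>" "?R x = f y" using RS by blast
    have Ry: "?R y = f x" using y refl_plane_invol[OF e1] by metis
    have "z y = 2 * t0 - z x" using refl_plane_height[OF e1, of t0 "f x"] y by simp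
    then have "z y > t0" using less by simp
    then have "y \<in> Msym t0" using contact_interior[OF A y(1)] Ry x(1) by auto
    then show ?thesis by (rule Msym_transfer[OF A _ x(1) Ry[symmetric]])
  next
    case equal
    have "nu x \<bullet> e \<le> 0" by (rule above_weak_normal[OF A x(1) equal])
    \<comment> \<open>Near such a point short vertical segments leave the cap at once, so a nearby
      cap point whose reflection is on the cap must lie in the plane. An open piece of the cap would
      then be horizontal.\<close>
    moreover have False if neg: "nu x \<bullet> e < 0"
    proof -
      have "nu x \<bullet> (- e) > 0" using neg by simp
      from enters_inside[OF x(1) this] obtain \<eta> where \<eta>: "\<eta> > 0" "\<And>x' s. x' \<in> \<Omega> \<Longrightarrow> dist x' x < \<eta> \<Longrightarrow> 0 < s \<Longrightarrow> s < \<eta> \<Longrightarrow> f x' + s *\<^sub>R (- e) \<in> W \<and> f x' - s *\<^sub>R (- e) \<notin> W \<union> S" by metis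
      have "isCont z x" using isCont_f[OF xb] by (intro continuous_intros)
      then obtain d where d: "d > 0" "\<And>y. dist y x < d \<Longrightarrow> dist (z y) (z x) < \<eta>/2"
        unfolding continuous_at_eps_delta using \<eta>(1) by (meson half_gt_zero)
      define Q where "Q = Msym t0 \<inter> ball x (min d \<eta>)"
      have "min d \<eta> > 0" using \<eta>(1) d(1) by simp
      then obtain y0 where "y0 \<in> Msym t0" "dist y0 x < min d \<eta>" using x(2) unfolding closure_approachable by blast
      then have y0: "y0 \<in> Q" by (simp add: Q_def dist_commute)
      have "z y = t0" if y: "y \<in> Q" for y
      proof (rule ccontr)
        assume ne: "z y \<noteq> t0"
        have yM: "y \<in> \<Omega>" "?R y \<in> S" "dist y x < \<eta>" "dist y x < d" using y Msym_subset[of y t0] by (auto simp: Q_def dist_commute)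
        have zs: "\<bar>z y - t0\<bar> < \<eta>/2" using d(2)[OF yM(4)] equal by (simp add: dist_real_def)
        show False
        proof (cases "z y > t0")
          case True
          have "f y + (2 * (z y - t0)) *\<^sub>R (- e) \<in> W" using \<eta>(2)[OF yM(1,3), of "2 * (z y - t0)"] True zs by auto
          moreover have "f y + (2 * (z y - t0)) *\<^sub>R (- e) = ?R y" by (simp add: refl_plane_def)
          ultimately show False using yM W(3) by auto
        next
          case False
          have "f y - (2 * (t0 - z y)) *\<^sub>R (- e) \<notin> W \<union> S" using \<eta>(2)[OF yM(1,3), of "2 * (t0 - z y)"] False ne zs by auto
          moreover have "f y - (2 * (t0 - z y)) *\<^sub>R (- e) = ?R y" by (simp add: refl_plane_def algebra_simps)
          ultimately show False using yM by auto
        qed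
      qed
      moreover have "open Q" "Q \<subseteq> \<Omega>" using oM MO by (auto simp: Q_def)
      ultimately show False using not_locally_horizontal[OF _ _ y0] by blast
    qed
    ultimately have "nu x \<bullet> e = 0" by force
    then show ?thesis by (rule contact_corner[OF A x(1) equal])
  qed
qed

text \<open>A nonempty symmetric set, open and closed in the connected \<open>\<Omega>\<close>,
  would be all of it. But points near the edge, at heights close to 0, are reflected to heights
  close to \<open>2 * t0\<close>, above the maximum \<open>h\<close>.\<close>

lemma Msym_empty:
  assumes A: "above t0" shows "Msym t0 = {}"
proof (rule ccontr)
  assume ne: "Msym t0 \<noteq> {}"
  have t0: "h/2 < t0" using A by (simp add: above_def)
  have MO: "Msym t0 \<subseteq> \<Omega>" using Msym_subset by blast
  have oM: "open (Msym t0)" unfolding Msym_def by (rule open_interior)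
  have "openin (top_of_set \<Omega>) (Msym t0)" using oM MO oO by (simp add: openin_open_eq)
  moreover have "closedin (top_of_set \<Omega>) (Msym t0)"
  proof -
    have "Msym t0 = \<Omega> \<inter> closure (Msym t0)" using Msym_closed[OF A] MO closure_subset by blast
    then show ?thesis by (metis closed_closure closedin_closed_Int)
  qed
  ultimately have M: "Msym t0 = \<Omega>" using conO ne connected_clopen by blast
  have "frontier \<Omega> \<noteq> {}"
  proof
    assume "frontier \<Omega> = {}"
    then have "\<Omega> = {} \<or> \<Omega> = UNIV" using frontier_eq_empty by blast
    moreover have "\<Omega> \<noteq> UNIV"
    proof
      assume "\<Omega> = UNIV"
      then have "(2::real,0::real) \<in> ball 0 1" using Ob by blast
      then show False by (simp add: norm_Pair)
    qed
    ultimately show False using xt by blast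
  qed
  then obtain w where w: "w \<in> frontier \<Omega>" by blast
  have wb: "w \<in> ball 0 1" using w clO by (auto simp: frontier_def)
  have "isCont z w" using isCont_f[OF wb] by (intro continuous_intros)
  moreover have zw: "z w = 0" by (rule zfr[OF w])
  moreover have "2 * t0 - h > 0" using t0 by simp
  ultimately obtain d where d0: "d > 0" "\<And>y. dist y w < d \<Longrightarrow> dist (z y) (z w) < 2 * t0 - h"
    unfolding continuous_at_eps_delta by blast
  then have d: "d > 0" "\<And>y. dist y w < d \<Longrightarrow> \<bar>z y\<bar> < 2 * t0 - h" using zw by (simp_all add: dist_real_def)
  have "w \<in> closure \<Omega>" using w by (simp add: frontier_def)
  then obtain y where y: "y \<in> \<Omega>" "dist y w < d" using d(1) unfolding closure_approachable by blast
  have "refl_plane e t0 (f y) \<in> S" using M y Msym_subset by blast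
  then obtain y' where y': "y' \<in> \<Omega>" "refl_plane e t0 (f y) = f y'" by blast
  have "z y' = 2 * t0 - z y" using refl_plane_height[OF e1, of t0 "f y"] y'(2) by simp
  then show False using hmax[OF y'(1)] d(2)[OF y(2)] by linarith
qed

lemma above_imp_Pt: assumes A: "above t0" shows "Pt t0"
  unfolding Pt_def
proof (intro conjI ballI impI)
  fix x assume x: "x \<in> \<Omega>"
  show "refl_plane e t0 (f x) \<in> W" if "z x > t0"
    using above_weak_reflection[OF A x that] contact_interior[OF A x that] Msym_empty[OF A] by blast
  show "nu x \<bullet> e < 0" if "z x = t0"
    using above_weak_normal[OF A x that] contact_corner[OF A x that] Msym_empty[OF A] by force
qed

text \<open>By compactness: if planes approaching \<open>t0\<close> from below violate the property,
  their offending points accumulate at a point of height at least \<open>t0\<close>. Above the plane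
  the limit contradicts openness of the inside; on the plane it contradicts the downward normal
  together with the uniformity in \<open>enters_inside\<close>.\<close>

lemma Pt_open:
  assumes t0: "h/2 < t0" and P: "Pt t0"
  shows "\<exists>\<delta>>0. \<forall>t. t0 - \<delta> < t \<and> t \<le> t0 \<longrightarrow> Pt t"
proof (rule ccontr)
  assume "\<not> ?thesis"
  then have "\<forall>n::nat. \<exists>t. t0 - 1 / real (Suc n) < t \<and> t \<le> t0 \<and> \<not> Pt t"
    by (metis of_nat_0_less_iff zero_less_Suc zero_less_divide_1_iff)
  then obtain T where T: "\<And>n. t0 - 1 / real (Suc n) < T n" "\<And>n. T n \<le> t0" "\<And>n. \<not> Pt (T n)" by metis
  have Tlim: "T \<longlonglongrightarrow> t0"
  proof (rule tendsto_sandwich[of "\<lambda>n. t0 - 1 / real (Suc n)" _ _ "\<lambda>n. t0"])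
    show "(\<lambda>n. t0 - 1 / real (Suc n)) \<longlonglongrightarrow> t0"
      using tendsto_diff[OF tendsto_const[of t0] LIMSEQ_inverse_real_of_nat] by (simp add: inverse_eq_divide)
  qed (use T(1)[THEN less_imp_le] T(2) in \<open>auto intro!: always_eventually\<close>)
  have "\<forall>n. \<exists>x\<in>\<Omega>. (z x > T n \<and> refl_plane e (T n) (f x) \<notin> W) \<or> (z x = T n \<and> nu x \<bullet> e \<ge> 0)"
    using T(3) unfolding Pt_def by (metis not_less)
  then obtain X where X: "\<And>n. X n \<in> \<Omega>" "\<And>n. (z (X n) > T n \<and> refl_plane e (T n) (f (X n)) \<notin> W) \<or> (z (X n) = T n \<and> nu (X n) \<bullet> e \<ge> 0)"
    by metis
  have "\<forall>n. X n \<in> closure \<Omega>" using X(1) closure_subset by blast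
  then obtain x r where x: "x \<in> closure \<Omega>" and r: "strict_mono r" and lim: "(X \<circ> r) \<longlonglongrightarrow> x"
    using compact_cl unfolding compact_def by metis
  have xb: "x \<in> ball 0 1" using x clO by blast
  have flim: "(\<lambda>n. f (X (r n))) \<longlonglongrightarrow> f x" using isCont_tendsto_compose[OF isCont_f[OF xb] lim] by (simp add: o_def)
  have nlim: "(\<lambda>n. nu (X (r n))) \<longlonglongrightarrow> nu x" using isCont_tendsto_compose[OF isCont_nu[OF xb] lim] by (simp add: o_def)
  have zlim: "(\<lambda>n. z (X (r n))) \<longlonglongrightarrow> z x" by (intro tendsto_intros flim)
  have Tr: "(\<lambda>n. T (r n)) \<longlonglongrightarrow> t0" using LIMSEQ_subseq_LIMSEQ[OF Tlim r] by (simp add: o_def)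
  have zge: "z x \<ge> t0" by (rule LIMSEQ_le[OF Tr zlim]) (metis X(2) less_imp_le order_refl)
  have hpos: "h > 0" using zpos[OF xt(1)] xt(2) by simp
  have xO: "x \<in> \<Omega>" using closure_pos[OF x] zge t0 hpos by simp
  have Rlim: "(\<lambda>n. refl_plane e (T (r n)) (f (X (r n)))) \<longlonglongrightarrow> refl_plane e t0 (f x)"
    unfolding refl_plane_def by (intro tendsto_intros flim Tr)
  show False
  proof (cases "z x > t0")
    case True
    then have "refl_plane e t0 (f x) \<in> W" using P xO by (simp add: Pt_def)
    then have "\<forall>\<^sub>F n in sequentially. refl_plane e (T (r n)) (f (X (r n))) \<in> W" using Rlim W(1) by (rule topological_tendstoD[rotated 2])
    moreover have "\<forall>\<^sub>F n in sequentially. z (X (r n)) - T (r n) > 0"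
      by (rule order_tendstoD(1)[of _ "z x - t0"]) (use True in \<open>auto intro!: tendsto_intros zlim Tr\<close>)
    ultimately have "\<forall>\<^sub>F n in sequentially. False" by eventually_elim (use X(2) in force)
    then show False by simp
  next
    case False
    then have zx: "z x = t0" using zge by simp
    then have neg: "nu x \<bullet> e < 0" using P xO by (simp add: Pt_def)
    then have "nu x \<bullet> (- e) > 0" by simp
    from enters_inside[OF xO this] obtain \<eta> where \<eta>: "\<eta> > 0" "\<And>x' s. x' \<in> \<Omega> \<Longrightarrow> dist x' x < \<eta> \<Longrightarrow> 0 < s \<Longrightarrow> s < \<eta> \<Longrightarrow> f x' + s *\<^sub>R (- e) \<in> W" by metis
    have "\<forall>\<^sub>F n in sequentially. dist (X (r n)) x < \<eta>" using tendstoD[OF lim \<eta>(1)] by (simp add: o_def)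
    moreover have "\<forall>\<^sub>F n in sequentially. 2 * (z (X (r n)) - T (r n)) < \<eta>"
    proof (rule order_tendstoD(2))
      show "(\<lambda>n. 2 * (z (X (r n)) - T (r n))) \<longlonglongrightarrow> 2 * (z x - t0)" by (intro tendsto_intros zlim Tr)
    qed (use zx \<eta> in simp)
    moreover have "\<forall>\<^sub>F n in sequentially. nu (X (r n)) \<bullet> e < 0"
      by (rule order_tendstoD(2)[OF tendsto_inner[OF nlim tendsto_const] neg])
    ultimately have "\<forall>\<^sub>F n in sequentially. False"
    proof eventually_elim
      case (elim n)
      then have a: "z (X (r n)) > T (r n)" "refl_plane e (T (r n)) (f (X (r n))) \<notin> W" using X(2)[of "r n"] by auto
      have "f (X (r n)) + (2 * (z (X (r n)) - T (r n))) *\<^sub>R (- e) \<in> W" by (rule \<eta>(2)[OF X(1) elim(1)]) (use a elim in auto)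
      then show False using a(2) by (simp add: refl_plane_def)
    qed
    then show False by simp
  qed
qed

text \<open>Above height \<open>h\<close> the property holds vacuously. The supremum of the heights
  where it fails would itself satisfy it by \<open>above_imp_Pt\<close>, and then so would all
  heights slightly below by \<open>Pt_open\<close>.\<close>

lemma alexandrov_reflection:
  assumes "h/2 < t" shows "Pt t"
proof (rule ccontr)
  assume n: "\<not> Pt t"
  define B where "B = {t. h/2 < t \<and> \<not> Pt t}"
  have vac: "Pt t" if "t > h" for t using hmax that unfolding Pt_def by force
  have tB: "t \<in> B" using assms n by (simp add: B_def)
  have bdd: "bdd_above B" using vac by (auto simp: B_def bdd_above_def) (metis not_le)
  define t0 where "t0 = Sup B"
  have t0: "h/2 < t0" using cSup_upper[OF tB bdd] assms by (simp add: t0_def)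
  have A: "above t0" unfolding above_def
  proof (intro conjI allI impI t0)
    fix t assume "t > t0"
    then show "Pt t" using cSup_upper[OF _ bdd, of t] t0 by (force simp: B_def t0_def)
  qed
  obtain \<delta> where \<delta>: "\<delta> > 0" "\<And>t. t0 - \<delta> < t \<Longrightarrow> t \<le> t0 \<Longrightarrow> Pt t" using Pt_open[OF t0 above_imp_Pt[OF A]] by blast
  have "s \<le> t0 - \<delta>" if "s \<in> B" for s
    using \<delta>(2)[of s] that cSup_upper[OF that bdd] by (force simp: B_def t0_def)
  then have "t0 \<le> t0 - \<delta>" unfolding t0_def using tB by (intro cSup_least) auto
  then show False using \<delta> by simp
qed

end

section \<open>Height of a cap\<close>

context csurf
begin

lemma Dv_scale: "Dv x (c *\<^sub>R v) = c *\<^sub>R Dv x v" and II_scale: "II x (c *\<^sub>R v) = c\<^sup>2 *\<^sub>R II x v"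
  by (simp_all add: Dv_def II_def scaleR_add_right power_mult_distrib power2_eq_square algebra_simps)

text \<open>First and second order conditions when \<open>x\<close> moves along \<open>v\<close> and
  \<open>y\<close> along \<open>v'\<close>. To get rid of the norm, \<open>m\<close> denotes the
  height shifted so that \<open>m 0 = b * \<gamma>\<close>; maximality says that \<open>m\<close> is
  at most \<open>b\<close> times the norm of \<open>p\<close>, and comparing squares yields the
  smooth function \<open>\<Psi>\<close> with minimum 0.\<close>

lemma two_point_second_order:
  assumes x: "x \<in> ball 0 1" and y: "y \<in> ball 0 1" and b: "b > 0" and \<gamma>: "\<gamma> > 0"
    and Y: "f x - f y + \<tau> *\<^sub>R e = - \<gamma> *\<^sub>R nu y" and nl: "norm (f x - f y + \<tau> *\<^sub>R e) = \<gamma>"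
    and mx: "\<forall>\<^sub>F w in nhds (x,y). f (fst w) \<bullet> e - b * norm (f (fst w) - f (snd w) + \<tau> *\<^sub>R e) \<le> f x \<bullet> e - b * \<gamma>"
  shows "b * (nu y \<bullet> Dv x v) - b * (nu y \<bullet> Dv y v') = - (Dv x v \<bullet> e)"
    "b\<^sup>2 * ((Dv x v - Dv y v') \<bullet> (Dv x v - Dv y v')) - b\<^sup>2 * \<gamma> * (nu y \<bullet> II x v - nu y \<bullet> II y v') - (Dv x v \<bullet> e)\<^sup>2 - b * \<gamma> * (II x v \<bullet> e) \<ge> 0"
proof -
  define p where "p s = f (x + s *\<^sub>R v) - f (y + s *\<^sub>R v') + \<tau> *\<^sub>R e" for s
  define m where "m s = f (x + s *\<^sub>R v) \<bullet> e - f x \<bullet> e + b * \<gamma>" for s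
  define \<Psi> where "\<Psi> s = b\<^sup>2 * (p s \<bullet> p s) - m s * m s" for s
  define p' where "p' s = Dv (x + s *\<^sub>R v) v - Dv (y + s *\<^sub>R v') v'" for s
  define m' where "m' s = Dv (x + s *\<^sub>R v) v \<bullet> e" for s
  have dp: "(p has_vector_derivative p' s) (at s)" if "x + s *\<^sub>R v \<in> ball 0 1" "y + s *\<^sub>R v' \<in> ball 0 1" for s
    unfolding p_def p'_def
    using has_vector_derivative_add[OF has_vector_derivative_diff[OF curve_deriv[OF that(1)] curve_deriv[OF that(2)]] has_vector_derivative_const[of "\<tau> *\<^sub>R e"]] by simp
  have dm: "(m has_real_derivative m' s) (at s)" if "x + s *\<^sub>R v \<in> ball 0 1" for s
  proof -
    have "((\<lambda>s. f (x + s *\<^sub>R v) \<bullet> e) has_real_derivative m' s) (at s)"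
      using bounded_linear.has_vector_derivative[OF bounded_linear_inner_left curve_deriv[OF that]]
      by (simp add: has_real_derivative_iff_has_vector_derivative m'_def)
    from DERIV_add[OF this DERIV_const[of "b * \<gamma> - f x \<bullet> e"]] show ?thesis by (simp add: m_def[abs_def] algebra_simps)
  qed
  have inner_der: "((\<lambda>s. A s \<bullet> B s) has_real_derivative (A s \<bullet> B' + A' \<bullet> B s)) (at s)"
    if "(A has_vector_derivative A') (at s)" "(B has_vector_derivative B') (at s)" for A B :: "real \<Rightarrow> real^3" and A' B' s
    using has_derivative_inner[OF that[unfolded has_vector_derivative_def]] unfolding has_field_derivative_def
    by (rule has_derivative_eq_rhs) (simp add: fun_eq_iff algebra_simps)
  have evx: "\<forall>\<^sub>F s in nhds (0::real). x + s *\<^sub>R v \<in> ball 0 1" using eventually_line_in_open[OF open_ball x] .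
  have evy: "\<forall>\<^sub>F s in nhds (0::real). y + s *\<^sub>R v' \<in> ball 0 1" using eventually_line_in_open[OF open_ball y] .
  have d1: "\<forall>\<^sub>F s in nhds 0. (\<Psi> has_real_derivative (b\<^sup>2 * (p s \<bullet> p' s + p' s \<bullet> p s) - (m' s * m s + m' s * m s))) (at s)"
    using evx evy
  proof eventually_elim
    case (elim s)
    show ?case unfolding \<Psi>_def
      by (intro DERIV_diff DERIV_cmult inner_der dp elim DERIV_mult[OF dm dm])
  qed
  have x0: "x + 0 *\<^sub>R v \<in> ball 0 1" "y + 0 *\<^sub>R v' \<in> ball 0 1" using x y by simp_all
  have dp': "(p' has_vector_derivative (II x v - II y v')) (at 0)"
    unfolding p'_def using has_vector_derivative_diff[OF curve_deriv2[OF x0(1)] curve_deriv2[OF x0(2)]] by simp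
  have dm': "(m' has_real_derivative (II x v \<bullet> e)) (at 0)"
    using bounded_linear.has_vector_derivative[OF bounded_linear_inner_left curve_deriv2[OF x0(1)]]
    by (simp add: has_real_derivative_iff_has_vector_derivative m'_def[abs_def])
  have d2: "((\<lambda>s. b\<^sup>2 * (p s \<bullet> p' s + p' s \<bullet> p s) - (m' s * m s + m' s * m s)) has_real_derivative
     (b\<^sup>2 * ((p 0 \<bullet> (II x v - II y v') + p' 0 \<bullet> p' 0) + (p' 0 \<bullet> p' 0 + (II x v - II y v') \<bullet> p 0))
      - (((II x v \<bullet> e) * m 0 + m' 0 * m' 0) + ((II x v \<bullet> e) * m 0 + m' 0 * m' 0)))) (at 0)"
    by (intro DERIV_diff DERIV_cmult DERIV_add inner_der dp x0 dp' DERIV_mult[OF dm' dm[OF x0(1)]])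
  have p0: "p 0 = - \<gamma> *\<^sub>R nu y" and p'0: "p' 0 = Dv x v - Dv y v'" and m0: "m 0 = b * \<gamma>" and m'0: "m' 0 = Dv x v \<bullet> e"
    using Y by (simp_all add: p_def p'_def m_def m'_def)
  have pn: "p 0 \<bullet> p 0 = \<gamma>\<^sup>2" using nl by (simp add: p_def flip: power2_norm_eq_inner)
  have "\<Psi> 0 = 0" unfolding \<Psi>_def pn m0 by (simp add: power2_eq_square)
  moreover have "\<forall>\<^sub>F s in nhds 0. \<Psi> s \<ge> 0"
  proof -
    have "((\<lambda>s. (x + s *\<^sub>R v, y + s *\<^sub>R v')) \<longlongrightarrow> (x + 0 *\<^sub>R v, y + 0 *\<^sub>R v')) (nhds 0)"
      by (intro tendsto_Pair tendsto_add tendsto_const tendsto_scaleR filterlim_ident)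
    then have lim: "filterlim (\<lambda>s. (x + s *\<^sub>R v, y + s *\<^sub>R v')) (nhds (x,y)) (nhds 0)" by simp
    have e1: "\<forall>\<^sub>F s in nhds 0. m s \<le> b * norm (p s)"
      using eventually_compose_filterlim[OF mx lim] by eventually_elim (simp add: m_def p_def)
    have "isCont m 0" using DERIV_isCont[OF dm[OF x0(1)]] .
    then have "\<forall>\<^sub>F s in nhds 0. m s > 0"
      using m0 b \<gamma> order_tendstoD(1)[of m "m 0" "at 0" 0] by (simp add: isCont_def eventually_nhds_conv_at)
    with e1 show ?thesis
    proof eventually_elim
      case (elim s)
      have "m s * m s \<le> (b * norm (p s)) * (b * norm (p s))" using elim by (intro mult_mono) auto
      also have "\<dots> = b\<^sup>2 * (p s \<bullet> p s)" by (simp add: power2_eq_square dot_square_norm algebra_simps)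
      finally show ?case by (simp add: \<Psi>_def)
    qed
  qed
  ultimately have mn: "\<forall>\<^sub>F s in nhds 0. \<Psi> 0 \<le> \<Psi> s" by simp
  note r = second_derivative_at_min[OF d1 d2 mn]
  have "b\<^sup>2 * (p 0 \<bullet> p' 0) = m' 0 * m 0" using r(1) by (simp add: inner_commute)
  then have "\<gamma> * b * (b * (nu y \<bullet> Dv x v) - b * (nu y \<bullet> Dv y v') + Dv x v \<bullet> e) = 0"
    unfolding p0 p'0 m0 m'0 by (simp add: power2_eq_square inner_diff_right algebra_simps)
  then show "b * (nu y \<bullet> Dv x v) - b * (nu y \<bullet> Dv y v') = - (Dv x v \<bullet> e)" using b \<gamma> by simp
  have "b\<^sup>2 * (p 0 \<bullet> (II x v - II y v') + p' 0 \<bullet> p' 0) - ((II x v \<bullet> e) * m 0 + m' 0 * m' 0) \<ge> 0"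
    using r(2) unfolding inner_commute[of "II x v - II y v'" "p 0"] by (simp add: algebra_simps)
  then show "b\<^sup>2 * ((Dv x v - Dv y v') \<bullet> (Dv x v - Dv y v')) - b\<^sup>2 * \<gamma> * (nu y \<bullet> II x v - nu y \<bullet> II y v') - (Dv x v \<bullet> e)\<^sup>2 - b * \<gamma> * (II x v \<bullet> e) \<ge> 0"
    unfolding p0 p'0 m0 m'0 by (simp add: power2_eq_square inner_diff_right algebra_simps)
qed

text \<open>In its use \<open>C\<close> is the product of the two unit normals, \<open>E\<close> the
  downward component of the second one, and \<open>c\<close> the length of
  \<open>b *\<^sub>R \<nu> + e\<close>. The bounds on \<open>1 - C\<close> make both squares in the
  last hypothesis at most the square of \<open>\<gamma>\<close>; division by
  \<open>2 * b * \<gamma>\<close> gives the claim.\<close>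

lemma two_point_algebra:
  fixes b \<gamma> c C E s :: real
  assumes "b > 1" "0 < \<gamma>" "\<gamma> < 1" "0 \<le> 1 - C" "1 - C \<le> 2 * \<gamma>" "c \<ge> b - E"
    and "b\<^sup>2 * ((1-(1-\<gamma>))\<^sup>2 + (C-(1-\<gamma>))\<^sup>2) + 2 * b\<^sup>2 * \<gamma> * (1-\<gamma>)\<^sup>2 \<ge> 2 * b * \<gamma> * c"
  shows "b * \<gamma> * (1 - \<gamma>) \<le> E"
proof -
  have "\<bar>C - (1-\<gamma>)\<bar> \<le> \<bar>\<gamma>\<bar>" using assms by linarith
  then have "(C-(1-\<gamma>))\<^sup>2 \<le> \<gamma>\<^sup>2" by (simp add: abs_le_square_iff)
  then have "b\<^sup>2 * ((1-(1-\<gamma>))\<^sup>2 + (C-(1-\<gamma>))\<^sup>2) \<le> b\<^sup>2 * (\<gamma>\<^sup>2 + \<gamma>\<^sup>2)" by (intro mult_left_mono add_mono) auto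
  moreover have "2 * b * \<gamma> * (b - E) \<le> 2 * b * \<gamma> * c" using assms by (intro mult_left_mono) auto
  ultimately have "2 * b * \<gamma> * (b - E) \<le> b\<^sup>2 * (\<gamma>\<^sup>2 + \<gamma>\<^sup>2) + 2 * b\<^sup>2 * \<gamma> * (1-\<gamma>)\<^sup>2" using assms(7) by linarith
  moreover have "b\<^sup>2 * (\<gamma>\<^sup>2 + \<gamma>\<^sup>2) + 2 * b\<^sup>2 * \<gamma> * (1-\<gamma>)\<^sup>2 = (2 * b * \<gamma>) * (b * \<gamma> + b * (1-\<gamma>)\<^sup>2)"
    by (simp add: power2_eq_square algebra_simps)
  ultimately have "(2 * b * \<gamma>) * (b - E) \<le> (2 * b * \<gamma>) * (b * \<gamma> + b * (1-\<gamma>)\<^sup>2)" by simp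
  then have "b - E \<le> b * \<gamma> + b * (1-\<gamma>)\<^sup>2" using assms by (simp add: mult_le_cancel_left_pos)
  then show ?thesis by (simp add: power2_eq_square algebra_simps)
qed

text \<open>The first order condition makes \<open>b *\<^sub>R nu y + e\<close> a multiple of
  \<open>nu x\<close>, so for large \<open>b\<close> the two normals are nearly parallel. The second
  order conditions are added over two orthonormal directions at each point, the first being
  orthogonal to both normals and common to both points; the normal curvatures then enter only
  through their sums, which are 2.\<close>

lemma two_point_estimate:
  assumes x: "x \<in> ball 0 1" and y: "y \<in> ball 0 1" and e: "e \<bullet> e = 1" and b: "b > 2" and \<gamma>: "0 < \<gamma>" "\<gamma> < 1"
    and Y: "f x - f y + \<tau> *\<^sub>R e = - \<gamma> *\<^sub>R nu y"
    and mx: "\<forall>\<^sub>F w in nhds (x,y). f (fst w) \<bullet> e - b * norm (f (fst w) - f (snd w) + \<tau> *\<^sub>R e) \<le> f x \<bullet> e - b * \<gamma>"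
    and C: "nu x \<bullet> nu y > 1/2" and bl: "1 / (b-1)\<^sup>2 \<le> 2 * \<gamma>"
  shows "b * \<gamma> * (1 - \<gamma>) \<le> - (nu y \<bullet> e)"
proof -
  define \<mu> where "\<mu> = nu x"
  define \<nu> where "\<nu> = nu y"
  define C where "C = \<mu> \<bullet> \<nu>"
  define E where "E = - (\<nu> \<bullet> e)"
  have mm: "\<mu> \<bullet> \<mu> = 1" "\<nu> \<bullet> \<nu> = 1" using nun x y by (auto simp: \<mu>_def \<nu>_def)
  then have nm: "norm \<mu> = 1" "norm \<nu> = 1" "norm e = 1" using e by (auto simp: norm_eq_1)
  have b0: "b > 0" using b by simp
  have nl: "norm (f x - f y + \<tau> *\<^sub>R e) = \<gamma>" unfolding Y using nm \<gamma> by (simp add: \<nu>_def)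
  note so = two_point_second_order[OF x y b0 \<gamma>(1) Y nl mx]
  have Dv0: "Dv y 0 = 0" by (simp add: Dv_def)
  have "(b *\<^sub>R \<nu> + e) \<bullet> Dv x v = 0" for v
    using so(1)[of v 0] by (simp add: Dv0 inner_add_left \<nu>_def inner_commute[of e])
  from this[of "(1,0)"] this[of "(0,1)"] have "(b *\<^sub>R \<nu> + e) \<bullet> fu x = 0" "(b *\<^sub>R \<nu> + e) \<bullet> fv x = 0" by (simp_all add: Dv_def)
  then have nrm: "b *\<^sub>R \<nu> + e = ((b *\<^sub>R \<nu> + e) \<bullet> \<mu>) *\<^sub>R \<mu>" unfolding \<mu>_def by (rule normal_multiple[OF x])
  define c where "c = (b *\<^sub>R \<nu> + e) \<bullet> \<mu>"
  have cm: "b *\<^sub>R \<nu> + e = c *\<^sub>R \<mu>" using nrm by (simp add: c_def)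
  have C1: "1/2 < C" "C \<le> 1" using C Cauchy_Schwarz_ineq2[of \<mu> \<nu>] nm by (auto simp: C_def \<mu>_def \<nu>_def)
  have em: "\<bar>e \<bullet> \<mu>\<bar> \<le> 1" "\<bar>\<nu> \<bullet> e\<bar> \<le> 1" using Cauchy_Schwarz_ineq2[of e \<mu>] Cauchy_Schwarz_ineq2[of \<nu> e] nm by auto
  have "c = b * C + e \<bullet> \<mu>" by (simp add: c_def C_def inner_add_left inner_commute[of \<nu> \<mu>])
  moreover have "b * C > 2 * (1/2)" using b C1 by (intro mult_strict_mono) auto
  ultimately have cpos: "c > 0" using em by linarith
  have c2: "c\<^sup>2 = (b - E)\<^sup>2 + (1 - E\<^sup>2)"
  proof -
    have "c\<^sup>2 = (c *\<^sub>R \<mu>) \<bullet> (c *\<^sub>R \<mu>)" using mm by (simp add: power2_eq_square)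
    also have "\<dots> = (b *\<^sub>R \<nu> + e) \<bullet> (b *\<^sub>R \<nu> + e)" by (simp add: cm)
    also have "\<dots> = b\<^sup>2 + 2 * b * (\<nu> \<bullet> e) + 1" using mm e by (simp add: inner_add_left inner_add_right power2_eq_square inner_commute)
    finally show ?thesis by (simp add: E_def power2_eq_square algebra_simps)
  qed
  have E1: "\<bar>E\<bar> \<le> 1" using em by (simp add: E_def)
  then have E2: "E\<^sup>2 \<le> 1" by (simp add: abs_square_le_1)
  have "(b - E)\<^sup>2 \<le> c\<^sup>2" using c2 E2 by linarith
  then have cge: "c \<ge> b - E" using cpos power2_le_imp_le[of "b - E" c] by simp
  have C2: "c\<^sup>2 * (1 - C\<^sup>2) = 1 - E\<^sup>2"
  proof -
    have "(c *\<^sub>R \<mu>) \<bullet> \<nu> = b - E" unfolding cm[symmetric] using mm by (simp add: inner_add_left inner_add_right E_def inner_commute)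
    then have "c * C = b - E" by (simp add: C_def)
    then have "c\<^sup>2 * C\<^sup>2 = (b - E)\<^sup>2" by (metis power_mult_distrib)
    moreover have "c\<^sup>2 * (1 - C\<^sup>2) = c\<^sup>2 - c\<^sup>2 * C\<^sup>2" by (simp add: right_diff_distrib)
    ultimately show ?thesis using c2 by linarith
  qed
  have "1 - C \<le> 1 - C\<^sup>2" using C1 by (simp add: power2_eq_square mult_left_le)
  also have "\<dots> = (1 - E\<^sup>2) / c\<^sup>2" using C2 cpos by (simp add: field_simps)
  also have "\<dots> \<le> 1 / (b-1)\<^sup>2"
  proof (rule frac_le)
    show "(b-1)\<^sup>2 \<le> c\<^sup>2" using cge E1 b by (intro power_mono) auto
  qed (use b in auto)
  finally have C3: "1 - C \<le> 2 * \<gamma>" using bl by linarith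
  obtain \<xi> where \<xi>: "\<xi> \<bullet> \<xi> = 1" "\<xi> \<bullet> \<mu> = 0" "\<xi> \<bullet> \<nu> = 0" by (rule unit_perp_two)
  define \<xi>2 where "\<xi>2 = cross3 \<mu> \<xi>"
  define \<eta>2 where "\<eta>2 = cross3 \<nu> \<xi>"
  have fx: "orthoframe \<xi> \<xi>2 (nu x)" unfolding \<xi>2_def \<mu>_def[symmetric] by (rule orthoframe_cross[OF mm(1) \<xi>(1,2)])
  have fy: "orthoframe \<xi> \<eta>2 (nu y)" unfolding \<eta>2_def \<nu>_def[symmetric] by (rule orthoframe_cross[OF mm(2) \<xi>(1,3)])
  obtain v1 v2 where v: "Dv x v1 = \<xi>" "Dv x v2 = \<xi>2" using tangent_frame[OF x fx] .
  obtain w1 w2 where w: "Dv y w1 = \<xi>" "Dv y w2 = \<eta>2" using tangent_frame[OF y fy] .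
  have tx: "II x v1 \<bullet> \<mu> + II x v2 \<bullet> \<mu> = 2" unfolding \<mu>_def by (rule II_trace[OF x]) (use fx in \<open>auto simp: v orthoframe_def\<close>)
  have ty: "II y w1 \<bullet> \<nu> + II y w2 \<bullet> \<nu> = 2" unfolding \<nu>_def by (rule II_trace[OF y]) (use fy in \<open>auto simp: w orthoframe_def\<close>)
  have xy: "\<xi>2 \<bullet> \<eta>2 = C"
  proof -
    have "\<xi>2 \<bullet> \<eta>2 = (\<mu> \<bullet> \<nu>) * (\<xi> \<bullet> \<xi>) - (\<mu> \<bullet> \<xi>) * (\<xi> \<bullet> \<nu>)"
      unfolding \<xi>2_def \<eta>2_def by (simp add: cross3_simps)
    then show ?thesis using \<xi> by (simp add: C_def)
  qed
  have nx2: "(\<nu> \<bullet> \<xi>2)\<^sup>2 = 1 - C\<^sup>2"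
  proof -
    have "\<nu> \<bullet> \<nu> = (\<nu> \<bullet> \<xi>) * (\<nu> \<bullet> \<xi>) + (\<nu> \<bullet> \<xi>2) * (\<nu> \<bullet> \<xi>2) + (\<nu> \<bullet> nu x) * (\<nu> \<bullet> nu x)" by (rule orthoframe_inner[OF fx])
    then show ?thesis using mm \<xi> by (simp add: C_def \<mu>_def power2_eq_square inner_commute)
  qed
  \<comment> \<open>The displacement of \<open>y\<close> is \<open>1 - \<gamma>\<close> times the
    corresponding one of \<open>x\<close>. To first order in \<open>\<gamma>\<close> this is the
    ratio of displacements between the unit sphere and its outer parallel sphere at distance
    \<open>\<gamma>\<close>.\<close>
  define s where "s = 1 - \<gamma>"
  have key: "b\<^sup>2 * ((\<alpha> - s *\<^sub>R \<beta>) \<bullet> (\<alpha> - s *\<^sub>R \<beta>)) - b\<^sup>2 * (\<nu> \<bullet> \<alpha>)\<^sup>2 - b * \<gamma> * c * (II x v \<bullet> \<mu>) + b\<^sup>2 * \<gamma> * s\<^sup>2 * (II y w \<bullet> \<nu>) \<ge> 0"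
    if "Dv x v = \<alpha>" "Dv y w = \<beta>" for v w \<alpha> \<beta>
  proof -
    have "b\<^sup>2 * ((\<alpha> - s *\<^sub>R \<beta>) \<bullet> (\<alpha> - s *\<^sub>R \<beta>)) - b\<^sup>2 * \<gamma> * (\<nu> \<bullet> II x v - s\<^sup>2 * (\<nu> \<bullet> II y w)) - (\<alpha> \<bullet> e)\<^sup>2 - b * \<gamma> * (II x v \<bullet> e) \<ge> 0"
      using so(2)[of v "s *\<^sub>R w"] that by (simp add: Dv_scale II_scale \<nu>_def)
    moreover have "\<alpha> \<bullet> e = - b * (\<nu> \<bullet> \<alpha>)" using so(1)[of v 0] that by (simp add: Dv0 \<nu>_def)
    moreover have "b * (\<nu> \<bullet> II x v) + II x v \<bullet> e = c * (II x v \<bullet> \<mu>)"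
    proof -
      have "II x v \<bullet> (b *\<^sub>R \<nu> + e) = II x v \<bullet> (c *\<^sub>R \<mu>)" by (simp add: cm)
      then show ?thesis by (simp add: inner_add_left inner_add_right inner_commute)
    qed
    then have "b * \<gamma> * (b * (\<nu> \<bullet> II x v) + II x v \<bullet> e) = b * \<gamma> * (c * (II x v \<bullet> \<mu>))" by simp
    ultimately show ?thesis by (simp add: power2_eq_square algebra_simps inner_commute)
  qed
  have k1: "b\<^sup>2 * (1 - s)\<^sup>2 - b * \<gamma> * c * (II x v1 \<bullet> \<mu>) + b\<^sup>2 * \<gamma> * s\<^sup>2 * (II y w1 \<bullet> \<nu>) \<ge> 0"
  proof -
    have "(\<xi> - s *\<^sub>R \<xi>) \<bullet> (\<xi> - s *\<^sub>R \<xi>) = (1 - s)\<^sup>2" using \<xi> by (simp add: inner_diff_left inner_diff_right power2_eq_square algebra_simps)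
    moreover have "\<nu> \<bullet> \<xi> = 0" using \<xi> by (simp add: inner_commute)
    ultimately show ?thesis using key[OF v(1) w(1)] by simp
  qed
  have k2: "b\<^sup>2 * (1 + s\<^sup>2 - 2 * s * C) - b\<^sup>2 * (1 - C\<^sup>2) - b * \<gamma> * c * (II x v2 \<bullet> \<mu>) + b\<^sup>2 * \<gamma> * s\<^sup>2 * (II y w2 \<bullet> \<nu>) \<ge> 0"
  proof -
    have "\<xi>2 \<bullet> \<xi>2 = 1" "\<eta>2 \<bullet> \<eta>2 = 1" using fx fy by (auto simp: orthoframe_def)
    then have "(\<xi>2 - s *\<^sub>R \<eta>2) \<bullet> (\<xi>2 - s *\<^sub>R \<eta>2) = 1 + s\<^sup>2 - 2 * s * C"
      using xy by (simp add: inner_diff_left inner_diff_right power2_eq_square algebra_simps inner_commute)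
    then show ?thesis using key[OF v(2) w(2)] nx2 by simp
  qed
  have "b * \<gamma> * c * (II x v1 \<bullet> \<mu>) + b * \<gamma> * c * (II x v2 \<bullet> \<mu>) = b * \<gamma> * c * 2"
    unfolding tx[symmetric] by (simp add: distrib_left)
  moreover have "b\<^sup>2 * \<gamma> * s\<^sup>2 * (II y w1 \<bullet> \<nu>) + b\<^sup>2 * \<gamma> * s\<^sup>2 * (II y w2 \<bullet> \<nu>) = b\<^sup>2 * \<gamma> * s\<^sup>2 * 2"
    unfolding ty[symmetric] by (simp add: distrib_left)
  moreover have "b\<^sup>2 * (1 - s)\<^sup>2 + (b\<^sup>2 * (1 + s\<^sup>2 - 2 * s * C) - b\<^sup>2 * (1 - C\<^sup>2)) = b\<^sup>2 * ((1-s)\<^sup>2 + (C-s)\<^sup>2)"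
    by (simp add: power2_eq_square algebra_simps)
  ultimately have "b\<^sup>2 * ((1-s)\<^sup>2 + (C-s)\<^sup>2) + 2 * b\<^sup>2 * \<gamma> * s\<^sup>2 \<ge> 2 * b * \<gamma> * c" using k1 k2 by simp
  then have "b * \<gamma> * (1 - \<gamma>) \<le> E"
    using two_point_algebra[of b \<gamma> C E c] b \<gamma> C1 C3 cge unfolding s_def by auto
  then show ?thesis by (simp add: E_def \<nu>_def)
qed

end

context cap
begin

text \<open>Above half the height the cap is a graph by Alexandrov reflection. For the graph one maximises
  \<open>z p - (2 / \<tau>) * norm (p - q + \<tau> e)\<close> over pairs of points \<open>p\<close>, \<open>q\<close> of the cap and lets \<open>\<tau>\<close> tend to 0: this
  replaces the usual argument with the Laplacian of \<open>nu\<close>, which needs more than two derivatives of \<open>f\<close>.\<close>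

lemma height_at_most_4: "h \<le> 4"
proof (rule ccontr)
  assume "\<not> h \<le> 4"
  then have h4: "h > 4" by simp
  \<comment> \<open>Strictly between \<open>h/2\<close>, above which reflection holds, and
    \<open>h - 2\<close>, below which the maximising points cannot fall.\<close>
  define t0 where "t0 = h/2 + (h/2 - 2) / 2"
  have t0: "h/2 < t0" "t0 < h - 2" "t0 > 0" using h4 by (auto simp: t0_def field_simps)
  define K where "K = {x \<in> closure \<Omega>. t0 \<le> z x}"
  have czc: "continuous_on (closure \<Omega>) z" by (intro continuous_intros cfO)
  have "closedin (top_of_set (closure \<Omega>)) (closure \<Omega> \<inter> z -` {t0..})" by (rule continuous_closedin_preimage[OF czc]) simp
  then have "compact (closure \<Omega> \<inter> z -` {t0..})" using closedin_compact[OF compact_cl] by blast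
  then have cK: "compact K" by (simp add: K_def Int_def vimage_def)
  have KO: "x \<in> \<Omega>" if "x \<in> K" for x using closure_pos[of x] that t0 by (auto simp: K_def)
  define \<tau> where "\<tau> n = 1 / real (n + 5)" for n
  have \<tau>: "\<tau> n > 0" "\<tau> n \<le> 1/5" for n by (auto simp: \<tau>_def field_simps)
  have \<tau>lim: "\<tau> \<longlonglongrightarrow> 0" unfolding \<tau>_def by (rule LIMSEQ_ignore_initial_segment[OF lim_1_over_n])
  \<comment> \<open>For small \<open>\<tau>\<close> the point at height \<open>\<tau>\<close> above
    \<open>f x\<close> has distance about \<open>\<tau>\<close> times
    \<open>- (nu x \<bullet> e)\<close> from the cap, so in the limit
    \<open>z + 2 * (nu \<bullet> e)\<close> is maximised. The sharp coefficient would be 1; the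
    value 2 makes the final inequality strict.\<close>
  define b where "b n = 2 / \<tau> n" for n
  have b: "b n > 2" for n using \<tau>[of n] by (simp add: b_def field_simps)
  define G where "G n w = z (fst w) - b n * norm (f (fst w) - f (snd w) + \<tau> n *\<^sub>R e)" for n w
  have cf1: "continuous_on (K \<times> closure \<Omega>) (\<lambda>w. f (fst w))" and cf2: "continuous_on (K \<times> closure \<Omega>) (\<lambda>w. f (snd w))"
    by (rule continuous_on_compose2[OF cfO]; auto intro!: continuous_intros simp: K_def)+
  have "\<exists>w\<in>K \<times> closure \<Omega>. \<forall>w'\<in>K \<times> closure \<Omega>. G n w' \<le> G n w" for n
  proof (rule continuous_attains_sup)
    show "compact (K \<times> closure \<Omega>)" by (intro compact_Times cK compact_cl)
    have "xt \<in> closure \<Omega>" using xt closure_subset[of \<Omega>] by auto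
    then have "xt \<in> K" using xt t0 by (simp add: K_def)
    then show "K \<times> closure \<Omega> \<noteq> {}" using \<open>xt \<in> closure \<Omega>\<close> by auto
    show "continuous_on (K \<times> closure \<Omega>) (G n)" unfolding G_def by (intro continuous_intros cf1 cf2)
  qed
  then obtain w where w: "\<And>n. w n \<in> K \<times> closure \<Omega>" "\<And>n w'. w' \<in> K \<times> closure \<Omega> \<Longrightarrow> G n w' \<le> G n (w n)" by metis
  have "compact (K \<times> closure \<Omega>)" by (intro compact_Times cK compact_cl)
  then obtain l r where l: "l \<in> K \<times> closure \<Omega>" and r: "strict_mono r" and lim: "(w \<circ> r) \<longlonglongrightarrow> l"
    using w(1) unfolding compact_def by metis
  define X where "X n = fst (w (r n))" for n
  define Y where "Y n = snd (w (r n))" for n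
  define T where "T n = \<tau> (r n)" for n
  define B where "B n = b (r n)" for n
  have Tlim: "T \<longlonglongrightarrow> 0" using LIMSEQ_subseq_LIMSEQ[OF \<tau>lim r] by (simp add: T_def[abs_def] o_def)
  have T: "T n > 0" "T n \<le> 1/5" for n using \<tau> by (auto simp: T_def)
  have Bn: "B n > 2" "B n = 2 / T n" for n using b by (auto simp: B_def T_def b_def)
  have XK: "X n \<in> K" "Y n \<in> closure \<Omega>" for n using w(1)[of "r n"] by (auto simp: X_def Y_def mem_Times_iff)
  have XO: "X n \<in> \<Omega>" for n using KO XK by blast
  have Gmax: "z x - B n * norm (f x - f y + T n *\<^sub>R e) \<le> z (X n) - B n * norm (f (X n) - f (Y n) + T n *\<^sub>R e)" if "x \<in> K" "y \<in> closure \<Omega>" for x y n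
    using w(2)[of "(x,y)" "r n"] that by (simp add: G_def X_def Y_def B_def T_def)
  define D where "D n = f (X n) - f (Y n) + T n *\<^sub>R e" for n
  define L where "L n = norm (D n)" for n
  have xtK: "xt \<in> K" using xt t0 closure_subset by (auto simp: K_def)
  have ne: "norm e = 1" using e1 by (simp add: norm_eq_1)
  \<comment> \<open>Comparison with the pair \<open>(xt, xt)\<close>, whose value is
    \<open>h - 2\<close>. It keeps \<open>X n\<close> above \<open>t0\<close>, away from the edge of
    \<open>K\<close>, and bounds the distance \<open>L n\<close> by \<open>T n\<close>.\<close>
  have top: "h - 2 \<le> z (X n) - B n * L n" for n
    using Gmax[OF xtK, of xt n] xt subsetD[OF closure_subset[of \<Omega>] xt(1)] T[of n] ne by (simp add: L_def D_def Bn(2))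
  have zX: "z (X n) \<ge> h - 2" for n
  proof -
    have "B n * L n \<ge> 0" using Bn(1)[of n] by (auto simp: L_def)
    then show ?thesis using top[of n] by linarith
  qed
  have LT: "L n \<le> T n" for n
  proof -
    have "B n * L n \<le> 2" using top[of n] hmax[OF XO[of n]] by linarith
    then have "2 * L n \<le> 2 * T n" using T[of n] unfolding Bn(2) by (simp add: field_simps)
    then show ?thesis by simp
  qed
  define x where "x = fst l"
  have limX: "X \<longlonglongrightarrow> x" using tendsto_fst[OF lim] by (simp add: X_def[abs_def] x_def o_def)
  have limY: "Y \<longlonglongrightarrow> snd l" using tendsto_snd[OF lim] by (simp add: Y_def[abs_def] o_def)
  have xK: "x \<in> K" and sK: "snd l \<in> closure \<Omega>" using l by (auto simp: x_def mem_Times_iff)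
  have xO: "x \<in> \<Omega>" using KO xK by blast
  have xb: "x \<in> ball 0 1" using Ob xO by blast
  have fX: "(\<lambda>n. f (X n)) \<longlonglongrightarrow> f x" using isCont_tendsto_compose[OF isCont_f[OF xb] limX] .
  have fYl: "(\<lambda>n. f (Y n)) \<longlonglongrightarrow> f (snd l)" using isCont_tendsto_compose[OF isCont_f limY] sK clO by blast
  have L0: "L \<longlonglongrightarrow> 0" by (rule tendsto_sandwich[OF _ _ tendsto_const Tlim]) (use LT in \<open>auto simp: L_def\<close>)
  then have D0: "D \<longlonglongrightarrow> 0" unfolding L_def by (rule tendsto_norm_zero_cancel)
  have "(\<lambda>n. D n - T n *\<^sub>R e) \<longlonglongrightarrow> 0 - 0 *\<^sub>R e" by (intro tendsto_intros D0 Tlim)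
  then have "(\<lambda>n. f (X n) - f (Y n)) \<longlonglongrightarrow> 0" by (simp add: D_def)
  moreover have "(\<lambda>n. f (X n) - f (Y n)) \<longlonglongrightarrow> f x - f (snd l)" by (intro tendsto_intros fX fYl)
  ultimately have "f x = f (snd l)" using LIMSEQ_unique by fastforce
  then have xl: "snd l = x" using inj_onD[OF injf, of "snd l" x] sK xb clO ball_subset_cball by (metis subsetD)
  have limY: "Y \<longlonglongrightarrow> x" using limY xl by simp
  have fY: "(\<lambda>n. f (Y n)) \<longlonglongrightarrow> f x" using fYl xl by simp
  have nX: "(\<lambda>n. nu (X n)) \<longlonglongrightarrow> nu x" and nY: "(\<lambda>n. nu (Y n)) \<longlonglongrightarrow> nu x"
    using isCont_tendsto_compose[OF isCont_nu[OF xb]] limX limY by blast+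
  have zx: "z x \<ge> h - 2"
  proof (rule LIMSEQ_le_const)
    show "(\<lambda>n. z (X n)) \<longlonglongrightarrow> z x" by (intro tendsto_intros fX)
  qed (use zX in blast)
  have E0: "nu x \<bullet> e < 0"
    using alexandrov_reflection[of "z x"] zx t0 xO unfolding Pt_def by auto
  have YO: "\<forall>\<^sub>F n in sequentially. Y n \<in> \<Omega>" using topological_tendstoD[OF limY oO xO] .
  \<comment> \<open>If the shifted point lay on the cap, the plane halfway between the two points
    would reflect one cap point to another, against Alexandrov reflection. So the norm is
    differentiated away from 0.\<close>
  have Dpos: "L n > 0" if "Y n \<in> \<Omega>" for n
  proof (rule ccontr)
    assume "\<not> L n > 0"
    then have "D n = 0" by (simp add: L_def)
    then have eq: "f (Y n) = f (X n) + T n *\<^sub>R e" by (simp add: D_def algebra_simps)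
    define t where "t = z (X n) + T n / 2"
    have t: "h/2 < t" using zX[of n] t0 T[of n] by (simp add: t_def)
    have "z (Y n) = z (X n) + T n" unfolding eq using e1 by (simp add: inner_add_left)
    then have zt: "z (Y n) > t" and re: "2 * (z (Y n) - t) = T n" using T[of n] by (simp_all add: t_def)
    have "refl_plane e t (f (Y n)) \<in> W" using alexandrov_reflection[OF t] that zt unfolding Pt_def by blast
    moreover have "refl_plane e t (f (Y n)) = f (X n)" unfolding refl_plane_def re by (simp add: eq)
    ultimately show False using W(3) XO[of n] by auto
  qed
  \<comment> \<open>\<open>Y n\<close> is a point of the cap nearest to the shifted point, so the
    connecting vector is normal to the cap.\<close>
  have Dnu: "\<forall>\<^sub>F n in sequentially. D n = (D n \<bullet> nu (Y n)) *\<^sub>R nu (Y n)"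
    using YO
  proof eventually_elim
    case (elim n)
    let ?c = "f (X n) + T n *\<^sub>R e"
    have "\<forall>\<^sub>F y in nhds (Y n). y \<in> \<Omega>" using oO elim by (rule eventually_nhds_in_open)
    then have "\<forall>\<^sub>F y in nhds (Y n). norm (f (Y n) - ?c) \<le> norm (f y - ?c)"
    proof eventually_elim
      case (elim y)
      have "y \<in> closure \<Omega>" using elim closure_subset by blast
      from Gmax[OF XK(1)[of n] this, of n] have "B n * norm (D n) \<le> B n * norm (f (X n) - f y + T n *\<^sub>R e)" by (simp add: D_def)
      then have "norm (D n) \<le> norm (f (X n) - f y + T n *\<^sub>R e)" using Bn(1)[of n] by (simp add: mult_le_cancel_left)
      moreover have "D n = - (f (Y n) - ?c)" "f (X n) - f y + T n *\<^sub>R e = - (f y - ?c)" by (simp_all add: D_def algebra_simps)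
      ultimately show ?case by (metis norm_minus_cancel)
    qed
    then have "f (Y n) - ?c = ((f (Y n) - ?c) \<bullet> nu (Y n)) *\<^sub>R nu (Y n)" by (rule critical_distance[OF Ob[OF elim]])
    moreover have "f (Y n) - ?c = - D n" by (simp add: D_def algebra_simps)
    ultimately show ?case by (metis inner_minus_left minus_minus scaleR_minus_left)
  qed
  obtain \<epsilon> \<phi> gr where g: "good_def_fn \<Omega> x \<epsilon> \<phi> gr" using good_def_fn_exists[OF xO oO Obs] .
  have \<epsilon>: "\<epsilon> > 0" and grc: "isCont gr (f x)" and gr0: "gr (f x) = nu x" using g by (auto simp: good_def_fn_def)
  have nearX: "\<forall>\<^sub>F n in sequentially. f (X n) \<in> ball (f x) \<epsilon>" "\<forall>\<^sub>F n in sequentially. f (Y n) \<in> ball (f x) \<epsilon>"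
    using topological_tendstoD[OF fX open_ball] topological_tendstoD[OF fY open_ball] \<epsilon> by auto
  have "\<forall>\<^sub>F n in sequentially. \<exists>t. 0 < t \<and> t < 1 \<and> gr (f (Y n) + t *\<^sub>R (f (X n) - f (Y n))) \<bullet> (f (X n) - f (Y n)) = 0"
    using nearX YO
  proof eventually_elim
    case (elim n)
    let ?v = "f (X n) - f (Y n)"
    have "\<exists>t>0. t < 1 \<and> \<phi> (f (Y n) + 1 *\<^sub>R ?v) - \<phi> (f (Y n) + 0 *\<^sub>R ?v) = (1 - 0) * (gr (f (Y n) + t *\<^sub>R ?v) \<bullet> ?v)"
    proof (rule MVT2)
      fix t :: real assume t: "0 \<le> t" "t \<le> 1"
      have "f (Y n) + t *\<^sub>R ?v = (1 - t) *\<^sub>R f (Y n) + t *\<^sub>R f (X n)" by (simp add: algebra_simps)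
      then have "f (Y n) + t *\<^sub>R ?v \<in> ball (f x) \<epsilon>" using convexD[OF convex_ball elim(2,1), of "1 - t" t] t by simp
      then show "((\<lambda>t. \<phi> (f (Y n) + t *\<^sub>R ?v)) has_real_derivative (gr (f (Y n) + t *\<^sub>R ?v) \<bullet> ?v)) (at t)"
        by (intro has_real_derivative_gradient_line good_D(1)[OF g])
    qed simp
    moreover have "\<phi> (f (X n)) = 0" "\<phi> (f (Y n)) = 0" using good_D(3)[OF g] elim XO by blast+
    ultimately show ?case by auto
  qed
  then obtain N where N: "\<And>n. n \<ge> N \<Longrightarrow> \<exists>t. 0 < t \<and> t < 1 \<and> gr (f (Y n) + t *\<^sub>R (f (X n) - f (Y n))) \<bullet> (f (X n) - f (Y n)) = 0"
    unfolding eventually_sequentially by blast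
  define s where "s n = (if n \<ge> N then SOME t. 0 < t \<and> t < 1 \<and> gr (f (Y n) + t *\<^sub>R (f (X n) - f (Y n))) \<bullet> (f (X n) - f (Y n)) = 0 else 0)" for n
  have s: "0 < s n \<and> s n < 1 \<and> gr (f (Y n) + s n *\<^sub>R (f (X n) - f (Y n))) \<bullet> (f (X n) - f (Y n)) = 0" if "n \<ge> N" for n
    using someI_ex[OF N[OF that]] that by (simp add: s_def)
  have s01: "\<bar>s n\<bar> \<le> 1" for n using s[of n] by (cases "n \<ge> N") (auto simp: s_def)
  define P where "P n = f (Y n) + s n *\<^sub>R (f (X n) - f (Y n))" for n
  have P: "P \<longlonglongrightarrow> f x"
  proof -
    have "(\<lambda>n. f (X n) - f (Y n)) \<longlonglongrightarrow> 0" using tendsto_diff[OF fX fY] by simp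
    then have "(\<lambda>n. s n *\<^sub>R (f (X n) - f (Y n))) \<longlonglongrightarrow> 0"
      by (rule tendsto_0_le[where K = 1]) (auto intro!: always_eventually mult_left_le_one_le s01)
    from tendsto_add[OF fY this] show ?thesis by (simp add: P_def[abs_def])
  qed
  have grP: "(\<lambda>n. gr (P n)) \<longlonglongrightarrow> nu x" using isCont_tendsto_compose[OF grc P] gr0 by simp
  \<comment> \<open>Both points satisfy the local equation, so by the mean value theorem the secant
    is orthogonal to a gradient taken between them. Gradient and \<open>nu (Y n)\<close> have the
    same limit, and the secant has length at most \<open>2 * T n\<close>; the normal part of the
    secant is thus small compared with \<open>T n\<close>.\<close>
  have ratio: "(\<lambda>n. (f (X n) - f (Y n)) \<bullet> nu (Y n) / T n) \<longlonglongrightarrow> 0"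
  proof (rule tendsto_norm_zero_cancel, rule tendsto_sandwich[OF _ _ tendsto_const])
    have "(\<lambda>n. 2 * norm (nu (Y n) - gr (P n))) \<longlonglongrightarrow> 2 * norm (nu x - nu x)" by (intro tendsto_intros nY grP)
    then show "(\<lambda>n. 2 * norm (nu (Y n) - gr (P n))) \<longlonglongrightarrow> 0" by simp
    show "\<forall>\<^sub>F n in sequentially. norm ((f (X n) - f (Y n)) \<bullet> nu (Y n) / T n) \<le> 2 * norm (nu (Y n) - gr (P n))"
      using eventually_ge_at_top[of N]
    proof eventually_elim
      case (elim n)
      let ?v = "f (X n) - f (Y n)"
      have "?v \<bullet> gr (P n) = 0" using s[OF elim] by (simp add: P_def inner_commute)
      then have "?v \<bullet> nu (Y n) = ?v \<bullet> (nu (Y n) - gr (P n))" by (simp add: inner_diff_right)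
      then have "\<bar>?v \<bullet> nu (Y n)\<bar> \<le> norm ?v * norm (nu (Y n) - gr (P n))" using Cauchy_Schwarz_ineq2 by metis
      moreover have "norm ?v \<le> 2 * T n"
      proof -
        have "?v = D n - T n *\<^sub>R e" by (simp add: D_def)
        then have "norm ?v \<le> norm (D n) + norm (T n *\<^sub>R e)" by (metis norm_triangle_ineq4)
        then show ?thesis using LT[of n] T[of n] ne by (simp add: L_def)
      qed
      then have "norm ?v * norm (nu (Y n) - gr (P n)) \<le> 2 * T n * norm (nu (Y n) - gr (P n))" by (intro mult_right_mono) auto
      ultimately show ?case using T[of n] by (simp add: field_simps)
    qed
  qed auto
  \<comment> \<open>The signed distance divided by the shift. Its limit, the vertical component of
    the normal, makes the penalty a quantity of the limit point alone.\<close>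
  define q where "q n = (D n \<bullet> nu (Y n)) / T n" for n
  have q: "q \<longlonglongrightarrow> nu x \<bullet> e"
  proof -
    have "q = (\<lambda>n. (f (X n) - f (Y n)) \<bullet> nu (Y n) / T n + e \<bullet> nu (Y n))"
      using T by (simp add: fun_eq_iff q_def D_def inner_add_left add_divide_distrib less_imp_neq[symmetric])
    moreover have "(\<lambda>n. (f (X n) - f (Y n)) \<bullet> nu (Y n) / T n + e \<bullet> nu (Y n)) \<longlonglongrightarrow> 0 + e \<bullet> nu x"
      by (intro tendsto_intros ratio nY)
    ultimately have "q \<longlonglongrightarrow> e \<bullet> nu x" by simp
    then show ?thesis by (simp add: inner_commute)
  qed
  have qneg: "\<forall>\<^sub>F n in sequentially. q n < (nu x \<bullet> e) / 2" by (rule order_tendstoD(2)[OF q]) (use E0 in simp)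
  have C1: "\<forall>\<^sub>F n in sequentially. nu (X n) \<bullet> nu (Y n) > 1/2"
    by (rule order_tendstoD(1)[OF tendsto_inner[OF nX nY]]) (use nun[OF xb] in simp)
  have Tsmall: "\<forall>\<^sub>F n in sequentially. T n < - (nu x \<bullet> e)" by (rule order_tendstoD(2)[OF Tlim]) (use E0 in simp)
  have main: "\<forall>\<^sub>F n in sequentially. 2 * (- q n) * (1 - T n * (- q n)) \<le> - (nu (Y n) \<bullet> e)"
    using YO Dnu qneg C1 Tsmall
  proof eventually_elim
    case (elim n)
    note Yn = Ob[OF elim(1)]
    have Tq: "D n \<bullet> nu (Y n) = T n * q n" using T[of n] by (simp add: q_def)
    have neg: "q n < 0" using elim(3) E0 by linarith
    have "norm (nu (Y n)) = 1" using nun[OF Yn] by (simp add: norm_eq_1)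
    then have "L n = \<bar>T n * q n\<bar>" using elim(2) Tq unfolding L_def by (metis mult.right_neutral norm_scaleR)
    then have Ln: "L n = T n * (- q n)" using neg T[of n] by (simp add: abs_mult)
    have Deq: "D n = - L n *\<^sub>R nu (Y n)" using elim(2) Tq Ln by (metis minus_minus mult_minus_right)
    have "B n * L n * (1 - L n) \<le> - (nu (Y n) \<bullet> e)"
    proof (rule two_point_estimate[OF Ob[OF XO[of n]] Yn e1 Bn(1)[of n]])
      show "0 < L n" by (rule Dpos[OF elim(1)])
      show "L n < 1" using LT[of n] T[of n] by simp
      show "f (X n) - f (Y n) + T n *\<^sub>R e = - L n *\<^sub>R nu (Y n)" using Deq by (simp add: D_def)
      show "1/2 < nu (X n) \<bullet> nu (Y n)" using elim by simp
      have "1 / (B n - 1)\<^sup>2 \<le> (T n)\<^sup>2"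
      proof -
        have "1 / T n \<le> B n - 1" using T[of n] by (simp add: Bn(2) field_simps)
        then have "(1 / T n)\<^sup>2 \<le> (B n - 1)\<^sup>2" using T[of n] by (intro power_mono) auto
        then have "1 / (B n - 1)\<^sup>2 \<le> 1 / (1 / T n)\<^sup>2" using T[of n] by (intro divide_left_mono) (auto intro!: mult_pos_pos simp: Bn(2) field_simps)
        then show ?thesis by (simp add: power_divide)
      qed
      also have "(T n)\<^sup>2 \<le> 2 * L n"
      proof -
        have "T n * T n \<le> T n * (2 * (- q n))" using elim(3,5) T[of n] by (intro mult_left_mono) auto
        then show ?thesis by (simp add: Ln power2_eq_square)
      qed
      finally show "1 / (B n - 1)\<^sup>2 \<le> 2 * L n" .
      have "\<forall>\<^sub>F u in nhds (X n, Y n). u \<in> {u \<in> \<Omega>. z u > t0} \<times> \<Omega>"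
      proof (rule eventually_nhds_in_open)
        have "open {u \<in> \<Omega>. z u > t0}"
          using continuous_open_preimage[OF continuous_on_subset[OF czc closure_subset] oO, of "{t0<..}"] by (simp add: Int_def vimage_def)
        then show "open ({u \<in> \<Omega>. z u > t0} \<times> \<Omega>)" using oO by (rule open_Times)
        show "(X n, Y n) \<in> {u \<in> \<Omega>. z u > t0} \<times> \<Omega>" using XO zX[of n] t0 elim(1) by auto
      qed
      then show "\<forall>\<^sub>F u in nhds (X n, Y n). z (fst u) - B n * norm (f (fst u) - f (snd u) + T n *\<^sub>R e) \<le> z (X n) - B n * L n"
      proof eventually_elim
        case (elim u)
        then have "fst u \<in> K" "snd u \<in> closure \<Omega>" using closure_subset by (auto simp: K_def mem_Times_iff)
        from Gmax[OF this, of n] show ?case by (simp add: L_def D_def)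
      qed
    qed
    moreover have "B n * L n = 2 * (- q n)" using T[of n] by (simp add: Bn(2) Ln)
    ultimately have "2 * (- q n) * (1 - L n) \<le> - (nu (Y n) \<bullet> e)" by (simp only:)
    then show ?case by (simp only: Ln)
  qed
  have l1: "(\<lambda>n. 2 * (- q n) * (1 - T n * (- q n))) \<longlonglongrightarrow> 2 * (- (nu x \<bullet> e)) * (1 - 0 * (- (nu x \<bullet> e)))" by (intro tendsto_intros q Tlim)
  have l2: "(\<lambda>n. - (nu (Y n) \<bullet> e)) \<longlonglongrightarrow> - (nu x \<bullet> e)" by (intro tendsto_intros nY)
  \<comment> \<open>A positive number would be at least twice itself.\<close>
  have "2 * (- (nu x \<bullet> e)) * (1 - 0 * (- (nu x \<bullet> e))) \<le> - (nu x \<bullet> e)"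
    by (rule tendsto_le[OF _ l2 l1 main]) simp
  then show False using E0 by simp
qed

end

section \<open>Winding numbers and zeros of planar maps\<close>

lemma path_logarithm:
  fixes p :: "real \<Rightarrow> complex"
  assumes "path p" "0 \<notin> path_image p"
  obtains q where "path q" "\<And>t. t \<in> {0..1} \<Longrightarrow> p t = exp (q t)"
    "winding_number p 0 = (q 1 - q 0) / (2 * of_real pi * \<i>)"
proof -
  obtain q where q: "continuous_on {0..1} q" "\<And>t. t \<in> {0..1} \<Longrightarrow> p t = exp (q t)"
  proof (rule continuous_logarithm_on_contractible[of "{0..1::real}" p])
    show "continuous_on {0..1} p" using assms by (simp add: path_def)
    show "contractible {0..1::real}" by (intro convex_imp_contractible) auto
    show "p z \<noteq> 0" if "z \<in> {0..1}" for z using assms(2) that by (auto simp: path_image_def image_iff)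
  qed blast
  have pq: "path q" using q(1) by (simp add: path_def)
  have "winding_number p 0 = winding_number (exp \<circ> q) 0" by (rule winding_number_cong) (use q(2) in auto)
  then show thesis using winding_number_compose_exp[OF pq] q(2) pq that by (simp add: pathfinish_def pathstart_def)
qed

lemma winding_number_times_path:
  fixes p q :: "real \<Rightarrow> complex"
  assumes "path p" "0 \<notin> path_image p" "path q" "0 \<notin> path_image q"
  shows "winding_number (\<lambda>t. p t * q t) 0 = winding_number p 0 + winding_number q 0"
proof -
  obtain P where P: "path P" "\<And>t. t \<in> {0..1} \<Longrightarrow> p t = exp (P t)" "winding_number p 0 = (P 1 - P 0) / (2 * of_real pi * \<i>)"
    using path_logarithm[OF assms(1,2)] by blast
  obtain Q where Q: "path Q" "\<And>t. t \<in> {0..1} \<Longrightarrow> q t = exp (Q t)" "winding_number q 0 = (Q 1 - Q 0) / (2 * of_real pi * \<i>)"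
    using path_logarithm[OF assms(3,4)] by blast
  have "path (\<lambda>t. P t + Q t)" using P(1) Q(1) unfolding path_def by (intro continuous_intros)
  note w = winding_number_compose_exp[OF this]
  have "winding_number (\<lambda>t. p t * q t) 0 = winding_number (exp \<circ> (\<lambda>t. P t + Q t)) 0"
    by (rule winding_number_cong) (use P(2) Q(2) in \<open>auto simp: exp_add\<close>)
  then show ?thesis unfolding w P(3) Q(3) by (simp add: pathfinish_def pathstart_def diff_divide_distrib add_divide_distrib)
qed

lemma winding_number_cnj_path:
  assumes "path p" "0 \<notin> path_image p" "pathfinish p = pathstart p"
  shows "winding_number (\<lambda>t. cnj (p t)) 0 = - winding_number p 0"
proof -
  obtain P where P: "path P" "\<And>t. t \<in> {0..1} \<Longrightarrow> p t = exp (P t)" "winding_number p 0 = (P 1 - P 0) / (2 * of_real pi * \<i>)"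
    using path_logarithm[OF assms(1,2)] by blast
  have "path (\<lambda>t. cnj (P t))" using P(1) unfolding path_def by (intro continuous_intros)
  note w = winding_number_compose_exp[OF this]
  have "winding_number (\<lambda>t. cnj (p t)) 0 = winding_number (exp \<circ> (\<lambda>t. cnj (P t))) 0"
    by (rule winding_number_cong) (use P(2) in \<open>auto simp: exp_cnj\<close>)
  also have "\<dots> = cnj (- winding_number p 0)" unfolding w P(3) by (simp add: pathfinish_def pathstart_def)
  also have "\<dots> = - winding_number p 0"
    using integer_winding_number[OF assms(1,3,2)] by (auto simp: Ints_def)
  finally show ?thesis .
qed

section \<open>Signed simple zeros and an argument principle for continuous maps\<close>

definition cfac :: "int \<Rightarrow> complex \<Rightarrow> complex \<Rightarrow> complex" where
  "cfac s a w = (if s = 1 then w - a else cnj (w - a))"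

lemma cfac_eq_0 [simp]: "cfac s a w = 0 \<longleftrightarrow> w = a" by (auto simp: cfac_def)

lemma continuous_on_cfac [continuous_intros]: "continuous_on S g \<Longrightarrow> continuous_on S (\<lambda>w. cfac s a (g w))"
  by (cases "s = 1") (auto simp: cfac_def intro!: continuous_intros)

lemma winding_number_cfac:
  assumes "path L" "a \<notin> path_image L" "pathfinish L = pathstart L" "s = 1 \<or> s = -1"
  shows "winding_number (\<lambda>t. cfac s a (L t)) 0 = of_int s * winding_number L a"
proof -
  have p: "path (\<lambda>t. L t - a)" "0 \<notin> path_image (\<lambda>t. L t - a)" "pathfinish (\<lambda>t. L t - a) = pathstart (\<lambda>t. L t - a)"
    using assms by (auto simp: path_def path_image_def pathfinish_def pathstart_def intro!: continuous_intros)
  from assms(4) show ?thesis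
  proof
    assume "s = 1" then show ?thesis by (simp add: cfac_def winding_number_offset[of L a])
  next
    assume "s = -1" then show ?thesis using winding_number_cnj_path[OF p] by (simp add: cfac_def winding_number_offset[of L a])
  qed
qed

text \<open>A condition of Rouche type: near \<open>a\<close> the map is closer to the model
  \<open>q w * cfac s a w\<close> than the model is to 0, with \<open>q\<close> continuous and
  non-zero also at \<open>a\<close>. It passes to quotients by factors \<open>cfac\<close> at other
  zeros and says nothing about derivatives, so it suits maps that are merely continuous.\<close>

definition simple_zero :: "(complex \<Rightarrow> complex) \<Rightarrow> int \<Rightarrow> complex \<Rightarrow> bool" where
  "simple_zero F s a \<longleftrightarrow> (\<exists>\<delta>>0. \<exists>q. continuous_on (ball a \<delta>) q \<and>
     (\<forall>w\<in>ball a \<delta>. q w \<noteq> 0 \<and> (w \<noteq> a \<longrightarrow> cmod (F w - q w * cfac s a w) < cmod (q w * cfac s a w))))"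

lemma simple_zero_divide:
  assumes z: "simple_zero F s a" and ab: "a \<noteq> b" and r: "0 < r" "dist a b > r"
    and G: "\<And>w. dist w b > r \<Longrightarrow> G w = F w / cfac u b w"
  shows "simple_zero G s a"
proof -
  obtain \<delta> q where d: "\<delta> > 0" "continuous_on (ball a \<delta>) q"
    "\<And>w. w \<in> ball a \<delta> \<Longrightarrow> q w \<noteq> 0 \<and> (w \<noteq> a \<longrightarrow> cmod (F w - q w * cfac s a w) < cmod (q w * cfac s a w))"
    using z unfolding simple_zero_def by blast
  define \<delta>' where "\<delta>' = min \<delta> (dist a b - r)"
  have far: "dist w b > r" "w \<in> ball a \<delta>" if "w \<in> ball a \<delta>'" for w
    using that dist_triangle[of a b w] by (auto simp: \<delta>'_def)
  then have wb: "w \<noteq> b" if "w \<in> ball a \<delta>'" for w using that r by force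
  show ?thesis unfolding simple_zero_def
  proof (intro exI[of _ \<delta>'] conjI exI[of _ "\<lambda>w. q w / cfac u b w"] ballI impI)
    show "\<delta>' > 0" using d r by (simp add: \<delta>'_def)
    show "continuous_on (ball a \<delta>') (\<lambda>w. q w / cfac u b w)"
      by (intro continuous_intros continuous_on_subset[OF d(2)]) (auto simp: wb \<delta>'_def)
    fix w assume w: "w \<in> ball a \<delta>'"
    show "q w / cfac u b w \<noteq> 0" using d(3)[OF far(2)[OF w]] wb[OF w] by simp
    assume "w \<noteq> a"
    then have *: "cmod (F w - q w * cfac s a w) < cmod (q w * cfac s a w)" using d(3)[OF far(2)[OF w]] by blast
    have "G w - q w / cfac u b w * cfac s a w = (F w - q w * cfac s a w) / cfac u b w"
      unfolding G[OF far(1)[OF w]] by (simp add: diff_divide_distrib)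
    moreover have "q w / cfac u b w * cfac s a w = (q w * cfac s a w) / cfac u b w" by simp
    ultimately show "cmod (G w - q w / cfac u b w * cfac s a w) < cmod (q w / cfac u b w * cfac s a w)"
      using * wb[OF w] by (simp add: norm_divide divide_strict_right_mono)
  qed
qed

text \<open>The quotient of \<open>F\<close> by \<open>cfac\<close> need not have a limit at
  \<open>b\<close>, but it is closer to \<open>q\<close> than \<open>q\<close> is to 0. On a small
  disk it is interpolated with \<open>q\<close>, linearly in the distance from \<open>b\<close>;
  such convex combinations are non-zero.\<close>

lemma remove_zero:
  assumes oD: "open D" and cF: "continuous_on D F" and bD: "b \<in> D" and Fb: "F b = 0"
    and z: "simple_zero F s b" and \<rho>: "\<rho> > 0"
  obtains G r where "continuous_on D G" "0 < r" "r < \<rho>" "\<And>w. dist w b > r \<Longrightarrow> G w = F w / cfac s b w"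
    "\<And>w. dist w b \<le> r \<Longrightarrow> w \<in> D \<and> G w \<noteq> 0"
proof -
  obtain \<delta> q where d: "\<delta> > 0" "continuous_on (ball b \<delta>) q"
    "\<And>w. w \<in> ball b \<delta> \<Longrightarrow> q w \<noteq> 0 \<and> (w \<noteq> b \<longrightarrow> cmod (F w - q w * cfac s b w) < cmod (q w * cfac s b w))"
    using z unfolding simple_zero_def by blast
  obtain \<eta> where \<eta>: "\<eta> > 0" "ball b \<eta> \<subseteq> D" using oD bD open_contains_ball by blast
  define r where "r = min \<rho> (min \<delta> \<eta>) / 2"
  have r: "0 < r" "r < \<rho>" "r < \<delta>" "r < \<eta>" using d \<eta> \<rho> by (auto simp: r_def min_def)
  have sub: "cball b r \<subseteq> D" "cball b r \<subseteq> ball b \<delta>" using r \<eta> by (auto simp: subset_iff)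
  define Q where "Q w = F w / cfac s b w" for w
  define X where "X w = dist w b / r" for w
  define I where "I w = of_real (X w) * Q w + of_real (1 - X w) * q w" for w
  have Qq: "cmod (Q w - q w) < cmod (q w)" if "w \<in> ball b \<delta>" "w \<noteq> b" for w
  proof -
    have "cmod (F w - q w * cfac s b w) < cmod (q w * cfac s b w)" using d(3) that by blast
    moreover have "F w - q w * cfac s b w = (Q w - q w) * cfac s b w" using that by (simp add: Q_def left_diff_distrib)
    ultimately show ?thesis using that by (simp add: norm_mult)
  qed
  define G where "G w = (if dist w b \<le> r then I w else Q w)" for w
  have cQ: "continuous_on (D - {b}) Q" unfolding Q_def by (intro continuous_intros continuous_on_subset[OF cF]) auto
  have cI1: "continuous_on (cball b r - {b}) I" unfolding I_def X_def
    by (intro continuous_intros continuous_on_subset[OF cQ] continuous_on_subset[OF d(2)]) (use r sub in auto)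
  have Ib: "(I \<longlongrightarrow> I b) (at b within cball b r)"
  proof -
    have cqb: "(q \<longlongrightarrow> q b) (at b within cball b r)"
    proof -
      have "continuous_on (cball b r) q" by (rule continuous_on_subset[OF d(2)]) (use sub in auto)
      then show ?thesis using r by (auto simp: continuous_on_def)
    qed
    have X0: "(X \<longlongrightarrow> 0) (at b within cball b r)" unfolding X_def by (rule tendsto_eq_rhs, (rule tendsto_intros)+) (use r in auto)
    have t2: "((\<lambda>w. of_real (1 - X w) * q w) \<longlongrightarrow> of_real (1 - 0) * q b) (at b within cball b r)"
      by (intro tendsto_intros X0 cqb)
    have t1: "((\<lambda>w. of_real (X w) * Q w) \<longlongrightarrow> 0) (at b within cball b r)"
    proof (rule Lim_null_comparison)
      show "((\<lambda>w. \<bar>X w\<bar> * (2 * cmod (q w))) \<longlongrightarrow> 0) (at b within cball b r)"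
        by (rule tendsto_eq_rhs, (rule tendsto_intros X0 cqb)+) simp
      show "\<forall>\<^sub>F w in at b within cball b r. cmod (of_real (X w) * Q w) \<le> \<bar>X w\<bar> * (2 * cmod (q w))"
        unfolding eventually_at
      proof (intro exI[of _ r] conjI ballI impI)
        fix w assume "w \<in> cball b r" "w \<noteq> b \<and> dist w b < r"
        then have "cmod (Q w - q w) < cmod (q w)" using sub Qq by blast
        then have "cmod (Q w) \<le> 2 * cmod (q w)" using norm_triangle_sub[of "Q w" "q w"] by simp
        then show "cmod (of_real (X w) * Q w) \<le> \<bar>X w\<bar> * (2 * cmod (q w))" by (simp add: norm_mult mult_left_mono)
      qed (use r in auto)
    qed
    have "I b = 0 + of_real (1 - 0) * q b" by (simp add: I_def X_def)
    then show ?thesis using tendsto_add[OF t1 t2] unfolding I_def by simp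
  qed
  have cI: "continuous_on (cball b r) I"
  proof -
    have "(I \<longlongrightarrow> I w) (at w within cball b r)" if "w \<in> cball b r" for w
    proof (cases "w = b")
      case True then show ?thesis using Ib by simp
    next
      case False
      have "(I \<longlongrightarrow> I w) (at w within cball b r - {b})" using cI1 that False by (auto simp: continuous_on_def)
      moreover have "at w within cball b r - {b} = at w within cball b r"
        by (rule at_within_nhd[of w "- {b}"]) (use False in auto)
      ultimately show ?thesis by simp
    qed
    then show ?thesis by (auto simp: continuous_on_def)
  qed
  have cG: "continuous_on D G"
  proof -
    have DD: "D = cball b r \<union> (D - ball b r)" using sub by auto
    have "continuous_on (cball b r \<union> (D - ball b r)) (\<lambda>w. if dist w b \<le> r then I w else Q w)"
    proof (rule continuous_on_cases_local)
      show "closedin (top_of_set (cball b r \<union> (D - ball b r))) (cball b r)" by (rule closed_subset) auto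
      have "closedin (top_of_set D) (D - ball b r)" using closedin_closed_Int[of "- ball b r" D] by (simp add: Diff_eq closed_Compl)
      then show "closedin (top_of_set (cball b r \<union> (D - ball b r))) (D - ball b r)" unfolding DD[symmetric] .
      show "continuous_on (D - ball b r) Q" by (rule continuous_on_subset[OF cQ]) (use r in auto)
      show "I x = Q x" if "x \<in> cball b r \<and> \<not> dist x b \<le> r \<or> x \<in> D - ball b r \<and> dist x b \<le> r" for x
      proof -
        have "dist x b = r" using that by (auto simp: dist_commute)
        then show ?thesis using r by (simp add: I_def X_def)
      qed
    qed (rule cI)
    then show ?thesis unfolding G_def DD[symmetric] .
  qed
  show thesis
  proof (rule that[OF cG r(1,2)])
    fix w assume "dist w b > r" then show "G w = F w / cfac s b w" by (simp add: G_def Q_def)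
  next
    fix w assume w: "dist w b \<le> r"
    then have wD: "w \<in> cball b r" by (simp add: dist_commute)
    then have qw: "q w \<noteq> 0" using d(3) sub by blast
    have X01: "0 \<le> X w" "X w \<le> 1" using w r by (auto simp: X_def field_simps)
    have "I w \<noteq> 0"
    proof (cases "w = b")
      case True then show ?thesis using qw by (simp add: I_def X_def)
    next
      case False
      have "I w = q w + of_real (X w) * (Q w - q w)" by (simp add: I_def algebra_simps)
      moreover have "cmod (of_real (X w) * (Q w - q w)) < cmod (q w)"
      proof -
        have "cmod (of_real (X w) * (Q w - q w)) \<le> cmod (Q w - q w)" using X01 by (simp add: norm_mult mult_left_le_one_le)
        also have "\<dots> < cmod (q w)" using Qq[OF _ False] wD sub by blast
        finally show ?thesis .
      qed
      ultimately show ?thesis by (metis add.inverse_unique less_irrefl norm_minus_cancel)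
    qed
    then show "w \<in> D \<and> G w \<noteq> 0" using w wD sub by (auto simp: G_def)
  qed
qed

text \<open>Zeros are divided out one at a time, each factor \<open>cfac\<close> contributing its
  sign times the winding number of \<open>L\<close> around it. Once no zero is left, the map has a
  logarithm on the contractible set and contributes 0.\<close>

lemma winding_number_sum_zeros:
  assumes oD: "open D" and conD: "contractible D" and L: "path L" "pathfinish L = pathstart L" "path_image L \<subseteq> D"
    and fZ: "finite Z"
  shows "\<lbrakk>continuous_on D F; {w\<in>D. F w = 0} = Z; path_image L \<inter> Z = {};
    \<And>a. a \<in> Z \<Longrightarrow> (s a = 1 \<or> s a = -1) \<and> simple_zero F (s a) a\<rbrakk>
    \<Longrightarrow> winding_number (F \<circ> L) 0 = (\<Sum>a\<in>Z. of_int (s a) * winding_number L a)"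
  using fZ
proof (induction Z arbitrary: F rule: finite_induct)
  case empty
  obtain g where g: "continuous_on D g" "\<And>x. x \<in> D \<Longrightarrow> F x = exp (g x)"
    by (rule continuous_logarithm_on_contractible[OF empty.prems(1) conD]) (use empty.prems(2) in auto)
  have p: "path (g \<circ> L)" by (rule path_continuous_image[OF L(1) continuous_on_subset[OF g(1) L(3)]])
  have "winding_number (F \<circ> L) 0 = winding_number (exp \<circ> (g \<circ> L)) 0"
    by (rule winding_number_cong) (use g(2) L(3) in \<open>auto simp: path_image_def image_subset_iff\<close>)
  then show ?case using winding_number_compose_exp[OF p] L(2) by (simp add: pathfinish_def pathstart_def o_def)
next
  case (insert b Z)
  have b: "b \<in> D" "F b = 0" using insert.prems(2) by auto
  have sb: "s b = 1 \<or> s b = -1" "simple_zero F (s b) b" using insert.prems(4) by auto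
  have "open (- (path_image L \<union> Z))" using closed_path_image[OF L(1)] finite_imp_closed[OF insert.hyps(1)] by auto
  moreover have "b \<in> - (path_image L \<union> Z)" using insert.hyps(2) insert.prems(3) by auto
  ultimately obtain \<rho> where \<rho>: "\<rho> > 0" "ball b \<rho> \<subseteq> - (path_image L \<union> Z)" using open_contains_ball by blast
  obtain G r where G: "continuous_on D G" "0 < r" "r < \<rho>" "\<And>w. dist w b > r \<Longrightarrow> G w = F w / cfac (s b) b w"
    "\<And>w. dist w b \<le> r \<Longrightarrow> w \<in> D \<and> G w \<noteq> 0"
    using remove_zero[OF oD insert.prems(1) b sb(2) \<rho>(1)] by blast
  have far: "dist w b > r" if "w \<in> path_image L \<union> Z" for w
  proof -
    have "w \<notin> ball b \<rho>" using \<rho> that by blast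
    then show ?thesis using G(3) by (simp add: dist_commute)
  qed
  have ZG: "{w \<in> D. G w = 0} = Z"
  proof (intro set_eqI iffI)
    fix w assume w: "w \<in> {w \<in> D. G w = 0}"
    then have "dist w b > r" using G(5)[of w] by force
    then have "w \<noteq> b" "F w = 0" using w G(4)[of w] G(2) by auto
    then show "w \<in> Z" using insert.prems(2) w by auto
  next
    fix w assume w: "w \<in> Z"
    then have "w \<in> D" "F w = 0" using insert.prems(2) by auto
    then show "w \<in> {w \<in> D. G w = 0}" using G(4)[OF far] w by simp
  qed
  have IH: "winding_number (G \<circ> L) 0 = (\<Sum>a\<in>Z. of_int (s a) * winding_number L a)"
  proof (rule insert.IH[OF G(1) ZG])
    show "path_image L \<inter> Z = {}" using insert.prems(3) by auto
    fix a assume a: "a \<in> Z"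
    then have "a \<noteq> b" using insert.hyps by auto
    then show "(s a = 1 \<or> s a = -1) \<and> simple_zero G (s a) a"
      using insert.prems(4)[of a] a simple_zero_divide[OF _ _ G(2) far G(4), of "s a" a] by auto
  qed
  have Lt: "L t \<in> path_image L" if "t \<in> {0..1}" for t using that by (auto simp: path_image_def)
  have "winding_number (F \<circ> L) 0 = winding_number (\<lambda>t. (G \<circ> L) t * cfac (s b) b (L t)) 0"
  proof (rule winding_number_cong)
    fix t :: real assume "0 \<le> t" "t \<le> 1"
    then have "dist (L t) b > r" using far Lt by auto
    then show "(F \<circ> L) t = (G \<circ> L) t * cfac (s b) b (L t)" using G(4) G(2) by auto
  qed
  also have "\<dots> = winding_number (G \<circ> L) 0 + winding_number (\<lambda>t. cfac (s b) b (L t)) 0"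
  proof (rule winding_number_times_path)
    show "path (G \<circ> L)" by (rule path_continuous_image[OF L(1) continuous_on_subset[OF G(1) L(3)]])
    show "0 \<notin> path_image (G \<circ> L)"
    proof
      assume "0 \<in> path_image (G \<circ> L)"
      then obtain w where "w \<in> path_image L" "G w = 0" unfolding path_image_compose by auto
      then have "w \<in> Z" using ZG L(3) by auto
      then show False using insert.prems(3) \<open>w \<in> path_image L\<close> by auto
    qed
    show "path (\<lambda>t. cfac (s b) b (L t))" using L(1) unfolding path_def by (intro continuous_intros)
    show "0 \<notin> path_image (\<lambda>t. cfac (s b) b (L t))" using insert.prems(3) by (auto simp: path_image_def dest: sym)
  qed
  also have "winding_number (\<lambda>t. cfac (s b) b (L t)) 0 = of_int (s b) * winding_number L b"
    using insert.prems(3) by (intro winding_number_cfac L sb) auto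
  finally show ?case using IH insert.hyps by (simp add: o_def)
qed

text \<open>\<open>p\<close> and \<open>q\<close> are the Wirtinger coefficients: the derivative is
  \<open>p * h + q * cnj h\<close>. The determinant is the difference of the squares of their
  moduli, so its sign tells which term dominates, and the dominant one is the model.\<close>

lemma simple_zero_if_det:
  assumes D: "(F has_derivative (\<lambda>h. of_real (Re h) * \<alpha> + of_real (Im h) * \<beta>)) (at a)" and Fa: "F a = 0"
    and det: "Re \<alpha> * Im \<beta> - Im \<alpha> * Re \<beta> \<noteq> 0"
  shows "simple_zero F (if Re \<alpha> * Im \<beta> - Im \<alpha> * Re \<beta> > 0 then 1 else -1) a"
proof -
  define p where "p = (\<alpha> - \<i> * \<beta>) / 2"
  define q where "q = (\<alpha> + \<i> * \<beta>) / 2"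
  define s :: int where "s = (if Re \<alpha> * Im \<beta> - Im \<alpha> * Re \<beta> > 0 then 1 else -1)"
  define u where "u = (if s = 1 then p else q)"
  define v where "v = (if s = 1 then q else p)"
  have dpq: "(cmod p)\<^sup>2 - (cmod q)\<^sup>2 = Re \<alpha> * Im \<beta> - Im \<alpha> * Re \<beta>"
    unfolding cmod_power2 by (simp add: p_def q_def power2_eq_square field_simps)
  have uv: "cmod v < cmod u"
  proof (rule power_less_imp_less_base[where n = 2])
    show "(cmod v)\<^sup>2 < (cmod u)\<^sup>2" using dpq det by (auto simp: u_def v_def s_def split: if_splits)
  qed simp
  have lin: "of_real (Re h) * \<alpha> + of_real (Im h) * \<beta> = p * h + q * cnj h" for h
    by (simp add: p_def q_def complex_eq_iff field_simps)
  have lin2: "p * (w - a) + q * cnj (w - a) - u * cfac s a w = v * (if s = 1 then cnj (w - a) else w - a)" for w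
    by (simp add: u_def v_def cfac_def)
  define \<epsilon> where "\<epsilon> = (cmod u - cmod v) / 2"
  have "\<epsilon> > 0" using uv by (simp add: \<epsilon>_def)
  then obtain \<delta> where \<delta>: "\<delta> > 0" "\<And>w. norm (w - a) < \<delta> \<Longrightarrow>
     norm (F w - F a - (of_real (Re (w - a)) * \<alpha> + of_real (Im (w - a)) * \<beta>)) \<le> \<epsilon> * norm (w - a)"
    using D unfolding has_derivative_at_alt by blast
  have "simple_zero F s a" unfolding simple_zero_def
  proof (intro exI[of _ \<delta>] conjI exI[of _ "\<lambda>w. u"] ballI impI)
    show "u \<noteq> 0" using uv by auto
    fix w assume "w \<in> ball a \<delta>" "w \<noteq> a"
    then have wa: "norm (w - a) < \<delta>" "norm (w - a) > 0" by (auto simp: dist_norm norm_minus_commute)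
    have "F w - u * cfac s a w = (F w - F a - (p * (w - a) + q * cnj (w - a))) + v * (if s = 1 then cnj (w - a) else w - a)"
      using lin2[of w] Fa by (simp add: algebra_simps)
    then have "cmod (F w - u * cfac s a w) \<le> cmod (F w - F a - (p * (w - a) + q * cnj (w - a))) + cmod (v * (if s = 1 then cnj (w - a) else w - a))"
      by (simp only: norm_triangle_ineq)
    also have "\<dots> \<le> \<epsilon> * norm (w - a) + cmod v * norm (w - a)"
      using \<delta>(2)[OF wa(1)] unfolding lin by (intro add_mono) (auto simp: norm_mult simp flip: complex_cnj_diff)
    also have "\<dots> = (\<epsilon> + cmod v) * norm (w - a)" by (simp add: distrib_right)
    also have "\<dots> < cmod u * norm (w - a)" using uv wa by (intro mult_strict_right_mono) (auto simp: \<epsilon>_def field_simps)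
    also have "\<dots> = cmod (u * cfac s a w)" by (auto simp: norm_mult cfac_def simp flip: complex_cnj_diff)
    finally show "cmod (F w - u * cfac s a w) < cmod (u * cfac s a w)" .
  qed (use \<delta> in auto)
  then show ?thesis by (simp add: s_def)
qed

section \<open>Counting integer crossings of a real function\<close>

lemma floor_constant_if_no_integer:
  fixes k :: "real \<Rightarrow> real"
  assumes "continuous_on {a..b} k" "a \<le> b" "\<And>t. t \<in> {a..b} \<Longrightarrow> k t \<notin> \<int>"
  shows "\<lfloor>k a\<rfloor> = \<lfloor>k b\<rfloor>"
proof (rule ccontr)
  assume ne: "\<lfloor>k a\<rfloor> \<noteq> \<lfloor>k b\<rfloor>"
  have "\<exists>m::int. (k a \<le> m \<and> m \<le> k b) \<or> (k b \<le> m \<and> m \<le> k a)"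
  proof (cases "\<lfloor>k a\<rfloor> < \<lfloor>k b\<rfloor>")
    case True then show ?thesis by (intro exI[of _ "\<lfloor>k b\<rfloor>"]) linarith
  next
    case False then show ?thesis using ne by (intro exI[of _ "\<lfloor>k a\<rfloor>"]) linarith
  qed
  then obtain m :: int where "(k a \<le> m \<and> m \<le> k b) \<or> (k b \<le> m \<and> m \<le> k a)" by blast
  then have "\<exists>t\<ge>a. t \<le> b \<and> k t = m" using IVT'[of k a m b] IVT2'[of k b m a] assms(1,2) by blast
  then show False using assms(3) by (metis Ints_of_int atLeastAtMost_iff)
qed

text \<open>In the application \<open>k\<close> is a lift divided by \<open>2 * pi\<close>, and
  passing the sheet means passing an integer. The floor at \<open>t\<close> itself is left out: it
  agrees with the right or the left neighbours depending on the direction.\<close>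

definition crossing :: "(real \<Rightarrow> real) \<Rightarrow> int \<Rightarrow> real \<Rightarrow> bool" where
  "crossing k \<sigma> t \<longleftrightarrow> (\<exists>\<delta>>0. \<exists>m::int. \<forall>s. (t < s \<and> s < t + \<delta> \<longrightarrow> \<lfloor>k s\<rfloor> = m) \<and> (t - \<delta> < s \<and> s < t \<longrightarrow> \<lfloor>k s\<rfloor> = m - \<sigma>))"

lemma floor_change_eq_crossings:
  fixes k :: "real \<Rightarrow> real"
  assumes k: "continuous_on UNIV k"
  shows "\<lbrakk>a \<le> b; k a \<notin> \<int>; k b \<notin> \<int>; finite {t\<in>{a..b}. k t \<in> \<int>}; \<And>t. t \<in> {a..b} \<Longrightarrow> k t \<in> \<int> \<Longrightarrow> crossing k (\<sigma> t) t\<rbrakk>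
   \<Longrightarrow> \<lfloor>k b\<rfloor> - \<lfloor>k a\<rfloor> = (\<Sum>t\<in>{t\<in>{a..b}. k t \<in> \<int>}. \<sigma> t)"
proof (induction "card {t\<in>{a..b}. k t \<in> \<int>}" arbitrary: b rule: less_induct)
  case less
  let ?T = "\<lambda>b. {t\<in>{a..b}. k t \<in> \<int>}"
  show ?case
  proof (cases "?T b = {}")
    case True
    then have "\<lfloor>k a\<rfloor> = \<lfloor>k b\<rfloor>" by (intro floor_constant_if_no_integer continuous_on_subset[OF k] less.prems) auto
    then show ?thesis unfolding True by simp
  next
    case False
    define \<tau> where "\<tau> = Max (?T b)"
    have \<tau>T: "\<tau> \<in> ?T b" unfolding \<tau>_def by (rule Max_in[OF less.prems(4) False])
    have \<tau>max: "t \<le> \<tau>" if "t \<in> ?T b" for t unfolding \<tau>_def by (rule Max_ge[OF less.prems(4) that])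
    have \<tau>: "a < \<tau>" "\<tau> < b" using \<tau>T less.prems(2,3) by (metis (mono_tags, lifting) atLeastAtMost_iff mem_Collect_eq order_le_less)+
    obtain \<delta> m where d: "\<delta> > 0" "\<And>s. \<tau> < s \<Longrightarrow> s < \<tau> + \<delta> \<Longrightarrow> \<lfloor>k s\<rfloor> = m" "\<And>s. \<tau> - \<delta> < s \<Longrightarrow> s < \<tau> \<Longrightarrow> \<lfloor>k s\<rfloor> = m - \<sigma> \<tau>"
      using less.prems(5)[of \<tau>] \<tau>T unfolding crossing_def by blast
    define b' where "b' = min (\<tau> + \<delta> / 2) b"
    have b': "\<tau> < b'" "b' < \<tau> + \<delta>" "b' \<le> b" using d \<tau> by (auto simp: b'_def)
    \<comment> \<open>Beyond \<open>M\<close> and before \<open>\<tau>\<close> there is no integer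
      time, and the left half of the crossing condition holds; \<open>a'\<close> is placed there so
      that the induction hypothesis covers all earlier crossings.\<close>
    define M where "M = Max (insert a (insert (\<tau> - \<delta>) (?T b - {\<tau>})))"
    have fM: "finite (insert a (insert (\<tau> - \<delta>) (?T b - {\<tau>})))" using less.prems(4) by auto
    have M\<tau>: "M < \<tau>" unfolding M_def using fM \<tau> d \<tau>max by (subst Max_less_iff) (force simp: order_less_le)+
    have Mge: "a \<le> M" "\<tau> - \<delta> \<le> M" "\<And>t. t \<in> ?T b \<Longrightarrow> t \<noteq> \<tau> \<Longrightarrow> t \<le> M" unfolding M_def by (rule Max_ge[OF fM]; simp)+
    define a' where "a' = (M + \<tau>) / 2"
    have a': "M < a'" "a' < \<tau>" "a \<le> a'" "\<tau> - \<delta> < a'" using M\<tau> Mge by (auto simp: a'_def)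
    have Ta': "?T a' = ?T b - {\<tau>}"
    proof (intro set_eqI iffI)
      fix t assume "t \<in> ?T a'" then show "t \<in> ?T b - {\<tau>}" using a' \<tau> by auto
    next
      fix t assume t: "t \<in> ?T b - {\<tau>}" then have "t \<le> M" using Mge(3) by blast then show "t \<in> ?T a'" using t a' by auto
    qed
    have ka': "k a' \<notin> \<int>"
    proof
      assume "k a' \<in> \<int>" then have "a' \<in> ?T b" using a' \<tau> by auto
      then show False using Mge(3)[of a'] a' by auto
    qed
    have e1: "\<lfloor>k a'\<rfloor> - \<lfloor>k a\<rfloor> = sum \<sigma> (?T a')"
    proof (rule less.hyps)
      show "card (?T a') < card (?T b)" unfolding Ta' by (rule card_Diff1_less[OF less.prems(4) \<tau>T])
      show "finite (?T a')" unfolding Ta' using less.prems(4) by auto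
      show "crossing k (\<sigma> t) t" if "t \<in> {a..a'}" "k t \<in> \<int>" for t using less.prems(5)[of t] that a' \<tau> by auto
    qed (use a' ka' less.prems in auto)
    have e2: "\<lfloor>k b'\<rfloor> = \<lfloor>k b\<rfloor>"
    proof (rule floor_constant_if_no_integer[OF continuous_on_subset[OF k] b'(3)])
      fix t assume t: "t \<in> {b'..b}" show "k t \<notin> \<int>"
      proof
        assume "k t \<in> \<int>" then have "t \<in> ?T b" using t b' \<tau> by auto
        then show False using \<tau>max[of t] t b' by auto
      qed
    qed simp
    have "\<lfloor>k b'\<rfloor> = m" "\<lfloor>k a'\<rfloor> = m - \<sigma> \<tau>" using d b' a' by auto
    moreover have "sum \<sigma> (?T b) = \<sigma> \<tau> + sum \<sigma> (?T b - {\<tau>})" by (rule sum.remove[OF less.prems(4) \<tau>T])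
    ultimately show ?thesis using e1 e2 unfolding Ta' by simp
  qed
qed

lemma crossing_if_changes_sign:
  fixes h :: "real \<Rightarrow> real" and m :: int
  assumes h: "isCont h t" and hm: "h t = 2 * pi * m" and \<delta>: "\<delta> > 0"
    and \<sigma>: "\<sigma> = 1 \<or> \<sigma> = -1"
    and up: "\<And>s. t < s \<Longrightarrow> s < t + \<delta> \<Longrightarrow> of_int \<sigma> * (h s - 2 * pi * m) > 0"
    and down: "\<And>s. t - \<delta> < s \<Longrightarrow> s < t \<Longrightarrow> of_int \<sigma> * (h s - 2 * pi * m) < 0"
  shows "crossing (\<lambda>s. h s / (2 * pi)) \<sigma> t"
proof -
  obtain \<epsilon> where e: "\<epsilon> > 0" "\<And>s. dist s t < \<epsilon> \<Longrightarrow> dist (h s) (h t) < pi"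
    using h pi_gt_zero unfolding continuous_at_eps_delta by metis
  define \<eta> where "\<eta> = min \<delta> \<epsilon>"
  have near: "\<bar>h s - 2 * pi * m\<bar> < pi" if "\<bar>s - t\<bar> < \<eta>" for s using e(2)[of s] that by (auto simp: \<eta>_def dist_real_def hm)
  have fl: "\<lfloor>h s / (2 * pi)\<rfloor> = (if h s - 2 * pi * m > 0 then m else m - 1)" if s: "\<bar>s - t\<bar> < \<eta>" "h s - 2 * pi * m \<noteq> 0" for s
  proof (cases "h s - 2 * pi * m > 0")
    case True
    then have "\<lfloor>h s / (2 * pi)\<rfloor> = m" using near[OF s(1)] by (intro floor_unique) (auto simp: field_simps abs_less_iff)
    then show ?thesis using True by simp
  next
    case False
    then have "h s - 2 * pi * m < 0" using s(2) by linarith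
    then have "\<lfloor>h s / (2 * pi)\<rfloor> = m - 1" using near[OF s(1)] by (intro floor_unique) (auto simp: field_simps abs_less_iff)
    then show ?thesis using False by simp
  qed
  show ?thesis unfolding crossing_def
  proof (intro exI[of _ \<eta>] conjI exI[of _ "if \<sigma> = 1 then m else m - 1"] allI impI)
    show "\<eta> > 0" using e \<delta> by (simp add: \<eta>_def)
    fix s
    have "\<eta> \<le> \<delta>" by (simp add: \<eta>_def)
    show "\<lfloor>h s / (2 * pi)\<rfloor> = (if \<sigma> = 1 then m else m - 1)" if s: "t < s \<and> s < t + \<eta>"
      using up[of s] s \<sigma> \<open>\<eta> \<le> \<delta>\<close> by (subst fl) auto
    show "\<lfloor>h s / (2 * pi)\<rfloor> = (if \<sigma> = 1 then m else m - 1) - \<sigma>" if s: "t - \<eta> < s \<and> s < t"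
      using down[of s] s \<sigma> \<open>\<eta> \<le> \<delta>\<close> by (subst fl) auto
  qed
qed

section \<open>Linking with a horizontal circle\<close>

definition cx :: "real \<times> real \<Rightarrow> complex" where "cx w = Complex (fst w) (snd w)"
definition rp :: "complex \<Rightarrow> real \<times> real" where "rp z = (Re z, Im z)"

lemma rp_cx [simp]: "rp (cx w) = w" and cx_rp [simp]: "cx (rp z) = z"
  by (simp_all add: cx_def rp_def)

lemma norm_cx [simp]: "cmod (cx w) = norm w" and norm_rp [simp]: "norm (rp z) = cmod z"
  by (simp_all add: cx_def rp_def norm_prod_def cmod_def)

lemma cx_Re_Im: "cx w = of_real (fst w) + \<i> * of_real (snd w)"
  by (simp add: cx_def complex_eq_iff)

lemma continuous_on_cx [continuous_intros]: "continuous_on S g \<Longrightarrow> continuous_on S (\<lambda>t. cx (g t))"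
  unfolding cx_Re_Im by (intro continuous_intros)

lemma continuous_on_rp [continuous_intros]: "continuous_on S g \<Longrightarrow> continuous_on S (\<lambda>t. rp (g t))"
  unfolding rp_def by (intro continuous_intros)

lemma inj_cx: "inj cx" by (rule inj_on_inverseI[of _ rp]) simp

text \<open>The parameter counts turns, so the period is 1 as in
  \<open>tube_winding_zero\<close>.\<close>

definition circ :: "real^3 \<Rightarrow> real^3 \<Rightarrow> real^3 \<Rightarrow> real \<Rightarrow> real \<Rightarrow> real \<Rightarrow> real^3" where
  "circ a b e \<rho> z0 t = (\<rho> * cos (2 * pi * t)) *\<^sub>R a + (\<rho> * sin (2 * pi * t)) *\<^sub>R b + z0 *\<^sub>R e"

text \<open>It vanishes exactly on the circle, so its winding number around 0 along a closed curve
  off the circle is the linking number of the curve with the circle.\<close>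

definition lev :: "real^3 \<Rightarrow> real^3 \<Rightarrow> real^3 \<Rightarrow> real \<Rightarrow> real \<Rightarrow> real^3 \<Rightarrow> complex" where
  "lev a b e \<rho> z0 x = of_real ((x \<bullet> a)\<^sup>2 + (x \<bullet> b)\<^sup>2 - \<rho>\<^sup>2) + \<i> * of_real (x \<bullet> e - z0)"

lemma Re_lev: "Re (lev a b e \<rho> z0 x) = (x \<bullet> a)\<^sup>2 + (x \<bullet> b)\<^sup>2 - \<rho>\<^sup>2" and Im_lev: "Im (lev a b e \<rho> z0 x) = x \<bullet> e - z0"
  by (simp_all add: lev_def)

lemma continuous_on_lev [continuous_intros]: "continuous_on S g \<Longrightarrow> continuous_on S (\<lambda>t. lev a b e \<rho> z0 (g t))"
  unfolding lev_def by (intro continuous_intros)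

lemma continuous_on_circ [continuous_intros]: "continuous_on S (circ a b e \<rho> z0)"
  unfolding circ_def by (intro continuous_intros)

lemma circ_inner:
  assumes "orthoframe a b e"
  shows "circ a b e \<rho> z0 t \<bullet> a = \<rho> * cos (2 * pi * t)" "circ a b e \<rho> z0 t \<bullet> b = \<rho> * sin (2 * pi * t)" "circ a b e \<rho> z0 t \<bullet> e = z0"
  using assms by (auto simp: circ_def orthoframe_def inner_add_left inner_add_right inner_commute)

lemma circ_periodic: "circ a b e \<rho> z0 (t + 1) = circ a b e \<rho> z0 t"
proof -
  have "2 * pi * (t + 1) = 2 * pi * t + 2 * pi" by (simp add: algebra_simps)
  then show ?thesis by (simp add: circ_def)
qed

lemma circ_periodic_int: "circ a b e \<rho> z0 (t + of_int n) = circ a b e \<rho> z0 t"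
proof -
  have "cis (2 * pi * (t + of_int n)) = cis (2 * pi * t)" by (simp add: distrib_left cis_mult[symmetric] cis_multiple_2pi)
  then show ?thesis by (simp add: circ_def complex_eq_iff)
qed

lemma circ_eq_imp_int:
  assumes "orthoframe a b e" "\<rho> > 0" "circ a b e \<rho> z0 s = circ a b e \<rho> z0 t"
  shows "\<exists>m::int. s - t = of_int m"
proof -
  have "\<rho> * cos (2 * pi * s) = \<rho> * cos (2 * pi * t)" "\<rho> * sin (2 * pi * s) = \<rho> * sin (2 * pi * t)"
    using circ_inner(1)[OF assms(1), of \<rho> z0 s] circ_inner(1)[OF assms(1), of \<rho> z0 t]
      circ_inner(2)[OF assms(1), of \<rho> z0 s] circ_inner(2)[OF assms(1), of \<rho> z0 t] unfolding assms(3) by linarith+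
  then have "cis (2 * pi * s) = cis (2 * pi * t)" using assms(2) by (simp add: complex_eq_iff)
  then obtain m :: int where "2 * pi * s - 2 * pi * t = 2 * pi * of_int m" using cis_eq_imp_int by blast
  then have "2 * pi * (s - t) = 2 * pi * of_int m" by (simp add: algebra_simps)
  then have "s - t = of_int m" by simp
  then show ?thesis ..
qed

lemma lev_circ: "orthoframe a b e \<Longrightarrow> lev a b e \<rho> z0 (circ a b e \<rho> z0 t) = 0"
proof -
  assume "orthoframe a b e"
  moreover have "(\<rho> * cos (2 * pi * t))\<^sup>2 + (\<rho> * sin (2 * pi * t))\<^sup>2 = \<rho>\<^sup>2 * ((cos (2 * pi * t))\<^sup>2 + (sin (2 * pi * t))\<^sup>2)"
    by (simp only: power_mult_distrib distrib_left)
  ultimately show ?thesis unfolding lev_def by (simp add: circ_inner)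
qed

lemma lev_eq_0_imp_circ:
  assumes fr: "orthoframe a b e" and \<rho>: "\<rho> > 0" and x: "lev a b e \<rho> z0 x = 0"
  shows "\<exists>t\<in>{t0..<t0+1}. x = circ a b e \<rho> z0 t"
proof -
  have re: "(x \<bullet> a)\<^sup>2 + (x \<bullet> b)\<^sup>2 = \<rho>\<^sup>2" and im: "x \<bullet> e = z0"
    using x Re_lev[of a b e \<rho> z0 x] Im_lev[of a b e \<rho> z0 x] by auto
  have "(x \<bullet> a / \<rho>)\<^sup>2 + (x \<bullet> b / \<rho>)\<^sup>2 = 1" using re \<rho> by (simp add: power_divide add_divide_distrib[symmetric])
  then obtain u where u: "x \<bullet> a / \<rho> = cos u" "x \<bullet> b / \<rho> = sin u" by (rule sincos_total_2pi)
  define t where "t = u / (2 * pi)"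
  have "x = (x \<bullet> a) *\<^sub>R a + (x \<bullet> b) *\<^sub>R b + (x \<bullet> e) *\<^sub>R e" by (rule orthoframe_expand[OF fr])
  moreover have "x \<bullet> a = \<rho> * cos (2 * pi * t)" "x \<bullet> b = \<rho> * sin (2 * pi * t)" using u \<rho> by (auto simp: t_def field_simps)
  ultimately have xt: "x = circ a b e \<rho> z0 t" using im by (simp add: circ_def)
  define t' where "t' = t0 + frac (t - t0)"
  have "t' = t + of_int (- \<lfloor>t - t0\<rfloor>)" by (simp add: t'_def frac_def)
  then have "circ a b e \<rho> z0 t' = circ a b e \<rho> z0 t" using circ_periodic_int by metis
  moreover have "t' \<in> {t0..<t0+1}" by (simp add: t'_def frac_lt_1)
  ultimately show ?thesis using xt by metis
qed

lemma circ_has_vector_derivative: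
  "(circ a b e \<rho> z0 has_vector_derivative (2 * pi) *\<^sub>R ((\<rho> * cos (2 * pi * t)) *\<^sub>R b - (\<rho> * sin (2 * pi * t)) *\<^sub>R a)) (at t)"
proof -
  have c: "((\<lambda>t. \<rho> * cos (2 * pi * t)) has_vector_derivative - (2 * pi * (\<rho> * sin (2 * pi * t)))) (at t)"
    unfolding has_real_derivative_iff_has_vector_derivative[symmetric] by (auto intro!: derivative_eq_intros)
  have s: "((\<lambda>t. \<rho> * sin (2 * pi * t)) has_vector_derivative 2 * pi * (\<rho> * cos (2 * pi * t))) (at t)"
    unfolding has_real_derivative_iff_has_vector_derivative[symmetric] by (auto intro!: derivative_eq_intros)
  have "((\<lambda>t. (\<rho> * cos (2 * pi * t)) *\<^sub>R a + (\<rho> * sin (2 * pi * t)) *\<^sub>R b + z0 *\<^sub>R e) has_vector_derivative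
     (- (2 * pi * (\<rho> * sin (2 * pi * t)))) *\<^sub>R a + (2 * pi * (\<rho> * cos (2 * pi * t))) *\<^sub>R b + 0) (at t)"
    by (intro has_vector_derivative_add has_vector_derivative_const)
      (use has_vector_derivative_scaleR[OF c[folded has_real_derivative_iff_has_vector_derivative] has_vector_derivative_const[of a]]
        has_vector_derivative_scaleR[OF s[folded has_real_derivative_iff_has_vector_derivative] has_vector_derivative_const[of b]] in simp_all)
  moreover have "(- (2 * pi * (\<rho> * sin (2 * pi * t)))) *\<^sub>R a + (2 * pi * (\<rho> * cos (2 * pi * t))) *\<^sub>R b + 0
     = (2 * pi) *\<^sub>R ((\<rho> * cos (2 * pi * t)) *\<^sub>R b - (\<rho> * sin (2 * pi * t)) *\<^sub>R a)" by (simp add: scaleR_diff_right)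
  ultimately show ?thesis unfolding circ_def[abs_def] by simp
qed

lemma continuous_nonzero_sign:
  fixes k :: "'a::topological_space \<Rightarrow> real"
  assumes "connected S" "continuous_on S k" "\<And>x. x \<in> S \<Longrightarrow> k x \<noteq> 0"
  obtains c :: int where "c = 1 \<or> c = -1" "\<And>x. x \<in> S \<Longrightarrow> of_int c * k x > 0"
proof -
  have conn: "connected (k ` S)" by (rule connected_continuous_image[OF assms(2,1)])
  have "(\<forall>x\<in>S. k x > 0) \<or> (\<forall>x\<in>S. k x < 0)"
  proof (rule ccontr)
    assume "\<not> ?thesis"
    then obtain x y where "x \<in> S" "y \<in> S" "k x \<le> 0" "0 \<le> k y" by (meson linorder_not_less)
    then have "0 \<in> k ` S" using connectedD_interval[OF conn, of "k x" "k y" 0] by auto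
    then show False using assms(3) by auto
  qed
  then show thesis using that[of 1] that[of "-1"] by auto
qed

section \<open>Signed crossings of the circle with the surface\<close>

context csurf
begin

text \<open>The Jacobian determinant of \<open>lev\<close> composed with \<open>f\<close>, with real
  and imaginary part as target coordinates.\<close>

definition jac :: "real^3 \<Rightarrow> real^3 \<Rightarrow> real^3 \<Rightarrow> real \<times> real \<Rightarrow> real" where
  "jac a b e w = (2 * (f w \<bullet> a) * (fu w \<bullet> a) + 2 * (f w \<bullet> b) * (fu w \<bullet> b)) * (fv w \<bullet> e)
     - (fu w \<bullet> e) * (2 * (f w \<bullet> a) * (fv w \<bullet> a) + 2 * (f w \<bullet> b) * (fv w \<bullet> b))"

text \<open>The determinant is twice the triple product of \<open>fu w\<close>, \<open>fv w\<close>
  and the last vector, which at a point of the circle is opposite to the direction of travel. So it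
  compares the sign of a zero of \<open>lev\<close> in the parameter disk with the sign of the
  crossing of circle and surface.\<close>

lemma jac_eq:
  assumes w: "w \<in> ball 0 1" and fr: "orthoframe a b e" and b: "b = cross3 e a"
  shows "jac a b e w = 2 * (cross3 (fu w) (fv w) \<bullet> nu w) * (nu w \<bullet> ((f w \<bullet> b) *\<^sub>R a - (f w \<bullet> a) *\<^sub>R b))"
proof -
  have bac: "cross3 (cross3 x y) z = (x \<bullet> z) *\<^sub>R y - (y \<bullet> z) *\<^sub>R x" for x y z :: "real^3"
    by (simp add: cross3_simps forall_3)
  have dc: "cross3 x y \<bullet> cross3 u v = (x \<bullet> u) * (y \<bullet> v) - (x \<bullet> v) * (y \<bullet> u)" for x y u v :: "real^3"
    by (simp add: cross3_simps)
  have be: "cross3 b e = a" unfolding b bac using fr by (simp add: orthoframe_def)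
  have ae: "cross3 a e = - b" unfolding b by (rule cross_skew)
  have "cross3 ((2 * (f w \<bullet> a)) *\<^sub>R a + (2 * (f w \<bullet> b)) *\<^sub>R b) e = 2 *\<^sub>R ((f w \<bullet> b) *\<^sub>R a - (f w \<bullet> a) *\<^sub>R b)"
    by (simp add: cross_add_left cross_mult_left be ae scaleR_diff_right)
  moreover have "jac a b e w = cross3 (fu w) (fv w) \<bullet> cross3 ((2 * (f w \<bullet> a)) *\<^sub>R a + (2 * (f w \<bullet> b)) *\<^sub>R b) e"
    unfolding dc by (simp add: jac_def inner_add_right algebra_simps)
  ultimately have j: "jac a b e w = cross3 (fu w) (fv w) \<bullet> (2 *\<^sub>R ((f w \<bullet> b) *\<^sub>R a - (f w \<bullet> a) *\<^sub>R b))" by simp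
  have "cross3 (fu w) (fv w) = (cross3 (fu w) (fv w) \<bullet> nu w) *\<^sub>R nu w"
    by (rule normal_multiple[OF w]) (simp_all add: dot_cross_self)
  then obtain \<kappa> where \<kappa>: "cross3 (fu w) (fv w) = \<kappa> *\<^sub>R nu w" ..
  show ?thesis unfolding j \<kappa> using nun[OF w] by simp
qed

text \<open>The lift of the collar function along the circle is periodic, so its integer crossings
  over one period cancel. They correspond bijectively to the points of the sheet on the circle, and
  by \<open>jac_eq\<close> their signs are those of \<open>jac\<close> up to one common
  sign.\<close>

lemma signed_count_zero:
  assumes fr: "orthoframe a b e" and b: "b = cross3 e a" and \<rho>: "\<rho> > 0"
    and oU: "open U" and cU: "\<And>t. cball (circ a b e \<rho> z0 t) 2 \<subseteq> U"
    and reg: "\<And>w. w \<in> ball 0 1 \<Longrightarrow> lev a b e \<rho> z0 (f w) = 0 \<Longrightarrow> jac a b e w \<noteq> 0"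
    and fin: "finite {w \<in> ball 0 1. lev a b e \<rho> z0 (f w) = 0}"
    and G: "open G" "G \<subseteq> ball 0 1" "f ` G \<subseteq> U" "closedin (top_of_set U) (f ` G)"
  shows "(\<Sum>w\<in>{w\<in>G. lev a b e \<rho> z0 (f w) = 0}. if jac a b e w > 0 then 1 else - 1 :: int) = 0"
proof -
  let ?C = "circ a b e \<rho> z0" and ?l = "lev a b e \<rho> z0"
  have Gc: "G \<subseteq> cball 0 1" using G(2) ball_subset_cball by blast
  define s where "s w = (if jac a b e w > 0 then 1 else - 1 :: int)" for w
  \<comment> \<open>The orientation of \<open>fu\<close>, \<open>fv\<close>, \<open>nu\<close> is
    constant on the connected disk; this is the common sign.\<close>
  obtain c :: int where c: "c = 1 \<or> c = -1" "\<And>w. w \<in> ball 0 1 \<Longrightarrow> of_int c * (cross3 (fu w) (fv w) \<bullet> nu w) > 0"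
  proof (rule continuous_nonzero_sign[of "ball 0 1 :: (real \<times> real) set" "\<lambda>w. cross3 (fu w) (fv w) \<bullet> nu w"])
    show "continuous_on (ball 0 1) (\<lambda>w. cross3 (fu w) (fv w) \<bullet> nu w)"
      by (intro continuous_intros continuous_on_cross cont_fu cont_fv cont_nu)
    fix w :: "real \<times> real" assume w: "w \<in> ball 0 1"
    have "cross3 (fu w) (fv w) = (cross3 (fu w) (fv w) \<bullet> nu w) *\<^sub>R nu w"
      by (rule normal_multiple[OF w]) (simp_all add: dot_cross_self)
    then show "cross3 (fu w) (fv w) \<bullet> nu w \<noteq> 0" using cross_ne[OF w] by auto
  qed auto
  obtain g where col: "collar G U g" using collar_exists[OF G(1,2) oU G(3,4)] .
  have CU: "?C t \<in> U" for t using cU[of t] by auto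
  have "continuous_on UNIV (\<lambda>t. g (?C t))"
    by (rule continuous_on_compose2[of U g]) (use col CU in \<open>auto simp: collar_def intro!: continuous_intros\<close>)
  then obtain h where h: "continuous_on UNIV h" "\<And>t. g (?C t) = cis (h t)"
    by (rule circle_lift) (use col CU in \<open>auto simp: collar_def intro!: convex_imp_contractible\<close>)
  have hper: "h (t + 1) = h t" for t
    by (rule tube_winding_zero[OF G(2,1) col _ _ cU circ_periodic h]) (auto intro!: continuous_intros)
  define kk where "kk t = h t / (2 * pi)" for t
  have ck: "continuous_on UNIV kk" unfolding kk_def by (intro continuous_intros h) auto
  have kint: "kk t \<in> \<int> \<longleftrightarrow> ?C t \<in> f ` G" for t
  proof -
    have "kk t \<in> \<int> \<longleftrightarrow> cis (h t) = 1"
    proof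
      assume "kk t \<in> \<int>"
      then have "cis (2 * pi * kk t) = 1" by (rule cis_multiple_2pi)
      then show "cis (h t) = 1" by (simp add: kk_def)
    next
      assume "cis (h t) = 1"
      then obtain m :: int where "h t = 2 * pi * of_int m" using cis_eq_1_imp_int by blast
      then show "kk t \<in> \<int>" by (simp add: kk_def)
    qed
    then show ?thesis using col CU[of t] by (auto simp: collar_def h(2)[symmetric])
  qed
  let ?Z = "{w \<in> ball 0 1. ?l (f w) = 0}" and ?ZG = "{w \<in> G. ?l (f w) = 0}"
  \<comment> \<open>A starting point off the sheet exists because only finitely many points of the
    surface lie on the circle.\<close>
  obtain t0 where t0: "?C t0 \<notin> f ` ?Z"
  proof (rule ccontr)
    assume "\<not> thesis"
    then have "?C ` {0..<1} \<subseteq> f ` ?Z" using that by blast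
    then have "finite (?C ` {0..<1::real})" using fin finite_subset by blast
    moreover have "inj_on ?C {0..<1}"
    proof (rule inj_onI)
      fix x y :: real assume xy: "x \<in> {0..<1}" "y \<in> {0..<1}" "?C x = ?C y"
      then obtain m :: int where m: "x - y = of_int m" using circ_eq_imp_int[OF fr \<rho>] by blast
      then have "\<bar>real_of_int m\<bar> < 1" using xy by auto
      then have "m = 0" by linarith
      then show "x = y" using m by simp
    qed
    ultimately have "finite {0..<1::real}" by (rule finite_imageD)
    then show False using infinite_Ico[of 0 "1::real"] by simp
  qed
  have kt0: "kk t0 \<notin> \<int>" using t0 kint[of t0] lev_circ[OF fr, of \<rho> z0 t0] G(2) by fastforce
  have kper: "kk (t0 + 1) = kk t0" using hper by (simp add: kk_def)
  define T where "T = {t \<in> {t0..t0+1}. kk t \<in> \<int>}"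
  define \<psi> where "\<psi> t = inv_into (cball 0 1) f (?C t)" for t
  have \<psi>: "\<psi> t \<in> G" "f (\<psi> t) = ?C t" "?l (f (\<psi> t)) = 0" if t: "kk t \<in> \<int>" for t
  proof -
    obtain w where w: "w \<in> G" "?C t = f w" using kint[of t] t by auto
    then have "\<psi> t = w" unfolding \<psi>_def using inv_into_f_f[OF injf, of w] Gc by auto
    then show "\<psi> t \<in> G" "f (\<psi> t) = ?C t" "?l (f (\<psi> t)) = 0" using w lev_circ[OF fr, of \<rho> z0 t] by auto
  qed
  have tne: "t \<noteq> t0 + 1" if "kk t \<in> \<int>" for t using that kt0 kper by auto
  have bij: "bij_betw \<psi> T ?ZG"
    unfolding bij_betw_def
  proof (intro conjI inj_onI set_eqI iffI)
    fix x y assume xy: "x \<in> T" "y \<in> T" "\<psi> x = \<psi> y"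
    then have k: "kk x \<in> \<int>" "kk y \<in> \<int>" by (auto simp: T_def)
    have "?C x = ?C y" using \<psi>(2)[OF k(1)] \<psi>(2)[OF k(2)] xy(3) by simp
    then obtain m :: int where m: "x - y = of_int m" using circ_eq_imp_int[OF fr \<rho>] by blast
    have "x < t0 + 1" "y < t0 + 1" "t0 \<le> x" "t0 \<le> y" using xy tne[OF k(1)] tne[OF k(2)] by (auto simp: T_def)
    then have "\<bar>real_of_int m\<bar> < 1" using m by linarith
    then have "m = 0" by linarith
    then show "x = y" using m by simp
  next
    fix w assume "w \<in> \<psi> ` T" then show "w \<in> ?ZG" using \<psi> by (auto simp: T_def)
  next
    fix w assume w: "w \<in> ?ZG"
    then obtain t where t: "t \<in> {t0..<t0+1}" "f w = ?C t" using lev_eq_0_imp_circ[OF fr \<rho>, of z0 "f w" t0] by auto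
    have kt: "kk t \<in> \<int>" using kint[of t] w t(2)[symmetric] by auto
    have "\<psi> t = w" unfolding \<psi>_def t(2)[symmetric] using inv_into_f_f[OF injf, of w] Gc w by auto
    moreover have "t \<in> T" using t kt by (auto simp: T_def)
    ultimately show "w \<in> \<psi> ` T" by blast
  qed
  have fZG: "finite ?ZG" by (rule finite_subset[OF _ fin]) (use G(2) in auto)
  then have fT: "finite T" using bij_betw_finite[OF bij] by simp
  \<comment> \<open>The minus sign reflects that the vector in \<open>jac_eq\<close> points against
    the direction of travel.\<close>
  define \<sigma> where "\<sigma> t = - c * s (\<psi> t)" for t
  have \<sigma>1: "\<sigma> t = 1 \<or> \<sigma> t = -1" for t using c(1) by (auto simp: \<sigma>_def s_def)
  have cross: "crossing kk (\<sigma> t) t" if t: "kk t \<in> \<int>" for t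
  proof -
    note w = \<psi>[OF t]
    have wb: "\<psi> t \<in> ball 0 1" using w G by auto
    define v where "v = (2 * pi) *\<^sub>R ((\<rho> * cos (2 * pi * t)) *\<^sub>R b - (\<rho> * sin (2 * pi * t)) *\<^sub>R a)"
    define d where "d = nu (\<psi> t) \<bullet> v"
    have dj: "pi * jac a b e (\<psi> t) = - (cross3 (fu (\<psi> t)) (fv (\<psi> t)) \<bullet> nu (\<psi> t)) * d"
      unfolding jac_eq[OF wb fr b] w(2) circ_inner[OF fr] d_def v_def
      by (simp add: inner_diff_right algebra_simps)
    have jn: "jac a b e (\<psi> t) \<noteq> 0" using reg[OF wb w(3)] .
    have \<sigma>d: "of_int (\<sigma> t) * d > 0"
    proof -
      let ?\<kappa> = "cross3 (fu (\<psi> t)) (fv (\<psi> t)) \<bullet> nu (\<psi> t)"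
      have p1: "of_int c * ?\<kappa> > 0" using c(2)[OF wb] .
      have p2: "of_int (s (\<psi> t)) * (pi * jac a b e (\<psi> t)) > 0"
        using jn pi_gt_zero by (auto simp: s_def zero_less_mult_iff mult_less_0_iff)
      have "(of_int c * of_int c :: real) = 1" using c(1) by auto
      then have "of_int (s (\<psi> t)) * (pi * jac a b e (\<psi> t)) = (of_int c * of_int c) * (of_int (s (\<psi> t)) * (- ?\<kappa> * d))" unfolding dj by simp
      also have "\<dots> = (of_int c * ?\<kappa>) * (of_int (\<sigma> t) * d)" by (simp add: \<sigma>_def)
      finally have "(of_int c * ?\<kappa>) * (of_int (\<sigma> t) * d) > 0" using p2 by simp
      then show ?thesis by (rule zero_less_mult_pos[OF _ p1])
    qed
    obtain m :: int and \<epsilon> \<phi> gr \<delta> where m: "h t = 2 * pi * of_int m" and gd: "good_def_fn G (\<psi> t) \<epsilon> \<phi> gr" and \<delta>: "\<delta> > 0"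
      and sd: "\<And>\<tau>. \<tau> \<in> UNIV \<Longrightarrow> dist \<tau> t < \<delta> \<Longrightarrow> ?C \<tau> \<in> ball (f (\<psi> t)) \<epsilon> \<and> (\<phi> (?C \<tau>) > 0 \<longrightarrow> h \<tau> > 2 * pi * of_int m) \<and>
       (\<phi> (?C \<tau>) < 0 \<longrightarrow> h \<tau> < 2 * pi * of_int m) \<and> (\<phi> (?C \<tau>) = 0 \<longrightarrow> h \<tau> = 2 * pi * of_int m)"
      by (rule lift_sides[where T = UNIV and c = ?C and h = h, OF col w(1) UNIV_I w(2)[symmetric] _ h(1)]) (use CU h(2) in \<open>auto intro!: continuous_intros\<close>)
    have \<epsilon>: "f (\<psi> t) \<in> ball (f (\<psi> t)) \<epsilon>" and gr0: "gr (f (\<psi> t)) = nu (\<psi> t)" using gd by (auto simp: good_def_fn_def)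
    have \<phi>0: "\<phi> (?C t) = 0" using good_D(3)[OF gd \<epsilon>] w(1,2) imageI[OF w(1), of f] by simp
    have "(\<phi> has_derivative (\<lambda>k. nu (\<psi> t) \<bullet> k)) (at (?C t))" using good_D(1)[OF gd \<epsilon>] gr0 w(2) by simp
    from vector_derivative_diff_chain_within[OF circ_has_vector_derivative[of a b e \<rho> z0 t] has_derivative_at_withinI[OF this]]
    have "(\<phi> \<circ> ?C has_real_derivative d) (at t)"
      unfolding has_real_derivative_iff_has_vector_derivative d_def v_def .
    then have D: "((\<lambda>\<tau>. of_int (\<sigma> t) * \<phi> (?C \<tau>)) has_real_derivative of_int (\<sigma> t) * d) (at t)"
      unfolding o_def by (rule DERIV_cmult)
    obtain d1 where d1: "d1 > 0" "\<And>k. k > 0 \<Longrightarrow> k < d1 \<Longrightarrow> of_int (\<sigma> t) * \<phi> (?C t) < of_int (\<sigma> t) * \<phi> (?C (t + k))"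
      using DERIV_pos_inc_right[OF D \<sigma>d] by blast
    obtain d2 where d2: "d2 > 0" "\<And>k. k > 0 \<Longrightarrow> k < d2 \<Longrightarrow> of_int (\<sigma> t) * \<phi> (?C (t - k)) < of_int (\<sigma> t) * \<phi> (?C t)"
      using DERIV_pos_inc_left[OF D \<sigma>d] by blast
    show ?thesis unfolding kk_def[abs_def]
    proof (rule crossing_if_changes_sign[where h = h and \<delta> = "min \<delta> (min d1 d2)", OF _ m _ \<sigma>1[of t]])
      show "isCont h t" using h(1) continuous_on_eq_continuous_at[of UNIV h] by auto
      show "min \<delta> (min d1 d2) > 0" using \<delta> d1 d2 by simp
      fix u
      show "of_int (\<sigma> t) * (h u - 2 * pi * m) > 0" if u: "t < u" "u < t + min \<delta> (min d1 d2)"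
      proof -
        have "of_int (\<sigma> t) * \<phi> (?C u) > 0" using d1(2)[of "u - t"] u \<phi>0 by simp
        moreover have "dist u t < \<delta>" using u by (auto simp: dist_real_def)
        ultimately show ?thesis using sd[of u] \<sigma>1[of t] by auto
      qed
      show "of_int (\<sigma> t) * (h u - 2 * pi * m) < 0" if u: "t - min \<delta> (min d1 d2) < u" "u < t"
      proof -
        have "of_int (\<sigma> t) * \<phi> (?C u) < 0" using d2(2)[of "t - u"] u \<phi>0 by simp
        moreover have "dist u t < \<delta>" using u by (auto simp: dist_real_def)
        ultimately show ?thesis using sd[of u] \<sigma>1[of t] by auto
      qed
    qed
  qed
  have "\<lfloor>kk (t0 + 1)\<rfloor> - \<lfloor>kk t0\<rfloor> = sum \<sigma> {t \<in> {t0..t0+1}. kk t \<in> \<int>}"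
    by (rule floor_change_eq_crossings[OF ck]) (use kt0 kper fT cross in \<open>auto simp: T_def\<close>)
  then have "sum \<sigma> T = 0" unfolding T_def kper by simp
  moreover have "sum \<sigma> T = - c * (\<Sum>t\<in>T. s (\<psi> t))" unfolding \<sigma>_def by (rule sum_distrib_left[symmetric])
  moreover have "(\<Sum>t\<in>T. s (\<psi> t)) = sum s ?ZG" by (rule sum.reindex_bij_betw[OF bij])
  ultimately have "sum s ?ZG = 0" using c(1) by auto
  then show ?thesis by (simp add: s_def)
qed

lemma lev_derivative:
  assumes w: "w \<in> ball 0 1"
  shows "((\<lambda>z. lev a b e \<rho> z0 (f (rp z))) has_derivative
     (\<lambda>h. of_real (Re h) * (of_real (2 * (f w \<bullet> a) * (fu w \<bullet> a) + 2 * (f w \<bullet> b) * (fu w \<bullet> b)) + \<i> * of_real (fu w \<bullet> e))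
       + of_real (Im h) * (of_real (2 * (f w \<bullet> a) * (fv w \<bullet> a) + 2 * (f w \<bullet> b) * (fv w \<bullet> b)) + \<i> * of_real (fv w \<bullet> e)))) (at (cx w))"
proof -
  have "bounded_linear rp" unfolding rp_def[abs_def] by (intro bounded_linear_Pair bounded_linear_Re bounded_linear_Im)
  then have "(rp has_derivative rp) (at (cx w))" by (rule bounded_linear_imp_has_derivative)
  moreover have "(f has_derivative (\<lambda>(a,b). a *\<^sub>R fu w + b *\<^sub>R fv w)) (at (rp (cx w)))" using df[OF w] by simp
  ultimately have "(f \<circ> rp has_derivative (\<lambda>(a,b). a *\<^sub>R fu w + b *\<^sub>R fv w) \<circ> rp) (at (cx w))" by (rule diff_chain_at)
  then have d: "((\<lambda>z. f (rp z)) has_derivative (\<lambda>h. Re h *\<^sub>R fu w + Im h *\<^sub>R fv w)) (at (cx w))"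
    by (simp add: o_def rp_def)
  note di = has_derivative_inner_left[OF d]
  show ?thesis unfolding lev_def
    by (rule has_derivative_eq_rhs, (rule derivative_intros di)+)
      (simp add: fun_eq_iff complex_eq_iff inner_add_left algebra_simps)
qed

lemma simple_zero_lev:
  assumes w: "w \<in> ball 0 1" and l0: "lev a b e \<rho> z0 (f w) = 0" and j: "jac a b e w \<noteq> 0"
  shows "simple_zero (\<lambda>z. lev a b e \<rho> z0 (f (rp z))) (if jac a b e w > 0 then 1 else -1) (cx w)"
  using simple_zero_if_det[OF lev_derivative[OF w, of a b e \<rho> z0]] l0 j by (simp add: jac_def)

text \<open>The level set is compact since it avoids the boundary circle. An accumulation point
  would be a zero that is not isolated, whereas simple zeros are isolated.\<close>

lemma finite_level_set:
  assumes reg: "\<And>w. w \<in> ball 0 1 \<Longrightarrow> lev a b e \<rho> z0 (f w) = 0 \<Longrightarrow> jac a b e w \<noteq> 0"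
    and bd: "\<And>w. w \<in> sphere 0 1 \<Longrightarrow> lev a b e \<rho> z0 (f w) \<noteq> 0"
  shows "finite {w \<in> ball 0 1. lev a b e \<rho> z0 (f w) = 0}"
proof (rule ccontr)
  let ?Z = "{w \<in> ball 0 1. lev a b e \<rho> z0 (f w) = 0}"
  assume inf: "infinite ?Z"
  have eq: "?Z = cball 0 1 \<inter> (\<lambda>w. lev a b e \<rho> z0 (f w)) -` {0}" using bd by (auto simp: less_le)
  have "continuous_on (cball 0 1) (\<lambda>w. lev a b e \<rho> z0 (f w))" by (intro continuous_intros cf)
  then have "closed (cball 0 1 \<inter> (\<lambda>w. lev a b e \<rho> z0 (f w)) -` {0})" by (rule continuous_closed_preimage) auto
  then have "closed ?Z" using eq by simp
  moreover have "bounded ?Z" by (rule bounded_subset[of "ball 0 1"]) auto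
  ultimately have "compact ?Z" by (simp add: compact_eq_bounded_closed)
  then obtain x where x: "x \<in> ?Z" "x islimpt ?Z" using inf unfolding compact_eq_Bolzano_Weierstrass by blast
  have "simple_zero (\<lambda>z. lev a b e \<rho> z0 (f (rp z))) (if jac a b e x > 0 then 1 else -1) (cx x)"
    using simple_zero_lev reg x(1) by blast
  then obtain \<delta> q s where d: "\<delta> > 0" "\<And>z. z \<in> ball (cx x) \<delta> \<Longrightarrow> z \<noteq> cx x \<Longrightarrow>
       cmod (lev a b e \<rho> z0 (f (rp z)) - q z * cfac s (cx x) z) < cmod (q z * cfac s (cx x) z)"
    unfolding simple_zero_def by metis
  have "\<exists>y\<in>?Z. y \<noteq> x \<and> dist y x < \<delta>" using x(2) d(1) unfolding islimpt_approachable by blast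
  then obtain y where y: "y \<in> ?Z" "y \<noteq> x" "dist y x < \<delta>" by blast
  have "cx x - cx y = cx (x - y)" by (simp add: cx_def complex_eq_iff)
  then have "cx y \<in> ball (cx x) \<delta>" using y(3) by (simp add: dist_norm norm_minus_commute)
  moreover have "cx y \<noteq> cx x" using y(2) by (metis rp_cx)
  ultimately show False using d(2)[of "cx y"] y(1) by simp
qed

text \<open>The argument principle gives a sum over the zeros of sign times winding number of the
  loop. Grouped by the value \<open>k\<close> of the winding number, each group is \<open>k\<close>
  times the signed count of one sheet, hence 0.\<close>

lemma level_winding_zero:
  assumes fr: "orthoframe a b e" and b: "b = cross3 e a" and \<rho>: "\<rho> > 0"
    and oU: "open U" and cU: "\<And>t. cball (circ a b e \<rho> z0 t) 2 \<subseteq> U"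
    and reg: "\<And>w. w \<in> ball 0 1 \<Longrightarrow> lev a b e \<rho> z0 (f w) = 0 \<Longrightarrow> jac a b e w \<noteq> 0"
    and sph: "f ` sphere 0 1 \<inter> U = {}"
    and L: "path L" "pathfinish L = pathstart L" "path_image L \<subseteq> ball 0 1" "f ` path_image L \<inter> U = {}"
  shows "winding_number (\<lambda>t. lev a b e \<rho> z0 (f (L t))) 0 = 0"
proof -
  let ?l = "lev a b e \<rho> z0"
  define K where "K = cx \<circ> L"
  have pK: "path K" "pathfinish K = pathstart K" "path_image K = cx ` path_image L"
    using L(1,2) by (simp_all add: K_def path_image_compose, simp_all add: path_def pathfinish_def pathstart_def o_def continuous_on_cx)
  have zU: "x \<in> U" if l0: "?l x = 0" for x
  proof -
    obtain t where "x = circ a b e \<rho> z0 t" using lev_eq_0_imp_circ[OF fr \<rho> l0] by blast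
    then show ?thesis using cU[of t] by auto
  qed
  define Z where "Z = {w \<in> ball 0 1. ?l (f w) = 0}"
  have fZ: "finite Z" unfolding Z_def by (rule finite_level_set[OF reg]) (use sph zU in blast)+
  define s where "s w = (if jac a b e w > 0 then 1 else - 1 :: int)" for w
  define wn where "wn w = winding_number K (cx w)" for w
  have cfb: "continuous_on (ball 0 1) f" by (rule continuous_on_subset[OF cf ball_subset_cball])
  have "winding_number ((\<lambda>z. ?l (f (rp z))) \<circ> K) 0 = (\<Sum>a\<in>cx ` Z. of_int (s (rp a)) * winding_number K a)"
  proof (rule winding_number_sum_zeros[where D = "ball 0 1"])
    show "contractible (ball (0::complex) 1)" by (simp add: convex_imp_contractible)
    show "path_image K \<subseteq> ball 0 1" using L(3) by (auto simp: pK(3))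
    show "finite (cx ` Z)" using fZ by simp
    show "continuous_on (ball 0 1) (\<lambda>z. ?l (f (rp z)))"
      by (intro continuous_intros continuous_on_compose2[OF cfb]) auto
    show "{z \<in> ball 0 1. ?l (f (rp z)) = 0} = cx ` Z"
    proof (intro set_eqI iffI)
      fix z assume "z \<in> {z \<in> ball 0 1. ?l (f (rp z)) = 0}"
      then have "rp z \<in> Z" by (simp add: Z_def)
      then show "z \<in> cx ` Z" by (metis cx_rp imageI)
    qed (auto simp: Z_def)
    show "path_image K \<inter> cx ` Z = {}"
    proof -
      have "path_image L \<inter> Z = {}" using L(4) zU by (auto simp: Z_def)
      then show ?thesis unfolding pK(3) by (simp add: image_Int[OF inj_cx, symmetric])
    qed
    fix z assume "z \<in> cx ` Z"
    then obtain w where w: "w \<in> Z" "z = cx w" by auto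
    then show "(s (rp z) = 1 \<or> s (rp z) = -1) \<and> simple_zero (\<lambda>z. ?l (f (rp z))) (s (rp z)) z"
      using simple_zero_lev[of w a b e \<rho> z0] reg[of w] by (auto simp: Z_def s_def)
  qed (use pK in auto)
  also have "\<dots> = (\<Sum>w\<in>Z. of_int (s w) * wn w)"
    by (subst sum.reindex) (auto simp: wn_def intro: inj_on_subset[OF inj_cx])
  also have "\<dots> = (\<Sum>k\<in>wn ` Z. \<Sum>w\<in>{w. w \<in> Z \<and> wn w = k}. of_int (s w) * wn w)" by (rule sum.image_gen[OF fZ])
  also have "\<dots> = (\<Sum>k\<in>wn ` Z. 0)"
  proof (rule sum.cong[OF refl])
    fix k
    define V where "V P = {w \<in> ball 0 1. f w \<in> U \<and> cx w \<notin> path_image K \<and> P (wn w)}" for P :: "complex \<Rightarrow> bool"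
    have oV: "open (V P)" for P
    proof -
      have o1: "open (ball 0 1 \<inter> f -` U)" by (rule continuous_open_preimage[OF cfb open_ball oU])
      have o2: "open (\<Union>j\<in>{j. P j}. {z. z \<notin> path_image K \<and> winding_number K z = j})"
        by (intro open_UN ballI open_winding_number_levelsets pK)
      have "open (cx -` (\<Union>j\<in>{j. P j}. {z. z \<notin> path_image K \<and> winding_number K z = j}))"
        by (rule open_vimage[OF o2]) (auto intro!: continuous_intros)
      moreover have "V P = (ball 0 1 \<inter> f -` U) \<inter> cx -` (\<Union>j\<in>{j. P j}. {z. z \<notin> path_image K \<and> winding_number K z = j})"
        by (auto simp: V_def wn_def)
      ultimately show ?thesis using open_Int[OF o1] by simp
    qed
    \<comment> \<open>The parameters over the tube around which the loop winds \<open>k\<close>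
      times. Their image is closed in \<open>U\<close>: loop and boundary circle are mapped outside
      \<open>U\<close>, and the parameters with other winding numbers form an open set.\<close>
    define G where "G = V (\<lambda>j. j = k)"
    have "f ` G = U \<inter> f ` (cball 0 1 - V (\<lambda>j. j \<noteq> k))"
    proof (intro set_eqI iffI)
      fix y assume "y \<in> f ` G" then show "y \<in> U \<inter> f ` (cball 0 1 - V (\<lambda>j. j \<noteq> k))" by (auto simp: G_def V_def)
    next
      fix y assume "y \<in> U \<inter> f ` (cball 0 1 - V (\<lambda>j. j \<noteq> k))"
      then obtain w where w: "w \<in> cball 0 1" "w \<notin> V (\<lambda>j. j \<noteq> k)" "y = f w" "f w \<in> U" by auto
      have "w \<notin> sphere 0 1" using sph w by blast
      then have wb: "w \<in> ball 0 1" using w(1) by auto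
      have "cx w \<notin> path_image K"
      proof
        assume "cx w \<in> path_image K"
        then have "w \<in> path_image L" unfolding pK(3) by (metis imageE rp_cx)
        then show False using L(4) w(4) by auto
      qed
      then have "w \<in> G" using w wb by (auto simp: G_def V_def)
      then show "y \<in> f ` G" using w by auto
    qed
    moreover have "compact (f ` (cball 0 1 - V (\<lambda>j. j \<noteq> k)))"
      by (intro compact_continuous_image continuous_on_subset[OF cf] compact_diff oV) auto
    ultimately have cl: "closedin (top_of_set U) (f ` G)" using closedin_closed_Int[OF compact_imp_closed] by metis
    have "(\<Sum>w\<in>{w\<in>G. ?l (f w) = 0}. s w) = 0" unfolding s_def
      by (rule signed_count_zero[OF fr b \<rho> oU cU reg fZ[unfolded Z_def] _ _ _ cl]) (use oV in \<open>auto simp: G_def V_def\<close>)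
    moreover have "{w\<in>G. ?l (f w) = 0} = {w. w \<in> Z \<and> wn w = k}"
    proof -
      have "cx w \<notin> path_image K" if "?l (f w) = 0" for w
      proof
        assume "cx w \<in> path_image K"
        then have "w \<in> path_image L" unfolding pK(3) by (metis imageE rp_cx)
        then show False using L(4) zU[OF that] by auto
      qed
      then show ?thesis using zU by (auto simp: G_def V_def Z_def)
    qed
    ultimately have s0: "(\<Sum>w\<in>{w. w \<in> Z \<and> wn w = k}. s w) = 0" by simp
    have "(\<Sum>w\<in>{w. w \<in> Z \<and> wn w = k}. of_int (s w) * wn w) = (\<Sum>w\<in>{w. w \<in> Z \<and> wn w = k}. of_int (s w) * k)"
      by (rule sum.cong) auto
    also have "\<dots> = of_int (\<Sum>w\<in>{w. w \<in> Z \<and> wn w = k}. s w) * k" by (simp add: sum_distrib_right)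
    finally show "(\<Sum>w\<in>{w. w \<in> Z \<and> wn w = k}. of_int (s w) * wn w) = 0" using s0 by simp
  qed
  finally show ?thesis by (simp add: K_def o_def)
qed

end

section \<open>Slabs and the final loop\<close>

lemma path_in_slit_plane_winding:
  assumes "path p" "path_image p \<inter> \<real>\<^sub>\<le>\<^sub>0 = {}"
  shows "winding_number p 0 = (Ln (pathfinish p) - Ln (pathstart p)) / (2 * of_real pi * \<i>)"
proof -
  have im: "p ` {0..1} \<inter> \<real>\<^sub>\<le>\<^sub>0 = {}" using assms(2) by (simp add: path_image_def)
  have nz: "p t \<notin> \<real>\<^sub>\<le>\<^sub>0" if "0 \<le> t" "t \<le> 1" for t using im that by (auto simp: disjoint_iff)
  have "path (\<lambda>t. Ln (p t))" using assms(1) nz unfolding path_def by (auto intro!: continuous_intros)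
  note w = winding_number_compose_exp[OF this]
  have "winding_number p 0 = winding_number (exp \<circ> (\<lambda>t. Ln (p t))) 0"
  proof (rule winding_number_cong)
    fix t :: real assume "0 \<le> t" "t \<le> 1"
    then have "p t \<noteq> 0" using nz[of t] by auto
    then show "p t = (exp \<circ> (\<lambda>t. Ln (p t))) t" by simp
  qed
  then show ?thesis unfolding w by (simp add: pathfinish_def pathstart_def)
qed

text \<open>On the slit plane the principal logarithm measures the change of argument along
  \<open>p\<close>; along \<open>q\<close> the logarithm of the negative does. At the two junctions
  these logarithms differ by pi in opposite directions, which adds up to one full turn.\<close>

lemma winding_slit_then_left_half_plane:
  assumes p: "path p" "path_image p \<inter> \<real>\<^sub>\<le>\<^sub>0 = {}" and q: "path q" "\<And>z. z \<in> path_image q \<Longrightarrow> Re z < 0"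
    and pq: "pathfinish p = pathstart q" "pathfinish q = pathstart p" and im: "Im (pathstart p) < 0" "Im (pathfinish p) > 0"
  shows "winding_number (p +++ q) 0 = 1"
proof -
  have 0: "0 \<notin> path_image p" "0 \<notin> path_image q" using p(2) q(2)[of 0] by auto
  define q' where "q' = (\<lambda>t. - q t)"
  have q': "path q'" "path_image q' \<inter> \<real>\<^sub>\<le>\<^sub>0 = {}"
  proof -
    show "path q'" using q(1) unfolding path_def q'_def by (intro continuous_intros)
    show "path_image q' \<inter> \<real>\<^sub>\<le>\<^sub>0 = {}"
      using q(2) by (force simp: path_image_def q'_def complex_nonpos_Reals_iff)
  qed
  have z0: "0 \<notin> path_image q'" using q'(2) by auto
  have "winding_number q 0 = winding_number (\<lambda>t. -1 * q' t) 0" by (simp add: q'_def)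
  also have "\<dots> = winding_number (\<lambda>t. -1) 0 + winding_number q' 0"
    by (rule winding_number_times_path[OF _ _ q'(1) z0]) (auto simp: path_def path_image_def intro!: continuous_intros)
  also have "winding_number (\<lambda>t. -1) 0 = 0" by (rule winding_number_constI) auto
  finally have wq: "winding_number q 0 = (Ln (- pathfinish q) - Ln (- pathstart q)) / (2 * of_real pi * \<i>)"
    unfolding path_in_slit_plane_winding[OF q'] by (simp add: q'_def pathfinish_def pathstart_def)
  have nz: "pathstart p \<noteq> 0" "pathfinish p \<noteq> 0" using im by auto
  have l: "Ln (- pathfinish q) = Ln (pathstart p) + \<i> * pi" "Ln (- pathstart q) = Ln (pathfinish p) - \<i> * pi"
    unfolding pq(2) pq(1)[symmetric] using Ln_minus[OF nz(1)] Ln_minus[OF nz(2)] im by auto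
  have "winding_number (p +++ q) 0 = winding_number p 0 + winding_number q 0"
    by (rule winding_number_join[OF p(1) 0(1) q(1) 0(2) pq(1)])
  also have "\<dots> = (2 * of_real pi * \<i>) / (2 * of_real pi * \<i>)"
    unfolding path_in_slit_plane_winding[OF p] wq l by (simp add: diff_divide_distrib[symmetric] add_divide_distrib[symmetric])
  finally show ?thesis by simp
qed

lemma closure_component_Int:
  fixes A :: "'a::real_normed_vector set"
  assumes "open A" "x \<in> closure (connected_component_set A w)" "x \<in> A"
  shows "x \<in> connected_component_set A w"
proof -
  have "x \<in> connected_component_set A x" using assms(3) by simp
  then have "connected_component_set A x \<inter> connected_component_set A w \<noteq> {}"
    using assms(2) open_Int_closure_eq_empty[OF open_connected_component[OF assms(1), of x], of "connected_component_set A w"] by blast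
  then have "connected_component_set A x = connected_component_set A w" unfolding connected_component_overlap by blast
  then show ?thesis using \<open>x \<in> connected_component_set A x\<close> by simp
qed

section \<open>Caps, slabs and regular levels\<close>

context csurf
begin

lemma csurf_translate: "csurf (\<lambda>x. f x + v) fu fv fuu fuv fvv nu nuu nuv"
proof
  show "((\<lambda>x. f x + v) has_derivative (\<lambda>(a,b). a *\<^sub>R fu x + b *\<^sub>R fv x)) (at x)" if "x \<in> ball 0 1" for x
    using has_derivative_add[OF df[OF that] has_derivative_const] by simp
  show "continuous_on (cball 0 1) (\<lambda>x. f x + v)" by (intro continuous_intros cf)
  show "inj_on (\<lambda>x. f x + v) (cball 0 1)" using injf by (simp add: inj_on_def)
qed (use dfu dfv dnu cuu cuv cvv cnu cnv nun nufu nufv ind mc in auto)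

text \<open>The component at \<open>w\<close> of the part of \<open>\<Delta>\<close> above height
  \<open>k\<close> is a cap: a frontier point of it has height \<open>k\<close>, since it is a
  frontier point of \<open>\<Delta>\<close> or otherwise would belong to the component.\<close>

lemma compact_region_height:
  assumes u: "u \<bullet> u = 1" and \<Delta>: "closed \<Delta>" "\<Delta> \<subseteq> ball 0 1" and fr: "\<And>x. x \<in> frontier \<Delta> \<Longrightarrow> f x \<bullet> u = k"
    and w: "w \<in> interior \<Delta>"
  shows "f w \<bullet> u \<le> k + 4"
proof (rule ccontr)
  assume "\<not> ?thesis"
  then have w4: "f w \<bullet> u > k + 4" by simp
  define g where "g x = f x + (- k) *\<^sub>R u" for x
  interpret g: csurf g fu fv fuu fuv fvv nu nuu nuv unfolding g_def[abs_def] by (rule csurf_translate)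
  have gu: "g x \<bullet> u = f x \<bullet> u - k" for x using u by (simp add: g_def inner_diff_left)
  define A where "A = interior \<Delta> \<inter> (\<lambda>x. g x \<bullet> u) -` {0<..}"
  have iD: "interior \<Delta> \<subseteq> ball 0 1" "\<Delta> \<subseteq> cball 0 1" using interior_subset \<Delta>(2) ball_subset_cball by blast+
  have "continuous_on (interior \<Delta>) (\<lambda>x. g x \<bullet> u)"
    by (intro continuous_intros continuous_on_subset[OF g.cf]) (use iD interior_subset in blast)
  then have oA: "open A" unfolding A_def by (rule continuous_open_preimage) auto
  have wA: "w \<in> A" using w w4 by (simp add: A_def gu)
  define \<Omega> where "\<Omega> = connected_component_set A w"
  have wO: "w \<in> \<Omega>" and OA: "\<Omega> \<subseteq> A" using wA by (auto simp: \<Omega>_def connected_component_subset)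
  have AD: "A \<subseteq> \<Delta>" unfolding A_def using interior_subset by blast
  then have cl: "closure \<Omega> \<subseteq> \<Delta>" using closure_minimal[OF _ \<Delta>(1)] OA by blast
  have oO: "open \<Omega>" unfolding \<Omega>_def by (rule open_connected_component[OF oA])
  have cc: "continuous_on (closure \<Omega>) (\<lambda>x. g x \<bullet> u)" by (intro continuous_intros continuous_on_subset[OF g.cf]) (use cl iD in blast)
  have ge0: "g x \<bullet> u \<ge> 0" if "x \<in> closure \<Omega>" for x
    by (rule continuous_ge_on_closure[OF cc that]) (use OA in \<open>auto simp: A_def\<close>)
  have fr0: "g x \<bullet> u = 0" if "x \<in> frontier \<Omega>" for x
  proof (rule ccontr)
    assume ne: "g x \<bullet> u \<noteq> 0"
    have x: "x \<in> closure \<Omega>" "x \<notin> \<Omega>" using that oO by (auto simp: frontier_def interior_open)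
    then have pos: "g x \<bullet> u > 0" using ge0[OF x(1)] ne by simp
    have "x \<in> interior \<Delta>"
    proof (rule ccontr)
      assume "x \<notin> interior \<Delta>"
      then have "x \<in> frontier \<Delta>" using x(1) cl closure_subset by (auto simp: frontier_def)
      then show False using fr[of x] pos by (simp add: gu)
    qed
    then have "x \<in> A" using pos by (simp add: A_def)
    then have "x \<in> \<Omega>" using closure_component_Int[OF oA] x(1) unfolding \<Omega>_def by blast
    then show False using x by simp
  qed
  have "bounded \<Delta>" by (rule bounded_subset[OF bounded_ball \<Delta>(2)])
  then have "bounded \<Omega>" by (rule bounded_subset) (use OA AD in blast)
  then have "compact (closure \<Omega>)" by (simp add: compact_closure)
  then obtain xt where xt: "xt \<in> closure \<Omega>" "\<And>x. x \<in> closure \<Omega> \<Longrightarrow> g x \<bullet> u \<le> g xt \<bullet> u"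
    using continuous_attains_sup[OF _ _ cc] wO closure_subset by blast
  have wc: "w \<in> closure \<Omega>" using wO closure_subset by blast
  have xp: "g xt \<bullet> u > 4" using xt(2)[OF wc] w4 by (simp add: gu)
  have xtO: "xt \<in> \<Omega>"
  proof (rule ccontr)
    assume "xt \<notin> \<Omega>"
    then have "xt \<in> frontier \<Omega>" using xt(1) oO by (simp add: frontier_def interior_open)
    then show False using fr0 xp by fastforce
  qed
  interpret c: cap g fu fv fuu fuv fvv nu nuu nuv \<Omega> u "g xt \<bullet> u" xt
  proof
    show "connected \<Omega>" by (simp add: \<Omega>_def)
    show "closure \<Omega> \<subseteq> ball 0 1" using cl \<Delta>(2) by blast
    show "g x \<bullet> u > 0" if "x \<in> \<Omega>" for x using that OA by (auto simp: A_def)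
    show "g x \<bullet> u \<le> g xt \<bullet> u" if "x \<in> \<Omega>" for x using xt(2) that closure_subset by blast
  qed (use u oO fr0 xtO in auto)
  show False using c.height_at_most_4 xp by simp
qed

text \<open>If the component stayed away from the boundary, filling its holes would give a compact
  region whose frontier is connected. The frontier lies in the two bounding planes of the slab,
  hence in one of them, and the central point has distance 5 from that plane, more than a cap
  allows.\<close>

lemma slab_component_reaches_boundary:
  assumes w1: "w1 \<in> ball 0 1" and e: "e \<bullet> e = 1"
  defines "A \<equiv> {w \<in> ball 0 1. \<bar>f w \<bullet> e - f w1 \<bullet> e\<bar> < 5}"
  shows "closure (connected_component_set A w1) \<inter> sphere 0 1 \<noteq> {}" and "open A"
proof -
  have cfb: "continuous_on (ball 0 1) f" by (rule continuous_on_subset[OF cf ball_subset_cball])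
  have "continuous_on (ball 0 1) (\<lambda>w. \<bar>f w \<bullet> e - f w1 \<bullet> e\<bar>)" by (intro continuous_intros cfb)
  then have "open (ball 0 1 \<inter> (\<lambda>w. \<bar>f w \<bullet> e - f w1 \<bullet> e\<bar>) -` {..<5})" by (rule continuous_open_preimage) auto
  moreover have "A = ball 0 1 \<inter> (\<lambda>w. \<bar>f w \<bullet> e - f w1 \<bullet> e\<bar>) -` {..<5}" by (auto simp: A_def)
  ultimately show oA: "open A" by simp
  show "closure (connected_component_set A w1) \<inter> sphere 0 1 \<noteq> {}"
  proof
    assume em: "closure (connected_component_set A w1) \<inter> sphere 0 1 = {}"
    define \<Omega> where "\<Omega> = connected_component_set A w1"
    define S where "S = closure \<Omega>"
    have OA: "\<Omega> \<subseteq> A" by (simp add: \<Omega>_def connected_component_subset)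
    have Ab: "A \<subseteq> ball 0 1" by (auto simp: A_def)
    have w1O: "w1 \<in> \<Omega>" using w1 by (simp add: \<Omega>_def A_def)
    have oO: "open \<Omega>" unfolding \<Omega>_def by (rule open_connected_component[OF oA])
    have "S \<subseteq> cball 0 1" unfolding S_def by (rule closure_minimal[OF subset_trans[OF subset_trans[OF OA Ab] ball_subset_cball]]) simp
    then have Sb: "S \<subseteq> ball 0 1" using em unfolding S_def \<Omega>_def[symmetric] by (auto simp: less_le disjoint_iff)
    have conS: "connected S" unfolding S_def \<Omega>_def by (intro connected_imp_connected_closure) simp
    have ccS: "continuous_on S (\<lambda>w. \<bar>f w \<bullet> e - f w1 \<bullet> e\<bar>)" by (intro continuous_intros continuous_on_subset[OF cfb Sb])
    have lvl: "\<bar>f x \<bullet> e - f w1 \<bullet> e\<bar> = 5" if x: "x \<in> S" "x \<notin> \<Omega>" for x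
    proof (rule antisym)
      show "\<bar>f x \<bullet> e - f w1 \<bullet> e\<bar> \<le> 5"
        by (rule continuous_le_on_closure[OF ccS[unfolded S_def] x(1)[unfolded S_def]]) (use OA in \<open>auto simp: A_def\<close>)
      show "5 \<le> \<bar>f x \<bullet> e - f w1 \<bullet> e\<bar>"
      proof (rule ccontr)
        assume "\<not> ?thesis"
        then have "x \<in> A" using x(1) Sb by (auto simp: A_def)
        then have "x \<in> \<Omega>" using closure_component_Int[OF oA] x(1) unfolding S_def \<Omega>_def by blast
        then show False using x by simp
      qed
    qed
    \<comment> \<open>The outer component of the complement, represented by \<open>(2, 0)\<close>, a
      point outside the disk. Its complement \<open>\<Delta>\<close> is \<open>S\<close> with all
      holes filled.\<close>
    define C where "C = connected_component_set (- S) (2,0)"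
    have "norm (2::real, 0::real) = 2" by (simp add: norm_Pair)
    then have far: "(2,0) \<in> - (ball 0 1 :: (real \<times> real) set)" by simp
    have "connected (- (ball 0 1 :: (real \<times> real) set))" by (rule connected_complement_bounded_convex) auto
    then have bC: "- ball 0 1 \<subseteq> C" unfolding C_def by (rule connected_component_maximal[OF far]) (use Sb in auto)
    have "closed S" by (simp add: S_def)
    then have oC: "open C" unfolding C_def by (intro open_connected_component) auto
    have CS: "C \<inter> S = {}" using connected_component_subset[of "- S"] unfolding C_def by blast
    have Ccomp: "C \<in> components (- S)" unfolding C_def components_def using far Sb by blast
    define \<Delta> where "\<Delta> = - C"
    have D: "closed \<Delta>" "\<Delta> \<subseteq> ball 0 1" using oC bC by (auto simp: \<Delta>_def)
    have "frontier C \<subseteq> frontier (- S)" unfolding C_def by (rule frontier_of_connected_component_subset)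
    also have "\<dots> \<subseteq> S" unfolding frontier_complement by (rule frontier_subset_closed[OF \<open>closed S\<close>])
    finally have fS: "frontier C \<subseteq> S" .
    have fO: "frontier C \<inter> \<Omega> = {}"
    proof -
      have "\<Omega> \<inter> C = {}" using CS closure_subset[of \<Omega>] unfolding S_def by blast
      then have "\<Omega> \<inter> closure C = {}" using open_Int_closure_eq_empty[OF oO] by blast
      then show ?thesis by (auto simp: frontier_def)
    qed
    \<comment> \<open>A fact about the plane: a component of the complement of a connected closed
      set has connected frontier. It is what singles out one of the two bounding planes.\<close>
    have conF: "connected (frontier C)" by (rule connected_frontier_component_complement[OF conS Ccomp])
    obtain c :: int where c: "c = 1 \<or> c = -1" "\<And>x. x \<in> frontier C \<Longrightarrow> of_int c * (f x \<bullet> e - f w1 \<bullet> e) > 0"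
    proof (rule continuous_nonzero_sign[OF conF, of "\<lambda>x. f x \<bullet> e - f w1 \<bullet> e"])
      show "continuous_on (frontier C) (\<lambda>x. f x \<bullet> e - f w1 \<bullet> e)"
        by (intro continuous_intros continuous_on_subset[OF cfb]) (use fS Sb in blast)
      show "f x \<bullet> e - f w1 \<bullet> e \<noteq> 0" if "x \<in> frontier C" for x
      proof -
        have "\<bar>f x \<bullet> e - f w1 \<bullet> e\<bar> = 5" using lvl that fS fO by blast
        then show ?thesis by auto
      qed
    qed auto
    \<comment> \<open>The direction pointing away from the plane that carries the frontier, so that
      \<open>w1\<close> lies 5 above it.\<close>
    define u where "u = - of_int c *\<^sub>R e"
    have u: "u \<bullet> u = 1" using c(1) e by (auto simp: u_def)
    have fu': "f x \<bullet> u = f w1 \<bullet> u - 5" if x: "x \<in> frontier \<Delta>" for x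
    proof -
      have xC: "x \<in> frontier C" using x by (simp add: \<Delta>_def frontier_complement)
      then have "\<bar>f x \<bullet> e - f w1 \<bullet> e\<bar> = 5" using lvl fS fO by blast
      then show ?thesis using c(2)[OF xC] c(1) by (auto simp: u_def abs_if split: if_splits)
    qed
    have "\<Omega> \<subseteq> \<Delta>" using CS closure_subset[of \<Omega>] unfolding S_def \<Delta>_def by blast
    then have "w1 \<in> interior \<Delta>" using interior_maximal[OF _ oO] w1O by blast
    from compact_region_height[OF u D fu' this] show False by simp
  qed
qed

lemma slab_path:
  assumes w1: "w1 \<in> ball 0 1" and e: "e \<bullet> e = 1" and s: "s < 1"
  obtains \<gamma> where "path \<gamma>" "pathstart \<gamma> = w1" "norm (pathfinish \<gamma>) > s"
    "\<And>w. w \<in> path_image \<gamma> \<Longrightarrow> w \<in> ball 0 1 \<and> \<bar>f w \<bullet> e - f w1 \<bullet> e\<bar> < 5"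
proof -
  define A where "A = {w \<in> ball 0 1. \<bar>f w \<bullet> e - f w1 \<bullet> e\<bar> < 5}"
  define \<Omega> where "\<Omega> = connected_component_set A w1"
  note sl = slab_component_reaches_boundary[OF w1 e, folded A_def \<Omega>_def]
  obtain x where x: "x \<in> closure \<Omega>" "x \<in> sphere 0 1" using sl(1) by blast
  have "1 - s > 0" using s by simp
  then obtain y where y: "y \<in> \<Omega>" "dist y x < 1 - s" using x(1) unfolding closure_approachable by blast
  have "norm x \<le> norm y + dist y x" by (metis dist_commute dist_norm norm_triangle_sub)
  then have ny: "norm y > s" using x y by simp
  have "open \<Omega>" unfolding \<Omega>_def by (rule open_connected_component[OF sl(2)])
  then have "path_connected \<Omega>" by (rule connected_open_path_connected) (simp add: \<Omega>_def)
  moreover have "w1 \<in> \<Omega>" using w1 by (simp add: \<Omega>_def A_def)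
  ultimately obtain \<gamma> where g: "path \<gamma>" "path_image \<gamma> \<subseteq> \<Omega>" "pathstart \<gamma> = w1" "pathfinish \<gamma> = y" using y(1) unfolding path_connected_def by metis
  have "\<Omega> \<subseteq> A" by (simp add: \<Omega>_def connected_component_subset)
  then show thesis using that[OF g(1,3)] g(2,4) ny by (auto simp: A_def)
qed

text \<open>Sard's theorem for the map formed by the squared distance from the axis and the height:
  its critical values are negligible, while the open rectangle of admissible values is not. The
  detour through \<open>real^2\<close> is dictated by the form of \<open>baby_Sard\<close>.\<close>

lemma regular_level_exists:
  assumes r: "0 < r1" "r1 < r2" and z: "z1 < z2"
  obtains \<rho> z0 where "r1 < \<rho>" "\<rho> < r2" "z1 < z0" "z0 < z2"
    "\<And>w. w \<in> ball 0 1 \<Longrightarrow> lev a b e \<rho> z0 (f w) = 0 \<Longrightarrow> jac a b e w \<noteq> 0"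
proof -
  define c :: "real^2 \<Rightarrow> real \<times> real" where "c v = (v $ 1, v $ 2)" for v
  define P where "P x = (x \<bullet> a)\<^sup>2 + (x \<bullet> b)\<^sup>2" for x
  define P' where "P' w x = 2 * (f w \<bullet> a) * (x \<bullet> a) + 2 * (f w \<bullet> b) * (x \<bullet> b)" for w x
  define \<Phi> :: "real^2 \<Rightarrow> real^2" where "\<Phi> v = P (f (c v)) *\<^sub>R axis 1 1 + (f (c v) \<bullet> e) *\<^sub>R axis 2 1" for v
  define \<Phi>' :: "real^2 \<Rightarrow> real^2 \<Rightarrow> real^2" where
    "\<Phi>' v h = (let x = (h $ 1) *\<^sub>R fu (c v) + (h $ 2) *\<^sub>R fv (c v) in P' (c v) x *\<^sub>R axis 1 1 + (x \<bullet> e) *\<^sub>R axis 2 1)" for v h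
  define S where "S = {v. c v \<in> ball 0 1 \<and> jac a b e (c v) = 0}"
  have D: "(\<Phi> has_derivative \<Phi>' v) (at v)" if v: "c v \<in> ball 0 1" for v
  proof -
    have "bounded_linear c" unfolding c_def[abs_def] by (intro bounded_linear_Pair bounded_linear_vec_nth)
    then have "(c has_derivative c) (at v)" by (rule bounded_linear_imp_has_derivative)
    from diff_chain_at[OF this df[OF v]]
    have d: "((\<lambda>v. f (c v)) has_derivative (\<lambda>h. (h $ 1) *\<^sub>R fu (c v) + (h $ 2) *\<^sub>R fv (c v))) (at v)"
      by (simp add: o_def c_def)
    note di = has_derivative_inner_left[OF d]
    show ?thesis unfolding \<Phi>_def[abs_def] P_def
      by (rule has_derivative_eq_rhs, (rule derivative_intros di)+)
        (simp add: fun_eq_iff \<Phi>'_def Let_def P'_def algebra_simps)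
  qed
  have "negligible (\<Phi> ` S)"
  proof (rule baby_Sard)
    fix v assume v: "v \<in> S"
    then have cv: "c v \<in> ball 0 1" by (simp add: S_def)
    show D': "(\<Phi> has_derivative \<Phi>' v) (at v within S)" using D[OF cv] by (rule has_derivative_at_withinI)
    have "det (matrix (\<Phi>' v)) = jac a b e (c v)"
      unfolding det_2 by (simp add: matrix_def \<Phi>'_def Let_def P'_def jac_def axis_def algebra_simps)
    then have "det (matrix (\<Phi>' v)) = 0" using v by (simp add: S_def)
    then show "rank (matrix (\<Phi>' v)) < CARD(2)" by (simp only: det_eq_0_rank)
  qed simp
  moreover have "\<not> negligible (box (vector [r1\<^sup>2, z1]) (vector [r2\<^sup>2, z2] :: real^2))"
  proof (rule open_not_negligible)
    have "r1\<^sup>2 < r2\<^sup>2" using r by (intro power_strict_mono) auto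
    then show "box (vector [r1\<^sup>2, z1]) (vector [r2\<^sup>2, z2] :: real^2) \<noteq> {}" using z
      unfolding box_ne_empty Basis_vec_def by (auto simp: cart_eq_inner_axis[symmetric] forall_2 inner_axis)
  qed (rule open_box)
  ultimately have "\<not> box (vector [r1\<^sup>2, z1]) (vector [r2\<^sup>2, z2] :: real^2) \<subseteq> \<Phi> ` S" using negligible_subset by blast
  then obtain y where y: "y \<in> box (vector [r1\<^sup>2, z1]) (vector [r2\<^sup>2, z2] :: real^2)" "y \<notin> \<Phi> ` S" by blast
  then have y1: "r1\<^sup>2 < y $ 1" "y $ 1 < r2\<^sup>2" "z1 < y $ 2" "y $ 2 < z2" by (auto simp: mem_box_cart forall_2)
  define \<rho> where "\<rho> = sqrt (y $ 1)"
  have y0: "0 < y $ 1" using y1(1) by (rule order.strict_trans1[OF zero_le_power2])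
  have \<rho>2: "\<rho>\<^sup>2 = y $ 1" using y0 by (simp add: \<rho>_def)
  have \<rho>: "r1 < \<rho>" "\<rho> < r2" using y1 r unfolding \<rho>_def by (auto intro: real_less_rsqrt real_less_lsqrt)
  show thesis
  proof (rule that[OF \<rho> y1(3,4)])
    fix w assume w: "w \<in> ball 0 1" "lev a b e \<rho> (y $ 2) (f w) = 0"
    define v where "v = (vector [fst w, snd w] :: real^2)"
    have cv: "c v = w" by (simp add: c_def v_def)
    have "P (f w) = y $ 1" "f w \<bullet> e = y $ 2"
      using Re_lev[of a b e \<rho> "y $ 2" "f w"] Im_lev[of a b e \<rho> "y $ 2" "f w"] w(2) \<rho>2 by (auto simp: P_def)
    then have "\<Phi> v = y" by (simp add: \<Phi>_def cv vec_eq_iff forall_2 axis_def)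
    then have "v \<notin> S" using y(2) by blast
    then show "jac a b e w \<noteq> 0" using w(1) by (simp add: S_def cv)
  qed
qed

section \<open>The loop and the contradiction\<close>

lemma norm_frame:
  assumes "orthoframe a b e"
  shows "(norm x)\<^sup>2 = (x \<bullet> a)\<^sup>2 + (x \<bullet> b)\<^sup>2 + (x \<bullet> e)\<^sup>2"
  unfolding power2_norm_eq_inner using orthoframe_inner[OF assms, of x x] by (simp add: power2_eq_square)

lemma boundary_not_far:
  assumes wp: "wp \<in> ball 0 1" "f wp = 0" and far: "\<And>w. w \<in> sphere 0 1 \<Longrightarrow> norm (f w) \<ge> 60"
  shows False
proof -
  have cn: "continuous_on (cball 0 1) (\<lambda>w. norm (f w))" by (intro continuous_intros cf)
  have ccl: "compact {w \<in> cball 0 1. norm (f w) \<le> c}" for c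
  proof -
    have "closed (cball 0 1 \<inter> (\<lambda>w. norm (f w)) -` {..c})" by (rule continuous_closed_preimage[OF cn]) auto
    moreover have "cball 0 1 \<inter> (\<lambda>w. norm (f w)) -` {..c} = {w \<in> cball 0 1. norm (f w) \<le> c}" by auto
    moreover have "bounded {w \<in> cball 0 1. norm (f w) \<le> c}" by (rule bounded_subset[of "cball 0 1"]) auto
    ultimately show ?thesis by (simp add: compact_eq_bounded_closed)
  qed
  have inb: "w \<in> ball 0 1" if "w \<in> cball 0 1" "norm (f w) < 60" for w
    using far[of w] that by (cases "norm w = 1") auto
  \<comment> \<open>The parameters mapped into the ball of radius 59 form a compact subset of the
    open disk. Beyond their largest norm \<open>s\<close> there is an annulus, connected and mapped
    outside that ball; the two slab paths end there and are joined there.\<close>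
  obtain wm where wm: "wm \<in> {w \<in> cball 0 1. norm (f w) \<le> 59}" "\<And>w. w \<in> {w \<in> cball 0 1. norm (f w) \<le> 59} \<Longrightarrow> norm w \<le> norm wm"
  proof -
    have "\<exists>x\<in>{w \<in> cball 0 1. norm (f w) \<le> 59}. \<forall>y\<in>{w \<in> cball 0 1. norm (f w) \<le> 59}. norm y \<le> norm x"
    proof (rule continuous_attains_sup[OF ccl])
      have "wp \<in> {w \<in> cball 0 1. norm (f w) \<le> 59}" using wp by simp
      then show "{w \<in> cball 0 1. norm (f w) \<le> 59} \<noteq> {}" by blast
    qed (intro continuous_intros)
    then show thesis using that by blast
  qed
  define s where "s = norm wm"
  have s: "s < 1" "0 \<le> s" using inb[of wm] wm(1) by (auto simp: s_def)
  have s59: "norm (f w) > 59" if "w \<in> ball 0 1" "norm w > s" for w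
    using wm(2)[of w] that by (force simp: s_def)
  \<comment> \<open>The segment from \<open>wp\<close> to the boundary is followed up to the
    frontier of \<open>K\<close>; this keeps \<open>\<sigma>\<close> over the ball of radius 20 and
    gives its end point norm exactly 20.\<close>
  define K where "K = {w \<in> cball 0 1. norm (f w) \<le> 20}"
  have Kcl: "closed K" unfolding K_def by (rule compact_imp_closed[OF ccl])
  have "norm (1::real, 0::real) = 1" by (simp add: norm_Pair)
  then have "norm (f (1,0)) \<ge> 60" by (intro far) simp
  then have "pathfinish (linepath wp (1,0)) \<notin> K" by (simp add: K_def)
  moreover have "pathstart (linepath wp (1,0)) \<in> K" using wp by (simp add: K_def)
  ultimately obtain \<sigma> where \<sigma>: "path \<sigma>" "pathstart \<sigma> = wp" "path_image \<sigma> \<subseteq> K" "pathfinish \<sigma> \<in> frontier K"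
    using exists_path_subpath_to_frontier_closed[OF Kcl path_linepath, of wp "(1,0)"] by (metis le_inf_iff pathstart_linepath)
  define w' where "w' = pathfinish \<sigma>"
  have Kb: "K \<subseteq> ball 0 1" using inb by (force simp: K_def)
  have w'K: "w' \<in> K" using \<sigma>(3) pathfinish_in_path_image[of \<sigma>] by (auto simp: w'_def)
  have w'b: "w' \<in> ball 0 1" using w'K Kb by blast
  have fw': "norm (f w') = 20"
  proof (rule ccontr)
    assume "norm (f w') \<noteq> 20"
    then have lt: "norm (f w') < 20" using w'K by (simp add: K_def)
    have "open (ball 0 1 \<inter> (\<lambda>w. norm (f w)) -` {..<20})"
      by (rule continuous_open_preimage[OF continuous_on_subset[OF cn ball_subset_cball]]) auto
    then have "ball 0 1 \<inter> (\<lambda>w. norm (f w)) -` {..<20} \<subseteq> interior K" by (rule interior_maximal[rotated]) (auto simp: K_def)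
    then have "w' \<in> interior K" using w'b lt by auto
    then show False using \<sigma>(4) by (simp add: w'_def frontier_def)
  qed
  \<comment> \<open>The axis runs through both end points of the path, so the two slabs are centred
    at heights 0 and 20 and are 10 apart.\<close>
  define e where "e = (1/20) *\<^sub>R f w'"
  have f20: "f w' = 20 *\<^sub>R e" by (simp add: e_def)
  have e: "e \<bullet> e = 1" using fw' by (simp add: e_def flip: power2_norm_eq_inner)
  obtain a where a: "a \<bullet> a = 1" "a \<bullet> e = 0" using unit_perp_two[of e e] by metis
  define b where "b = cross3 e a"
  have fr: "orthoframe a b e" unfolding b_def by (rule orthoframe_cross[OF e a])
  obtain \<gamma>1 where g1: "path \<gamma>1" "pathstart \<gamma>1 = wp" "norm (pathfinish \<gamma>1) > s"
    "\<And>w. w \<in> path_image \<gamma>1 \<Longrightarrow> w \<in> ball 0 1 \<and> \<bar>f w \<bullet> e - f wp \<bullet> e\<bar> < 5" using slab_path[OF wp(1) e s(1)] by blast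
  obtain \<gamma>2 where g2: "path \<gamma>2" "pathstart \<gamma>2 = w'" "norm (pathfinish \<gamma>2) > s"
    "\<And>w. w \<in> path_image \<gamma>2 \<Longrightarrow> w \<in> ball 0 1 \<and> \<bar>f w \<bullet> e - f w' \<bullet> e\<bar> < 5" using slab_path[OF w'b e s(1)] by blast
  define R where "R = {w::real \<times> real. s < norm (w - 0) \<and> norm (w - 0) < 1}"
  have "path_connected R" unfolding R_def by (rule path_connected_annulus) simp
  moreover have "pathfinish \<gamma>1 \<in> R" "pathfinish \<gamma>2 \<in> R"
    using g1(3,4) g2(3,4) pathfinish_in_path_image[of \<gamma>1] pathfinish_in_path_image[of \<gamma>2] by (auto simp: R_def)
  ultimately obtain \<eta> where \<eta>: "path \<eta>" "path_image \<eta> \<subseteq> R" "pathstart \<eta> = pathfinish \<gamma>1" "pathfinish \<eta> = pathfinish \<gamma>2"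
    unfolding path_connected_def by blast
  obtain \<rho> z0 where \<rho>: "30 < \<rho>" "\<rho> < 31" and z0: "9 < z0" "z0 < 11"
    and reg: "\<And>w. w \<in> ball 0 1 \<Longrightarrow> lev a b e \<rho> z0 (f w) = 0 \<Longrightarrow> jac a b e w \<noteq> 0"
    by (rule regular_level_exists[of 30 31 9 11 a b e], simp, simp, simp, blast)
  have sq: "900 < \<rho>\<^sup>2" "\<rho>\<^sup>2 < 961" "0 \<le> z0\<^sup>2" "z0\<^sup>2 < 121"
    using power_strict_mono[of 30 \<rho> 2] power_strict_mono[of \<rho> 31 2] power_strict_mono[of z0 11 2] \<rho> z0 by simp_all
  \<comment> \<open>Radius 3 leaves room for the closed balls of radius 2 required by
    \<open>signed_count_zero\<close>.\<close>
  define U where "U = (\<Union>t. ball (circ a b e \<rho> z0 t) 3)"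
  have oU: "open U" by (auto simp: U_def)
  have cU: "cball (circ a b e \<rho> z0 t) 2 \<subseteq> U" for t
  proof -
    have "cball (circ a b e \<rho> z0 t) 2 \<subseteq> ball (circ a b e \<rho> z0 t) 3" by auto
    then show ?thesis unfolding U_def by blast
  qed
  have Uprop: "\<bar>x \<bullet> e - z0\<bar> < 3 \<and> norm x < 59 \<and> norm x > 20" if xU: "x \<in> U" for x
  proof -
    obtain t where t: "norm (x - circ a b e \<rho> z0 t) < 3" using xU by (auto simp: U_def dist_norm norm_minus_commute)
    let ?c = "circ a b e \<rho> z0 t"
    have ne: "norm e = 1" using e by (simp add: norm_eq_1)
    have "\<bar>(x - ?c) \<bullet> e\<bar> \<le> norm (x - ?c)" using Cauchy_Schwarz_ineq2[of "x - ?c" e] ne by simp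
    then have h: "\<bar>x \<bullet> e - z0\<bar> < 3" using t circ_inner(3)[OF fr] by (simp add: inner_diff_left)
    have lc: "lev a b e \<rho> z0 ?c = 0" by (rule lev_circ[OF fr])
    have "(norm ?c)\<^sup>2 = \<rho>\<^sup>2 + z0\<^sup>2"
      using norm_frame[OF fr, of ?c] Re_lev[of a b e \<rho> z0 ?c] lc circ_inner(3)[OF fr, of \<rho> z0 t] by simp
    then have "900 < (norm ?c)\<^sup>2" "(norm ?c)\<^sup>2 < 1764" using sq by linarith+
    then have "30 < norm ?c" "norm ?c < 42" using power_less_imp_less_base[of 30 2 "norm ?c"] power_less_imp_less_base[of "norm ?c" 2 42] by auto
    moreover have "norm x \<le> norm ?c + norm (x - ?c)" "norm ?c \<le> norm x + norm (x - ?c)"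
      using norm_triangle_sub[of x ?c] norm_triangle_sub[of ?c x] by (auto simp: norm_minus_commute)
    ultimately show ?thesis using h t by auto
  qed
  define l where "l w = lev a b e \<rho> z0 (f w)" for w
  have cl: "continuous_on (ball 0 1) l" unfolding l_def by (intro continuous_intros continuous_on_subset[OF cf ball_subset_cball])
  define \<gamma> where "\<gamma> = \<gamma>1 +++ \<eta> +++ reversepath \<gamma>2"
  have \<gamma>: "path \<gamma>" "pathstart \<gamma> = wp" "pathfinish \<gamma> = w'" using g1 g2 \<eta> by (auto simp: \<gamma>_def)
  have \<gamma>im: "path_image \<gamma> \<subseteq> path_image \<gamma>1 \<union> R \<union> path_image \<gamma>2"
  proof -
    have "path_image (\<eta> +++ reversepath \<gamma>2) \<subseteq> R \<union> path_image \<gamma>2"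
      using path_image_join_subset[of \<eta> "reversepath \<gamma>2"] \<eta>(2) unfolding path_image_reversepath by blast
    then show ?thesis using path_image_join_subset[of \<gamma>1 "\<eta> +++ reversepath \<gamma>2"] unfolding \<gamma>_def by blast
  qed
  have z1: "f wp \<bullet> e = 0" "f w' \<bullet> e = 20" using wp(2) f20 e by auto
  \<comment> \<open>\<open>lev\<close> is a nonpositive real exactly on the flat disk bounded by the
    circle. The slab paths miss it by height, and in the annulus a point at height \<open>z0\<close>
    with norm above 59 is too far from the axis.\<close>
  have \<gamma>w: "w \<in> ball 0 1 \<and> f w \<notin> U \<and> l w \<notin> \<real>\<^sub>\<le>\<^sub>0" if wg: "w \<in> path_image \<gamma>" for w
  proof -
    consider "w \<in> path_image \<gamma>1" | "w \<in> R" | "w \<in> path_image \<gamma>2" using wg \<gamma>im by blast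
    then show ?thesis
    proof cases
      case 1
      then have "w \<in> ball 0 1" "f w \<bullet> e < 5" using g1(4)[OF 1] z1 by auto
      then show ?thesis using Uprop[of "f w"] z0 by (auto simp: l_def complex_nonpos_Reals_iff Im_lev)
    next
      case 2
      then have w: "w \<in> ball 0 1" "norm (f w) > 59" using s59[of w] by (auto simp: R_def)
      have "Re (l w) > 0" if "Im (l w) = 0"
      proof -
        have "3481 < (norm (f w))\<^sup>2" using w(2) power_strict_mono[of 59 "norm (f w)" 2] by simp
        moreover have "f w \<bullet> e = z0" using that by (simp add: l_def Im_lev)
        ultimately show ?thesis using norm_frame[OF fr, of "f w"] sq by (simp add: l_def Re_lev)
      qed
      then have "l w \<notin> \<real>\<^sub>\<le>\<^sub>0" unfolding complex_nonpos_Reals_iff by fastforce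
      then show ?thesis using w Uprop[of "f w"] by auto
    next
      case 3
      then have "w \<in> ball 0 1" "f w \<bullet> e > 15" using g2(4)[OF 3] z1 by auto
      then show ?thesis using Uprop[of "f w"] z0 by (auto simp: l_def complex_nonpos_Reals_iff Im_lev)
    qed
  qed
  \<comment> \<open>Points of norm at most 20 are closer to the axis than \<open>\<rho>\<close>, so
    the real part stays negative: the return along \<open>\<sigma>\<close> passes through the circle
    and never around it.\<close>
  have \<sigma>w: "w \<in> ball 0 1 \<and> f w \<notin> U \<and> Re (l w) < 0" if "w \<in> path_image \<sigma>" for w
  proof -
    have w: "w \<in> K" using that \<sigma>(3) by blast
    then have n20: "norm (f w) \<le> 20" by (simp add: K_def)
    then have "(norm (f w))\<^sup>2 \<le> 400" using power_mono[of "norm (f w)" 20 2] by simp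
    moreover have "0 \<le> (f w \<bullet> e)\<^sup>2" by simp
    ultimately have "Re (l w) < 0" using norm_frame[OF fr, of "f w"] sq unfolding l_def Re_lev by linarith
    then show ?thesis using w Kb Uprop[of "f w"] n20 by auto
  qed
  define L where "L = \<gamma> +++ reversepath \<sigma>"
  have L: "path L" "pathfinish L = pathstart L" using \<gamma> \<sigma>(1,2) by (auto simp: L_def w'_def)
  have Lim: "path_image L \<subseteq> path_image \<gamma> \<union> path_image \<sigma>"
    using path_image_join_subset[of \<gamma> "reversepath \<sigma>"] by (simp add: L_def)
  have "winding_number (\<lambda>t. lev a b e \<rho> z0 (f (L t))) 0 = 0"
  proof (rule level_winding_zero[OF fr b_def _ oU cU reg _ L])
    show "f ` sphere 0 1 \<inter> U = {}"
    proof (rule ccontr)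
      assume "f ` sphere 0 1 \<inter> U \<noteq> {}"
      then obtain w where w: "w \<in> sphere 0 1" "f w \<in> U" by blast
      show False using far[OF w(1)] Uprop[OF w(2)] by simp
    qed
    show "path_image L \<subseteq> ball 0 1" using Lim \<gamma>w \<sigma>w by blast
    show "f ` path_image L \<inter> U = {}" using Lim \<gamma>w \<sigma>w by blast
  qed (use \<rho> in auto)
  moreover have "(\<lambda>t. lev a b e \<rho> z0 (f (L t))) = (l \<circ> \<gamma>) +++ (l \<circ> reversepath \<sigma>)"
    unfolding path_compose_join[symmetric] L_def[symmetric] by (simp add: l_def o_def)
  moreover have "winding_number ((l \<circ> \<gamma>) +++ (l \<circ> reversepath \<sigma>)) 0 = 1"
  proof (rule winding_slit_then_left_half_plane)
    show "path (l \<circ> \<gamma>)" by (rule path_continuous_image[OF \<gamma>(1) continuous_on_subset[OF cl]]) (use \<gamma>w in blast)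
    show "path (l \<circ> reversepath \<sigma>)"
      by (rule path_continuous_image[OF _ continuous_on_subset[OF cl]]) (use \<sigma>w \<sigma>(1) in \<open>simp_all add: subset_eq\<close>)
    show "path_image (l \<circ> \<gamma>) \<inter> \<real>\<^sub>\<le>\<^sub>0 = {}" unfolding path_image_compose using \<gamma>w by blast
    show "Re z < 0" if "z \<in> path_image (l \<circ> reversepath \<sigma>)" for z using that \<sigma>w unfolding path_image_compose by auto
    show "pathfinish (l \<circ> \<gamma>) = pathstart (l \<circ> reversepath \<sigma>)" "pathfinish (l \<circ> reversepath \<sigma>) = pathstart (l \<circ> \<gamma>)"
      using \<gamma> \<sigma>(2) by (simp_all add: pathfinish_compose pathstart_compose w'_def)
    show "Im (pathstart (l \<circ> \<gamma>)) < 0" "Im (pathfinish (l \<circ> \<gamma>)) > 0"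
      using \<gamma> z1 z0 by (simp_all add: pathfinish_compose pathstart_compose l_def Im_lev)
  qed
  ultimately show False by simp
qed

end

theorem theorem3p3:
  shows "\<exists>R0::real. R0 \<ge> pi \<and>
     (\<forall>H::real. \<forall>f :: real \<times> real \<Rightarrow> real^3. \<forall>p.
        H > 0 \<longrightarrow> H_disk H f \<longrightarrow> p \<in> f ` cball 0 1 \<longrightarrow>
        infdist p (f ` sphere 0 1) < R0 / H)"
proof (intro exI[of _ 60] conjI allI impI)
  show "pi \<le> 60" using pi_less_4 by linarith
  fix H :: real and f :: "real \<times> real \<Rightarrow> real^3" and p
  assume H: "H > 0" and hd: "H_disk H f" and p: "p \<in> f ` cball 0 1"
  obtain w where w: "w \<in> cball 0 1" "p = f w" using p by blast
  show "infdist p (f ` sphere 0 1) < 60 / H"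
  proof (cases "norm w = 1")
    case True
    then have "p \<in> f ` sphere 0 1" using w by simp
    then show ?thesis using H by simp
  next
    case False
    then have wb: "w \<in> ball 0 1" using w by simp
    obtain fu fv fuu fuv fvv nu nuu nuv where cs: "csurf (\<lambda>x. H *\<^sub>R (f x - p)) fu fv fuu fuv fvv nu nuu nuv"
      using H_disk_imp_csurf[OF H hd, of p] by blast
    interpret csurf "\<lambda>x. H *\<^sub>R (f x - p)" fu fv fuu fuv fvv nu nuu nuv by (rule cs)
    show ?thesis
    proof (rule ccontr)
      assume "\<not> ?thesis"
      then have far: "60 / H \<le> infdist p (f ` sphere 0 1)" by simp
      show False
      proof (rule boundary_not_far[OF wb])
        show "H *\<^sub>R (f w - p) = 0" using w by simp
        fix x :: "real \<times> real" assume "x \<in> sphere 0 1"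
        then have "infdist p (f ` sphere 0 1) \<le> dist p (f x)" by (intro infdist_le imageI)
        then have "60 / H \<le> dist p (f x)" using far by linarith
        then have "60 \<le> H * dist p (f x)" using H by (simp add: field_simps)
        also have "\<dots> = norm (H *\<^sub>R (f x - p))" using H by (simp add: dist_norm norm_minus_commute del: scaleR_right_diff_distrib)
        finally show "60 \<le> norm (H *\<^sub>R (f x - p))" .
      qed
    qed
  qed
qed

end
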